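(* Let $\mathscr C$ be a non-empty set of finite sets, let $\mathcal P=\mathcal P(\mathscr C)$ be the partition category over $\mathscr C$, let $\xi$ be the least cardinal strictly greater than $|A|$ for every $A\in\mathscr C$, and let $I_r=\{\alpha\in\mathcal P:\operatorname{rank}(\alpha)\le r\}$ for $0\le r<\xi$, with $I_\omega=\mathcal P$ if $\xi=\omega$. (i) The minimal ideal $I_0$ is (isomorphic to) a partial rectangular band, so its congruences are precisely those corresponding to the relations $\sigma_{\mathcal E_1,\mathcal E_2}$ described in the context. In particular, $\operatorname{Cong}(I_0)$ is isomorphic to the lattice direct product $$\prod_{A\in\mathscr C}\mathfrak{Eq}(\mathfrak{Eq}(A))\times\prod_{A\in\mathscr C}\mathfrak{Eq}(\mathfrak{Eq}(A)).$$ (ii) (If $\xi>1$.) The ideal $I_1$ is retractable, every congruence on $I_0$ is liftable to $I_1$, and, with $D_1=I_1\setminus I_0$, $$\operatorname{Cong}(I_1)=\{\tau\cup\Delta_{D_1}:\tau\in\operatorname{Cong}(I_0)\}\cup\{\theta^{I_1}_{I_1,\tau}:\tau\in\operatorname{Cong}(I_0)\}.$$ In particular, $\operatorname{Cong}(I_1)$ is isomorphic to the lattice direct product $\operatorname{Cong}(I_0)\times\mathbf 2$, where $\mathbf 2$ is the two-element chain. (iii) For $r\ge2$ (i.e. $2\le r<\xi$, and also $r=\omega$ if $\xi=\omega$), $$\operatorname{Cong}(I_r)=\{\mu^{I_r}_{I_q,N^\natural},\lambda^{I_r}_{I_q,N^\natural},\rho^{I_r}_{I_q,N^\natural},R^{I_r}_{I_q,N^\natural}:0\le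 q\le1,\ N\unlhd\mathcal S_{q+1}\}\cup\{R^{I_r}_{I_q,N^\natural}:2\le q<r,\ N\unlhd\mathcal S_{q+1}\}\cup\{\widetilde\nabla_{I_r}\}.$$ The listed congruences are distinct and the inclusion order is as follows. Order pairs $(q,N)$ lexicographically (these form a chain). For $q,q'\le1$ and $\kappa,\kappa'\in\{\mu,\lambda,\rho,R\}$, $\kappa_{I_q,N^\natural}\subseteq\kappa'_{I_{q'},N'^\natural}$ iff $(q,N)\le(q',N')$ and $\kappa\le\kappa'$ in the diamond with bottom $\mu$, top $R$ and incomparable middle elements $\lambda,\rho$; the congruences $R_{I_q,N^\natural}$ with $q\ge2$ form a chain in the lexicographic order of $(q,N)$, lying above all those with $q\le1$; and $\widetilde\nabla_{I_r}$ is the top element.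
   Context: **Partition category.** Let $X=\bigcup_{A\in\mathscr C}A$ with disjoint copies $X'=\{x':x\in X\}$ and $X''=\{x'':x\in X\}$. For $A,B\in\mathscr C$, $\mathcal P_{A,B}$ is the set of all set partitions of $A\cup B'$; for $\alpha\in\mathcal P_{A,B}$, $\mathbf d(\alpha)=A$, $\mathbf r(\alpha)=B$. For $\alpha\in\mathcal P_{A,B}$, $\beta\in\mathcal P_{B,C}$, regard them as equivalences, rename each $b'$ in $\alpha$ and each $b$ in $\beta$ to $b''$ ($b\in B$), take the join of the resulting equivalences on $A\cup B''\cup C'$, and restrict to $A\cup C'$: this is $\alpha\beta\in\mathcal P_{A,C}$. $\mathcal P=\bigcup_{A,B}\mathcal P_{A,B}$. A block of $\alpha\in\mathcal P_{A,B}$ is a transversal if it meets both $A$ and $B'$; $\operatorname{rank}(\alpha)$ is the number of transversals. The $\mathscr J=\mathscr D$-classes of $\mathcal P$ are $D_q=\{\alpha:\operatorname{rank}(\alpha)=q\}$, $0\le q<\xi$, all stable and regular. $\mathfrak{Eq}(Z)$ is the lattice of equivalences on $Z$; $\mathcal S_q$ is the symmetric group on $\{1,\ldots,q\}$. **Groups.** For $0\le q<\xi$ fix $X_q\in\mathscr C$ with $n_q=|X_q|\ge q$, $X_q=\{x_1,\ldots,x_{n_q}\}$. For $\pi\in\mathcal S_q$, $\pi^\natural\in\mathcal P_{X_q,X_q}$ has blocks $\{x_i,x_{i\pi}'\}$ ($1\le i\le q$) and singletons otherwise. $N^\natural=\{\pi^\natural:\pi\in N\}$. $\mathcal S_q^\natural$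 is a group $\mathscr H$-class in $D_q$. **Congruences.** For a partial semigroup (category without necessarily having identities) $S$, write $x\sim y$ if $\mathbf d(x)=\mathbf d(y)$ and $\mathbf r(x)=\mathbf r(y)$. A congruence on $S$ is an equivalence contained in $\sim$ and compatible with all defined left and right multiplications. $\operatorname{Cong}(S)$ is the lattice of congruences. $\Delta_S$ is equality, $\widetilde\nabla_S=\{(x,y):x\sim y\}$. For an ideal $I$ (non-empty, closed under defined multiplication by elements of $S$ on either side), $R_I^S=\widetilde\nabla_I\cup\Delta_S$. Green's relations: $x\mathrel{\mathscr R}y\Leftrightarrow xS^1=yS^1$, $x\mathrel{\mathscr L}y\Leftrightarrow S^1x=S^1y$, $x\mathrel{\mathscr J}y\Leftrightarrow S^1xS^1=S^1yS^1$, $\mathscr H=\mathscr R\cap\mathscr L$ ($S^1$ is $S$ with identities adjoined where needed). For $N$ a normal subgroup of a group $\mathscr H$-class in a $\mathscr J$-class $D$ minimal among those in $S\setminus I$, $\nu_N=\{(axb,ayb):x,y\in N,\ a,b\in S^1,\ axb,ayb\in D\}$ and $R^S_{I,N}=R_I^S\cup\nu_N$. Let $M$ be the minimal ideal of $S$. An ideal $I$ is retractable if there is a map $f:I\to M$ (then unique) with $x\sim xf$, $(xy)f=(xf)(yf)$ for all defined products, and $xf=x$ for $x\in M$. A congruence $\tau$ on $M$ is liftable to $S$ if $\tau\cup\Delta_S\in\operatorname{Cong}(S)$. For $I$ retractable and $\tau$ liftable, $\theta^S_{I,\tau}=\{(x,y)\in I\times I:(xf,yf)\in\tau\}\cup\Delta_S$.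 For $I$ retractable, $\lambda^S_{I,N}=\{(x,y)\in I\times I:x\sim y,\ (xf,yf)\in\mathscr L\}\cup\nu_N\cup\Delta_S$, and $\rho^S_{I,N}$, $\mu^S_{I,N}$ are defined likewise with $\mathscr R$, $\mathscr H$ in place of $\mathscr L$. **Partial rectangular bands.** Given non-empty sets $X_A,Y_A$ ($A\in\mathscr C$), the $X_A$ pairwise disjoint and the $Y_A$ pairwise disjoint, the partial rectangular band is $\bigcup_{A,B}X_A\times Y_B$ with $\mathbf d(x,y)=A$, $\mathbf r(x,y)=B$ for $x\in X_A,y\in Y_B$, and $(x_1,y_1)(x_2,y_2)=(x_1,y_2)$ when $\mathbf r(x_1,y_1)=\mathbf d(x_2,y_2)$. For tuples $\mathcal E_1=(\varepsilon^A_1)_A$, $\mathcal E_2=(\varepsilon_2^A)_A$ with $\varepsilon_1^A\in\mathfrak{Eq}(X_A)$, $\varepsilon_2^A\in\mathfrak{Eq}(Y_A)$, $\sigma_{\mathcal E_1,\mathcal E_2}$ relates $(x_1,y_1)$, $(x_2,y_2)$ iff both lie in a common $X_A\times Y_B$ and $(x_1,x_2)\in\varepsilon_1^A$, $(y_1,y_2)\in\varepsilon_2^B$. Isomorphisms preserve $\mathbf d$, $\mathbf r$. *)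

theory Defs
  imports
    "HOL-Algebra.Sym_Groups"
    "HOL-Algebra.Lattice"
    "HOL-Library.Disjoint_Sets"
    "HOL-Library.Extended_Nat"
begin

section \<open>Partial semigroups\<close>

text \<open>The product \<open>prd S x y\<close> is meaningful only for \<open>x, y \<in> carrier S\<close> with
  \<open>tgt S x = src S y\<close>; its value elsewhere is never used.\<close>

record ('m, 'o) psgp = "'m partial_object" +
  src :: "'m \<Rightarrow> 'o"
  tgt :: "'m \<Rightarrow> 'o"
  prd :: "'m \<Rightarrow> 'm \<Rightarrow> 'm"

definition sub_psgp :: "('m, 'o) psgp \<Rightarrow> 'm set \<Rightarrow> ('m, 'o) psgp" where
  "sub_psgp S I = S \<lparr> carrier := I \<rparr>"

definition psgp_iso :: "('m, 'o) psgp \<Rightarrow> ('n, 'o) psgp \<Rightarrow> ('m \<Rightarrow> 'n) \<Rightarrow> bool" where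
  "psgp_iso S T f \<longleftrightarrow>
     bij_betw f (carrier S) (carrier T) \<and>
     (\<forall>x\<in>carrier S. src T (f x) = src S x \<and> tgt T (f x) = tgt S x) \<and>
     (\<forall>x\<in>carrier S. \<forall>y\<in>carrier S. tgt S x = src S y \<longrightarrow> f (prd S x y) = prd T (f x) (f y))"

definition psim :: "('m, 'o) psgp \<Rightarrow> 'm rel" where
  "psim S = {(x, y). x \<in> carrier S \<and> y \<in> carrier S \<and> src S x = src S y \<and> tgt S x = tgt S y}"

definition Cong :: "('m, 'o) psgp \<Rightarrow> 'm rel set" where
  "Cong S = {\<sigma>. equiv (carrier S) \<sigma> \<and> \<sigma> \<subseteq> psim S \<and>
     (\<forall>(x, y)\<in>\<sigma>. \<forall>a\<in>carrier S.
        (tgt S a = src S x \<longrightarrow> (prd S a x, prd S a y) \<in> \<sigma>) \<and>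
        (tgt S x = src S a \<longrightarrow> (prd S x a, prd S y a) \<in> \<sigma>))}"

definition is_ideal :: "('m, 'o) psgp \<Rightarrow> 'm set \<Rightarrow> bool" where
  "is_ideal S I \<longleftrightarrow> I \<noteq> {} \<and> I \<subseteq> carrier S \<and>
     (\<forall>x\<in>I. \<forall>a\<in>carrier S.
        (tgt S a = src S x \<longrightarrow> prd S a x \<in> I) \<and>
        (tgt S x = src S a \<longrightarrow> prd S x a \<in> I))"

definition is_min_ideal :: "('m, 'o) psgp \<Rightarrow> 'm set \<Rightarrow> bool" where
  "is_min_ideal S M \<longleftrightarrow> is_ideal S M \<and> (\<forall>I. is_ideal S I \<longrightarrow> M \<subseteq> I)"

definition min_ideal :: "('m, 'o) psgp \<Rightarrow> 'm set" where
  "min_ideal S = (THE M. is_min_ideal S M)"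

lemma min_ideal_eq: "is_min_ideal S M \<Longrightarrow> min_ideal S = M"
  unfolding min_ideal_def by (rule the_equality) (auto simp: is_min_ideal_def)


subsection \<open>Green's relations\<close>

text \<open>\<open>adj1 S\<close> models \<open>S\<^sup>1\<close>: \<open>None\<close> stands for the identity at whichever object the product
  requires. Where \<open>S\<close> already has that identity, \<open>None\<close> acts in the same way, so
  the sets \<open>xS\<^sup>1\<close>, \<open>S\<^sup>1x\<close>, \<open>S\<^sup>1xS\<^sup>1\<close> and the relations defined from them are unaffected.\<close>

definition adj1 :: "('m, 'o) psgp \<Rightarrow> 'm option set" where
  "adj1 S = insert None (Some ` carrier S)"

text \<open>\<open>can_sandwich S a x b\<close> says that \<open>axb\<close> is defined, \<open>sandwich S a x b\<close> is its value.\<close>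

definition can_sandwich :: "('m, 'o) psgp \<Rightarrow> 'm option \<Rightarrow> 'm \<Rightarrow> 'm option \<Rightarrow> bool" where
  "can_sandwich S a x b \<longleftrightarrow> (\<forall>s. a = Some s \<longrightarrow> tgt S s = src S x) \<and> (\<forall>t. b = Some t \<longrightarrow> tgt S x = src S t)"

definition sandwich :: "('m, 'o) psgp \<Rightarrow> 'm option \<Rightarrow> 'm \<Rightarrow> 'm option \<Rightarrow> 'm" where
  "sandwich S a x b =
     (let y = (case a of None \<Rightarrow> x | Some s \<Rightarrow> prd S s x)
      in (case b of None \<Rightarrow> y | Some t \<Rightarrow> prd S y t))"

definition right_ideal1 :: "('m, 'o) psgp \<Rightarrow> 'm \<Rightarrow> 'm set" where
  "right_ideal1 S x = {sandwich S None x b | b. b \<in> adj1 S \<and> can_sandwich S None x b}"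

definition left_ideal1 :: "('m, 'o) psgp \<Rightarrow> 'm \<Rightarrow> 'm set" where
  "left_ideal1 S x = {sandwich S a x None | a. a \<in> adj1 S \<and> can_sandwich S a x None}"

definition ideal1 :: "('m, 'o) psgp \<Rightarrow> 'm \<Rightarrow> 'm set" where
  "ideal1 S x = {sandwich S a x b | a b. a \<in> adj1 S \<and> b \<in> adj1 S \<and> can_sandwich S a x b}"

definition green_R :: "('m, 'o) psgp \<Rightarrow> 'm rel" where
  "green_R S = {(x, y). x \<in> carrier S \<and> y \<in> carrier S \<and> right_ideal1 S x = right_ideal1 S y}"

definition green_L :: "('m, 'o) psgp \<Rightarrow> 'm rel" where
  "green_L S = {(x, y). x \<in> carrier S \<and> y \<in> carrier S \<and> left_ideal1 S x = left_ideal1 S y}"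

definition green_J :: "('m, 'o) psgp \<Rightarrow> 'm rel" where
  "green_J S = {(x, y). x \<in> carrier S \<and> y \<in> carrier S \<and> ideal1 S x = ideal1 S y}"

definition green_H :: "('m, 'o) psgp \<Rightarrow> 'm rel" where
  "green_H S = green_R S \<inter> green_L S"


subsection \<open>Rees-type congruences and retractions\<close>

definition nabla_on :: "('m, 'o) psgp \<Rightarrow> 'm set \<Rightarrow> 'm rel" where
  "nabla_on S I = psim S \<inter> I \<times> I"

text \<open>In \<open>nu_rel S N\<close> the set \<open>N\<close> is meant to be a normal subgroup of a group \<open>\<H>\<close>-class of \<open>S\<close>;
  \<open>D\<close> is the \<open>\<J>\<close>-class containing it.\<close>

definition nu_rel :: "('m, 'o) psgp \<Rightarrow> 'm set \<Rightarrow> 'm rel" where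
  "nu_rel S N =
     (let D = green_J S `` N in
      {(sandwich S a x b, sandwich S a y b) | a b x y.
         a \<in> adj1 S \<and> b \<in> adj1 S \<and> x \<in> N \<and> y \<in> N \<and>
         can_sandwich S a x b \<and> can_sandwich S a y b \<and>
         sandwich S a x b \<in> D \<and> sandwich S a y b \<in> D})"

definition R_cong :: "('m, 'o) psgp \<Rightarrow> 'm set \<Rightarrow> 'm set \<Rightarrow> 'm rel" where
  "R_cong S I N = (nabla_on S I \<union> Id_on (carrier S)) \<union> nu_rel S N"

definition is_retraction :: "('m, 'o) psgp \<Rightarrow> 'm set \<Rightarrow> ('m \<Rightarrow> 'm) \<Rightarrow> bool" where
  "is_retraction S I f \<longleftrightarrow>
     (\<forall>x\<in>I. f x \<in> min_ideal S \<and> (x, f x) \<in> psim S) \<and>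
     (\<forall>x\<in>I. \<forall>y\<in>I. tgt S x = src S y \<longrightarrow> f (prd S x y) = prd S (f x) (f y)) \<and>
     (\<forall>x\<in>min_ideal S. f x = x)"

definition retractable :: "('m, 'o) psgp \<Rightarrow> 'm set \<Rightarrow> bool" where
  "retractable S I \<longleftrightarrow> is_ideal S I \<and> (\<exists>f. is_retraction S I f)"

text \<open>The retraction of a retractable ideal is unique as a map on \<open>I\<close>; only values on \<open>I\<close>
  are used below.\<close>

definition retr :: "('m, 'o) psgp \<Rightarrow> 'm set \<Rightarrow> 'm \<Rightarrow> 'm" where
  "retr S I = (SOME f. is_retraction S I f)"

definition liftable :: "('m, 'o) psgp \<Rightarrow> 'm rel \<Rightarrow> bool" where
  "liftable S \<tau> \<longleftrightarrow> \<tau> \<in> Cong (sub_psgp S (min_ideal S)) \<and> \<tau> \<union> Id_on (carrier S) \<in> Cong S"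

definition theta_cong :: "('m, 'o) psgp \<Rightarrow> 'm set \<Rightarrow> 'm rel \<Rightarrow> 'm rel" where
  "theta_cong S I \<tau> = {(x, y). x \<in> I \<and> y \<in> I \<and> (retr S I x, retr S I y) \<in> \<tau>} \<union> Id_on (carrier S)"

definition retr_cong :: "'m rel \<Rightarrow> ('m, 'o) psgp \<Rightarrow> 'm set \<Rightarrow> 'm set \<Rightarrow> 'm rel" where
  "retr_cong K S I N =
     {(x, y). x \<in> I \<and> y \<in> I \<and> (x, y) \<in> psim S \<and> (retr S I x, retr S I y) \<in> K}
     \<union> nu_rel S N \<union> Id_on (carrier S)"

definition lambda_cong :: "('m, 'o) psgp \<Rightarrow> 'm set \<Rightarrow> 'm set \<Rightarrow> 'm rel" where
  "lambda_cong S = retr_cong (green_L S) S"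

definition rho_cong :: "('m, 'o) psgp \<Rightarrow> 'm set \<Rightarrow> 'm set \<Rightarrow> 'm rel" where
  "rho_cong S = retr_cong (green_R S) S"

definition mu_cong :: "('m, 'o) psgp \<Rightarrow> 'm set \<Rightarrow> 'm set \<Rightarrow> 'm rel" where
  "mu_cong S = retr_cong (green_H S) S"

datatype kind = Mu | Lam | Rho | Ree

primrec kappa_cong :: "kind \<Rightarrow> ('m, 'o) psgp \<Rightarrow> 'm set \<Rightarrow> 'm set \<Rightarrow> 'm rel" where
  "kappa_cong Mu = mu_cong"
| "kappa_cong Lam = lambda_cong"
| "kappa_cong Rho = rho_cong"
| "kappa_cong Ree = R_cong"

definition kind_le :: "kind \<Rightarrow> kind \<Rightarrow> bool" where
  "kind_le k k' \<longleftrightarrow> k = k' \<or> k = Mu \<or> k' = Ree"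


subsection \<open>Partial rectangular bands\<close>

definition prb_data :: "'o set \<Rightarrow> ('o \<Rightarrow> 'x set) \<Rightarrow> ('o \<Rightarrow> 'y set) \<Rightarrow> bool" where
  "prb_data C X Y \<longleftrightarrow> (\<forall>A\<in>C. X A \<noteq> {} \<and> Y A \<noteq> {}) \<and> disjoint_family_on X C \<and> disjoint_family_on Y C"

definition prb :: "'o set \<Rightarrow> ('o \<Rightarrow> 'x set) \<Rightarrow> ('o \<Rightarrow> 'y set) \<Rightarrow> ('x \<times> 'y, 'o) psgp" where
  "prb C X Y = \<lparr> carrier = (\<Union>A\<in>C. \<Union>B\<in>C. X A \<times> Y B),
     src = (\<lambda>p. THE A. A \<in> C \<and> fst p \<in> X A),
     tgt = (\<lambda>p. THE B. B \<in> C \<and> snd p \<in> Y B),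
     prd = (\<lambda>p q. (fst p, snd q)) \<rparr>"

definition prb_sigma ::
  "'o set \<Rightarrow> ('o \<Rightarrow> 'x set) \<Rightarrow> ('o \<Rightarrow> 'y set) \<Rightarrow> ('o \<Rightarrow> 'x rel) \<Rightarrow> ('o \<Rightarrow> 'y rel) \<Rightarrow> ('x \<times> 'y) rel" where
  "prb_sigma C X Y E1 E2 =
     {((x1, y1), (x2, y2)). \<exists>A\<in>C. \<exists>B\<in>C.
        (x1, y1) \<in> X A \<times> Y B \<and> (x2, y2) \<in> X A \<times> Y B \<and> (x1, x2) \<in> E1 A \<and> (y1, y2) \<in> E2 B}"


section \<open>Lattices\<close>

definition incl_order :: "'b set set \<Rightarrow> 'b set gorder" where
  "incl_order F = \<lparr> carrier = F, eq = (=), le = (\<subseteq>) \<rparr>"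

definition cong_lattice :: "('m, 'o) psgp \<Rightarrow> 'm rel gorder" where
  "cong_lattice S = incl_order (Cong S)"

definition Eqs :: "'b set \<Rightarrow> 'b rel set" where
  "Eqs Z = {\<epsilon>. equiv Z \<epsilon>}"

definition Eq_lattice :: "'b set \<Rightarrow> 'b rel gorder" where
  "Eq_lattice Z = incl_order (Eqs Z)"

definition prod_order :: "'b gorder \<Rightarrow> 'c gorder \<Rightarrow> ('b \<times> 'c) gorder" where
  "prod_order L M = \<lparr> carrier = carrier L \<times> carrier M, eq = (=),
     le = (\<lambda>(a, b) (c, d). le L a c \<and> le M b d) \<rparr>"

definition Prod_order :: "'i set \<Rightarrow> ('i \<Rightarrow> 'b gorder) \<Rightarrow> ('i \<Rightarrow> 'b) gorder" where
  "Prod_order J L = \<lparr> carrier = (\<Pi>\<^sub>E i\<in>J. carrier (L i)), eq = (=),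
     le = (\<lambda>f g. \<forall>i\<in>J. le (L i) (f i) (g i)) \<rparr>"

definition two_chain :: "bool gorder" where
  "two_chain = \<lparr> carrier = UNIV, eq = (=), le = (\<le>) \<rparr>"

text \<open>\<open>join_pres\<close> and \<open>meet_pres\<close> include the assertion that both structures are lattices.\<close>

definition lattice_iso :: "'b gorder \<Rightarrow> 'c gorder \<Rightarrow> ('b \<Rightarrow> 'c) \<Rightarrow> bool" where
  "lattice_iso L M f \<longleftrightarrow> bij_betw f (carrier L) (carrier M) \<and> join_pres L M f \<and> meet_pres L M f"

definition lattice_isomorphic :: "'b gorder \<Rightarrow> 'c gorder \<Rightarrow> bool" where
  "lattice_isomorphic L M \<longleftrightarrow> (\<exists>f. lattice_iso L M f)"


section \<open>The partition category\<close>

text \<open>\<open>Inl\<close> and \<open>Inr\<close> give the two copies \<open>A\<close> and \<open>B'\<close>, so that \<open>A \<union> B'\<close> is \<open>A <+> B\<close>. A set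
  partition determines its underlying set, hence also \<open>A\<close> and \<open>B\<close>.\<close>

type_synonym 'a part = "('a + 'a) set set"

definition pdom :: "'a part \<Rightarrow> 'a set" where
  "pdom \<alpha> = {a. Inl a \<in> \<Union>\<alpha>}"

definition pcod :: "'a part \<Rightarrow> 'a set" where
  "pcod \<alpha> = {b. Inr b \<in> \<Union>\<alpha>}"

definition eqrel :: "'b set set \<Rightarrow> 'b rel" where
  "eqrel P = {(u, v). \<exists>b\<in>P. u \<in> b \<and> v \<in> b}"

datatype 'a layer = Upper_layer 'a | Middle_layer 'a | Lower_layer 'a

definition upper_part :: "'a + 'a \<Rightarrow> 'a layer" where
  "upper_part = case_sum Upper_layer Middle_layer"

definition lower_part :: "'a + 'a \<Rightarrow> 'a layer" where
  "lower_part = case_sum Middle_layer Lower_layer"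

definition outer_part :: "'a + 'a \<Rightarrow> 'a layer" where
  "outer_part = case_sum Upper_layer Lower_layer"

text \<open>The join of the two (renamed) equivalences is the transitive closure of their union.\<close>

definition pjoin :: "'a part \<Rightarrow> 'a part \<Rightarrow> 'a layer rel" where
  "pjoin \<alpha> \<beta> = (map_prod upper_part upper_part ` eqrel \<alpha> \<union> map_prod lower_part lower_part ` eqrel \<beta>)\<^sup>+"

definition pmult :: "'a part \<Rightarrow> 'a part \<Rightarrow> 'a part" where
  "pmult \<alpha> \<beta> = (pdom \<alpha> <+> pcod \<beta>) //
     {(u, v). u \<in> pdom \<alpha> <+> pcod \<beta> \<and> v \<in> pdom \<alpha> <+> pcod \<beta> \<and> (outer_part u, outer_part v) \<in> pjoin \<alpha> \<beta>}"

definition part_cat :: "'a set set \<Rightarrow> ('a part, 'a set) psgp" where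
  "part_cat C = \<lparr> carrier = {\<alpha>. \<exists>A\<in>C. \<exists>B\<in>C. partition_on (A <+> B) \<alpha>},
     src = pdom, tgt = pcod, prd = pmult \<rparr>"

definition transversals :: "'a part \<Rightarrow> ('a + 'a) set set" where
  "transversals \<alpha> = {b \<in> \<alpha>. (\<exists>x. Inl x \<in> b) \<and> (\<exists>y. Inr y \<in> b)}"

definition rank :: "'a part \<Rightarrow> nat" where
  "rank \<alpha> = card (transversals \<alpha>)"

text \<open>As the sets in \<open>C\<close> are finite, the least cardinal \<open>\<xi>\<close> is at most \<open>\<omega>\<close>; here \<open>\<infinity>\<close> is \<open>\<omega>\<close>.\<close>

definition xi :: "'a set set \<Rightarrow> enat" where
  "xi C = (LEAST k. \<forall>A\<in>C. enat (card A) < k)"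

definition rank_ideal :: "'a set set \<Rightarrow> enat \<Rightarrow> 'a part set" where
  "rank_ideal C r = {\<alpha> \<in> carrier (part_cat C). enat (rank \<alpha>) \<le> r}"

definition rank_psgp :: "'a set set \<Rightarrow> enat \<Rightarrow> ('a part, 'a set) psgp" where
  "rank_psgp C r = sub_psgp (part_cat C) (rank_ideal C r)"

text \<open>\<open>natural x n q \<pi>\<close> is \<open>\<pi>\<^sup>\<natural>\<close> for \<open>X\<^sub>q = {x 1, \<dots>, x n}\<close> (the \<open>x i\<close> distinct) and \<open>\<pi> \<in> \<S>\<^sub>q\<close>, \<open>q \<le> n\<close>.\<close>

definition natural :: "(nat \<Rightarrow> 'a) \<Rightarrow> nat \<Rightarrow> nat \<Rightarrow> (nat \<Rightarrow> nat) \<Rightarrow> 'a part" where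
  "natural x n q \<pi> =
     (\<lambda>i. {Inl (x i), Inr (x (\<pi> i))}) ` {1..q} \<union>
     (\<lambda>i. {Inl (x i)}) ` {q+1..n} \<union> (\<lambda>i. {Inr (x i)}) ` {q+1..n}"

text \<open>\<open>sym_group\<close> composes from right to left, so \<open>\<pi> \<mapsto> \<pi>\<^sup>\<natural>\<close> is an anti-isomorphism onto
  \<open>\<S>\<^sub>q\<^sup>\<natural>\<close>; the normal subgroups are the same for either order of composition.

  The set below consists of the pairs \<open>(q, N)\<close> with \<open>q\<close> in the given range and
  \<open>N\<close> normal in \<open>\<S>\<^sub>q\<^sub>+\<^sub>1\<close>.\<close>

definition qN_pairs :: "nat set \<Rightarrow> (nat \<times> (nat \<Rightarrow> nat) set) set" where
  "qN_pairs Q = {(q, N). q \<in> Q \<and> N \<lhd> sym_group (q + 1)}"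

definition qN_le :: "nat \<times> (nat \<Rightarrow> nat) set \<Rightarrow> nat \<times> (nat \<Rightarrow> nat) set \<Rightarrow> bool" where
  "qN_le p p' \<longleftrightarrow> fst p < fst p' \<or> (fst p = fst p' \<and> snd p \<subseteq> snd p')"

end

theory Submission
  imports Defs
begin

text \<open>A set partition of \<open>A \<union> B'\<close> is determined by its saturated sets, which form a Boolean
  subalgebra of \<open>Pow A \<times> Pow B\<close>, that is, a Boolean relation between \<open>Pow A\<close> and \<open>Pow B\<close>. Under this
  encoding the product of the partition category is relational composition, and the partitions of rank
  \<open>q\<close> are the composites \<open>u O v\<inverse>\<close> of two graphs \<open>u\<close>, \<open>v\<close> of homomorphisms onto \<open>Pow {1..q}\<close>. A congruence
  therefore induces one on the monoid of Boolean relations on each \<open>{1..q}\<close>. A non-trivial pair of which one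
  member has rank \<open>q\<close> leads there either to a pair of permutations, which is measured by a normal subgroup of
  \<open>\<S>\<^sub>q\<close>, or to the identity being related to a relation of lower rank. For \<open>q \<ge> 2\<close>, multiplication with
  the idempotents that forget one point then yields non-trivial pairs one rank lower. In ranks 0 and 1 the
  map \<open>\<alpha> \<mapsto> (ker \<alpha>, coker \<alpha>)\<close> is multiplicative into a rectangular band, which is why the collapse may stop at
  the kernel, the cokernel or both there.\<close>

section \<open>Normal subgroups of a symmetric group are linearly ordered: 3-cycles, commutators,
  the four-group\<close>

section \<open>Normal subgroups of symmetric groups\<close>

text \<open>The set \<open>{1..q}\<close> need not be an object, and an ideal need not contain
  identities. What rescues the argument is that a composite factoring through \<open>{1..q}\<close>
  has rank at most \<open>q\<close> and so is a legitimate multiplier: pairs are pulled back along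
  halves and pushed forward along arbitrary relations. Two halves that differ by more than a
  permutation are told apart by altering a Boolean section of one with a single set outside its
  domain that the other sends to a point. Two accidents of small numbers shape the list. A
  congruence that respects kernels or cokernels must remain one when a pair that differs by a
  permutation of \<open>q + 1\<close> points drops in rank; for \<open>q \<le> 1\<close> it does,
  because every subalgebra of \<open>Pow {1, 2}\<close> is invariant under permutations. And one
  pair of rank 0 with different cokernels spreads to all objects only by multipliers of rank 2, so
  rank at most 1 leaves a whole product of lattices, while larger ideals leave just four kinds. The
  chain of pairs \<open>(q, N)\<close> rests on the normal subgroups of a symmetric group being
  linearly ordered, where degree 4 with its four-group is the case to watch.\<close>

lemma permutes_triple:
  assumes d: "distinct [a, b, c]" "distinct [a', b', c']" and s: "{a, b, c} \<subseteq> {1..n}" "{a', b', c'} \<subseteq> {1..n::nat}"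
  shows "\<exists>p. p permutes {1..n} \<and> p a = a' \<and> p b = b' \<and> p c = c'"
proof -
  have "card ({1..n} - {a, b, c}) = card ({1..n} - {a', b', c'})"
    using d s by (simp add: card_Diff_subset)
  then obtain f where f: "bij_betw f ({1..n} - {a, b, c}) ({1..n} - {a', b', c'})"
    using finite_same_card_bij[of "{1..n} - {a, b, c}" "{1..n} - {a', b', c'}"] by auto
  define p where "p x = (if x = a then a' else if x = b then b' else if x = c then c' else if x \<in> {1..n} then f x else x)" for x
  have 1: "bij_betw p {a, b, c} {a', b', c'}"
    using d unfolding bij_betw_def p_def inj_on_def by auto
  have 2: "bij_betw p ({1..n} - {a, b, c}) ({1..n} - {a', b', c'})"
    using f by (rule bij_betw_cong[THEN iffD1, rotated]) (auto simp: p_def)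
  have "bij_betw p ({a, b, c} \<union> ({1..n} - {a, b, c})) ({a', b', c'} \<union> ({1..n} - {a', b', c'}))"
    by (rule bij_betw_combine[OF 1 2]) auto
  moreover have "{a, b, c} \<union> ({1..n} - {a, b, c}) = {1..n}" "{a', b', c'} \<union> ({1..n} - {a', b', c'}) = {1..n}"
    using s by blast+
  ultimately have "bij_betw p {1..n} {1..n}" by simp
  then have "p permutes {1..n}"
    by (rule bij_imp_permutes) (use s in \<open>auto simp: p_def\<close>)
  moreover have "p a = a'" "p b = b'" "p c = c'" using d unfolding p_def by auto
  ultimately show ?thesis by blast
qed

lemma sym_normal_conj:
  assumes N: "N \<lhd> sym_group n" and x: "x \<in> N" and p: "p permutes {1..n}"
  shows "p \<circ> x \<circ> Hilbert_Choice.inv p \<in> N"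
proof -
  have "p \<in> carrier (sym_group n)" using p by (simp add: sym_group_carrier)
  then show ?thesis using normal.inv_op_closed2[OF N _ x] by (simp add: sym_group_mult)
qed

lemma sym_normal_comp: "N \<lhd> sym_group n \<Longrightarrow> x \<in> N \<Longrightarrow> y \<in> N \<Longrightarrow> x \<circ> y \<in> N"
  using subgroup.m_closed[OF normal_imp_subgroup, of N "sym_group n" x y] by (simp add: sym_group_mult)

lemma sym_normal_inv: "N \<lhd> sym_group n \<Longrightarrow> x \<in> N \<Longrightarrow> Hilbert_Choice.inv x \<in> N"
  using subgroup.m_inv_closed[OF normal_imp_subgroup, of N "sym_group n" x]
    sym_group_inv_equality[OF subgroup.mem_carrier[OF normal_imp_subgroup], of N n x] by simp

lemma sym_normal_permutes: "N \<lhd> sym_group n \<Longrightarrow> x \<in> N \<Longrightarrow> x permutes {1..n}"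
  using subgroup.mem_carrier[OF normal_imp_subgroup, of N "sym_group n" x] by (simp add: sym_group_carrier)

lemma sym_normal_subset: "N \<lhd> sym_group q \<Longrightarrow> N \<subseteq> {\<pi>. \<pi> permutes {1..q}}"
  using subgroup.subset[OF normal_imp_subgroup] sym_group_carrier by blast

lemma sym_normal_id: "N \<lhd> sym_group q \<Longrightarrow> id \<in> N"
  using subgroup.one_closed[OF normal_imp_subgroup] by (metis sym_group_one)

lemma sym_normal_conj_inv:
  assumes N: "N \<lhd> sym_group q" and p: "\<pi> \<in> N" and s: "\<sigma> permutes {1..q}"
  shows "Hilbert_Choice.inv \<sigma> \<circ> \<pi> \<circ> \<sigma> \<in> N"
proof -
  have "\<sigma> \<in> carrier (sym_group q)" using s by (simp add: sym_group_carrier)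
  then show ?thesis using normal.inv_op_closed1[OF N _ p] by (simp add: sym_group_mult)
qed

text \<open>All 3-cycles are conjugate in the symmetric group, because it is transitive on triples
  of distinct points, and they generate the alternating group.\<close>

lemma sym_normal_three_cycle:
  assumes N: "N \<lhd> sym_group n" and d: "distinct [a, b, c]" "{a, b, c} \<subseteq> {1..n}"
    and x: "transpose a b \<circ> transpose b c \<in> N"
  shows "carrier (alt_group n) \<subseteq> N"
proof -
  have tc: "three_cycles n \<subseteq> N"
  proof
    fix y assume "y \<in> three_cycles n"
    then obtain cs where cs: "y = cycle_of_list cs" "distinct cs" "length cs = 3" "set cs \<subseteq> {1..n}" by auto
    obtain a' b' c' where cs': "cs = [a', b', c']" using stupid_lemma[OF cs(3)] by blast
    have "distinct [a', b', c']" "{a', b', c'} \<subseteq> {1..n}" using cs cs' by auto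
    then obtain p where p: "p permutes {1..n}" "p a = a'" "p b = b'" "p c = c'"
      using permutes_triple[OF d(1) _ d(2)] by blast
    have "p \<circ> cycle_of_list [a, b, c] \<circ> Hilbert_Choice.inv p = cycle_of_list (map p [a, b, c])"
      by (rule conjugation_of_cycle[OF d(1) permutes_bij[OF p(1)]])
    then have "p \<circ> (transpose a b \<circ> transpose b c) \<circ> Hilbert_Choice.inv p = y"
      unfolding cs(1) cs' using p(2-4) by simp
    then show "y \<in> N" using sym_normal_conj[OF N x p(1)] by simp
  qed
  \<comment> \<open>Generation by 3-cycles is stated inside \<open>alt_group n\<close>. Viewing this
    group as the symmetric group with a smaller carrier moves \<open>generate\<close> to the ambient
    group, where \<open>N\<close> lives.\<close>
  have alt: "alt_group n = (sym_group n) \<lparr> carrier := carrier (alt_group n) \<rparr>"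
    unfolding alt_group_def by simp
  have "carrier (alt_group n) = generate (alt_group n) (three_cycles n)"
    by (rule alt_group_carrier_as_three_cycles)
  also have "\<dots> = generate ((sym_group n) \<lparr> carrier := carrier (alt_group n) \<rparr>) (three_cycles n)"
    using alt by simp
  also have "\<dots> = generate (sym_group n) (three_cycles n)"
    using group.generate_consistent[OF sym_group_is_group three_cycles_incl alt_group_is_subgroup] .
  also have "\<dots> \<subseteq> N"
    by (rule group.generate_subgroup_incl[OF sym_group_is_group tc normal_imp_subgroup[OF N]])
  finally show ?thesis .
qed

text \<open>The element is the commutator of \<open>\<sigma>\<close> with the transposition of
  \<open>a\<close> and \<open>c\<close>: \<open>\<sigma>\<close> times a conjugate of its inverse,
  where conjugating a transposition just relabels its two points. Two transpositions with exactly
  one common point would make it a 3-cycle.\<close>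

lemma sym_normal_commutator:
  assumes N: "N \<lhd> sym_group n" and s: "\<sigma> \<in> N" and a: "a \<in> {1..n}" "c \<in> {1..n}"
  shows "transpose (\<sigma> a) (\<sigma> c) \<circ> transpose a c \<in> N"
proof -
  have sp: "\<sigma> permutes {1..n}" by (rule sym_normal_permutes[OF N s])
  have tp: "transpose a c permutes {1..n}" using a by (rule permutes_swap_id)
  have "\<sigma> \<circ> (transpose a c \<circ> Hilbert_Choice.inv \<sigma> \<circ> Hilbert_Choice.inv (transpose a c)) \<in> N"
    by (intro sym_normal_comp[OF N s] sym_normal_conj[OF N _ tp] sym_normal_inv[OF N s])
  moreover have "\<sigma> \<circ> transpose a c = transpose (\<sigma> a) (\<sigma> c) \<circ> \<sigma>"
    using permutes_inj[OF sp] by (auto simp: fun_eq_iff transpose_def dest: injD)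
  then have "\<sigma> \<circ> (transpose a c \<circ> Hilbert_Choice.inv \<sigma> \<circ> Hilbert_Choice.inv (transpose a c))
      = transpose (\<sigma> a) (\<sigma> c) \<circ> (\<sigma> \<circ> Hilbert_Choice.inv \<sigma>) \<circ> Hilbert_Choice.inv (transpose a c)"
    by (simp only: o_assoc)
  ultimately show ?thesis unfolding permutes_inv_o(1)[OF sp] by simp
qed

text \<open>In both excluded cases the two transpositions of \<open>sym_normal_commutator\<close>
  have exactly one point in common, so \<open>N\<close> would contain a 3-cycle and hence the
  alternating group.\<close>

lemma sym_normal_moved:
  assumes N: "N \<lhd> sym_group n" and no: "\<not> carrier (alt_group n) \<subseteq> N" and s: "\<sigma> \<in> N"
    and a: "\<sigma> a \<noteq> a" and c: "c \<in> {1..n}" "c \<noteq> a" "c \<noteq> \<sigma> a"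
  shows "\<sigma> c \<noteq> c \<and> \<sigma> c \<noteq> a"
proof -
  have sp: "\<sigma> permutes {1..n}" by (rule sym_normal_permutes[OF N s])
  have aN: "a \<in> {1..n}" using permutes_not_in[OF sp] a by blast
  have bN: "\<sigma> a \<in> {1..n}" using permutes_in_image[OF sp] aN by simp
  have "False" if "\<sigma> c = a"
  proof -
    have t: "transpose (\<sigma> a) a \<circ> transpose a c \<in> N" using sym_normal_commutator[OF N s aN c(1)] that by simp
    then show False using sym_normal_three_cycle[OF N _ _ t] no a c aN bN by auto
  qed
  moreover have "False" if "\<sigma> c = c"
  proof -
    have t: "transpose (\<sigma> a) c \<circ> transpose c a \<in> N"
      using sym_normal_commutator[OF N s aN c(1)] that by (simp add: transpose_commute)
    then show False using sym_normal_three_cycle[OF N _ _ t] no a c aN bN by auto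
  qed
  ultimately show ?thesis by blast
qed

text \<open>For a moved point \<open>a\<close> and a third point \<open>c\<close> the commutator is
  a product of two disjoint transpositions. A fifth point would be fixed by it, which
  \<open>sym_normal_moved\<close> forbids, so the degree is 4.\<close>

lemma sym_normal_double_transposition:
  assumes N: "N \<lhd> sym_group n" and no: "\<not> carrier (alt_group n) \<subseteq> N" and ne: "N \<noteq> {id}" and n: "3 \<le> n"
  shows "n = 4 \<and> (\<exists>x\<in>N. x \<noteq> id \<and> x \<in> carrier (alt_group n))"
proof -
  have "id \<in> N" using subgroup.one_closed[OF normal_imp_subgroup[OF N]] by (simp add: sym_group_one)
  then obtain \<sigma> where s: "\<sigma> \<in> N" "\<sigma> \<noteq> id" using ne by blast
  have sp: "\<sigma> permutes {1..n}" by (rule sym_normal_permutes[OF N s(1)])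
  obtain a where a: "\<sigma> a \<noteq> a" using s(2) by (auto simp: fun_eq_iff)
  define b where "b = \<sigma> a"
  have aN: "a \<in> {1..n}" using permutes_not_in[OF sp] a by blast
  have bN: "b \<in> {1..n}" using permutes_in_image[OF sp] aN unfolding b_def by simp
  have "card {a, b} \<le> 2" by (simp add: card_insert_if)
  then have "\<not> {1..n} \<subseteq> {a, b}" using n card_mono[of "{a, b}" "{1..n}"] by auto
  then obtain c where c: "c \<in> {1..n}" "c \<noteq> a" "c \<noteq> b" by blast
  define d where "d = \<sigma> c"
  have dm: "d \<noteq> c" "d \<noteq> a" using sym_normal_moved[OF N no s(1) a c(1,2)] c(3) unfolding b_def d_def by auto
  have db: "d \<noteq> b" using permutes_inj[OF sp] c(2) unfolding b_def d_def by (auto dest: injD)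
  have dN: "d \<in> {1..n}" using permutes_in_image[OF sp] c unfolding d_def by simp
  let ?t = "transpose b d \<circ> transpose a c"
  have t: "?t \<in> N" using sym_normal_commutator[OF N s(1) aN c(1)] unfolding b_def d_def .
  have dist: "b \<noteq> a" "c \<noteq> a" "c \<noteq> b" "d \<noteq> c" "d \<noteq> a" "d \<noteq> b" using a c dm db unfolding b_def by auto
  have "n = 4"
  proof (rule ccontr)
    assume n4: "n \<noteq> 4"
    have cs: "card {a, b, c, d} = 4" using dist by simp
    have "{a, b, c, d} \<subseteq> {1..n}" using aN bN c dN by auto
    then have "4 \<le> n" using card_mono[of "{1..n}" "{a, b, c, d}"] cs by simp
    then have "\<not> {1..n} \<subseteq> {a, b, c, d}" using n4 card_mono[of "{a, b, c, d}" "{1..n}"] cs by auto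
    then obtain e where e: "e \<in> {1..n}" "e \<notin> {a, b, c, d}" by blast
    have "?t d \<noteq> d" using dist by (auto simp: transpose_def)
    moreover have "?t d = b" using dist by (auto simp: transpose_def)
    moreover have "?t e = e" using e by (auto simp: transpose_def)
    ultimately show False using sym_normal_moved[OF N no t, of d e] e by auto
  qed
  moreover have "?t \<in> carrier (alt_group n)"
  proof -
    have "evenperm ?t"
      using dist by (simp add: evenperm_comp permutation_swap_id evenperm_swap)
    then show ?thesis unfolding alt_group_carrier using sym_normal_permutes[OF N t] by simp
  qed
  moreover have "?t \<noteq> id"
  proof
    assume "?t = id"
    then have "?t a = a" by simp
    then show False using dist by (auto simp: transpose_def split: if_splits)
  qed
  ultimately show ?thesis using t by blast
qed

text \<open>In degree 4 a normal subgroup without 3-cycles consists of the identity and fixed-point-free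
  involutions, and such an involution is determined by its value at 1.\<close>

lemma sym4_normal_subset:
  assumes N: "N \<lhd> sym_group 4" "\<not> carrier (alt_group 4) \<subseteq> N" and N': "N' \<lhd> sym_group 4" "\<not> carrier (alt_group 4) \<subseteq> N'"
    and ne: "N' \<noteq> {id}"
  shows "N \<subseteq> N'"
proof
  fix \<sigma> assume s: "\<sigma> \<in> N"
  have id': "id \<in> N'" using subgroup.one_closed[OF normal_imp_subgroup[OF N'(1)]] by (simp add: sym_group_one)
  show "\<sigma> \<in> N'"
  proof (cases "\<sigma> = id")
    case False
    obtain \<rho> where r: "\<rho> \<in> N'" "\<rho> \<noteq> id" using ne id' by blast
    have four: "{1..4::nat} = {1, 2, 3, 4}" by auto
    have inv: "x (x a) = a \<and> (a \<in> {1..4} \<longrightarrow> x a \<noteq> a \<and> x a \<in> {1..4})"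
      if M: "M \<lhd> sym_group 4" "\<not> carrier (alt_group 4) \<subseteq> M" and x: "x \<in> M" "x \<noteq> id" for M x a
    proof -
      have xp: "x permutes {1..4}" by (rule sym_normal_permutes[OF M(1) x(1)])
      obtain e where e: "x e \<noteq> e" using x(2) by (auto simp: fun_eq_iff)
      note mv = sym_normal_moved[OF M x(1)]
      have ne: "x a \<noteq> a" if a: "a \<in> {1..4}" for a
      proof (cases "a = e \<or> a = x e")
        case True
        then show ?thesis using e permutes_inj[OF xp] by (auto dest: injD)
      next
        case False
        then show ?thesis using mv[OF e a] by blast
      qed
      have "x (x a) = a" if a: "a \<in> {1..4}"
      proof (rule ccontr)
        assume xx: "x (x a) \<noteq> a"
        obtain c where c: "x c = a" using permutes_surj[OF xp] by (metis surjD)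
        then have "c \<in> {1..4}" using a permutes_in_image[OF xp] by metis
        moreover have "c \<noteq> a" using c ne[OF a] by auto
        moreover have "c \<noteq> x a" using c xx by auto
        ultimately show False using mv[OF ne[OF a]] c by blast
      qed
      then show ?thesis using ne permutes_in_image[OF xp] permutes_not_in[OF xp] by (metis)
    qed
    define b where "b = \<sigma> 1"
    \<comment> \<open>Both \<open>\<sigma>\<close> and \<open>\<rho>\<close> move 1. Conjugation
      with this \<open>p\<close>, which fixes 1, turns \<open>\<rho>\<close> into an element of
      \<open>N'\<close> with the same value at 1 as \<open>\<sigma>\<close>, hence into
      \<open>\<sigma>\<close> itself.\<close>
    define p where "p = transpose (\<rho> 1) b"
    have 1: "(1::nat) \<in> {1..4}" by simp
    have b: "b \<in> {1..4}" "b \<noteq> 1" using inv[OF N s False, of 1] unfolding b_def by auto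
    have r1: "\<rho> 1 \<in> {1..4}" "\<rho> 1 \<noteq> 1" using inv[OF N' r, of 1] by auto
    have pp: "p permutes {1..4}" unfolding p_def using r1(1) b(1) by (rule permutes_swap_id)
    define \<tau> where "\<tau> = p \<circ> \<rho> \<circ> Hilbert_Choice.inv p"
    have tN: "\<tau> \<in> N'" unfolding \<tau>_def by (rule sym_normal_conj[OF N'(1) r(1) pp])
    have t1: "\<tau> 1 = b" unfolding \<tau>_def p_def using b r1 by (simp add: transpose_def)
    then have tne: "\<tau> \<noteq> id" using b by auto
    have tp: "\<tau> permutes {1..4}" by (rule sym_normal_permutes[OF N'(1) tN])
    have sp: "\<sigma> permutes {1..4}" by (rule sym_normal_permutes[OF N(1) s])
    have "\<sigma> x = \<tau> x" for x
    proof (cases "x \<in> {1..4}")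
      case False
      then show ?thesis using permutes_not_in[OF tp] permutes_not_in[OF sp] by simp
    next
      case x: True
      note S = inv[OF N s False] and T = inv[OF N' tN tne]
      consider "x = 1" | "x = b" | "x \<noteq> 1" "x \<noteq> b" by blast
      then show ?thesis
      proof cases
        case 1 then show ?thesis using t1 b_def by simp
      next
        case 2
        then show ?thesis using S[of 1] T[of 1] t1 unfolding b_def by simp
      next
        case 3
        have "\<sigma> x \<noteq> 1" "\<tau> x \<noteq> 1" using S[of x] T[of x] t1 3(2) unfolding b_def by auto
        moreover have "\<sigma> x \<noteq> b" "\<tau> x \<noteq> b"
          using injD[OF permutes_inj[OF sp], of x 1] injD[OF permutes_inj[OF tp], of x 1] 3(1) t1 unfolding b_def by auto
        moreover have "\<sigma> x \<noteq> x" "\<sigma> x \<in> {1..4}" "\<tau> x \<noteq> x" "\<tau> x \<in> {1..4}" using S[of x] T[of x] x by auto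
        ultimately show ?thesis using b x 3 unfolding four by auto
      qed
    qed
    then have "\<sigma> = \<tau>" by auto
    then show ?thesis using tN by simp
  qed (use id' in simp)
qed

text \<open>Subgroups that contain the alternating group are compared by parity, as the latter has
  index at most 2. From degree 3 on, a nontrivial normal subgroup that does not contain it exists
  only in degree 4, where \<open>sym4_normal_subset\<close> makes it unique. This is what turns the
  pairs \<open>(q, N)\<close> into a chain.\<close>

theorem normal_sym_chain:
  assumes N: "N \<lhd> sym_group n" and N': "N' \<lhd> sym_group n"
  shows "N \<subseteq> N' \<or> N' \<subseteq> N"
proof -
  have id: "id \<in> M" if "M \<lhd> sym_group n" for M
    using subgroup.one_closed[OF normal_imp_subgroup[OF that]] by (simp add: sym_group_one)
  show ?thesis
  proof (cases "N = {id} \<or> N' = {id}")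
    case True
    then show ?thesis using id[OF N] id[OF N'] by auto
  next
    case ne: False
    show ?thesis
    proof (cases "3 \<le> n")
      case False
      have two: "x = y" if x: "x permutes {1..n}" "x \<noteq> id" and y: "y permutes {1..n}" "y \<noteq> id" for x y
      proof -
        have "n \<noteq> 0" using x by auto
        moreover have "n \<noteq> 1" using x by (auto simp: permutes_sing)
        ultimately have "n = 2" using False by simp
        then have n2: "{1..n} = {1, 2}" by auto
        have "x = transpose 1 2 \<or> x = id" "y = transpose 1 2 \<or> y = id"
          using x(1) y(1) unfolding n2 permutes_doubleton_iff by auto
        then show ?thesis using x(2) y(2) by simp
      qed
      obtain x where x: "x \<in> N'" "x \<noteq> id" using ne id[OF N'] by blast
      have "y \<in> N'" if "y \<in> N" for y
        using two[OF sym_normal_permutes[OF N' x(1)] x(2) sym_normal_permutes[OF N that]] x id[OF N'] by blast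
      then show ?thesis by blast
    next
      case n: True
      have big: "M \<subseteq> M' \<or> M' \<subseteq> M"
        if M: "M \<lhd> sym_group n" "M' \<lhd> sym_group n" and A: "carrier (alt_group n) \<subseteq> M" "carrier (alt_group n) \<subseteq> M'" for M M'
      proof (cases "M \<subseteq> carrier (alt_group n)")
        case True
        then show ?thesis using A by blast
      next
        case False
        \<comment> \<open>An odd element of \<open>M\<close> carries the odd elements of
          \<open>M'\<close> into the alternating group, so \<open>M'\<close> lies in
          \<open>M\<close>.\<close>
        then obtain x where x: "x \<in> M" "x \<notin> carrier (alt_group n)" by blast
        have xp: "x permutes {1..n}" by (rule sym_normal_permutes[OF M(1) x(1)])
        have xo: "\<not> evenperm x" using x(2) xp unfolding alt_group_carrier by simp
        have "y \<in> M" if y: "y \<in> M'" for y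
        proof (cases "evenperm y")
          case True
          then show ?thesis using A(1) sym_normal_permutes[OF M(2) y] unfolding alt_group_carrier[symmetric] by (auto simp: alt_group_carrier)
        next
          case False
          have yp: "y permutes {1..n}" by (rule sym_normal_permutes[OF M(2) y])
          have perm: "permutation x" "permutation y" using xp yp permutation_permutes by blast+
          have "evenperm (Hilbert_Choice.inv x \<circ> y)"
            using evenperm_comp[OF permutation_inverse[OF perm(1)] perm(2)] evenperm_inv[OF perm(1)] xo False by simp
          then have "Hilbert_Choice.inv x \<circ> y \<in> M"
            using A(1) permutes_compose[OF yp permutes_inv[OF xp]] by (auto simp: alt_group_carrier)
          then have "x \<circ> (Hilbert_Choice.inv x \<circ> y) \<in> M" by (rule sym_normal_comp[OF M(1) x(1)])
          moreover have "x \<circ> (Hilbert_Choice.inv x \<circ> y) = y"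
            unfolding o_assoc permutes_inv_o(1)[OF xp] by simp
          ultimately show ?thesis by simp
        qed
        then show ?thesis by blast
      qed
      have mixed: "M \<subseteq> M'"
        if M: "M \<lhd> sym_group n" "M' \<lhd> sym_group n" and ne: "M \<noteq> {id}"
          and A: "\<not> carrier (alt_group n) \<subseteq> M" "carrier (alt_group n) \<subseteq> M'" for M M'
      proof -
        obtain x where n4: "n = 4" and x: "x \<in> M" "x \<noteq> id" "x \<in> carrier (alt_group n)"
          using sym_normal_double_transposition[OF M(1) A(1) ne n] by blast
        interpret G: group "sym_group n" by (rule sym_group_is_group)
        have "subgroup (M \<inter> M') (sym_group n)"
          using M normal_imp_subgroup G.subgroups_Inter_pair by blast
        then have I: "M \<inter> M' \<lhd> sym_group n"
        proof (rule G.normal_invI)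
          fix p h assume p: "p \<in> carrier (sym_group n)" and h: "h \<in> M \<inter> M'"
          show "p \<otimes>\<^bsub>sym_group n\<^esub> h \<otimes>\<^bsub>sym_group n\<^esub> inv\<^bsub>sym_group n\<^esub> p \<in> M \<inter> M'"
            using normal.inv_op_closed2[OF M(1) p] normal.inv_op_closed2[OF M(2) p] h by blast
        qed
        \<comment> \<open>The nontrivial even element of \<open>M\<close> lies in \<open>M'\<close>
          too. Thus the intersection is a nontrivial normal subgroup that does not contain the
          alternating group, and by \<open>sym4_normal_subset\<close> it is all of
          \<open>M\<close>.\<close>
        have "M \<inter> M' \<noteq> {id}" using x A(2) by blast
        then have "M \<subseteq> M \<inter> M'" using sym4_normal_subset[of M "M \<inter> M'"] M I A(1) unfolding n4 by blast
        then show ?thesis by blast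
      qed
      show ?thesis
      proof (cases "carrier (alt_group n) \<subseteq> N"; cases "carrier (alt_group n) \<subseteq> N'")
        assume "carrier (alt_group n) \<subseteq> N" "carrier (alt_group n) \<subseteq> N'"
        then show ?thesis using big[OF N N'] by blast
      next
        assume "carrier (alt_group n) \<subseteq> N" "\<not> carrier (alt_group n) \<subseteq> N'"
        then show ?thesis using mixed[OF N' N] ne by blast
      next
        assume "\<not> carrier (alt_group n) \<subseteq> N" "carrier (alt_group n) \<subseteq> N'"
        then show ?thesis using mixed[OF N N'] ne by blast
      next
        assume a: "\<not> carrier (alt_group n) \<subseteq> N" "\<not> carrier (alt_group n) \<subseteq> N'"
        then have "n = 4" using sym_normal_double_transposition[OF N _ _ n] ne by blast
        then show ?thesis using sym4_normal_subset[of N N'] N N' a ne by blast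
      qed
    qed
  qed
qed

section \<open>The category of Boolean relations: encoding of partitions, rank, separation of
  halves\<close>

section \<open>Boolean relations\<close>

definition brels :: "'a set \<Rightarrow> 'b set \<Rightarrow> ('a set \<times> 'b set) set set" where
  "brels A B = {s. s \<subseteq> Pow A \<times> Pow B \<and> ({}, {}) \<in> s \<and>
     (\<forall>P Q. (P, Q) \<in> s \<longrightarrow> (A - P, B - Q) \<in> s) \<and>
     (\<forall>P Q P' Q'. (P, Q) \<in> s \<longrightarrow> (P', Q') \<in> s \<longrightarrow> (P \<union> P', Q \<union> Q') \<in> s)}"

definition subalgs :: "'a set \<Rightarrow> 'a set set set" where
  "subalgs A = {G. G \<subseteq> Pow A \<and> {} \<in> G \<and> (\<forall>P\<in>G. A - P \<in> G) \<and> (\<forall>P\<in>G. \<forall>Q\<in>G. P \<union> Q \<in> G)}"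

lemma brelsI:
  assumes "\<And>P Q. (P, Q) \<in> s \<Longrightarrow> P \<subseteq> A \<and> Q \<subseteq> B" "({}, {}) \<in> s"
    "\<And>P Q. (P, Q) \<in> s \<Longrightarrow> (A - P, B - Q) \<in> s"
    "\<And>P Q P' Q'. (P, Q) \<in> s \<Longrightarrow> (P', Q') \<in> s \<Longrightarrow> (P \<union> P', Q \<union> Q') \<in> s"
  shows "s \<in> brels A B"
  unfolding brels_def using assms by (auto simp del: Pow_iff simp: subset_iff Pow_iff)

lemma brels_sub: "s \<in> brels A B \<Longrightarrow> (P, Q) \<in> s \<Longrightarrow> P \<subseteq> A \<and> Q \<subseteq> B"
  unfolding brels_def by blast

lemma brels_empty: "s \<in> brels A B \<Longrightarrow> ({}, {}) \<in> s"
  unfolding brels_def by blast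

lemma brels_compl: "s \<in> brels A B \<Longrightarrow> (P, Q) \<in> s \<Longrightarrow> (A - P, B - Q) \<in> s"
  unfolding brels_def by blast

lemma brels_Un: "s \<in> brels A B \<Longrightarrow> (P, Q) \<in> s \<Longrightarrow> (P', Q') \<in> s \<Longrightarrow> (P \<union> P', Q \<union> Q') \<in> s"
  unfolding brels_def by blast

lemma brels_full: "s \<in> brels A B \<Longrightarrow> (A, B) \<in> s"
  using brels_compl[OF _ brels_empty] by force

lemma brels_Diff:
  assumes s: "s \<in> brels A B" and 1: "(P, Q) \<in> s" and 2: "(P', Q') \<in> s"
  shows "(P - P', Q - Q') \<in> s"
proof -
  have "(A - ((A - P) \<union> P'), B - ((B - Q) \<union> Q')) \<in> s"
    by (intro brels_compl[OF s] brels_Un[OF s] 1 2)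
  moreover have "A - ((A - P) \<union> P') = P - P'" "B - ((B - Q) \<union> Q') = Q - Q'"
    using brels_sub[OF s 1] by auto
  ultimately show ?thesis by simp
qed

lemma brels_Int:
  assumes s: "s \<in> brels A B" and 1: "(P, Q) \<in> s" and 2: "(P', Q') \<in> s"
  shows "(P \<inter> P', Q \<inter> Q') \<in> s"
  using brels_Diff[OF s 1 brels_Diff[OF s 1 2]] by (simp add: Diff_Diff_Int)

lemma brels_UN:
  assumes s: "s \<in> brels A B" and "finite I" "\<And>i. i \<in> I \<Longrightarrow> (f i, g i) \<in> s"
  shows "((\<Union>i\<in>I. f i), (\<Union>i\<in>I. g i)) \<in> s"
  using assms(2,3) by (induction I) (auto simp: brels_empty[OF s] intro: brels_Un[OF s])

lemma brels_comp:
  assumes s: "s \<in> brels A B" and t: "t \<in> brels B C"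
  shows "s O t \<in> brels A C"
proof (rule brelsI)
  fix P Q assume "(P, Q) \<in> s O t"
  then obtain R where R: "(P, R) \<in> s" "(R, Q) \<in> t" by auto
  show "P \<subseteq> A \<and> Q \<subseteq> C" using brels_sub[OF s R(1)] brels_sub[OF t R(2)] by simp
  show "(A - P, C - Q) \<in> s O t" using brels_compl[OF s R(1)] brels_compl[OF t R(2)] by blast
next
  show "({}, {}) \<in> s O t" using brels_empty[OF s] brels_empty[OF t] by blast
next
  fix P Q P' Q' assume "(P, Q) \<in> s O t" "(P', Q') \<in> s O t"
  then obtain R R' where "(P, R) \<in> s" "(R, Q) \<in> t" "(P', R') \<in> s" "(R', Q') \<in> t" by auto
  then show "(P \<union> P', Q \<union> Q') \<in> s O t" using brels_Un[OF s] brels_Un[OF t] by blast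
qed

lemma brels_converse: "s \<in> brels A B \<Longrightarrow> s\<inverse> \<in> brels B A"
  unfolding brels_def by blast

lemma brels_Id: "Id_on (Pow A) \<in> brels A A"
  by (rule brelsI) (auto simp: Id_on_def)

lemma brels_left_Id: "s \<in> brels A B \<Longrightarrow> Id_on (Pow A) O s = s"
  using brels_sub by (fastforce simp: Id_on_def)

lemma brels_right_Id: "s \<in> brels A B \<Longrightarrow> s O Id_on (Pow B) = s"
  using brels_sub by (fastforce simp: Id_on_def)

lemma brels_objects: "s \<in> brels A B \<Longrightarrow> \<Union>(Domain s) = A \<and> \<Union>(Range s) = B"
  using brels_full brels_sub by blast

lemma brels_eq_objects: "s \<in> brels A B \<Longrightarrow> s \<in> brels A' B' \<Longrightarrow> A = A' \<and> B = B'"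
  using brels_objects by metis

lemma subalgs_Domain: "s \<in> brels A B \<Longrightarrow> Domain s \<in> subalgs A"
  unfolding subalgs_def brels_def by blast

lemma subalgs_Range: "s \<in> brels A B \<Longrightarrow> Range s \<in> subalgs B"
  unfolding subalgs_def brels_def by blast

lemma subalgs_full: "G \<in> subalgs A \<Longrightarrow> A \<in> G"
  unfolding subalgs_def by force

lemma subalgs_sub: "G \<in> subalgs A \<Longrightarrow> P \<in> G \<Longrightarrow> P \<subseteq> A"
  unfolding subalgs_def by auto

lemma subalgs_empty: "G \<in> subalgs A \<Longrightarrow> {} \<in> G"
  unfolding subalgs_def by auto

lemma subalgs_compl: "G \<in> subalgs A \<Longrightarrow> P \<in> G \<Longrightarrow> A - P \<in> G"
  unfolding subalgs_def by auto

lemma subalgs_Un: "G \<in> subalgs A \<Longrightarrow> P \<in> G \<Longrightarrow> Q \<in> G \<Longrightarrow> P \<union> Q \<in> G"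
  unfolding subalgs_def by auto

lemma subalgs_Diff:
  assumes G: "G \<in> subalgs A" and "P \<in> G" "Q \<in> G"
  shows "P - Q \<in> G"
proof -
  have "A - ((A - P) \<union> Q) \<in> G" using assms subalgs_compl subalgs_Un by metis
  moreover have "A - ((A - P) \<union> Q) = P - Q" using subalgs_sub[OF assms(1,2)] by auto
  ultimately show ?thesis by simp
qed

lemma subalgs_UN:
  assumes "G \<in> subalgs A" "finite I" "\<And>i. i \<in> I \<Longrightarrow> f i \<in> G"
  shows "(\<Union>i\<in>I. f i) \<in> G"
  using assms(2,3) by (induction I) (auto simp: subalgs_empty[OF assms(1)] intro: subalgs_Un[OF assms(1)])

lemma subalgs_Pow: "Pow A \<in> subalgs A"
  unfolding subalgs_def by auto

lemma subalgs_triv: "{{}, A} \<in> subalgs A"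
  unfolding subalgs_def by auto

lemma brels_Times:
  assumes "G \<in> subalgs A" "H \<in> subalgs B"
  shows "G \<times> H \<in> brels A B"
  using assms unfolding subalgs_def by (intro brelsI) blast+

text \<open>Closure under indistinguishability by \<open>G\<close> makes \<open>W\<close> a union of
  atoms of \<open>G\<close>, and finiteness puts the atoms and their unions into \<open>G\<close>.
  This is what makes equivalences and subalgebras interchangeable on a finite set.\<close>

lemma subalgs_closed_mem:
  assumes G: "G \<in> subalgs Z" and fin: "finite Z" and W: "W \<subseteq> Z"
    and cl: "\<And>x y. x \<in> W \<Longrightarrow> y \<in> Z \<Longrightarrow> \<forall>X\<in>G. x \<in> X \<longleftrightarrow> y \<in> X \<Longrightarrow> y \<in> W"
  shows "W \<in> G"
proof -
  have finG: "finite G" using G fin unfolding subalgs_def by (auto intro: finite_subset)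
  \<comment> \<open>For \<open>x\<close> in \<open>Z\<close> this is the intersection of the members
    that contain \<open>x\<close>, written as a complement of a union because \<open>subalgs\<close>
    is closed under these two operations by definition.\<close>
  define atm where "atm x = Z - (\<Union>X\<in>{X \<in> G. x \<notin> X}. X)" for x
  have atm: "atm x \<in> G" for x unfolding atm_def
    using finG by (intro subalgs_compl[OF G] subalgs_UN[OF G]) auto
  have "atm x \<subseteq> W" if x: "x \<in> W" for x
  proof
    fix y assume y: "y \<in> atm x"
    have "x \<in> X \<longleftrightarrow> y \<in> X" if X: "X \<in> G" for X
    proof
      assume "x \<in> X"
      then show "y \<in> X" using y subalgs_compl[OF G X] unfolding atm_def by blast
    next
      assume "y \<in> X"
      then show "x \<in> X" using y X unfolding atm_def by blast
    qed
    then show "y \<in> W" using cl[OF x] y unfolding atm_def by blast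
  qed
  moreover have "x \<in> atm x" if "x \<in> W" for x using that W unfolding atm_def by blast
  ultimately have "W = (\<Union>x\<in>W. atm x)" by blast
  also have "\<dots> \<in> G"
    using finite_subset[OF W fin] atm by (intro subalgs_UN[OF G])
  finally show ?thesis .
qed

subsection \<open>Halves\<close>

abbreviation idr :: "nat \<Rightarrow> (nat set \<times> nat set) set" where
  "idr q \<equiv> Id_on (Pow {1..q})"

text \<open>An element of \<open>halves q A\<close> is the graph of a homomorphism from a subalgebra of \<open>Pow A\<close> (its domain)
  onto \<open>Pow {1..q}\<close>.\<close>

definition halves :: "nat \<Rightarrow> 'a set \<Rightarrow> ('a set \<times> nat set) set set" where
  "halves q A = {u \<in> brels A {1..q}. u\<inverse> O u = idr q}"

definition rank_class :: "nat \<Rightarrow> 'a set \<Rightarrow> 'b set \<Rightarrow> ('a set \<times> 'b set) set set" where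
  "rank_class q A B = {u O v\<inverse> | u v. u \<in> halves q A \<and> v \<in> halves q B}"

lemma halves_brels: "u \<in> halves q A \<Longrightarrow> u \<in> brels A {1..q}"
  unfolding halves_def by simp

lemma halves_inv: "u \<in> halves q A \<Longrightarrow> u\<inverse> O u = idr q"
  unfolding halves_def by simp

lemma halves_Range:
  assumes u: "u \<in> halves q A"
  shows "Range u = Pow {1..q}"
proof
  show "Range u \<subseteq> Pow {1..q}" using brels_sub[OF halves_brels[OF u]] by blast
  show "Pow {1..q} \<subseteq> Range u"
  proof
    fix K assume "K \<in> Pow {1..q}"
    then have "(K, K) \<in> u\<inverse> O u" unfolding halves_inv[OF u] by auto
    then show "K \<in> Range u" by blast
  qed
qed

lemma halves_surj: "u \<in> halves q A \<Longrightarrow> J \<subseteq> {1..q} \<Longrightarrow> \<exists>P. (P, J) \<in> u"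
  using halves_Range by blast

lemma halves_unique:
  assumes u: "u \<in> halves q A" and "(P, J) \<in> u" "(P, K) \<in> u"
  shows "J = K"
proof -
  have "(J, K) \<in> u\<inverse> O u" using assms by blast
  then show ?thesis unfolding halves_inv[OF u] by auto
qed

text \<open>If one set had two images, a difference of the two would be a nonempty image of the
  empty set.\<close>

lemma halvesI:
  assumes u: "u \<in> brels A {1..q}" and "Range u = Pow {1..q}" and e: "\<And>K. ({}, K) \<in> u \<Longrightarrow> K = {}"
  shows "u \<in> halves q A"
proof -
  have "J = K" if "(P, J) \<in> u" "(P, K) \<in> u" for P J K
    using e[of "J - K"] e[of "K - J"] brels_Diff[OF u that] brels_Diff[OF u that(2,1)] by auto
  moreover have "\<exists>P. (P, J) \<in> u" if "J \<subseteq> {1..q}" for J using assms(2) that by blast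
  moreover have "J \<subseteq> {1..q}" if "(P, J) \<in> u" for P J using brels_sub[OF u that] by simp
  ultimately have "u\<inverse> O u = idr q" by (auto simp: Id_on_def relcomp_unfold)
  then show ?thesis using u unfolding halves_def by simp
qed

lemma halves_empty: "u \<in> halves q A \<Longrightarrow> ({}, K) \<in> u \<Longrightarrow> K = {}"
  by (rule halves_unique[OF _ _ brels_empty[OF halves_brels]])

lemma halves_full: "u \<in> halves q A \<Longrightarrow> (A, K) \<in> u \<Longrightarrow> K = {1..q}"
  by (rule halves_unique[OF _ _ brels_full[OF halves_brels]])

lemma idr_halves: "idr q \<in> halves q {1..q}"
  unfolding halves_def using brels_Id by (auto simp: Id_on_def)

lemma halves_comp: "u \<in> halves q A \<Longrightarrow> w \<in> halves k {1..q} \<Longrightarrow> u O w \<in> halves k A"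
proof -
  assume u: "u \<in> halves q A" and w: "w \<in> halves k {1..q}"
  have "(u O w)\<inverse> O (u O w) = w\<inverse> O ((u\<inverse> O u) O w)"
    by (simp add: converse_relcomp O_assoc)
  also have "\<dots> = idr k"
    using u w halves_inv halves_brels brels_left_Id by metis
  finally show ?thesis
    using brels_comp[OF halves_brels[OF u] halves_brels[OF w]] unfolding halves_def by simp
qed

text \<open>A factorisation of the identity on \<open>Pow {1..j}\<close> through \<open>Pow {1..q}\<close> injects the former
  into the latter, so cardinalities bound ranks.\<close>

lemma factor_le:
  assumes eq: "idr j = c O d" and c: "c \<subseteq> Pow {1..j} \<times> Pow {1..q}"
  shows "j \<le> q"
proof -
  have "\<forall>J\<in>Pow {1..j}. \<exists>K. (J, K) \<in> c \<and> (K, J) \<in> d"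
    using eq by (metis Id_onI relcompE Pair_inject)
  then obtain f where f: "\<And>J. J \<in> Pow {1..j} \<Longrightarrow> (J, f J) \<in> c \<and> (f J, J) \<in> d" by metis
  have "inj_on f (Pow {1..j})"
  proof (rule inj_onI)
    fix J K assume "J \<in> Pow {1..j}" "K \<in> Pow {1..j}" "f J = f K"
    then have "(J, K) \<in> c O d" using f by (metis relcompI)
    then show "J = K" using eq by (metis Id_onE Pair_inject)
  qed
  moreover have "f ` Pow {1..j} \<subseteq> Pow {1..q}" using f c by blast
  ultimately have "card (Pow {1..j}) \<le> card (Pow {1..q})"
    by (intro card_inj_on_le) auto
  then show ?thesis by (simp add: card_Pow)
qed

lemma rank_classI: "u \<in> halves q A \<Longrightarrow> v \<in> halves q B \<Longrightarrow> u O v\<inverse> \<in> rank_class q A B"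
  unfolding rank_class_def by blast

lemma rank_classE:
  assumes "s \<in> rank_class q A B"
  obtains u v where "u \<in> halves q A" "v \<in> halves q B" "s = u O v\<inverse>"
  using assms unfolding rank_class_def by blast

lemma rank_class_brels: "s \<in> rank_class q A B \<Longrightarrow> s \<in> brels A B"
  by (erule rank_classE) (simp add: brels_comp[OF halves_brels brels_converse[OF halves_brels]])

lemma rank_class_converse: "s \<in> rank_class q A B \<Longrightarrow> s\<inverse> \<in> rank_class q B A"
  by (erule rank_classE) (simp add: converse_relcomp rank_classI)

text \<open>Between matching halves nothing is lost: \<open>v\<inverse> O v\<close> is the identity
  on \<open>Pow {1..q}\<close>, so a relation on \<open>{1..q}\<close> can be read off from each of
  its copies between objects.\<close>

lemma half_sandwich:
  assumes "u \<in> halves q A" "v \<in> halves q B" "b \<in> brels {1..q} {1..q}"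
  shows "u\<inverse> O (u O b O v\<inverse>) O v = b"
proof -
  have "u\<inverse> O (u O b O v\<inverse>) O v = (u\<inverse> O u) O b O (v\<inverse> O v)" by (simp add: O_assoc)
  then show ?thesis using assms halves_inv brels_left_Id brels_right_Id by metis
qed

lemma half_sandwich_Id:
  assumes "u \<in> halves q A" "v \<in> halves q B"
  shows "u\<inverse> O (u O v\<inverse>) O v = idr q"
proof -
  have "u\<inverse> O (u O v\<inverse>) O v = (u\<inverse> O u) O (v\<inverse> O v)" by (simp add: O_assoc)
  then show ?thesis using assms halves_inv brels_left_Id brels_Id by metis
qed

text \<open>Sandwiching \<open>s\<close> with its own halves turns a factorisation of
  \<open>s\<close> into one of \<open>idr j\<close>, to which the counting argument applies.\<close>

lemma rank_class_factor_le:
  assumes "s \<in> rank_class j A C" "s = a O b" "a \<in> brels A {1..q}"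
  shows "j \<le> q"
proof -
  obtain u v where uv: "u \<in> halves j A" "v \<in> halves j C" "s = u O v\<inverse>"
    using assms(1) by (rule rank_classE)
  have "(u\<inverse> O a) O (b O v) = u\<inverse> O s O v" unfolding assms(2) by (simp only: O_assoc)
  also have "\<dots> = idr j" unfolding uv(3) by (rule half_sandwich_Id[OF uv(1,2)])
  finally have "idr j = (u\<inverse> O a) O (b O v)" by simp
  then show ?thesis
    by (rule factor_le)
      (use brels_comp[OF brels_converse[OF halves_brels[OF uv(1)]] assms(3)] in \<open>auto dest: brels_sub\<close>)
qed

lemma rank_class_unique:
  assumes "s \<in> rank_class j A B" "s \<in> rank_class q A B"
  shows "j = q"
proof -
  have "j \<le> q" if s: "s \<in> rank_class j A B" "s \<in> rank_class q A B" for j q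
  proof -
    obtain u v where "u \<in> halves q A" "s = u O v\<inverse>" using s(2) by (rule rank_classE)
    then show ?thesis using rank_class_factor_le[OF s(1)] halves_brels by metis
  qed
  then show ?thesis using assms by (simp add: eq_iff)
qed

subsection \<open>Permutations\<close>

definition perm_rel :: "nat \<Rightarrow> (nat \<Rightarrow> nat) \<Rightarrow> (nat set \<times> nat set) set" where
  "perm_rel q \<pi> = {(J, \<pi> ` J) | J. J \<subseteq> {1..q}}"

lemma perm_rel_iff: "(J, K) \<in> perm_rel q \<pi> \<longleftrightarrow> J \<subseteq> {1..q} \<and> K = \<pi> ` J"
  unfolding perm_rel_def by auto

lemma perm_rel_halves:
  assumes p: "\<pi> permutes {1..q}"
  shows "perm_rel q \<pi> \<in> halves q {1..q}"
proof (rule halvesI)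
  have im: "\<pi> ` {1..q} = {1..q}" using p by (rule permutes_image)
  have inj: "inj \<pi>" using p by (rule permutes_inj)
  show br: "perm_rel q \<pi> \<in> brels {1..q} {1..q}"
  proof (rule brelsI)
    fix P Q assume "(P, Q) \<in> perm_rel q \<pi>"
    then have PQ: "P \<subseteq> {1..q}" "Q = \<pi> ` P" unfolding perm_rel_def by auto
    then show "P \<subseteq> {1..q} \<and> Q \<subseteq> {1..q}" using im by blast
    have "{1..q} - Q = \<pi> ` ({1..q} - P)" using PQ im inj by (metis image_set_diff)
    then show "({1..q} - P, {1..q} - Q) \<in> perm_rel q \<pi>" by (simp add: perm_rel_iff)
  qed (auto simp: perm_rel_iff)
  show "Range (perm_rel q \<pi>) = Pow {1..q}"
  proof
    show "Range (perm_rel q \<pi>) \<subseteq> Pow {1..q}" using brels_sub[OF br] by blast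
    show "Pow {1..q} \<subseteq> Range (perm_rel q \<pi>)"
    proof
      fix K assume "K \<in> Pow {1..q}"
      then obtain J where "J \<subseteq> {1..q}" "K = \<pi> ` J" using im by (metis PowD subset_imageE)
      then show "K \<in> Range (perm_rel q \<pi>)" using perm_rel_iff by (metis RangeI)
    qed
  qed
qed (auto simp: perm_rel_iff)

text \<open>Relational composition is written in the order of application, hence the reversed order
  of the permutations.\<close>

lemma perm_rel_comp:
  assumes p: "\<pi> permutes {1..q}"
  shows "perm_rel q \<pi> O perm_rel q \<rho> = perm_rel q (\<rho> \<circ> \<pi>)"
proof -
  have "\<pi> ` J \<subseteq> {1..q}" if "J \<subseteq> {1..q}" for J
    using permutes_image[OF p] that by blast
  then show ?thesis unfolding perm_rel_def by (force simp: image_comp)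
qed

lemma perm_rel_id: "perm_rel q id = idr q"
  unfolding perm_rel_def by (auto simp: Id_on_def)

lemma perm_rel_converse:
  assumes p: "\<pi> permutes {1..q}"
  shows "(perm_rel q \<pi>)\<inverse> = perm_rel q (Hilbert_Choice.inv \<pi>)"
proof -
  have "perm_rel q \<pi> O perm_rel q (Hilbert_Choice.inv \<pi>) = idr q"
    using p by (simp add: perm_rel_comp permutes_inv_o perm_rel_id)
  moreover have "(perm_rel q \<pi>)\<inverse> O perm_rel q \<pi> = idr q"
    using perm_rel_halves[OF p] by (rule halves_inv)
  ultimately show ?thesis
    using brels_left_Id brels_right_Id brels_converse
      halves_brels[OF perm_rel_halves[OF p]] halves_brels[OF perm_rel_halves[OF permutes_inv[OF p]]]
    by (metis O_assoc)
qed

lemma perm_rel_inject: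
  assumes "perm_rel q \<pi> = perm_rel q \<rho>" "\<pi> permutes {1..q}" "\<rho> permutes {1..q}"
  shows "\<pi> = \<rho>"
proof
  fix i show "\<pi> i = \<rho> i"
  proof (cases "i \<in> {1..q}")
    case True
    then have "({i}, {\<pi> i}) \<in> perm_rel q \<pi>" by (simp add: perm_rel_iff)
    then show ?thesis using assms(1) by (simp add: perm_rel_iff)
  next
    case False
    then show ?thesis using assms permutes_not_in by metis
  qed
qed

text \<open>Such a half is an automorphism of the algebra \<open>Pow {1..q}\<close>. Choosing a
  preimage for every set gives an injection of a finite set into itself, so every set also has an
  image, and only the empty set is sent to the empty set. The images of the \<open>q\<close>
  singletons are nonempty, disjoint and cover \<open>{1..q}\<close>, so they are singletons.\<close>

lemma halves_perm:
  assumes b: "b \<in> halves q {1..q}"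
  obtains \<pi> where "\<pi> permutes {1..q}" "b = perm_rel q \<pi>"
proof -
  have br: "b \<in> brels {1..q} {1..q}" using b by (rule halves_brels)
  have "\<forall>K\<in>Pow {1..q}. \<exists>J. (J, K) \<in> b" using halves_surj[OF b] by blast
  then obtain g where g: "\<And>K. K \<in> Pow {1..q} \<Longrightarrow> (g K, K) \<in> b" by metis
  have "inj_on g (Pow {1..q})" using g halves_unique[OF b] by (metis inj_onI)
  moreover have "g ` Pow {1..q} \<subseteq> Pow {1..q}" using g brels_sub[OF br] by blast
  ultimately have gim: "g ` Pow {1..q} = Pow {1..q}" by (simp add: endo_inj_surj)
  have dom: "\<exists>K. (J, K) \<in> b" if "J \<subseteq> {1..q}" for J
  proof -
    from that have "J \<in> g ` Pow {1..q}" using gim by simp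
    then show ?thesis using g by auto
  qed
  have inj: "J = J'" if "(J, K) \<in> b" "(J', K) \<in> b" for J J' K
  proof -
    have "(J - J', {}) \<in> b" "(J' - J, {}) \<in> b" 
      using brels_Diff[OF br that] brels_Diff[OF br that(2,1)] by auto
    moreover have "P = {}" if P: "(P, {}) \<in> b" for P
    proof -
      have "P \<in> g ` Pow {1..q}" "{} \<in> g ` Pow {1..q}"
        using brels_sub[OF br P] unfolding gim by auto
      then obtain K K' where K: "P = g K" "K \<in> Pow {1..q}" and K': "{} = g K'" "K' \<in> Pow {1..q}"
        by (elim imageE) blast
      then have "K = {}" using g[OF K(2)] P halves_unique[OF b] by metis
      moreover have "K' = {}" using K'(1) g[OF K'(2)] halves_empty[OF b] by auto
      ultimately show ?thesis using K K' by simp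
    qed
    ultimately show ?thesis by blast
  qed
  have "\<forall>i\<in>{1..q}. \<exists>K. ({i}, K) \<in> b" using dom by simp
  then obtain k where k: "\<And>i. i \<in> {1..q} \<Longrightarrow> ({i}, k i) \<in> b" by metis
  have kJ: "(J, \<Union>i\<in>J. k i) \<in> b" if "J \<subseteq> {1..q}" for J
  proof -
    have "((\<Union>i\<in>J. {i}), \<Union>i\<in>J. k i) \<in> b"
      using that k finite_subset[OF that] by (intro brels_UN[OF br]) auto
    then show ?thesis by simp
  qed
  have cover: "(\<Union>i\<in>{1..q}. k i) = {1..q}"
    using kJ[of "{1..q}"] halves_full[OF b] by simp
  have ne: "k i \<noteq> {}" if "i \<in> {1..q}" for i
    using inj[OF k[OF that], of "{}"] brels_empty[OF br] by auto
  have disj: "i = j" if "i \<in> {1..q}" "j \<in> {1..q}" "x \<in> k i" "x \<in> k j" for i j x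
  proof (rule ccontr)
    assume "i \<noteq> j"
    then have "({}, k i \<inter> k j) \<in> b" using brels_Int[OF br k[OF that(1)] k[OF that(2)]] by simp
    then show False using halves_empty[OF b] that by blast
  qed
  have "\<forall>x\<in>{1..q}. \<exists>i\<in>{1..q}. x \<in> k i" using cover by blast
  \<comment> \<open>\<open>h\<close> sends a point to the index of the image that contains it. It is
    onto because no image is empty, hence bijective, and its inverse is the permutation
    sought.\<close>
  then obtain h where h: "\<And>x. x \<in> {1..q} \<Longrightarrow> h x \<in> {1..q} \<and> x \<in> k (h x)" by metis
  have "h ` {1..q} = {1..q}"
  proof
    show "h ` {1..q} \<subseteq> {1..q}" using h by blast
    show "{1..q} \<subseteq> h ` {1..q}"
    proof
      fix i assume i: "i \<in> {1..q}"
      then obtain x where x: "x \<in> k i" using ne by blast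
      then have "x \<in> {1..q}" using cover i by blast
      then show "i \<in> h ` {1..q}" using h disj i x by blast
    qed
  qed
  then have bij: "bij_betw h {1..q} {1..q}" by (simp add: bij_betw_def eq_card_imp_inj_on)
  define \<pi> where "\<pi> i = (if i \<in> {1..q} then the_inv_into {1..q} h i else i)" for i
  have pb: "bij_betw \<pi> {1..q} {1..q}"
    using bij_betw_the_inv_into[OF bij] by (rule bij_betw_cong[THEN iffD1, rotated]) (simp add: \<pi>_def)
  then have perm: "\<pi> permutes {1..q}" by (rule bij_imp_permutes) (auto simp: \<pi>_def)
  have ki: "k i = {\<pi> i}" if i: "i \<in> {1..q}" for i
  proof
    have hp: "h (\<pi> i) = i" "\<pi> i \<in> {1..q}"
      using i bij pb f_the_inv_into_f_bij_betw[OF bij, of i] unfolding \<pi>_def bij_betw_def by auto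
    show "{\<pi> i} \<subseteq> k i" using h[OF hp(2)] hp by simp
    show "k i \<subseteq> {\<pi> i}"
    proof
      fix x assume x: "x \<in> k i"
      then have xq: "x \<in> {1..q}" using cover i by blast
      have "h x = i" using disj[of "h x" i x] h[OF xq] x i by blast
      then show "x \<in> {\<pi> i}" using hp bij xq unfolding bij_betw_def by (metis inj_onD singletonI)
    qed
  qed
  have "b = perm_rel q \<pi>"
  proof (rule subset_antisym; rule subsetI)
    fix x assume "x \<in> b"
    then obtain J K where x: "x = (J, K)" "(J, K) \<in> b" by (cases x) auto
    have J: "J \<subseteq> {1..q}" using brels_sub[OF br x(2)] by simp
    then have "K = (\<Union>i\<in>J. k i)" using kJ halves_unique[OF b] x(2) by blast
    also have "\<dots> = \<pi> ` J" using J ki by blast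
    finally show "x \<in> perm_rel q \<pi>" using x J by (simp add: perm_rel_iff)
  next
    fix x assume "x \<in> perm_rel q \<pi>"
    then obtain J where J: "x = (J, \<pi> ` J)" "J \<subseteq> {1..q}" unfolding perm_rel_def by auto
    have "(\<Union>i\<in>J. k i) = \<pi> ` J" using J ki by blast
    then show "x \<in> b" using kJ J by metis
  qed
  then show ?thesis using that perm by blast
qed

subsection \<open>Saturated sets of a partition\<close>

definition sat :: "('a + 'b) set set \<Rightarrow> ('a set \<times> 'b set) set" where
  "sat \<alpha> = {(P, Q). \<exists>\<beta>\<subseteq>\<alpha>. P <+> Q = \<Union>\<beta>}"

lemma Plus_vimage: "(Inl -` W) <+> (Inr -` W) = W"
proof
  show "W \<subseteq> (Inl -` W) <+> (Inr -` W)"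
  proof
    fix x assume "x \<in> W" then show "x \<in> (Inl -` W) <+> (Inr -` W)" by (cases x) auto
  qed
qed auto

lemma Plus_subset_iff: "P <+> Q \<subseteq> A <+> B \<longleftrightarrow> P \<subseteq> A \<and> Q \<subseteq> B"
  by auto

lemma Plus_Diff: "(A - P) <+> (B - Q) = (A <+> B) - (P <+> Q)"
  by auto

lemma Plus_Un: "(A \<union> P) <+> (B \<union> Q) = (A <+> B) \<union> (P <+> Q)"
  by auto

lemma sat_iff:
  assumes p: "partition_on (A <+> B) \<alpha>"
  shows "(P, Q) \<in> sat \<alpha> \<longleftrightarrow> P \<subseteq> A \<and> Q \<subseteq> B \<and>
    (\<forall>b\<in>\<alpha>. \<forall>x\<in>b. \<forall>y\<in>b. x \<in> P <+> Q \<longrightarrow> y \<in> P <+> Q)" (is "?l \<longleftrightarrow> ?r")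
proof
  assume ?l
  then obtain \<beta> where b: "\<beta> \<subseteq> \<alpha>" "P <+> Q = \<Union>\<beta>" unfolding sat_def by blast
  then have "P <+> Q \<subseteq> A <+> B" using partition_onD1[OF p] by (metis Union_mono)
  moreover have "y \<in> P <+> Q" if xy: "c \<in> \<alpha>" "x \<in> c" "y \<in> c" "x \<in> P <+> Q" for c x y
  proof -
    obtain d where d: "d \<in> \<beta>" "x \<in> d" using xy(4) b(2) by blast
    then have "d = c" using partition_onD2[OF p] b(1) xy(1,2) by (meson disjoint_iff disjointD subsetD)
    then show ?thesis using d(1) xy(3) b(2) by blast
  qed
  ultimately show ?r unfolding Plus_subset_iff by blast
next
  assume r: ?r
  define \<beta> where "\<beta> = {b \<in> \<alpha>. b \<subseteq> P <+> Q}"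
  have "x \<in> \<Union>\<beta>" if x: "x \<in> P <+> Q" for x
  proof -
    have "x \<in> A <+> B" using r x Plus_subset_iff[of P Q A B] by blast
    then obtain b where "b \<in> \<alpha>" "x \<in> b" using partition_onD1[OF p] by blast
    then show ?thesis using r x unfolding \<beta>_def by blast
  qed
  then have "P <+> Q = \<Union>\<beta>" unfolding \<beta>_def by blast
  moreover have "\<beta> \<subseteq> \<alpha>" unfolding \<beta>_def by blast
  ultimately show ?l unfolding sat_def by (simp only: mem_Collect_eq prod.case) (rule exI[of _ \<beta>], simp)
qed

lemma satI:
  assumes "partition_on (A <+> B) \<alpha>" "P \<subseteq> A" "Q \<subseteq> B"
    "\<And>b x y. b \<in> \<alpha> \<Longrightarrow> x \<in> b \<Longrightarrow> y \<in> b \<Longrightarrow> x \<in> P <+> Q \<Longrightarrow> y \<in> P <+> Q"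
  shows "(P, Q) \<in> sat \<alpha>"
  unfolding sat_iff[OF assms(1)] using assms(2-4) by blast

lemma sat_step:
  assumes "partition_on (A <+> B) \<alpha>" "(P, Q) \<in> sat \<alpha>" "b \<in> \<alpha>" "x \<in> b" "y \<in> b" "x \<in> P <+> Q"
  shows "y \<in> P <+> Q"
  using assms(2-6) unfolding sat_iff[OF assms(1)] by blast

lemma sat_block: "b \<in> \<alpha> \<Longrightarrow> (Inl -` b, Inr -` b) \<in> sat \<alpha>"
  unfolding sat_def using Plus_vimage[of b] by (auto intro!: exI[of _ "{b}"])

lemma sat_brels:
  assumes p: "partition_on (A <+> B) \<alpha>"
  shows "sat \<alpha> \<in> brels A B"
proof (rule brelsI)
  show "P \<subseteq> A \<and> Q \<subseteq> B" if "(P, Q) \<in> sat \<alpha>" for P Q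
    using that unfolding sat_iff[OF p] by blast
  show "({}, {}) \<in> sat \<alpha>" unfolding sat_def by (auto intro!: exI[of _ "{}"])
  show "(A - P, B - Q) \<in> sat \<alpha>" if PQ: "(P, Q) \<in> sat \<alpha>" for P Q
  proof -
    have st: "y \<in> (A <+> B) - (P <+> Q)" if "b \<in> \<alpha>" "x \<in> b" "y \<in> b" "x \<in> (A <+> B) - (P <+> Q)" for b x y
      using sat_step[OF p PQ that(1,3,2)] that partition_onD1[OF p] by blast
    show ?thesis by (rule satI[OF p Diff_subset Diff_subset]) (unfold Plus_Diff, rule st)
  qed
  show "(P \<union> P', Q \<union> Q') \<in> sat \<alpha>" if PQ: "(P, Q) \<in> sat \<alpha>" "(P', Q') \<in> sat \<alpha>" for P Q P' Q'
  proof (rule satI[OF p])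
    show "P \<union> P' \<subseteq> A" "Q \<union> Q' \<subseteq> B" using PQ unfolding sat_iff[OF p] by simp_all
    show "y \<in> (P \<union> P') <+> (Q \<union> Q')"
      if "b \<in> \<alpha>" "x \<in> b" "y \<in> b" "x \<in> (P \<union> P') <+> (Q \<union> Q')" for b x y
      using sat_step[OF p PQ(1) that(1-3)] sat_step[OF p PQ(2) that(1-3)] that(4) unfolding Plus_Un by blast
  qed
qed

text \<open>A block of \<open>\<alpha>\<close> is saturated for \<open>\<beta>\<close>, so it
  contains the \<open>\<beta>\<close>-block of each of its points; by symmetry the two blocks
  coincide.\<close>

lemma sat_inject:
  assumes p: "partition_on (A <+> B) \<alpha>" and p': "partition_on (A <+> B) \<beta>" and eq: "sat \<alpha> = sat \<beta>"
  shows "\<alpha> = \<beta>"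
proof -
  have "b \<in> \<beta>" if p: "partition_on (A <+> B) \<alpha>" and p': "partition_on (A <+> B) \<beta>"
    and eq: "sat \<alpha> = sat \<beta>" and b: "b \<in> \<alpha>" for \<alpha> \<beta> :: "('a + 'b) set set" and b
  proof -
    obtain x where x: "x \<in> b" using partition_onD3[OF p] b by fastforce
    then have "x \<in> \<Union>\<beta>" using partition_onD1[OF p] partition_onD1[OF p'] b by blast
    then obtain c where c: "c \<in> \<beta>" "x \<in> c" by blast
    have bs: "(Inl -` b, Inr -` b) \<in> sat \<beta>" using sat_block[OF b] eq by simp
    have cs: "(Inl -` c, Inr -` c) \<in> sat \<alpha>" using sat_block[OF c(1)] eq by simp
    have "y \<in> b" if "y \<in> c" for y
      using sat_step[OF p' bs c that] x unfolding Plus_vimage by simp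
    moreover have "y \<in> c" if "y \<in> b" for y
      using sat_step[OF p cs b x that] c(2) unfolding Plus_vimage by simp
    ultimately have "b = c" by blast
    then show ?thesis using c by simp
  qed
  from this[OF p p' eq] this[OF p' p eq[symmetric]] show ?thesis by blast
qed

text \<open>Points of \<open>A <+> B\<close> that no member of \<open>s\<close> separates are put
  into one block. A union of such blocks is closed under indistinguishability, and finiteness brings
  it back into \<open>s\<close> by \<open>subalgs_closed_mem\<close>.\<close>

lemma sat_surj:
  assumes s: "s \<in> brels A B" and fin: "finite A" "finite B"
  shows "\<exists>\<alpha>. partition_on (A <+> B) \<alpha> \<and> sat \<alpha> = s"
proof -
  define G where "G = (\<lambda>(P, Q). P <+> Q) ` s"
  have G: "G \<in> subalgs (A <+> B)"
    unfolding subalgs_def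
  proof (intro CollectI conjI ballI)
    show "G \<subseteq> Pow (A <+> B)" unfolding G_def using brels_sub[OF s] by auto
    show "{} \<in> G" unfolding G_def using brels_empty[OF s] by force
    fix X assume "X \<in> G"
    then obtain P Q where X: "X = P <+> Q" "(P, Q) \<in> s" unfolding G_def by auto
    show "(A <+> B) - X \<in> G" unfolding X Plus_Diff[symmetric] G_def using brels_compl[OF s X(2)] by force
    fix Y assume "Y \<in> G"
    then obtain P' Q' where Y: "Y = P' <+> Q'" "(P', Q') \<in> s" unfolding G_def by auto
    show "X \<union> Y \<in> G" unfolding X Y Plus_Un[symmetric] G_def using brels_Un[OF s X(2) Y(2)] by force
  qed
  define r where "r = {(x, y). x \<in> A <+> B \<and> y \<in> A <+> B \<and> (\<forall>X\<in>G. x \<in> X \<longleftrightarrow> y \<in> X)}"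
  have r: "equiv (A <+> B) r"
    unfolding r_def by (intro equivI refl_onI symI transI) auto
  have p: "partition_on (A <+> B) ((A <+> B) // r)"
    using r by (rule partition_on_quotient)
  have blk: "(\<exists>b\<in>(A <+> B) // r. x \<in> b \<and> y \<in> b) \<longleftrightarrow> (x, y) \<in> r" for x y
  proof
    assume "\<exists>b\<in>(A <+> B) // r. x \<in> b \<and> y \<in> b"
    then show "(x, y) \<in> r" using quotient_eq_iff[OF r] by metis
  next
    assume xy: "(x, y) \<in> r"
    then have "x \<in> A <+> B" unfolding r_def by blast
    then show "\<exists>b\<in>(A <+> B) // r. x \<in> b \<and> y \<in> b"
      using xy equiv_class_self[OF r] by (intro bexI[of _ "r `` {x}"]) (auto simp: quotientI)
  qed
  have "(P, Q) \<in> sat ((A <+> B) // r) \<longleftrightarrow> (P, Q) \<in> s" for P Q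
  proof
    assume PQ: "(P, Q) \<in> sat ((A <+> B) // r)"
    have "P <+> Q \<in> G"
    proof (rule subalgs_closed_mem[OF G])
      show "finite (A <+> B)" using fin by simp
      show "P <+> Q \<subseteq> A <+> B" using PQ unfolding sat_iff[OF p] Plus_subset_iff by blast
      then show "y \<in> P <+> Q" if "x \<in> P <+> Q" "y \<in> A <+> B" "\<forall>X\<in>G. x \<in> X \<longleftrightarrow> y \<in> X" for x y
      proof -
        have "(x, y) \<in> r" using that \<open>P <+> Q \<subseteq> A <+> B\<close> unfolding r_def by blast
        then obtain b where "b \<in> (A <+> B) // r" "x \<in> b" "y \<in> b" using blk[of x y] by blast
        then show ?thesis using sat_step[OF p PQ] that(1) by blast
      qed
    qed
    then obtain P' Q' where "P <+> Q = P' <+> Q'" "(P', Q') \<in> s" unfolding G_def by auto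
    then show "(P, Q) \<in> s" using Plus_subset_iff[of P Q P' Q'] Plus_subset_iff[of P' Q' P Q] by (metis subset_antisym subset_refl)
  next
    assume PQ: "(P, Q) \<in> s"
    then have PG: "P <+> Q \<in> G" unfolding G_def by force
    have stp: "y \<in> P <+> Q" if "b \<in> (A <+> B) // r" "x \<in> b" "y \<in> b" "x \<in> P <+> Q" for b x y
    proof -
      have "(x, y) \<in> r" using that blk[of x y] by metis
      then have "\<forall>X\<in>G. x \<in> X \<longleftrightarrow> y \<in> X" by (simp add: r_def)
      then show ?thesis using PG that(4) by (metis (no_types))
    qed
    show "(P, Q) \<in> sat ((A <+> B) // r)"
      using brels_sub[OF s PQ] by - (rule satI[OF p], blast, blast, rule stp)
  qed
  then have "sat ((A <+> B) // r) = s" by auto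
  then show ?thesis using p by blast
qed

subsection \<open>Factorisation and rank\<close>

text \<open>Homomorphisms onto \<open>Pow {1..q}\<close> are given by points that the subalgebra separates.\<close>

definition point_half :: "nat \<Rightarrow> (nat \<Rightarrow> 'a) \<Rightarrow> 'a set set \<Rightarrow> ('a set \<times> nat set) set" where
  "point_half q a G = {(P, {i \<in> {1..q}. a i \<in> P}) | P. P \<in> G}"

lemma point_half_iff: "(P, J) \<in> point_half q a G \<longleftrightarrow> P \<in> G \<and> J = {i \<in> {1..q}. a i \<in> P}"
  unfolding point_half_def by auto

lemma Domain_point_half: "Domain (point_half q a G) = G"
  unfolding point_half_def by auto

lemma point_half_halves:
  assumes G: "G \<in> subalgs A" and a: "\<And>i. i \<in> {1..q} \<Longrightarrow> a i \<in> A"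
    and sep: "\<And>J. J \<subseteq> {1..q} \<Longrightarrow> \<exists>P\<in>G. \<forall>i\<in>{1..q}. a i \<in> P \<longleftrightarrow> i \<in> J"
  shows "point_half q a G \<in> halves q A"
proof (rule halvesI)
  show "point_half q a G \<in> brels A {1..q}"
  proof (rule brelsI)
    show "({}, {}) \<in> point_half q a G" using subalgs_empty[OF G] by (simp add: point_half_iff)
    show "P \<subseteq> A \<and> J \<subseteq> {1..q}" if "(P, J) \<in> point_half q a G" for P J
      using that subalgs_sub[OF G] by (auto simp: point_half_iff)
    show "(A - P, {1..q} - J) \<in> point_half q a G" if "(P, J) \<in> point_half q a G" for P J
      using that subalgs_compl[OF G] a by (auto simp: point_half_iff)
    show "(P \<union> P', J \<union> J') \<in> point_half q a G"
      if "(P, J) \<in> point_half q a G" "(P', J') \<in> point_half q a G" for P J P' J'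
      using that subalgs_Un[OF G] by (auto simp: point_half_iff)
  qed
  show "Range (point_half q a G) = Pow {1..q}"
  proof
    show "Range (point_half q a G) \<subseteq> Pow {1..q}" by (auto simp: point_half_iff)
    show "Pow {1..q} \<subseteq> Range (point_half q a G)"
    proof
      fix J assume J: "J \<in> Pow {1..q}"
      then obtain P where P: "P \<in> G" "\<forall>i\<in>{1..q}. a i \<in> P \<longleftrightarrow> i \<in> J" using sep[of J] by blast
      then have "{i \<in> {1..q}. a i \<in> P} = J" using J by blast
      then have "(P, J) \<in> point_half q a G" using P by (simp add: point_half_iff)
      then show "J \<in> Range (point_half q a G)" by (rule RangeI)
    qed
  qed
qed (simp add: point_half_iff)

text \<open>One upper point \<open>a i\<close> and one lower point \<open>b i\<close> are chosen in
  each transversal. Unions of transversals are saturated, so these points are separated. A pair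
  \<open>(P, Q)\<close> is saturated iff \<open>P\<close> and \<open>Q\<close> are so for kernel and
  cokernel and contain the chosen points of the same transversals.\<close>

lemma sat_factor:
  fixes \<alpha> :: "('a + 'b) set set"
  assumes p: "partition_on (A <+> B) \<alpha>" and fin: "finite A" "finite B"
    and T: "T = {b \<in> \<alpha>. (\<exists>x. Inl x \<in> b) \<and> (\<exists>y. Inr y \<in> b)}"
  shows "sat \<alpha> \<in> rank_class (card T) A B"
proof -
  have "finite \<alpha>" using finite_elements[OF _ p] fin by simp
  then have finT: "finite T" unfolding T by simp
  then obtain g where g: "bij_betw g {1..card T} T" using ex_bij_betw_nat_finite_1 by blast
  then have gT: "g i \<in> T" if "i \<in> {1..card T}" for i using that unfolding bij_betw_def by blast
  then have "\<forall>i\<in>{1..card T}. \<exists>x y. Inl x \<in> g i \<and> Inr y \<in> g i" unfolding T by blast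
  then obtain a b where ab: "\<And>i. i \<in> {1..card T} \<Longrightarrow> Inl (a i) \<in> g i \<and> Inr (b i) \<in> g i" by metis
  have g\<alpha>: "g i \<in> \<alpha>" if "i \<in> {1..card T}" for i using gT[OF that] unfolding T by blast
  have gi: "i = j" if "i \<in> {1..card T}" "j \<in> {1..card T}" "x \<in> g i" "x \<in> g j" for i j x
  proof -
    have "g i = g j" using partition_onD2[OF p] g\<alpha> that by (meson disjoint_iff disjointD)
    then show ?thesis using g that unfolding bij_betw_def by (meson inj_onD)
  qed
  have s: "sat \<alpha> \<in> brels A B" using p by (rule sat_brels)
  \<comment> \<open>Upper and lower part of the union of the transversals indexed by
    \<open>K\<close>; this pair separates the chosen points with index in \<open>K\<close> from the
    others.\<close>
  define J where "J K = (Inl -` (\<Union>i\<in>K. g i), Inr -` (\<Union>i\<in>K. g i))" for K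
  have J: "J K \<in> sat \<alpha>" if "K \<subseteq> {1..card T}" for K
  proof -
    have "(\<Union>i\<in>K. (Inl -` g i :: 'a set), \<Union>i\<in>K. (Inr -` g i :: 'b set)) \<in> sat \<alpha>"
      using that finite_subset[OF that] g\<alpha> by (intro brels_UN[OF s] sat_block) auto
    then show ?thesis unfolding J_def vimage_UN .
  qed
  let ?u = "point_half (card T) a (Domain (sat \<alpha>))" and ?v = "point_half (card T) b (Range (sat \<alpha>))"
  have in_blk: "x \<in> A <+> B" if "c \<in> \<alpha>" "x \<in> c" for c x using partition_onD1[OF p] that by blast
  have "?u \<in> halves (card T) A"
  proof (rule point_half_halves)
    show "Domain (sat \<alpha>) \<in> subalgs A" using s by (rule subalgs_Domain)
    show "a i \<in> A" if "i \<in> {1..card T}" for i using in_blk[OF g\<alpha>[OF that]] ab[OF that] by blast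
    show "\<exists>P\<in>Domain (sat \<alpha>). \<forall>i\<in>{1..card T}. (a i \<in> P) = (i \<in> K)" if K: "K \<subseteq> {1..card T}" for K
    proof (rule bexI)
      show "fst (J K) \<in> Domain (sat \<alpha>)" using J[OF K] by (metis DomainI prod.collapse)
      show "\<forall>i\<in>{1..card T}. (a i \<in> fst (J K)) = (i \<in> K)"
        unfolding J_def fst_conv vimage_def using ab gi K by blast
    qed
  qed
  moreover have "?v \<in> halves (card T) B"
  proof (rule point_half_halves)
    show "Range (sat \<alpha>) \<in> subalgs B" using s by (rule subalgs_Range)
    show "b i \<in> B" if "i \<in> {1..card T}" for i using in_blk[OF g\<alpha>[OF that]] ab[OF that] by blast
    show "\<exists>P\<in>Range (sat \<alpha>). \<forall>i\<in>{1..card T}. (b i \<in> P) = (i \<in> K)" if K: "K \<subseteq> {1..card T}" for K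
    proof (rule bexI)
      show "snd (J K) \<in> Range (sat \<alpha>)" using J[OF K] by (metis RangeI prod.collapse)
      show "\<forall>i\<in>{1..card T}. (b i \<in> snd (J K)) = (i \<in> K)"
        unfolding J_def snd_conv vimage_def using ab gi K by blast
    qed
  qed
  moreover have "(P, Q) \<in> sat \<alpha> \<longleftrightarrow> (P, Q) \<in> ?u O ?v\<inverse>" for P Q
  proof
    assume PQ: "(P, Q) \<in> sat \<alpha>"
    have "a i \<in> P \<longleftrightarrow> b i \<in> Q" if i: "i \<in> {1..card T}" for i
      using sat_step[OF p PQ g\<alpha>[OF i], of "Inl (a i)" "Inr (b i)"]
        sat_step[OF p PQ g\<alpha>[OF i], of "Inr (b i)" "Inl (a i)"] ab[OF i] by auto
    then have "{i \<in> {1..card T}. a i \<in> P} = {i \<in> {1..card T}. b i \<in> Q}" by blast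
    moreover have "P \<in> Domain (sat \<alpha>)" "Q \<in> Range (sat \<alpha>)" using PQ by blast+
    ultimately have "(P, {i \<in> {1..card T}. a i \<in> P}) \<in> ?u" "(Q, {i \<in> {1..card T}. a i \<in> P}) \<in> ?v"
      by (simp_all only: point_half_iff simp_thms)
    then show "(P, Q) \<in> ?u O ?v\<inverse>" by blast
  next
    assume "(P, Q) \<in> ?u O ?v\<inverse>"
    then obtain K where K: "(P, K) \<in> ?u" "(Q, K) \<in> ?v" by blast
    then have i: "\<And>i. i \<in> {1..card T} \<Longrightarrow> a i \<in> P \<longleftrightarrow> b i \<in> Q" unfolding point_half_iff by blast
    obtain Q' P' where PQ': "(P, Q') \<in> sat \<alpha>" "(P', Q) \<in> sat \<alpha>" using K unfolding point_half_iff by blast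
    have PP: "y' \<in> P" if "c \<in> \<alpha>" "Inl x' \<in> c" "Inl y' \<in> c" "x' \<in> P" for c x' y'
      using sat_step[OF p PQ'(1) that(1-3)] that(4) by auto
    have QQ: "y' \<in> Q" if "c \<in> \<alpha>" "Inr x' \<in> c" "Inr y' \<in> c" "x' \<in> Q" for c x' y'
      using sat_step[OF p PQ'(2) that(1-3)] that(4) by auto
    \<comment> \<open>Only a transversal has points on both sides. Within it, membership of an upper
      point is that of \<open>a i\<close>, and membership of a lower point is that of
      \<open>b i\<close>.\<close>
    have mixed: "x' \<in> P \<longleftrightarrow> y' \<in> Q" if c: "c \<in> \<alpha>" "Inl x' \<in> c" "Inr y' \<in> c" for c x' y'
    proof -
      have "c \<in> T" using c unfolding T by blast
      then obtain i where gi: "i \<in> {1..card T}" "c = g i" using g unfolding bij_betw_def by blast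
      have "x' \<in> P \<longleftrightarrow> a i \<in> P" "y' \<in> Q \<longleftrightarrow> b i \<in> Q" using PP QQ c ab[OF gi(1)] unfolding gi(2) by blast+
      then show ?thesis using i[OF gi(1)] by simp
    qed
    have stp: "y \<in> P <+> Q" if c: "c \<in> \<alpha>" "x \<in> c" "y \<in> c" "x \<in> P <+> Q" for c x y
    proof (cases x)
      case (Inl x')
      then have x': "Inl x' \<in> c" "x' \<in> P" using c by auto
      show ?thesis
        using PP[OF c(1) x'(1) _ x'(2)] mixed[OF c(1) x'(1)] x'(2) c(3) by (cases y) auto
    next
      case (Inr x')
      then have x': "Inr x' \<in> c" "x' \<in> Q" using c by auto
      show ?thesis
        using QQ[OF c(1) x'(1) _ x'(2)] mixed[OF c(1) _ x'(1)] x'(2) c(3) by (cases y) auto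
    qed
    show "(P, Q) \<in> sat \<alpha>"
      using brels_sub[OF s PQ'(1)] brels_sub[OF s PQ'(2)] by - (rule satI[OF p], blast, blast, rule stp)
  qed
  then have "sat \<alpha> = ?u O ?v\<inverse>" by (metis subrelI subset_antisym)
  ultimately show ?thesis using rank_classI by metis
qed

lemma rank_ex:
  assumes "s \<in> brels A B" "finite A" "finite B"
  shows "\<exists>q. s \<in> rank_class q A B"
proof -
  obtain \<alpha> where "partition_on (A <+> B) \<alpha>" "sat \<alpha> = s" using sat_surj[OF assms] by blast
  then show ?thesis using sat_factor[OF _ assms(2,3) refl] by blast
qed

subsection \<open>Products of partitions\<close>

lemma pdom_partition: "partition_on (A <+> B) \<alpha> \<Longrightarrow> pdom \<alpha> = A"
  unfolding pdom_def partition_on_def by auto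

lemma pcod_partition: "partition_on (A <+> B) \<alpha> \<Longrightarrow> pcod \<alpha> = B"
  unfolding pcod_def partition_on_def by auto

lemma eqrel_I: "b \<in> \<alpha> \<Longrightarrow> x \<in> b \<Longrightarrow> y \<in> b \<Longrightarrow> (x, y) \<in> eqrel \<alpha>"
  unfolding eqrel_def by blast

lemma eqrel_sat:
  assumes "partition_on (A <+> B) \<alpha>" "(P, Q) \<in> sat \<alpha>" "(x, y) \<in> eqrel \<alpha>"
  shows "x \<in> P <+> Q \<longleftrightarrow> y \<in> P <+> Q"
proof -
  obtain b where "b \<in> \<alpha>" "x \<in> b" "y \<in> b" using assms(3) unfolding eqrel_def by blast
  then show ?thesis using sat_step[OF assms(1,2)] by blast
qed

lemma pjoin_upper: "b \<in> \<alpha> \<Longrightarrow> x \<in> b \<Longrightarrow> y \<in> b \<Longrightarrow> (upper_part x, upper_part y) \<in> pjoin \<alpha> \<beta>"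
  unfolding pjoin_def using eqrel_I[of b \<alpha> x y] by (intro trancl.r_into_trancl UnI1) force

lemma pjoin_lower: "b \<in> \<beta> \<Longrightarrow> x \<in> b \<Longrightarrow> y \<in> b \<Longrightarrow> (lower_part x, lower_part y) \<in> pjoin \<alpha> \<beta>"
  unfolding pjoin_def using eqrel_I[of b \<beta> x y] by (intro trancl.r_into_trancl UnI2) force

lemma pjoin_trans: "(x, y) \<in> pjoin \<alpha> \<beta> \<Longrightarrow> (y, z) \<in> pjoin \<alpha> \<beta> \<Longrightarrow> (x, z) \<in> pjoin \<alpha> \<beta>"
  unfolding pjoin_def by (rule trancl_trans)

lemma pjoin_sym: "(x, y) \<in> pjoin \<alpha> \<beta> \<Longrightarrow> (y, x) \<in> pjoin \<alpha> \<beta>"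
proof -
  have "sym (map_prod f f ` eqrel \<gamma>)" for f :: "'a + 'a \<Rightarrow> 'a layer" and \<gamma>
    by (rule symI) (force simp: eqrel_def)
  then have "sym (map_prod upper_part upper_part ` eqrel \<alpha> \<union> map_prod lower_part lower_part ` eqrel \<beta>)"
    by (intro sym_Un)
  then show "(x, y) \<in> pjoin \<alpha> \<beta> \<Longrightarrow> (y, x) \<in> pjoin \<alpha> \<beta>"
    unfolding pjoin_def by (rule symD[OF sym_trancl])
qed

lemma partition_block: "partition_on Z \<alpha> \<Longrightarrow> x \<in> Z \<Longrightarrow> \<exists>b\<in>\<alpha>. x \<in> b"
  using partition_onD1 by blast

lemma equiv_pmult:
  assumes p: "partition_on (A <+> B) \<alpha>" and q: "partition_on (B <+> C) \<beta>"
  shows "equiv (A <+> C) {(u, v). u \<in> A <+> C \<and> v \<in> A <+> C \<and> (outer_part u, outer_part v) \<in> pjoin \<alpha> \<beta>}"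
proof (intro equivI refl_onI symI transI)
  fix x assume x: "x \<in> A <+> C"
  have "(outer_part x, outer_part x) \<in> pjoin \<alpha> \<beta>"
  proof (cases x)
    case (Inl a)
    then have "(Inl a :: 'a + 'a) \<in> A <+> B" using x by auto
    then obtain b where "b \<in> \<alpha>" "Inl a \<in> b" using partition_block[OF p] by blast
    then show ?thesis using pjoin_upper[of b \<alpha> "Inl a" "Inl a" \<beta>] Inl
      by (simp add: upper_part_def outer_part_def)
  next
    case (Inr a)
    then have "(Inr a :: 'a + 'a) \<in> B <+> C" using x by auto
    then obtain b where "b \<in> \<beta>" "Inr a \<in> b" using partition_block[OF q] by blast
    then show ?thesis using pjoin_lower[of b \<beta> "Inr a" "Inr a" \<alpha>] Inr
      by (simp add: lower_part_def outer_part_def)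
  qed
  then show "(x, x) \<in> {(u, v). u \<in> A <+> C \<and> v \<in> A <+> C \<and> (outer_part u, outer_part v) \<in> pjoin \<alpha> \<beta>}"
    using x by simp
qed (auto intro: pjoin_sym pjoin_trans)

lemma pmult_partition:
  assumes p: "partition_on (A <+> B) \<alpha>" and q: "partition_on (B <+> C) \<beta>"
  shows "partition_on (A <+> C) (pmult \<alpha> \<beta>)"
  unfolding pmult_def pdom_partition[OF p] pcod_partition[OF q]
  using equiv_pmult[OF p q] by (rule partition_on_quotient)

lemma pmult_same_block:
  assumes p: "partition_on (A <+> B) \<alpha>" and q: "partition_on (B <+> C) \<beta>"
  shows "(\<exists>b\<in>pmult \<alpha> \<beta>. x \<in> b \<and> y \<in> b) \<longleftrightarrow>
    x \<in> A <+> C \<and> y \<in> A <+> C \<and> (outer_part x, outer_part y) \<in> pjoin \<alpha> \<beta>"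
proof -
  let ?r = "{(u, v). u \<in> A <+> C \<and> v \<in> A <+> C \<and> (outer_part u, outer_part v) \<in> pjoin \<alpha> \<beta>}"
  have e: "equiv (A <+> C) ?r" by (rule equiv_pmult[OF p q])
  have "(\<exists>b\<in>(A <+> C) // ?r. x \<in> b \<and> y \<in> b) \<longleftrightarrow> (x, y) \<in> ?r"
  proof
    assume "\<exists>b\<in>(A <+> C) // ?r. x \<in> b \<and> y \<in> b"
    then obtain b where "b \<in> (A <+> C) // ?r" "x \<in> b" "y \<in> b" by blast
    then show "(x, y) \<in> ?r" using quotient_eq_iff[OF e, of b b x y] by simp
  next
    assume xy: "(x, y) \<in> ?r"
    then have x: "x \<in> A <+> C" by simp
    show "\<exists>b\<in>(A <+> C) // ?r. x \<in> b \<and> y \<in> b"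
    proof (intro bexI conjI)
      show "x \<in> ?r `` {x}" using equiv_class_self[OF e x] .
      show "y \<in> ?r `` {x}" using xy by (rule ImageI) simp
      show "?r `` {x} \<in> (A <+> C) // ?r" using x by (rule quotientI)
    qed
  qed
  then show ?thesis unfolding pmult_def pdom_partition[OF p] pcod_partition[OF q] by simp
qed

text \<open>A saturated pair of the product is the trace on the outer layers of a set on all three
  layers that is closed under both partitions. The middle layer of that set is the element through
  which the two relations compose.\<close>

lemma sat_pmult:
  assumes p: "partition_on (A <+> B) \<alpha>" and q: "partition_on (B <+> C) \<beta>"
  shows "sat (pmult \<alpha> \<beta>) = sat \<alpha> O sat \<beta>"
proof -
  note pq = pmult_partition[OF p q]
  have "(P, R) \<in> sat (pmult \<alpha> \<beta>)" if PR: "(P, R) \<in> sat \<alpha> O sat \<beta>" for P R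
  proof -
    obtain Q where Q: "(P, Q) \<in> sat \<alpha>" "(Q, R) \<in> sat \<beta>" using PR by blast
    \<comment> \<open>Membership in the set with layers \<open>P\<close>, \<open>Q\<close>,
      \<open>R\<close>. It is constant along each generating step of the join, hence along the
      join.\<close>
    define W where "W z = (case z of Upper_layer a \<Rightarrow> a \<in> P | Middle_layer b \<Rightarrow> b \<in> Q | Lower_layer c \<Rightarrow> c \<in> R)" for z
    have Wu: "W (upper_part x) \<longleftrightarrow> x \<in> P <+> Q" for x
      by (cases x) (auto simp: W_def upper_part_def)
    have Wl: "W (lower_part x) \<longleftrightarrow> x \<in> Q <+> R" for x
      by (cases x) (auto simp: W_def lower_part_def)
    have Wo: "W (outer_part x) \<longleftrightarrow> x \<in> P <+> R" for x
      by (cases x) (auto simp: W_def outer_part_def)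
    have step: "W z \<longleftrightarrow> W z'"
      if zz: "(z, z') \<in> map_prod upper_part upper_part ` eqrel \<alpha> \<union> map_prod lower_part lower_part ` eqrel \<beta>" for z z'
    proof -
      consider x y where "z = upper_part x" "z' = upper_part y" "(x, y) \<in> eqrel \<alpha>"
        | x y where "z = lower_part x" "z' = lower_part y" "(x, y) \<in> eqrel \<beta>"
        using zz by auto
      then show ?thesis
        by cases (simp_all only: Wu Wl eqrel_sat[OF p Q(1)] eqrel_sat[OF q Q(2)])
    qed
    have join: "W z \<longleftrightarrow> W z'" if "(z, z') \<in> pjoin \<alpha> \<beta>" for z z'
      using that unfolding pjoin_def by (induction rule: trancl_induct) (simp_all only: step)
    show ?thesis
    proof (rule satI[OF pq])
      show "P \<subseteq> A" "R \<subseteq> C" using brels_sub[OF sat_brels[OF p] Q(1)] brels_sub[OF sat_brels[OF q] Q(2)] by simp_all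
      fix b x y assume b: "b \<in> pmult \<alpha> \<beta>" "x \<in> b" "y \<in> b" "x \<in> P <+> R"
      then have "(outer_part x, outer_part y) \<in> pjoin \<alpha> \<beta>" using pmult_same_block[OF p q, of x y] by blast
      then show "y \<in> P <+> R" using join b(4) Wo by metis
    qed
  qed
  moreover have "(P, R) \<in> sat \<alpha> O sat \<beta>" if PR: "(P, R) \<in> sat (pmult \<alpha> \<beta>)" for P R
  proof -
    have sub: "P \<subseteq> A" "R \<subseteq> C" using brels_sub[OF sat_brels[OF pq] PR] by simp_all
    have out: "y \<in> P <+> R" if "x \<in> P <+> R" "y \<in> A <+> C" "(outer_part x, outer_part y) \<in> pjoin \<alpha> \<beta>" for x y
    proof -
      have "x \<in> A <+> C" using that(1) sub by auto
      then have "\<exists>b\<in>pmult \<alpha> \<beta>. x \<in> b \<and> y \<in> b"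
        by (simp only: pmult_same_block[OF p q] that simp_thms)
      then obtain b where "b \<in> pmult \<alpha> \<beta>" "x \<in> b" "y \<in> b" by blast
      then show ?thesis using sat_step[OF pq PR] that(1) by blast
    qed
    \<comment> \<open>The middle points joined to a point of the given pair: the least middle layer
      that can make the three-layer set closed.\<close>
    define Q where "Q = {b \<in> B. \<exists>x\<in>P <+> R. (outer_part x, Middle_layer b) \<in> pjoin \<alpha> \<beta>}"
    have QB: "Q \<subseteq> B" unfolding Q_def by blast
    have inA: "x \<in> A <+> B" if "b \<in> \<alpha>" "x \<in> b" for b x using partition_onD1[OF p] that by blast
    have inB: "x \<in> B <+> C" if "b \<in> \<beta>" "x \<in> b" for b x using partition_onD1[OF q] that by blast
    have "(P, Q) \<in> sat \<alpha>"
    proof (rule satI[OF p sub(1) QB])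
      fix b x y assume b: "b \<in> \<alpha>" "x \<in> b" "y \<in> b" "x \<in> P <+> Q"
      note j = pjoin_upper[OF b(1-3), of \<beta>]
      obtain z where z: "z \<in> P <+> R" "(outer_part z, upper_part y) \<in> pjoin \<alpha> \<beta>"
      proof (cases x)
        case (Inl a)
        then show ?thesis using that[of "Inl a"] b(4) j by (auto simp: upper_part_def outer_part_def)
      next
        case (Inr a)
        then obtain z where "z \<in> P <+> R" "(outer_part z, upper_part x) \<in> pjoin \<alpha> \<beta>"
          using b(4) unfolding Q_def by (auto simp: upper_part_def)
        then show ?thesis using that pjoin_trans[OF _ j] by blast
      qed
      show "y \<in> P <+> Q"
      proof (cases y)
        case (Inl a)
        then have "(Inl a :: 'a + 'a) \<in> P <+> R"
          using z inA[OF b(1,3)] by (intro out[OF z(1)]) (auto simp: upper_part_def outer_part_def)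
        then show ?thesis using Inl by auto
      next
        case (Inr a)
        then show ?thesis using z inA[OF b(1,3)] unfolding Q_def by (auto simp: upper_part_def)
      qed
    qed
    moreover have "(Q, R) \<in> sat \<beta>"
    proof (rule satI[OF q QB sub(2)])
      fix b x y assume b: "b \<in> \<beta>" "x \<in> b" "y \<in> b" "x \<in> Q <+> R"
      note j = pjoin_lower[OF b(1-3), of \<alpha>]
      obtain z where z: "z \<in> P <+> R" "(outer_part z, lower_part y) \<in> pjoin \<alpha> \<beta>"
      proof (cases x)
        case (Inr a)
        then show ?thesis using that[of "Inr a"] b(4) j by (auto simp: lower_part_def outer_part_def)
      next
        case (Inl a)
        then obtain z where "z \<in> P <+> R" "(outer_part z, lower_part x) \<in> pjoin \<alpha> \<beta>"
          using b(4) unfolding Q_def by (auto simp: lower_part_def)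
        then show ?thesis using that pjoin_trans[OF _ j] by blast
      qed
      show "y \<in> Q <+> R"
      proof (cases y)
        case (Inr a)
        then have "(Inr a :: 'a + 'a) \<in> P <+> R"
          using z inB[OF b(1,3)] by (intro out[OF z(1)]) (auto simp: lower_part_def outer_part_def)
        then show ?thesis using Inr by auto
      next
        case (Inl a)
        then show ?thesis using z inB[OF b(1,3)] unfolding Q_def by (auto simp: lower_part_def)
      qed
    qed
    ultimately show ?thesis by blast
  qed
  ultimately show ?thesis by (metis subrelI subset_antisym)
qed

lemma rank_iff:
  assumes p: "partition_on (A <+> B) \<alpha>" and fin: "finite A" "finite B"
  shows "rank \<alpha> = q \<longleftrightarrow> sat \<alpha> \<in> rank_class q A B"
proof -
  have "sat \<alpha> \<in> rank_class (rank \<alpha>) A B"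
    unfolding rank_def by (rule sat_factor[OF p fin]) (simp add: transversals_def)
  then show ?thesis using rank_class_unique by metis
qed

subsection \<open>Rank arithmetic\<close>

definition rank_le :: "nat \<Rightarrow> 'a set \<Rightarrow> 'b set \<Rightarrow> ('a set \<times> 'b set) set set" where
  "rank_le q A B = (\<Union>k\<le>q. rank_class k A B)"

lemma rank_leI: "s \<in> rank_class k A B \<Longrightarrow> k \<le> q \<Longrightarrow> s \<in> rank_le q A B"
  unfolding rank_le_def by blast

lemma rank_leE:
  assumes "s \<in> rank_le q A B"
  obtains k where "k \<le> q" "s \<in> rank_class k A B"
  using assms unfolding rank_le_def by blast

lemma rank_le_mono: "s \<in> rank_le k A B \<Longrightarrow> k \<le> q \<Longrightarrow> s \<in> rank_le q A B"
  by (meson rank_leE rank_leI le_trans)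

lemma rank_le_brels: "s \<in> rank_le q A B \<Longrightarrow> s \<in> brels A B"
  by (meson rank_leE rank_class_brels)

lemma rank_le_converse: "s \<in> rank_le q A B \<Longrightarrow> s\<inverse> \<in> rank_le q B A"
  by (meson rank_leE rank_leI rank_class_converse)

lemma rank_class_comp_right:
  assumes s: "s \<in> rank_class q A B" and t: "t \<in> brels B C" and st: "s O t \<in> rank_class k A C"
  shows "k \<le> q"
proof -
  obtain u v where uv: "u \<in> halves q A" "v \<in> halves q B" "s = u O v\<inverse>" using s by (rule rank_classE)
  have "s O t = u O (v\<inverse> O t)" unfolding uv(3) by (rule O_assoc)
  then show ?thesis using rank_class_factor_le[OF st] halves_brels[OF uv(1)] by blast
qed

lemma rank_class_comp_left:
  assumes s: "s \<in> brels A B" and t: "t \<in> rank_class q B C" and st: "s O t \<in> rank_class k A C"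
  shows "k \<le> q"
proof (rule rank_class_comp_right)
  show "t\<inverse> \<in> rank_class q C B" using t by (rule rank_class_converse)
  show "s\<inverse> \<in> brels B A" using s by (rule brels_converse)
  show "t\<inverse> O s\<inverse> \<in> rank_class k C A" using rank_class_converse[OF st] by (simp add: converse_relcomp)
qed

lemma rank_le_comp_right:
  assumes s: "s \<in> rank_le q A B" and t: "t \<in> brels B C" and fin: "finite A" "finite C"
  shows "s O t \<in> rank_le q A C"
proof -
  obtain k where k: "k \<le> q" "s \<in> rank_class k A B" using s by (rule rank_leE)
  obtain j where j: "s O t \<in> rank_class j A C"
    using rank_ex[OF brels_comp[OF rank_class_brels[OF k(2)] t] fin] by blast
  then have "j \<le> k" by (rule rank_class_comp_right[OF k(2) t])
  then show ?thesis using rank_leI[OF j] k by simp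
qed

lemma rank_le_comp_left:
  assumes s: "s \<in> brels A B" and t: "t \<in> rank_le q B C" and fin: "finite A" "finite C"
  shows "s O t \<in> rank_le q A C"
  using rank_le_converse[OF rank_le_comp_right[OF rank_le_converse[OF t] brels_converse[OF s] fin(2,1)]]
  by (simp add: converse_relcomp)

lemma rank_le_factor:
  assumes a: "a \<in> brels A {1..q}" and b: "b \<in> brels {1..q} B" and fin: "finite A" "finite B"
  shows "a O b \<in> rank_le q A B"
proof -
  obtain k where k: "a O b \<in> rank_class k A B" using rank_ex[OF brels_comp[OF a b] fin] by blast
  then show ?thesis using rank_leI rank_class_factor_le[OF k refl a] by blast
qed

lemma halves_rank_class: "u \<in> halves q A \<Longrightarrow> u \<in> rank_class q A {1..q}"
  using rank_classI[OF _ idr_halves] brels_right_Id[OF halves_brels] by (metis converse_Id_on)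

text \<open>The lower half is a permutation here, and its converse can be absorbed into the upper
  one.\<close>

lemma rank_class_halves:
  assumes "w \<in> rank_class q A {1..q}"
  shows "w \<in> halves q A"
proof -
  obtain u b where ub: "u \<in> halves q A" "b \<in> halves q {1..q}" "w = u O b\<inverse>" using assms by (rule rank_classE)
  obtain \<pi> where p: "\<pi> permutes {1..q}" "b = perm_rel q \<pi>" using ub(2) by (rule halves_perm)
  have "b\<inverse> \<in> halves q {1..q}" unfolding p(2) perm_rel_converse[OF p(1)]
    by (rule perm_rel_halves[OF permutes_inv[OF p(1)]])
  then show ?thesis unfolding ub(3) by (rule halves_comp[OF ub(1)])
qed

text \<open>Factoring through \<open>{1..q}\<close> bounds the rank by \<open>q\<close>, and by
  \<open>rank_class_halves\<close> the value \<open>q\<close> is attained by halves only. Later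
  arguments use this to turn the failure of a half into a drop in rank.\<close>

lemma half_or_lower:
  assumes w: "w \<in> brels A {1..q}" "w \<notin> halves q A" and fin: "finite A"
  shows "\<exists>k<q. w \<in> rank_class k A {1..q}"
proof -
  obtain k where k: "w \<in> rank_class k A {1..q}" using rank_ex[OF w(1) fin] by auto
  have "k \<le> q" using rank_class_factor_le[OF k _ w(1), of "idr q"] brels_right_Id[OF w(1)] by simp
  moreover have "k \<noteq> q" using w(2) k rank_class_halves by blast
  ultimately have "k < q" by simp
  then show ?thesis using k by blast
qed

lemma sandwich_brels:
  assumes "a \<in> brels A B" "b \<in> brels B C" "c \<in> brels D C"
  shows "a O b O c\<inverse> \<in> brels A D"
  using assms by (intro brels_comp brels_converse)

lemma sandwich_rank:
  fixes q :: nat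
  assumes x: "x \<in> brels A {1..q}" and y: "y \<in> brels B {1..q}" and b: "b \<in> rank_class k {1..q} {1..q}"
    and fin: "finite A" "finite B"
  shows "x O b O y\<inverse> \<in> rank_le k A B"
  by (rule rank_le_comp_left[OF x rank_le_comp_right[OF rank_leI[OF b order_refl] brels_converse[OF y]
    finite_atLeastAtMost fin(2)] fin])

lemma sandwich_lower:
  assumes x: "x \<in> brels A {1..q}" and y: "y \<in> brels B {1..q}"
    and b: "b \<in> brels {1..q} {1..q}" "b \<notin> halves q {1..q}" and fin: "finite A" "finite B"
  shows "\<exists>k<q. x O b O y\<inverse> \<in> rank_class k A B"
proof -
  obtain k where k: "k < q" "b \<in> rank_class k {1..q} {1..q}" using half_or_lower[OF b] by auto
  obtain j where "j \<le> k" "x O b O y\<inverse> \<in> rank_class j A B"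
    using sandwich_rank[OF x y k(2) fin] by (rule rank_leE)
  then show ?thesis using k(1) by (intro exI[of _ j]) simp
qed

text \<open>The change of halves computed on the right, \<open>v'\<inverse> O v\<close>, equals the
  one computed on the left, \<open>u'\<inverse> O u\<close>, so one \<open>c\<close> serves both
  factors. It is itself a half on \<open>{1..q}\<close>, hence a permutation.\<close>

lemma halves_factor_unique:
  assumes u: "u \<in> halves q A" "u' \<in> halves q A" and v: "v \<in> halves q B" "v' \<in> halves q B"
    and eq: "u O v\<inverse> = u' O v'\<inverse>"
  obtains \<pi> where "\<pi> permutes {1..q}" "u = u' O perm_rel q \<pi>" "v = v' O perm_rel q \<pi>"
proof -
  define c where "c = v'\<inverse> O v"
  have "u = u O (v\<inverse> O v)" using halves_inv[OF v(1)] brels_right_Id[OF halves_brels[OF u(1)]] by simp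
  also have "\<dots> = (u O v\<inverse>) O v" by (simp add: O_assoc)
  also have "\<dots> = u' O c" unfolding eq c_def by (simp add: O_assoc)
  finally have uc: "u = u' O c" .
  have cb: "c \<in> brels {1..q} {1..q}"
    unfolding c_def using v by (intro brels_comp[OF brels_converse] halves_brels)
  have "c = (u'\<inverse> O u') O c" using halves_inv[OF u(2)] brels_left_Id[OF cb] by simp
  also have "\<dots> = u'\<inverse> O u" unfolding uc by (simp add: O_assoc)
  finally have c2: "c = u'\<inverse> O u" .
  have "c\<inverse> O c = (c\<inverse> O (u'\<inverse> O u')) O c" using halves_inv[OF u(2)] brels_right_Id[OF brels_converse[OF cb]] by simp
  also have "\<dots> = (u' O c)\<inverse> O (u' O c)" by (simp add: O_assoc converse_relcomp)
  also have "\<dots> = idr q" using halves_inv[OF u(1)] uc by simp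
  finally have ch: "c \<in> halves q {1..q}" using cb unfolding halves_def by simp
  then obtain \<pi> where p: "\<pi> permutes {1..q}" "c = perm_rel q \<pi>" by (rule halves_perm)
  have "v'\<inverse> = (u'\<inverse> O u') O v'\<inverse>"
    using halves_inv[OF u(2)] brels_left_Id[OF brels_converse[OF halves_brels[OF v(2)]]] by simp
  also have "\<dots> = u'\<inverse> O (u O v\<inverse>)" unfolding eq by (simp add: O_assoc)
  also have "\<dots> = c O v\<inverse>" unfolding c2 by (simp add: O_assoc)
  finally have "v' = (c O v\<inverse>)\<inverse>" by (metis converse_converse)
  then have "v' O c = v O (c\<inverse> O c)" by (simp add: O_assoc converse_relcomp)
  also have "\<dots> = v" using halves_inv[OF ch] brels_right_Id[OF halves_brels[OF v(1)]] by simp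
  finally have "v = v' O c" by simp
  then show ?thesis using that p uc by blast
qed

text \<open>Restriction of subsets from \<open>{1..q}\<close> to \<open>{1..k}\<close> is onto. The
  relation pads a factorisation through \<open>{1..k}\<close> to one through \<open>{1..q}\<close>,
  so that all ranks up to \<open>q\<close> can be treated on the single set
  \<open>{1..q}\<close>.\<close>

lemma embed_brels:
  assumes "k \<le> q"
  shows "\<exists>j\<in>brels {1..k} {1..q}. j O j\<inverse> = idr k"
proof (rule bexI)
  let ?j = "{(K \<inter> {1..k}, K) | K. K \<subseteq> {1..q}}"
  show "?j \<in> brels {1..k} {1..q}"
    using assms by (intro brelsI) (force simp: Int_Un_distrib2)+
  show "?j O ?j\<inverse> = idr k"
  proof
    show "idr k \<subseteq> ?j O ?j\<inverse>"
    proof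
      fix x assume "x \<in> idr k"
      then obtain K where K: "x = (K, K)" "K \<subseteq> {1..k}" by auto
      then have "(K, K) \<in> ?j" using assms by fastforce
      then show "x \<in> ?j O ?j\<inverse>" using K by blast
    qed
  qed auto
qed

lemma rank_le_ex_factor:
  assumes "s \<in> rank_le q A B"
  obtains a b where "a \<in> brels A {1..q}" "b \<in> brels B {1..q}" "s = a O b\<inverse>"
proof -
  obtain k where k: "k \<le> q" "s \<in> rank_class k A B" using assms by (rule rank_leE)
  obtain u v where uv: "u \<in> halves k A" "v \<in> halves k B" "s = u O v\<inverse>" using k(2) by (rule rank_classE)
  obtain j where j: "j \<in> brels {1..k} {1..q}" "j O j\<inverse> = idr k" using embed_brels[OF k(1)] by blast
  have "(u O j) O (v O j)\<inverse> = u O (j O j\<inverse>) O v\<inverse>" by (simp add: O_assoc converse_relcomp)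
  also have "\<dots> = s" unfolding j(2) uv(3)
    using brels_left_Id[OF brels_converse[OF halves_brels[OF uv(2)]]] by simp
  finally show ?thesis
    using that[OF brels_comp[OF halves_brels[OF uv(1)] j(1)] brels_comp[OF halves_brels[OF uv(2)] j(1)]] by simp
qed

text \<open>The intermediate element of \<open>Pow {1..k}\<close> is empty or full, and then the
  empty or the full set is also a partner of \<open>P\<close>.\<close>

lemma rank_le1_split:
  assumes s: "s \<in> rank_le 1 A B" and PQ: "(P, Q) \<in> s"
  shows "(P, {}) \<in> s \<or> (P, B) \<in> s"
proof -
  obtain k where k: "k \<le> 1" "s \<in> rank_class k A B" using s by (rule rank_leE)
  obtain u v where uv: "u \<in> halves k A" "v \<in> halves k B" "s = u O v\<inverse>" using k(2) by (rule rank_classE)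
  obtain J where J: "(P, J) \<in> u" "(Q, J) \<in> v" using PQ uv(3) by blast
  have "J \<subseteq> {1..k}" using brels_sub[OF halves_brels[OF uv(1)] J(1)] by simp
  moreover have "{1..k} = {} \<or> {1..k} = {1}" using k(1) by auto
  ultimately have "J = {} \<or> J = {1..k}" by auto
  then show ?thesis
    using J(1) brels_empty[OF halves_brels[OF uv(2)]] brels_full[OF halves_brels[OF uv(2)]] unfolding uv(3) by blast
qed

text \<open>By \<open>rank_le1_split\<close> the partner can be taken empty or full, and every
  Boolean relation continues from these two sets. So the kernel survives multiplication on the
  right; from rank 2 on this can fail.\<close>

lemma rank_le1_Domain:
  assumes s: "s \<in> rank_le 1 A B" and t: "t \<in> brels B C"
  shows "Domain (s O t) = Domain s"
proof
  show "Domain s \<subseteq> Domain (s O t)"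
  proof
    fix P assume "P \<in> Domain s"
    then obtain Q where "(P, Q) \<in> s" by blast
    then have "(P, {}) \<in> s \<or> (P, B) \<in> s" by (rule rank_le1_split[OF s])
    then show "P \<in> Domain (s O t)" using brels_empty[OF t] brels_full[OF t] by blast
  qed
qed blast

lemma rank_le1_Range:
  assumes s: "s \<in> brels A B" and t: "t \<in> rank_le 1 B C"
  shows "Range (s O t) = Range t"
  using rank_le1_Domain[OF rank_le_converse[OF t] brels_converse[OF s]]
  by (metis Domain_converse converse_relcomp)

text \<open>The relation of the partition in which every transversal is cut into its upper and its
  lower part: same kernel and cokernel, rank 0.\<close>

definition flat :: "('a set \<times> 'b set) set \<Rightarrow> ('a set \<times> 'b set) set" where
  "flat s = Domain s \<times> Range s"

lemma Times_rank0:
  assumes G: "G \<in> subalgs A" and H: "H \<in> subalgs B"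
  shows "G \<times> H \<in> rank_class 0 A B"
proof -
  have h: "K \<times> {{}} \<in> halves 0 Z" if "K \<in> subalgs Z" for K :: "'c set set" and Z
  proof (rule halvesI)
    have "{{} :: nat set} \<in> subalgs {1..0}" unfolding subalgs_def by simp
    then show "K \<times> {{}} \<in> brels Z {1..0::nat}" by (rule brels_Times[OF that])
    show "Range (K \<times> {{} :: nat set}) = Pow {1..0}" using subalgs_empty[OF that] by auto
  qed auto
  have "G \<times> H = (G \<times> {{} :: nat set}) O (H \<times> {{}})\<inverse>" by auto
  then show ?thesis using rank_classI[OF h[OF G] h[OF H]] by metis
qed

lemma rank0_flat:
  assumes s: "s \<in> rank_class 0 A B"
  shows "flat s = s"
proof -
  obtain u v where uv: "u \<in> halves 0 A" "v \<in> halves 0 B" "s = u O v\<inverse>" using s by (rule rank_classE)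
  have "J = {}" if "(P, J) \<in> u" for P J using brels_sub[OF halves_brels[OF uv(1)] that] by simp
  moreover have "J = {}" if "(P, J) \<in> v" for P J using brels_sub[OF halves_brels[OF uv(2)] that] by simp
  ultimately have "(P, Q) \<in> s" if "P \<in> Domain s" "Q \<in> Range s" for P Q using that unfolding uv(3) by blast
  then show ?thesis unfolding flat_def by auto
qed

lemma flat_rank0: "s \<in> brels A B \<Longrightarrow> flat s \<in> rank_class 0 A B"
  unfolding flat_def by (intro Times_rank0 subalgs_Domain subalgs_Range)

lemma subalgs_nonempty: "G \<in> subalgs A \<Longrightarrow> G \<noteq> {}"
  using subalgs_empty by blast

lemma Domain_flat: "s \<in> brels A B \<Longrightarrow> Domain (flat s) = Domain s"
  unfolding flat_def using brels_empty by (fastforce)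

lemma Range_flat: "s \<in> brels A B \<Longrightarrow> Range (flat s) = Range s"
  unfolding flat_def using brels_empty by (fastforce)

lemma flat_halves:
  assumes u: "u \<in> halves q A" and v: "v \<in> halves q B"
  shows "flat (u O v\<inverse>) = Domain u \<times> Domain v"
proof -
  have "Domain (u O v\<inverse>) = Domain u"
  proof
    show "Domain u \<subseteq> Domain (u O v\<inverse>)"
    proof
      fix P assume "P \<in> Domain u"
      then obtain J where J: "(P, J) \<in> u" by blast
      then obtain Q where "(Q, J) \<in> v"
        using halves_surj[OF v, of J] brels_sub[OF halves_brels[OF u] J] by blast
      then show "P \<in> Domain (u O v\<inverse>)" using J by blast
    qed
  qed blast
  moreover have "Range (u O v\<inverse>) = Domain v"
  proof
    show "Domain v \<subseteq> Range (u O v\<inverse>)"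
    proof
      fix P assume "P \<in> Domain v"
      then obtain J where J: "(P, J) \<in> v" by blast
      then obtain Q where "(Q, J) \<in> u"
        using halves_surj[OF u, of J] brels_sub[OF halves_brels[OF v] J] by blast
      then show "P \<in> Range (u O v\<inverse>)" using J by blast
    qed
  qed blast
  ultimately show ?thesis unfolding flat_def by simp
qed

lemma flat_comp:
  assumes "s \<in> rank_le 1 A B" "t \<in> rank_le 1 B C"
  shows "flat (s O t) = flat s O flat t"
proof -
  have "flat (s O t) = Domain s \<times> Range t"
    unfolding flat_def using rank_le1_Domain[OF assms(1) rank_le_brels[OF assms(2)]]
      rank_le1_Range[OF rank_le_brels[OF assms(1)] assms(2)] by simp
  moreover have "{} \<in> Range s" "{} \<in> Domain t"
    using brels_empty[OF rank_le_brels[OF assms(1)]] brels_empty[OF rank_le_brels[OF assms(2)]] by blast+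
  then have "flat s O flat t = Domain s \<times> Range t" unfolding flat_def by blast
  ultimately show ?thesis by simp
qed

subsection \<open>The idempotents that forget one point\<close>

text \<open>For \<open>i\<close> in \<open>{1..q}\<close>, the relation of the partition with blocks
  \<open>{j, j'}\<close> for \<open>j \<noteq> i\<close> and the two singletons \<open>{i}\<close>
  and \<open>{i'}\<close>.\<close>

definition forget :: "nat \<Rightarrow> nat \<Rightarrow> (nat set \<times> nat set) set" where
  "forget i q = {(J, K). J \<subseteq> {1..q} \<and> K \<subseteq> {1..q} \<and> J - {i} = K - {i}}"

lemma forget_brels: "forget i q \<in> brels {1..q} {1..q}"
  by (rule brelsI) (auto simp: forget_def)

lemma forget_rank:
  assumes i: "i \<in> {1..q}"
  shows "forget i q \<in> rank_class (q - 1) {1..q} {1..q}"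
proof -
  have "card ({1..q} - {i}) = q - 1" using i by simp
  then obtain a where a: "bij_betw a {1..q-1} ({1..q} - {i})"
    using ex_bij_betw_nat_finite_1[of "{1..q} - {i}"] by auto
  let ?u = "point_half (q - 1) a (Pow {1..q})"
  have u: "?u \<in> halves (q - 1) {1..q}"
  proof (rule point_half_halves[OF subalgs_Pow])
    show "a j \<in> {1..q}" if "j \<in> {1..q-1}" for j using a that unfolding bij_betw_def by blast
    show "\<exists>P\<in>Pow {1..q}. \<forall>j\<in>{1..q-1}. (a j \<in> P) = (j \<in> J)" if J: "J \<subseteq> {1..q-1}" for J
    proof (intro bexI ballI)
      show "a ` J \<in> Pow {1..q}" using a J unfolding bij_betw_def by blast
      show "(a j \<in> a ` J) = (j \<in> J)" if "j \<in> {1..q-1}" for j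
        using a J that unfolding bij_betw_def by (meson inj_on_image_mem_iff)
    qed
  qed
  have "(J, K) \<in> forget i q \<longleftrightarrow> (J, K) \<in> ?u O ?u\<inverse>" for J K
  proof -
    have "(J, K) \<in> ?u O ?u\<inverse> \<longleftrightarrow> J \<subseteq> {1..q} \<and> K \<subseteq> {1..q} \<and> (\<forall>j\<in>{1..q-1}. a j \<in> J \<longleftrightarrow> a j \<in> K)"
      unfolding relcomp_unfold point_half_def by auto
    also have "\<dots> \<longleftrightarrow> J \<subseteq> {1..q} \<and> K \<subseteq> {1..q} \<and> (\<forall>x\<in>a ` {1..q-1}. x \<in> J \<longleftrightarrow> x \<in> K)" by blast
    also have "a ` {1..q-1} = {1..q} - {i}" using a unfolding bij_betw_def by blast
    finally show ?thesis unfolding forget_def by blast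
  qed
  then have "forget i q = ?u O ?u\<inverse>" by (metis subrelI subset_antisym)
  then show ?thesis using rank_classI[OF u u] by simp
qed

subsection \<open>Separating half-diagrams\<close>

text \<open>Preimages of the points are made disjoint by removing the other ones, which does not
  affect the images since these are disjoint already. What is left of \<open>A\<close> goes to one
  piece. The pieces generate a copy of \<open>Pow {1..q}\<close> inside the domain of
  \<open>c\<close>.\<close>

lemma halves_section:
  assumes c: "c \<in> halves q A" and q: "1 \<le> q"
  obtains Q where "\<And>i. i \<in> {1..q} \<Longrightarrow> (Q i, {i}) \<in> c"
    "\<And>i j. i \<in> {1..q} \<Longrightarrow> j \<in> {1..q} \<Longrightarrow> i \<noteq> j \<Longrightarrow> Q i \<inter> Q j = {}" "(\<Union>i\<in>{1..q}. Q i) = A"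
proof -
  have cb: "c \<in> brels A {1..q}" using c by (rule halves_brels)
  have "\<forall>i\<in>{1..q}. \<exists>P. (P, {i}) \<in> c" using halves_surj[OF c] by auto
  then obtain R where R: "\<And>i. i \<in> {1..q} \<Longrightarrow> (R i, {i}) \<in> c" by metis
  define S where "S i = R i - (\<Union>j\<in>{1..q} - {i}. R j)" for i
  have S: "(S i, {i}) \<in> c" if i: "i \<in> {1..q}" for i
  proof -
    have "(S i, {i} - (\<Union>j\<in>{1..q} - {i}. {j})) \<in> c"
      unfolding S_def using R i by (intro brels_Diff[OF cb] brels_UN[OF cb]) auto
    moreover have "{i} - (\<Union>j\<in>{1..q} - {i}. {j}) = {i}" by auto
    ultimately show ?thesis by simp
  qed
  \<comment> \<open>All remaining points of \<open>A\<close> go to index 1, which is available as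
    \<open>q \<ge> 1\<close>; the complement of the other pieces is still sent to
    \<open>{1}\<close>.\<close>
  define Q where "Q i = (if i = 1 then A - (\<Union>j\<in>{2..q}. S j) else S i)" for i
  have "(A - (\<Union>j\<in>{2..q}. S j), {1..q} - (\<Union>j\<in>{2..q}. {j})) \<in> c"
    using S by (intro brels_Diff[OF cb] brels_full[OF cb] brels_UN[OF cb]) auto
  moreover have "{1..q} - (\<Union>j\<in>{2..q}. {j}) = {1}" using q by auto
  ultimately have "(Q 1, {1}) \<in> c" unfolding Q_def by simp
  then have 1: "(Q i, {i}) \<in> c" if "i \<in> {1..q}" for i
    using S[OF that] by (cases "i = 1") (simp_all add: Q_def)
  have 2: "Q i \<inter> Q j = {}" if "i \<in> {1..q}" "j \<in> {1..q}" "i \<noteq> j" for i j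
  proof -
    have "S i \<inter> S j = {}" using that unfolding S_def by blast
    moreover have "j \<noteq> 1 \<Longrightarrow> j \<in> {2..q}" "i \<noteq> 1 \<Longrightarrow> i \<in> {2..q}" using that by auto
    ultimately show ?thesis using that(3) unfolding Q_def by auto
  qed
  have 3: "(\<Union>i\<in>{1..q}. Q i) = A"
  proof
    show "(\<Union>i\<in>{1..q}. Q i) \<subseteq> A" using 1 brels_sub[OF cb] by blast
    show "A \<subseteq> (\<Union>i\<in>{1..q}. Q i)"
    proof
      fix x assume x: "x \<in> A"
      show "x \<in> (\<Union>i\<in>{1..q}. Q i)"
      proof (cases "\<exists>j\<in>{2..q}. x \<in> S j")
        case True
        then obtain j where "j \<in> {2..q}" "x \<in> S j" by blast
        then have "j \<in> {1..q}" "x \<in> Q j" unfolding Q_def by auto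
        then show ?thesis by blast
      next
        case False
        then have "x \<in> Q 1" using x unfolding Q_def by auto
        then show ?thesis using q by force
      qed
    qed
  qed
  show ?thesis using that 1 2 3 by blast
qed

text \<open>The two halves agree on a copy of \<open>Pow {1..q}\<close> with pieces
  \<open>Q i\<close>. Inside one piece there is a set \<open>P\<close> that \<open>w\<close> sends
  to \<open>{i}\<close> and that is outside the domain of \<open>u\<close>. A test relation that
  treats \<open>P\<close> as negligible looks like the identity to \<open>u\<close>, but lets
  \<open>w\<close> send something negligible to a point.\<close>

lemma separate_normalised:
  assumes u: "u \<in> halves q A" and w: "w \<in> halves q A" and uw: "u\<inverse> O w = idr q" and q: "1 \<le> q"
    and P0: "P0 \<in> Domain w" "P0 \<notin> Domain u"
  shows "\<exists>p\<in>brels {1..q} A. p O u = idr q \<and> p O w \<notin> halves q {1..q}"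
proof -
  have ub: "u \<in> brels A {1..q}" and wb: "w \<in> brels A {1..q}" using u w halves_brels by blast+
  \<comment> \<open>As \<open>u\<inverse> O w\<close> is the identity, each \<open>J\<close> has a
    preimage common to both halves, so their common part is still onto.\<close>
  have c: "u \<inter> w \<in> halves q A"
  proof (rule halvesI)
    show "u \<inter> w \<in> brels A {1..q}"
    proof (rule brelsI)
      show "({}, {}) \<in> u \<inter> w" using brels_empty[OF ub] brels_empty[OF wb] by blast
      show "P \<subseteq> A \<and> Q \<subseteq> {1..q}" if "(P, Q) \<in> u \<inter> w" for P Q using brels_sub[OF ub] that by blast
      show "(A - P, {1..q} - Q) \<in> u \<inter> w" if "(P, Q) \<in> u \<inter> w" for P Q
        using brels_compl[OF ub] brels_compl[OF wb] that by blast
      show "(P \<union> P', Q \<union> Q') \<in> u \<inter> w" if "(P, Q) \<in> u \<inter> w" "(P', Q') \<in> u \<inter> w" for P Q P' Q'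
        using brels_Un[OF ub] brels_Un[OF wb] that by blast
    qed
    show "Range (u \<inter> w) = Pow {1..q}"
    proof
      show "Range (u \<inter> w) \<subseteq> Pow {1..q}" using brels_sub[OF ub] by blast
      show "Pow {1..q} \<subseteq> Range (u \<inter> w)"
      proof
        fix J assume "J \<in> Pow {1..q}"
        then have "(J, J) \<in> u\<inverse> O w" unfolding uw by auto
        then show "J \<in> Range (u \<inter> w)" by blast
      qed
    qed
    show "K = {}" if "({}, K) \<in> u \<inter> w" for K using halves_empty[OF u] that by blast
  qed
  obtain Q where Q: "\<And>i. i \<in> {1..q} \<Longrightarrow> (Q i, {i}) \<in> u \<inter> w"
    and disj: "\<And>i j. i \<in> {1..q} \<Longrightarrow> j \<in> {1..q} \<Longrightarrow> i \<noteq> j \<Longrightarrow> Q i \<inter> Q j = {}"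
    and cover: "(\<Union>i\<in>{1..q}. Q i) = A"
    using halves_section[OF c q] by blast
  \<comment> \<open>The pieces cover \<open>A\<close>: if every trace of \<open>P0\<close> were in
    the domain of \<open>u\<close>, their union \<open>P0\<close> would be too.\<close>
  have "\<exists>i\<in>{1..q}. P0 \<inter> Q i \<notin> Domain u"
  proof (rule ccontr)
    assume "\<not> (\<exists>i\<in>{1..q}. P0 \<inter> Q i \<notin> Domain u)"
    then have "(\<Union>i\<in>{1..q}. P0 \<inter> Q i) \<in> Domain u"
      by (intro subalgs_UN[OF subalgs_Domain[OF ub]]) auto
    moreover have "(\<Union>i\<in>{1..q}. P0 \<inter> Q i) = P0"
      using cover subalgs_sub[OF subalgs_Domain[OF wb] P0(1)] by blast
    ultimately show False using P0(2) by simp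
  qed
  then obtain i where i: "i \<in> {1..q}" "P0 \<inter> Q i \<notin> Domain u" by blast
  obtain J where J: "(P0, J) \<in> w" using P0(1) by blast
  \<comment> \<open>Of the trace of \<open>P0\<close> on \<open>Q i\<close> and its complement in
    \<open>Q i\<close>, one is sent to \<open>{i}\<close> by \<open>w\<close>, and neither is in the
    domain of \<open>u\<close>.\<close>
  have "\<exists>P. P \<subseteq> Q i \<and> P \<notin> Domain u \<and> (P, {i}) \<in> w"
  proof (cases "i \<in> J")
    case True
    then have "(P0 \<inter> Q i, {i}) \<in> w" using brels_Int[OF wb J, of "Q i" "{i}"] Q[OF i(1)] by auto
    then show ?thesis using i(2) by blast
  next
    case False
    then have "{i} - J = {i}" by blast
    then have "(Q i - P0, {i}) \<in> w" using brels_Diff[OF wb _ J, of "Q i" "{i}"] Q[OF i(1)] by simp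
    moreover have "Q i - P0 \<notin> Domain u"
    proof
      assume "Q i - P0 \<in> Domain u"
      moreover have "Q i \<in> Domain u" using Q[OF i(1)] by blast
      ultimately have "Q i - (Q i - P0) \<in> Domain u" using subalgs_Diff[OF subalgs_Domain[OF ub]] by metis
      then show False using i(2) by (simp add: Diff_Diff_Int Int_commute)
    qed
    ultimately show ?thesis by blast
  qed
  then obtain P where P: "P \<subseteq> Q i" "P \<notin> Domain u" "(P, {i}) \<in> w" by blast
  define QK where "QK K = (\<Union>i\<in>K. Q i)" for K
  have QKu: "(QK K, K) \<in> u" if "K \<subseteq> {1..q}" for K
  proof -
    have "((\<Union>i\<in>K. Q i), (\<Union>i\<in>K. {i})) \<in> u"
      using that finite_subset[OF that] Q by (intro brels_UN[OF ub]) auto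
    then show ?thesis unfolding QK_def by simp
  qed
  have QKc: "A - QK K = QK ({1..q} - K)" if "K \<subseteq> {1..q}" for K
    using that disj unfolding QK_def cover[symmetric] by blast
  have QKP: "i \<in> K \<Longrightarrow> P \<subseteq> QK K" "i \<notin> K \<Longrightarrow> QK K \<inter> P = {}" if "K \<subseteq> {1..q}" for K
    using that disj i(1) P(1) unfolding QK_def by blast+
  have QKUn: "QK (K \<union> L) = QK K \<union> QK L" for K L unfolding QK_def by blast
  have PA: "P \<subseteq> A" using P(1) cover i(1) by blast
  \<comment> \<open>Up to the points of \<open>P\<close>, the set \<open>R\<close> is the union of
    the pieces indexed by \<open>K\<close>; in particular \<open>P\<close> is related to
    \<open>{}\<close>. Of the two candidates for \<open>R\<close>, one is \<open>QK K\<close>, and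
    the other differs from it by \<open>P\<close>, so only \<open>QK K\<close> is in the domain of
    \<open>u\<close>.\<close>
  define v where "v = {(R, K). K \<subseteq> {1..q} \<and> (R = QK K - P \<or> R = QK K \<union> P)}"
  have v_iff: "(R, K) \<in> v \<longleftrightarrow> K \<subseteq> {1..q} \<and> (R = QK K - P \<or> R = QK K \<union> P)" for R K
    unfolding v_def by simp
  have QKA: "QK K \<subseteq> A" if "K \<subseteq> {1..q}" for K using that unfolding QK_def cover[symmetric] by blast
  have vb: "v \<in> brels A {1..q}"
  proof (rule brelsI)
    show "({}, {}) \<in> v" unfolding v_iff QK_def by simp
    show "R \<subseteq> A \<and> K \<subseteq> {1..q}" if "(R, K) \<in> v" for R K using that PA QKA[of K] unfolding v_iff by blast
    show "(A - R, {1..q} - K) \<in> v" if RK: "(R, K) \<in> v" for R K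
    proof -
      have K: "K \<subseteq> {1..q}" and R: "R = QK K - P \<or> R = QK K \<union> P" using RK unfolding v_iff by blast+
      have "A - (QK K - P) = QK ({1..q} - K) \<union> P" "A - (QK K \<union> P) = QK ({1..q} - K) - P"
        unfolding QKc[OF K, symmetric] using PA by blast+
      then show ?thesis unfolding v_iff using R by auto
    qed
    show "(R \<union> R', K \<union> K') \<in> v" if "(R, K) \<in> v" "(R', K') \<in> v" for R K R' K'
      using that unfolding v_iff QKUn by blast
  qed
  have dom: "R = QK K \<and> L = K" if R: "(R, K) \<in> v" "(R, L) \<in> u" for R K L
  proof -
    have K: "K \<subseteq> {1..q}" and R': "R = QK K - P \<or> R = QK K \<union> P" using R unfolding v_iff by blast+
    have "QK K - R \<in> Domain u" "R - QK K \<in> Domain u"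
      using brels_Diff[OF ub QKu[OF K] R(2)] brels_Diff[OF ub R(2) QKu[OF K]] by blast+
    then have "QK K - R \<noteq> P" "R - QK K \<noteq> P" using P(2) by auto
    then have "R = QK K" using R' QKP[OF K] by (cases "i \<in> K") auto
    then show ?thesis using halves_unique[OF u R(2)] QKu[OF K] by simp
  qed
  have QKv: "(QK K, K) \<in> v" if K: "K \<subseteq> {1..q}" for K
    using QKP[OF K] K unfolding v_iff by (cases "i \<in> K") auto
  have "v\<inverse> O u = idr q"
  proof
    show "v\<inverse> O u \<subseteq> idr q"
    proof (rule subrelI)
      fix K L assume "(K, L) \<in> v\<inverse> O u"
      then obtain R where R: "(R, K) \<in> v" "(R, L) \<in> u" by blast
      then have "L = K" "K \<subseteq> {1..q}" using dom[OF R] brels_sub[OF vb R(1)] by simp_all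
      then show "(K, L) \<in> idr q" by (simp add: Id_on_iff)
    qed
    show "idr q \<subseteq> v\<inverse> O u"
    proof (rule subrelI)
      fix K L assume "(K, L) \<in> idr q"
      then have "L = K" "K \<subseteq> {1..q}" by auto
      then show "(K, L) \<in> v\<inverse> O u" using QKv[of K] QKu[of K] by blast
    qed
  qed
  moreover have "v\<inverse> O w \<notin> halves q {1..q}"
  proof
    assume h: "v\<inverse> O w \<in> halves q {1..q}"
    have "(P, {}) \<in> v" unfolding v_iff QK_def by simp
    then have "({}, {i}) \<in> v\<inverse> O w" using P(3) by blast
    then show False using halves_empty[OF h] by blast
  qed
  ultimately show ?thesis using brels_converse[OF vb] by blast
qed

text \<open>The first test is \<open>u\<inverse>\<close>. If it does not separate,
  \<open>u\<inverse> O w\<close> is a permutation, and after absorbing it into \<open>w\<close> the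
  halves agree wherever both are defined. As they are different, so are their domains, and a set in
  only one of these feeds \<open>separate_normalised\<close>, on whichever side it occurs.\<close>

lemma halves_separate:
  assumes u: "u \<in> halves q A" and w: "w \<in> halves q A" and q: "1 \<le> q"
    and ne: "\<And>\<pi>. \<pi> permutes {1..q} \<Longrightarrow> w \<noteq> u O perm_rel q \<pi>"
  shows "\<exists>p\<in>brels {1..q} A. (p O u = idr q \<and> p O w \<notin> halves q {1..q}) \<or>
    (p O w = idr q \<and> p O u \<notin> halves q {1..q})"
proof (cases "u\<inverse> O w \<in> halves q {1..q}")
  case False
  then show ?thesis using halves_inv[OF u] brels_converse[OF halves_brels[OF u]] by blast
next
  case True
  then obtain \<pi> where p: "\<pi> permutes {1..q}" "u\<inverse> O w = perm_rel q \<pi>" by (rule halves_perm)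
  have i: "Hilbert_Choice.inv \<pi> permutes {1..q}" using p(1) by (rule permutes_inv)
  define c where "c = perm_rel q \<pi>"
  have c: "c \<in> halves q {1..q}" "c\<inverse> \<in> halves q {1..q}"
    unfolding c_def perm_rel_converse[OF p(1)] using perm_rel_halves[OF p(1)] perm_rel_halves[OF i] .
  have cc: "c O c\<inverse> = idr q" "c\<inverse> O c = idr q"
    using halves_inv[OF c(1)] halves_inv[OF c(2)] by simp_all
  define w' where "w' = w O c\<inverse>"
  have w': "w' \<in> halves q A" unfolding w'_def by (rule halves_comp[OF w c(2)])
  have ww: "w = w' O c" unfolding w'_def O_assoc cc(2) using brels_right_Id[OF halves_brels[OF w]] by simp
  have uw': "u\<inverse> O w' = idr q"
  proof -
    have "u\<inverse> O w' = (u\<inverse> O w) O c\<inverse>" unfolding w'_def by (simp only: O_assoc)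
    then show ?thesis using p(2) cc(1) unfolding c_def by simp
  qed
  then have wu': "w'\<inverse> O u = idr q" by (metis converse_Id_on converse_converse converse_relcomp)
  show ?thesis
  proof (cases "Domain w' \<subseteq> Domain u")
    case False
    then obtain P0 where P0: "P0 \<in> Domain w'" "P0 \<notin> Domain u" by blast
    then obtain r where r: "r \<in> brels {1..q} A" "r O u = idr q" "r O w' \<notin> halves q {1..q}"
      using separate_normalised[OF u w' uw' q P0] by (elim bexE conjE)
    have "r O w \<notin> halves q {1..q}"
    proof
      assume "r O w \<in> halves q {1..q}"
      then have "(r O w) O c\<inverse> \<in> halves q {1..q}" by (rule halves_comp[OF _ c(2)])
      moreover have "(r O w) O c\<inverse> = r O w'" unfolding w'_def by (simp only: O_assoc)
      ultimately show False using r(3) by simp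
    qed
    then show ?thesis using r by blast
  next
    case sub: True
    have "\<not> Domain u \<subseteq> Domain w'"
    proof
      assume sub': "Domain u \<subseteq> Domain w'"
      have eq: "J = K" if "(P, J) \<in> u" "(P, K) \<in> w'" for P J K
      proof -
        have "(J, K) \<in> u\<inverse> O w'" using that by blast
        then show ?thesis unfolding uw' by auto
      qed
      have "u = w'"
      proof (rule subset_antisym; rule subrelI)
        fix P J assume PJ: "(P, J) \<in> u"
        then obtain K where "(P, K) \<in> w'" using sub' by blast
        then show "(P, J) \<in> w'" using eq[OF PJ] by simp
      next
        fix P K assume PK: "(P, K) \<in> w'"
        then obtain J where "(P, J) \<in> u" using sub by blast
        then show "(P, K) \<in> u" using eq[OF _ PK] by simp
      qed
      then show False using ne[OF p(1)] ww unfolding c_def by simp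
    qed
    then obtain P0 where P0: "P0 \<in> Domain u" "P0 \<notin> Domain w'" by blast
    then obtain r where r: "r \<in> brels {1..q} A" "r O w' = idr q" "r O u \<notin> halves q {1..q}"
      using separate_normalised[OF w' u wu' q P0] by (elim bexE conjE)
    \<comment> \<open>The permutation absorbed into \<open>w\<close> is undone on the left, so that
      the test relation yields the identity with the original \<open>w\<close>.\<close>
    define r' where "r' = c\<inverse> O r"
    have "r' O w = c\<inverse> O (r O w') O c" unfolding r'_def ww by (simp only: O_assoc)
    also have "\<dots> = idr q" unfolding r(2) using cc(2) brels_left_Id[OF halves_brels[OF c(1)]] by simp
    finally have 1: "r' O w = idr q" .
    have 2: "r' O u \<notin> halves q {1..q}"
    proof
      assume "r' O u \<in> halves q {1..q}"
      then have "c O (r' O u) \<in> halves q {1..q}" by (rule halves_comp[OF c(1)])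
      moreover have "c O (r' O u) = (c O c\<inverse>) O (r O u)" unfolding r'_def by (simp only: O_assoc)
      then have "c O (r' O u) = r O u"
        unfolding cc(1) using brels_left_Id[OF brels_comp[OF r(1) halves_brels[OF u]]] by simp
      ultimately show False using r(3) by simp
    qed
    have "r' \<in> brels {1..q} A" unfolding r'_def by (rule brels_comp[OF halves_brels[OF c(2)] r(1)])
    then show ?thesis using 1 2 by blast
  qed
qed

section \<open>How far one pair of a congruence spreads: separation, descent in rank,
  collapse\<close>

section \<open>Congruences in terms of Boolean relations\<close>

definition rank_set :: "enat \<Rightarrow> 'a set \<Rightarrow> 'b set \<Rightarrow> ('a set \<times> 'b set) set set" where
  "rank_set r A B = (\<Union>q\<in>{q. enat q \<le> r}. rank_class q A B)"

lemma rank_setI: "s \<in> rank_class q A B \<Longrightarrow> enat q \<le> r \<Longrightarrow> s \<in> rank_set r A B"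
  unfolding rank_set_def by blast

lemma rank_setE:
  assumes "s \<in> rank_set r A B"
  obtains q where "enat q \<le> r" "s \<in> rank_class q A B"
  using assms unfolding rank_set_def by blast

lemma rank_set_brels: "s \<in> rank_set r A B \<Longrightarrow> s \<in> brels A B"
  by (meson rank_setE rank_class_brels)

lemma rank_set_converse: "s \<in> rank_set r A B \<Longrightarrow> s\<inverse> \<in> rank_set r B A"
  by (meson rank_setE rank_setI rank_class_converse)

lemma rank_le_rank_set:
  assumes "s \<in> rank_le q A B" "enat q \<le> r"
  shows "s \<in> rank_set r A B"
proof -
  obtain k where "k \<le> q" "s \<in> rank_class k A B" using assms(1) by (rule rank_leE)
  then show ?thesis using rank_setI[of s k A B r] order_trans[of "enat k" "enat q" r] assms(2) by simp
qed

lemma rank_set_comp: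
  assumes s: "s \<in> rank_set r A B" and t: "t \<in> brels B D" and fin: "finite A" "finite D"
  shows "s O t \<in> rank_set r A D"
proof -
  obtain q where q: "enat q \<le> r" "s \<in> rank_class q A B" using s by (rule rank_setE)
  show ?thesis
    using rank_le_rank_set[OF rank_le_comp_right[OF rank_leI[OF q(2) order_refl] t fin] q(1)] .
qed

text \<open>Green's relation H among the relations of rank \<open>q\<close>: the same halves up to a
  permutation of \<open>{1..q}\<close>.\<close>

definition h_rel :: "nat \<Rightarrow> 'a set \<Rightarrow> 'b set \<Rightarrow> (('a set \<times> 'b set) set) rel" where
  "h_rel q A B = {(u O v\<inverse>, u O perm_rel q \<pi> O v\<inverse>) | u v \<pi>.
     u \<in> halves q A \<and> v \<in> halves q B \<and> \<pi> permutes {1..q}}"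

lemma h_relI:
  "u \<in> halves q A \<Longrightarrow> v \<in> halves q B \<Longrightarrow> \<pi> permutes {1..q} \<Longrightarrow> (u O v\<inverse>, u O perm_rel q \<pi> O v\<inverse>) \<in> h_rel q A B"
  unfolding h_rel_def by blast

lemma h_relE:
  assumes "(s, t) \<in> h_rel q A B"
  obtains u v \<pi> where "u \<in> halves q A" "v \<in> halves q B" "\<pi> permutes {1..q}"
    "s = u O v\<inverse>" "t = u O perm_rel q \<pi> O v\<inverse>"
  using assms unfolding h_rel_def by blast

lemma h_rel_rank:
  assumes "(s, t) \<in> h_rel q A B"
  shows "s \<in> rank_class q A B \<and> t \<in> rank_class q A B"
proof -
  obtain u v \<pi> where h: "u \<in> halves q A" "v \<in> halves q B" "\<pi> permutes {1..q}"
    "s = u O v\<inverse>" "t = u O perm_rel q \<pi> O v\<inverse>" using assms by (rule h_relE)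
  have "t = (u O perm_rel q \<pi>) O v\<inverse>" unfolding h(5) by (simp only: O_assoc)
  then show ?thesis
    using rank_classI[OF h(1,2)] rank_classI[OF halves_comp[OF h(1) perm_rel_halves[OF h(3)]] h(2)] h(4) by simp
qed

text \<open>What the empty set is related to depends on the lower half alone, since a permutation
  fixes the empty set. In \<open>descend\<close> this is the invariant that shows a pair to be
  outside \<open>h_rel\<close>.\<close>

lemma h_rel_empty_iff:
  assumes "(s, t) \<in> h_rel q A B"
  shows "({}, K) \<in> s \<longleftrightarrow> ({}, K) \<in> t"
proof -
  obtain u v \<pi> where h: "u \<in> halves q A" "v \<in> halves q B" "\<pi> permutes {1..q}"
    "s = u O v\<inverse>" "t = u O perm_rel q \<pi> O v\<inverse>" using assms by (rule h_relE)
  have e: "({}, {}) \<in> u" using brels_empty[OF halves_brels[OF h(1)]] .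
  have "({}, K) \<in> s \<longleftrightarrow> (K, {}) \<in> v"
    unfolding h(4) using halves_empty[OF h(1)] e by blast
  moreover have "({}, K) \<in> t \<longleftrightarrow> (K, {}) \<in> v"
  proof
    assume "({}, K) \<in> t"
    then obtain J L where JL: "({}, J) \<in> u" "(J, L) \<in> perm_rel q \<pi>" "(K, L) \<in> v" unfolding h(5) by blast
    then have "J = {}" using halves_empty[OF h(1)] by blast
    then have "L = {}" using JL(2) by (simp add: perm_rel_iff)
    then show "(K, {}) \<in> v" using JL(3) by simp
  next
    assume "(K, {}) \<in> v"
    moreover have "({}, {}) \<in> perm_rel q \<pi>" by (simp add: perm_rel_iff)
    ultimately show "({}, K) \<in> t" unfolding h(5) using e by blast
  qed
  ultimately show ?thesis by simp
qed

lemma halves_converse: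
  assumes "b \<in> halves q {1..q}"
  shows "b\<inverse> \<in> halves q {1..q}"
proof -
  obtain \<pi> where p: "\<pi> permutes {1..q}" "b = perm_rel q \<pi>" using assms by (rule halves_perm)
  show ?thesis unfolding p(2) perm_rel_converse[OF p(1)] by (rule perm_rel_halves[OF permutes_inv[OF p(1)]])
qed

text \<open>The transport of a congruence to saturated-set relations. All hom-sets share the one
  relation \<open>E\<close>, and multipliers range over \<open>rank_set r\<close> only, as the ideal
  need not contain the identities of the category.\<close>

locale brel_cong =
  fixes C :: "'a set set" and r :: enat and E :: "(('a set \<times> 'a set) set) rel"
  assumes fin: "\<And>A. A \<in> C \<Longrightarrow> finite A"
    and objects: "\<And>s t. (s, t) \<in> E \<Longrightarrow> \<exists>A\<in>C. \<exists>B\<in>C. s \<in> rank_set r A B \<and> t \<in> rank_set r A B"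
    and E_refl: "\<And>A B s. A \<in> C \<Longrightarrow> B \<in> C \<Longrightarrow> s \<in> rank_set r A B \<Longrightarrow> (s, s) \<in> E"
    and E_sym: "\<And>s t. (s, t) \<in> E \<Longrightarrow> (t, s) \<in> E"
    and E_trans: "\<And>s t u. (s, t) \<in> E \<Longrightarrow> (t, u) \<in> E \<Longrightarrow> (s, u) \<in> E"
    and E_left: "\<And>s t w A B D. (s, t) \<in> E \<Longrightarrow> s \<in> brels A B \<Longrightarrow> D \<in> C \<Longrightarrow> w \<in> rank_set r D A \<Longrightarrow> (w O s, w O t) \<in> E"
    and E_right: "\<And>s t w A B D. (s, t) \<in> E \<Longrightarrow> s \<in> brels A B \<Longrightarrow> D \<in> C \<Longrightarrow> w \<in> rank_set r B D \<Longrightarrow> (s O w, t O w) \<in> E"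
begin

lemma E_typed:
  assumes "(s, t) \<in> E" "s \<in> brels A B"
  shows "A \<in> C" "B \<in> C" "s \<in> rank_set r A B" "t \<in> rank_set r A B"
proof -
  obtain A' B' where AB: "A' \<in> C" "B' \<in> C" "s \<in> rank_set r A' B'" "t \<in> rank_set r A' B'"
    using objects[OF assms(1)] by blast
  have "A' = A \<and> B' = B" using brels_eq_objects[OF rank_set_brels[OF AB(3)] assms(2)] .
  then show "A \<in> C" "B \<in> C" "s \<in> rank_set r A B" "t \<in> rank_set r A B" using AB by auto
qed

text \<open>Relational converse is an anti-automorphism; through it each statement about left halves
  or ranges yields its mirror image.\<close>

lemma converse_cong: "brel_cong C r ((\<lambda>(s, t). (s\<inverse>, t\<inverse>)) ` E)"
proof
  let ?E = "(\<lambda>(s, t). (s\<inverse>, t\<inverse>)) ` E"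
  have conv: "(s, t) \<in> ?E \<longleftrightarrow> (s\<inverse>, t\<inverse>) \<in> E" for s t
    by (force simp: image_iff)
  show "finite A" if "A \<in> C" for A using that by (rule fin)
  show "\<exists>A\<in>C. \<exists>B\<in>C. s \<in> rank_set r A B \<and> t \<in> rank_set r A B" if st: "(s, t) \<in> ?E" for s t
  proof -
    obtain A B where AB: "A \<in> C" "B \<in> C" "s\<inverse> \<in> rank_set r A B" "t\<inverse> \<in> rank_set r A B"
      using objects st[unfolded conv] by blast
    then show ?thesis using rank_set_converse[OF AB(3)] rank_set_converse[OF AB(4)] by auto
  qed
  show "(s, s) \<in> ?E" if "A \<in> C" "B \<in> C" "s \<in> rank_set r A B" for A B s
    unfolding conv using E_refl[OF that(2,1) rank_set_converse[OF that(3)]] .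
  show "(t, s) \<in> ?E" if "(s, t) \<in> ?E" for s t using that E_sym unfolding conv by blast
  show "(s, u) \<in> ?E" if "(s, t) \<in> ?E" "(t, u) \<in> ?E" for s t u using that E_trans unfolding conv by blast
  show "(w O s, w O t) \<in> ?E" if "(s, t) \<in> ?E" "s \<in> brels A B" "D \<in> C" "w \<in> rank_set r D A" for s t w A B D
    using E_right[OF _ brels_converse[OF that(2)] that(3) rank_set_converse[OF that(4)]] that(1)
    unfolding conv converse_relcomp by blast
  show "(s O w, t O w) \<in> ?E" if "(s, t) \<in> ?E" "s \<in> brels A B" "D \<in> C" "w \<in> rank_set r B D" for s t w A B D
    using E_left[OF _ brels_converse[OF that(2)] that(3) rank_set_converse[OF that(4)]] that(1)
    unfolding conv converse_relcomp by blast
qed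

text \<open>The congruence that \<open>E\<close> induces on the monoid of Boolean relations on \<open>{1..q}\<close>, which need
  not be an object of the category.\<close>

definition ind :: "nat \<Rightarrow> ((nat set \<times> nat set) set) rel" where
  "ind q = {(b, c). b \<in> brels {1..q} {1..q} \<and> c \<in> brels {1..q} {1..q} \<and>
     (\<forall>X\<in>C. \<forall>Y\<in>C. \<forall>a\<in>brels X {1..q}. \<forall>a'\<in>brels Y {1..q}. (a O b O a'\<inverse>, a O c O a'\<inverse>) \<in> E)}"

lemma indI:
  assumes "b \<in> brels {1..q} {1..q}" "c \<in> brels {1..q} {1..q}"
    "\<And>X Y a a'. X \<in> C \<Longrightarrow> Y \<in> C \<Longrightarrow> a \<in> brels X {1..q} \<Longrightarrow> a' \<in> brels Y {1..q} \<Longrightarrow> (a O b O a'\<inverse>, a O c O a'\<inverse>) \<in> E"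
  shows "(b, c) \<in> ind q"
  using assms unfolding ind_def by simp

lemma indD: "(b, c) \<in> ind q \<Longrightarrow> X \<in> C \<Longrightarrow> Y \<in> C \<Longrightarrow> a \<in> brels X {1..q} \<Longrightarrow> a' \<in> brels Y {1..q} \<Longrightarrow>
    (a O b O a'\<inverse>, a O c O a'\<inverse>) \<in> E"
  unfolding ind_def by simp

lemma ind_brels: "(b, c) \<in> ind q \<Longrightarrow> b \<in> brels {1..q} {1..q} \<and> c \<in> brels {1..q} {1..q}"
  unfolding ind_def by simp

lemma ind_sym: "(b, c) \<in> ind q \<Longrightarrow> (c, b) \<in> ind q"
  using ind_brels by (intro indI) (auto intro: E_sym dest: indD)

lemma ind_trans: "(b, c) \<in> ind q \<Longrightarrow> (c, d) \<in> ind q \<Longrightarrow> (b, d) \<in> ind q"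
  using ind_brels by (intro indI) (blast intro: E_trans dest: indD)+

lemma ind_left:
  assumes bc: "(b, c) \<in> ind q" and d: "d \<in> brels {1..q} {1..q}"
  shows "(d O b, d O c) \<in> ind q"
proof (rule indI)
  show "d O b \<in> brels {1..q} {1..q}" "d O c \<in> brels {1..q} {1..q}"
    using ind_brels[OF bc] brels_comp[OF d] by auto
  fix X Y a a' assume "X \<in> C" "Y \<in> C" "a \<in> brels X {1..q}" "a' \<in> brels Y {1..q}"
  then show "(a O (d O b) O a'\<inverse>, a O (d O c) O a'\<inverse>) \<in> E"
    using indD[OF bc _ _ brels_comp[OF _ d]] by (simp add: O_assoc)
qed

lemma ind_right:
  assumes bc: "(b, c) \<in> ind q" and d: "d \<in> brels {1..q} {1..q}"
  shows "(b O d, c O d) \<in> ind q"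
proof (rule indI)
  show "b O d \<in> brels {1..q} {1..q}" "c O d \<in> brels {1..q} {1..q}"
    using ind_brels[OF bc] brels_comp[OF _ d] by auto
  fix X Y a a' assume "X \<in> C" "Y \<in> C" "a \<in> brels X {1..q}" and a': "a' \<in> brels Y {1..q}"
  then show "(a O (b O d) O a'\<inverse>, a O (c O d) O a'\<inverse>) \<in> E"
    using indD[OF bc _ _ _ brels_comp[OF a' brels_converse[OF d]]] by (simp add: O_assoc converse_relcomp)
qed

text \<open>The relation \<open>a O x\<inverse>\<close> factors through \<open>{1..q}\<close>, so it
  has rank at most \<open>q \<le> r\<close> and is a permitted multiplier, whereas
  \<open>x\<inverse>\<close> itself need not join two objects. The same applies on the
  right.\<close>

lemma ind_pull:
  assumes st: "(s, t) \<in> E" and s: "s \<in> brels X0 Y0" and q: "enat q \<le> r"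
    and x: "x \<in> brels X0 {1..q}" and y: "y \<in> brels Y0 {1..q}"
  shows "(x\<inverse> O s O y, x\<inverse> O t O y) \<in> ind q"
proof (rule indI)
  note ty = E_typed[OF st s]
  have t: "t \<in> brels X0 Y0" using rank_set_brels[OF ty(4)] .
  show "x\<inverse> O s O y \<in> brels {1..q} {1..q}" "x\<inverse> O t O y \<in> brels {1..q} {1..q}"
    by (rule brels_comp[OF brels_converse[OF x] brels_comp[OF s y]], rule brels_comp[OF brels_converse[OF x] brels_comp[OF t y]])
  fix X Y a a' assume X: "X \<in> C" "Y \<in> C" and a: "a \<in> brels X {1..q}" and a': "a' \<in> brels Y {1..q}"
  have 1: "a O x\<inverse> \<in> rank_set r X X0"
    by (rule rank_le_rank_set[OF rank_le_factor[OF a brels_converse[OF x] fin[OF X(1)] fin[OF ty(1)]] q])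
  have 2: "y O a'\<inverse> \<in> rank_set r Y0 Y"
    by (rule rank_le_rank_set[OF rank_le_factor[OF y brels_converse[OF a'] fin[OF ty(2)] fin[OF X(2)]] q])
  have "((a O x\<inverse>) O s, (a O x\<inverse>) O t) \<in> E" by (rule E_left[OF st s X(1) 1])
  then have "(((a O x\<inverse>) O s) O (y O a'\<inverse>), ((a O x\<inverse>) O t) O (y O a'\<inverse>)) \<in> E"
    by (rule E_right[OF _ brels_comp[OF rank_set_brels[OF 1] s] X(2) 2])
  then show "(a O (x\<inverse> O s O y) O a'\<inverse>, a O (x\<inverse> O t O y) O a'\<inverse>) \<in> E" by (simp add: O_assoc)
qed

lemma ind_lift:
  assumes E: "(x O b O y\<inverse>, x O c O y\<inverse>) \<in> E" and x: "x \<in> halves q X0" and y: "y \<in> halves q Y0"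
    and q: "enat q \<le> r" and b: "b \<in> brels {1..q} {1..q}" and c: "c \<in> brels {1..q} {1..q}"
  shows "(b, c) \<in> ind q"
  using ind_pull[OF E sandwich_brels[OF halves_brels[OF x] b halves_brels[OF y]] q halves_brels[OF x] halves_brels[OF y]]
  unfolding half_sandwich[OF x y b] half_sandwich[OF x y c] .

lemma half_middle_Id: "v \<in> halves q B \<Longrightarrow> u O idr q O v\<inverse> = u O v\<inverse>"
  using brels_left_Id[OF brels_converse[OF halves_brels]] by metis

lemma ind_perm_iff:
  assumes "u \<in> halves q A" "v \<in> halves q B" "A \<in> C" "B \<in> C" "enat q \<le> r" "\<pi> permutes {1..q}"
  shows "(u O v\<inverse>, u O perm_rel q \<pi> O v\<inverse>) \<in> E \<longleftrightarrow> (idr q, perm_rel q \<pi>) \<in> ind q"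
proof
  assume "(u O v\<inverse>, u O perm_rel q \<pi> O v\<inverse>) \<in> E"
  then show "(idr q, perm_rel q \<pi>) \<in> ind q"
    using ind_lift[OF _ assms(1,2,5) brels_Id halves_brels[OF perm_rel_halves[OF assms(6)]]]
    unfolding half_middle_Id[OF assms(2)] by blast
next
  assume "(idr q, perm_rel q \<pi>) \<in> ind q"
  from indD[OF this assms(3,4) halves_brels[OF assms(1)] halves_brels[OF assms(2)]]
  show "(u O v\<inverse>, u O perm_rel q \<pi> O v\<inverse>) \<in> E"
    unfolding half_middle_Id[OF assms(2)] .
qed

text \<open>Pulled back along the halves of \<open>s\<close>, the pair becomes the identity and a
  relation of rank at most \<open>k\<close>, too small for a half.\<close>

lemma lower_pair:
  assumes st: "(s, t) \<in> E" and s: "s \<in> rank_class q A B" and t: "t \<in> rank_class k A B" and kq: "k < q"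
    and q: "enat q \<le> r"
  shows "\<exists>b. (idr q, b) \<in> ind q \<and> b \<notin> halves q {1..q}"
proof -
  obtain u v where uv: "u \<in> halves q A" "v \<in> halves q B" "s = u O v\<inverse>" using s by (rule rank_classE)
  note ty = E_typed[OF st rank_class_brels[OF s]]
  have "(u\<inverse> O s O v, u\<inverse> O t O v) \<in> ind q"
    by (rule ind_pull[OF st rank_class_brels[OF s] q halves_brels[OF uv(1)] halves_brels[OF uv(2)]])
  moreover have "u\<inverse> O s O v = idr q" unfolding uv(3) by (rule half_sandwich_Id[OF uv(1,2)])
  moreover have "u\<inverse> O t O v \<notin> halves q {1..q}"
  proof
    assume "u\<inverse> O t O v \<in> halves q {1..q}"
    then have 1: "u\<inverse> O t O v \<in> rank_class q {1..q} {1..q}" by (rule halves_rank_class)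
    have "u\<inverse> O t O v \<in> rank_le k {1..q} {1..q}"
      by (intro rank_le_comp_left[OF brels_converse[OF halves_brels[OF uv(1)]]]
          rank_le_comp_right[OF rank_leI[OF t order_refl] halves_brels[OF uv(2)]] fin ty finite_atLeastAtMost)
    then obtain j where j: "j \<le> k" "u\<inverse> O t O v \<in> rank_class j {1..q} {1..q}" by (rule rank_leE)
    then show False using rank_class_unique[OF 1 j(2)] kq by simp
  qed
  ultimately show ?thesis by auto
qed

text \<open>The test relation \<open>p\<close> of \<open>halves_separate\<close> is applied in the
  form \<open>u O p\<close>, which joins two objects. One side of the pair is reproduced, the other
  drops in rank, and \<open>lower_pair\<close> applies.\<close>

lemma separate_left:
  assumes st: "(u O v\<inverse>, w O z\<inverse>) \<in> E" and q: "1 \<le> q" "enat q \<le> r"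
    and h: "u \<in> halves q A" "v \<in> halves q B" "w \<in> halves q A" "z \<in> halves q B"
    and ne: "\<And>\<pi>. \<pi> permutes {1..q} \<Longrightarrow> w \<noteq> u O perm_rel q \<pi>"
  shows "\<exists>b. (idr q, b) \<in> ind q \<and> b \<notin> halves q {1..q}"
proof -
  \<comment> \<open>Stated for arbitrary halves, because \<open>halves_separate\<close> does not
    determine which side of the pair drops.\<close>
  have low: ?thesis
    if st: "(u O v\<inverse>, w O z\<inverse>) \<in> E" and p: "p \<in> brels {1..q} A" "p O u = idr q" "p O w \<notin> halves q {1..q}"
      and h: "u \<in> halves q A" "v \<in> halves q B" "w \<in> halves q A" "z \<in> halves q B" for u v w z p
  proof -
    have sb: "u O v\<inverse> \<in> rank_class q A B" by (rule rank_classI[OF h(1,2)])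
    note ty = E_typed[OF st rank_class_brels[OF sb]]
    have up: "u O p \<in> rank_set r A A"
      by (rule rank_le_rank_set[OF rank_le_factor[OF halves_brels[OF h(1)] p(1) fin[OF ty(1)] fin[OF ty(1)]] q(2)])
    have "((u O p) O (u O v\<inverse>), (u O p) O (w O z\<inverse>)) \<in> E"
      by (rule E_left[OF st rank_class_brels[OF sb] ty(1) up])
    moreover have "(u O p) O (u O v\<inverse>) = u O (p O u) O v\<inverse>" by (simp only: O_assoc)
    then have "(u O p) O (u O v\<inverse>) = u O v\<inverse>" unfolding p(2) half_middle_Id[OF h(2)] .
    moreover have "(u O p) O (w O z\<inverse>) = u O (p O w) O z\<inverse>" by (simp only: O_assoc)
    ultimately have E: "(u O v\<inverse>, u O (p O w) O z\<inverse>) \<in> E" by simp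
    obtain k where k: "k < q" "u O (p O w) O z\<inverse> \<in> rank_class k A B"
      using sandwich_lower[OF halves_brels[OF h(1)] halves_brels[OF h(4)] brels_comp[OF p(1) halves_brels[OF h(3)]]
          p(3) fin[OF ty(1)] fin[OF ty(2)]] by blast
    show ?thesis by (rule lower_pair[OF E sb k(2,1) q(2)])
  qed
  obtain p where p: "p \<in> brels {1..q} A"
    "(p O u = idr q \<and> p O w \<notin> halves q {1..q}) \<or> (p O w = idr q \<and> p O u \<notin> halves q {1..q})"
    using halves_separate[OF h(1,3) q(1) ne] by blast
  then show ?thesis using low[OF st p(1) _ _ h] low[OF E_sym[OF st] p(1) _ _ h(3,4,1,2)] by blast
qed

end

lemma halves_sandwich_rank_class:
  assumes x: "x \<in> halves q A" and y: "y \<in> halves q B" and b: "b \<in> rank_class k {1..q} {1..q}"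
  shows "x O b O y\<inverse> \<in> rank_class k A B"
proof -
  obtain u v where uv: "u \<in> halves k {1..q}" "v \<in> halves k {1..q}" "b = u O v\<inverse>" using b by (rule rank_classE)
  have "x O b O y\<inverse> = (x O u) O (y O v)\<inverse>" unfolding uv(3) by (simp add: O_assoc converse_relcomp)
  then show ?thesis using rank_classI[OF halves_comp[OF x uv(1)] halves_comp[OF y uv(2)]] by simp
qed

context brel_cong begin

interpretation dual: brel_cong C r "(\<lambda>(s, t). (s\<inverse>, t\<inverse>)) ` E"
  by (rule converse_cong)

lemma dual_iff: "(s, t) \<in> (\<lambda>(s, t). (s\<inverse>, t\<inverse>)) ` E \<longleftrightarrow> (s\<inverse>, t\<inverse>) \<in> E"
  by (force simp: image_iff)

lemma dual_ind: "(b, c) \<in> dual.ind q \<Longrightarrow> (b\<inverse>, c\<inverse>) \<in> ind q"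
proof (rule indI)
  assume bc: "(b, c) \<in> dual.ind q"
  show "b\<inverse> \<in> brels {1..q} {1..q}" "c\<inverse> \<in> brels {1..q} {1..q}"
    using dual.ind_brels[OF bc] brels_converse by auto
  fix X Y a a' assume "X \<in> C" "Y \<in> C" "a \<in> brels X {1..q}" "a' \<in> brels Y {1..q}"
  from dual.indD[OF bc this(2,1,4,3)] show "(a O b\<inverse> O a'\<inverse>, a O c\<inverse> O a'\<inverse>) \<in> E"
    unfolding dual_iff by (simp add: converse_relcomp O_assoc)
qed

text \<open>If the ranks agree and the left halves differ only by a permutation, the right halves
  must differ by more, for otherwise the two permutations combine to one and the pair is in
  \<open>h_rel\<close>. Right halves are left halves for the converse congruence.\<close>

lemma separate_pair:
  assumes st: "(s, t) \<in> E" and s: "s \<in> rank_class q A B" and t: "t \<in> rank_class k A B" and kq: "k \<le> q"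
    and q: "1 \<le> q" "enat q \<le> r" and nh: "(s, t) \<notin> h_rel q A B"
  shows "\<exists>b. (idr q, b) \<in> ind q \<and> b \<notin> halves q {1..q}"
proof (cases "k < q")
  case True
  then show ?thesis using lower_pair[OF st s t _ q(2)] by blast
next
  case False
  then have t: "t \<in> rank_class q A B" using t kq by simp
  obtain u v where uv: "u \<in> halves q A" "v \<in> halves q B" "s = u O v\<inverse>" using s by (rule rank_classE)
  obtain w z where wz: "w \<in> halves q A" "z \<in> halves q B" "t = w O z\<inverse>" using t by (rule rank_classE)
  show ?thesis
  proof (cases "\<exists>\<pi>. \<pi> permutes {1..q} \<and> w = u O perm_rel q \<pi>")
    case False
    then show ?thesis using separate_left[OF st[unfolded uv(3) wz(3)] q uv(1,2) wz(1,2)] by blast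
  next
    case True
    then obtain \<pi> where \<pi>: "\<pi> permutes {1..q}" "w = u O perm_rel q \<pi>" by blast
    have ne: "z \<noteq> v O perm_rel q \<rho>" if \<rho>: "\<rho> permutes {1..q}" for \<rho>
    proof
      assume z: "z = v O perm_rel q \<rho>"
      have i: "Hilbert_Choice.inv \<rho> permutes {1..q}" using \<rho> by (rule permutes_inv)
      have "t = u O (perm_rel q \<pi> O perm_rel q (Hilbert_Choice.inv \<rho>)) O v\<inverse>"
        unfolding wz(3) z \<pi>(2) converse_relcomp perm_rel_converse[OF \<rho>] by (simp only: O_assoc)
      then have "(s, t) \<in> h_rel q A B"
        unfolding perm_rel_comp[OF \<pi>(1)] uv(3) by (simp only: h_relI[OF uv(1,2) permutes_compose[OF \<pi>(1) i]])
      then show False using nh by simp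
    qed
    have "(v O u\<inverse>, z O w\<inverse>) \<in> (\<lambda>(s, t). (s\<inverse>, t\<inverse>)) ` E"
      unfolding dual_iff using st unfolding uv(3) wz(3) by (simp add: converse_relcomp)
    then obtain b where b: "(idr q, b) \<in> dual.ind q" "b \<notin> halves q {1..q}"
      using dual.separate_left[OF _ q uv(2,1) wz(2,1) ne] by blast
    have "(idr q, b\<inverse>) \<in> ind q" using dual_ind[OF b(1)] by simp
    moreover have "b\<inverse> \<notin> halves q {1..q}" using b(2) halves_converse[of "b\<inverse>" q] by auto
    ultimately show ?thesis by blast
  qed
qed

text \<open>A relation on one point that is not a half has rank 0, and as \<open>Pow {1}\<close> has
  no proper subalgebra it is the full relation. Inserted between two halves it produces exactly the
  cut version of \<open>s\<close>.\<close>

lemma collapse1: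
  assumes b: "(idr 1, b) \<in> ind 1" "b \<notin> halves 1 {1..1}" and r: "1 \<le> r"
    and A: "A \<in> C" and B: "B \<in> C" and s: "s \<in> rank_le 1 A B"
  shows "(s, flat s) \<in> E"
proof -
  have r': "enat 1 \<le> r" using r by (simp add: one_enat_def)
  obtain k where k: "k \<le> 1" "s \<in> rank_class k A B" using s by (rule rank_leE)
  show ?thesis
  proof (cases "k = 0")
    case True
    then have "flat s = s" using k(2) rank0_flat by blast
    then show ?thesis using E_refl[OF A B rank_le_rank_set[OF s r']] by simp
  next
    case False
    then have "s \<in> rank_class 1 A B" using k by (simp add: le_Suc_eq)
    then obtain u v where uv: "u \<in> halves 1 A" "v \<in> halves 1 B" "s = u O v\<inverse>" by (rule rank_classE)
    have bb: "b \<in> brels {1..1} {1..1}" using ind_brels[OF b(1)] by simp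
    obtain j where "j < 1" "b \<in> rank_class j {1..1} {1..1}"
      using half_or_lower[OF bb b(2)] by auto
    then have "b \<in> rank_class 0 {1..1} {1..1}" by simp
    then have fb: "b = Domain b \<times> Range b" using rank0_flat unfolding flat_def by metis
    have Pow1: "G = Pow {1..1}" if G: "G \<in> subalgs {1..1::nat}" for G
    proof
      show "G \<subseteq> Pow {1..1}" using G unfolding subalgs_def by simp
      have "Pow {1..1::nat} = {{}, {1..1}}" by auto
      then show "Pow {1..1} \<subseteq> G" using subalgs_empty[OF G] subalgs_full[OF G] by simp
    qed
    have "Domain b = Pow {1..1}" "Range b = Pow {1..1}"
      using Pow1[OF subalgs_Domain[OF bb]] Pow1[OF subalgs_Range[OF bb]] .
    then have b_eq: "b = Pow {1..1} \<times> Pow {1..1}" using fb by simp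
    have "\<exists>J\<in>Pow {1..1}. (P, J) \<in> u" if "P \<in> Domain u" for P
      using that brels_sub[OF halves_brels[OF uv(1)]] by blast
    moreover have "\<exists>J\<in>Pow {1..1}. (P, J) \<in> v" if "P \<in> Domain v" for P
      using that brels_sub[OF halves_brels[OF uv(2)]] by blast
    ultimately have "u O b O v\<inverse> = Domain u \<times> Domain v"
      unfolding b_eq by (auto simp only: relcomp_unfold converse_iff mem_Collect_eq mem_Sigma_iff set_eq_iff
        Domain_iff split_paired_all prod.case) metis+
    also have "\<dots> = flat s" unfolding uv(3) by (rule flat_halves[OF uv(1,2), symmetric])
    finally have "u O b O v\<inverse> = flat s" .
    then show ?thesis
      using indD[OF b(1) A B halves_brels[OF uv(1)] halves_brels[OF uv(2)]]
      unfolding half_middle_Id[OF uv(2)] uv(3) by simp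
  qed
qed

text \<open>A set \<open>P\<close> in one range but not in the other is matched with two points of
  \<open>Y\<close>. Multiplication then turns one range into a prescribed subalgebra
  \<open>G\<close> and the other into the part of \<open>G\<close> that does not separate these
  points. Repetition shrinks any \<open>G\<close> to the trivial algebra. The multiplier factors
  through two points, hence the bound on \<open>r\<close>.\<close>

lemma rank0_right:
  assumes st: "(s, t) \<in> E" and s: "s \<in> rank_class 0 A B" and t: "t \<in> rank_class 0 A B"
    and ne: "Range s \<noteq> Range t" and r: "2 \<le> r"
    and X: "X \<in> C" and Y: "Y \<in> C" and H: "H \<in> subalgs X" and G: "G1 \<in> subalgs Y" "G2 \<in> subalgs Y"
  shows "(H \<times> G1, H \<times> G2) \<in> E"
proof -
  have r': "enat 2 \<le> r" using r by (simp add: numeral_eq_enat)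
  have r0: "enat 0 \<le> r" by (simp add: zero_enat_def[symmetric])
  have wlog: "(H \<times> G, H \<times> {{}, Y}) \<in> E"
    if st: "(s, t) \<in> E" and s: "s \<in> rank_class 0 A B" and t: "t \<in> rank_class 0 A B"
      and P: "P \<in> Range s" "P \<notin> Range t" and G: "G \<in> subalgs Y" for s t P G
    using G
  proof (induction "card G" arbitrary: G rule: less_induct)
    case less
    note sb = rank_class_brels[OF s] and tb = rank_class_brels[OF t]
    note ty = E_typed[OF st sb]
    have finG: "finite G" using subalgs_sub[OF less.prems] fin[OF Y] by (meson PowI finite_Pow_iff finite_subset subsetI)
    show ?case
    proof (cases "\<exists>Z\<in>G. Z \<noteq> {} \<and> Z \<noteq> Y")
      case False
      then have "G = {{}, Y}" using subalgs_empty[OF less.prems] subalgs_full[OF less.prems] by blast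
      then show ?thesis
        using E_refl[OF X Y rank_setI[OF Times_rank0[OF H less.prems] r0]] by simp
    next
      case True
      then obtain Z where Z: "Z \<in> G" "Z \<noteq> {}" "Z \<noteq> Y" by blast
      have ZY: "Z \<subseteq> Y" using subalgs_sub[OF less.prems Z(1)] .
      \<comment> \<open>Two points that \<open>G\<close> separates and that the induction step
        merges.\<close>
      obtain z1 z2 where z: "z1 \<in> Z" "z2 \<in> Y - Z" using Z(2,3) ZY by blast
      have PB: "P \<subseteq> B" using subalgs_sub[OF subalgs_Range[OF sb] P(1)] .
      have BP: "B - P \<notin> Range t"
      proof
        assume "B - P \<in> Range t"
        then have "B - (B - P) \<in> Range t" by (rule subalgs_compl[OF subalgs_Range[OF tb]])
        then show False using P(2) PB by (simp add: double_diff)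
      qed
      have Pn: "P \<noteq> {}" "P \<noteq> B"
        using P(2) subalgs_empty[OF subalgs_Range[OF tb]] subalgs_full[OF subalgs_Range[OF tb]] by auto
      then obtain p1 p2 where p: "p1 \<in> P" "p2 \<in> B - P" using PB by blast
      have J2: "J \<subseteq> {1..2::nat} \<Longrightarrow> J = {} \<or> J = {1} \<or> J = {2} \<or> J = {1..2}" for J
      proof -
        assume J: "J \<subseteq> {1..2}"
        have "{1..2::nat} = {1, 2}" by auto
        then show ?thesis using J by auto
      qed
      have half2: "point_half 2 (\<lambda>i. if i = 1 then c1 else c2) K \<in> halves 2 D"
        if K: "K \<in> subalgs D" "Q \<in> K" "c1 \<in> Q" "c2 \<in> D - Q" for K D and Q :: "'a set" and c1 c2
      proof (rule point_half_halves[OF K(1)])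
        show "(if i = 1 then c1 else c2) \<in> D" for i :: nat using K(3,4) subalgs_sub[OF K(1,2)] by auto
        have m: "{} \<in> K" "D \<in> K" "Q \<in> K" "D - Q \<in> K"
          using subalgs_empty[OF K(1)] subalgs_full[OF K(1)] K(2) subalgs_compl[OF K(1,2)] by auto
        have c: "c1 \<in> D" "c1 \<in> Q" "c2 \<in> D" "c2 \<notin> Q" using K(3,4) subalgs_sub[OF K(1,2)] by auto
        show "\<exists>P\<in>K. \<forall>i\<in>{1..2}. ((if i = 1 then c1 else c2) \<in> P) = (i \<in> J)" if "J \<subseteq> {1..2::nat}" for J
        proof -
          have i12: "i = 1 \<or> i = 2" if "i \<in> {1..2::nat}" for i using that by auto
          from J2[OF that] consider "J = {}" | "J = {1}" | "J = {2}" | "J = {1..2}" by blast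
          then show ?thesis
          proof cases
            case 1 then show ?thesis using m(1) by (intro bexI[of _ "{}"]) auto
          next
            case 2 then show ?thesis using m(3) c i12 by (intro bexI[of _ Q]) force+
          next
            case 3 then show ?thesis using m(4) c i12 by (intro bexI[of _ "D - Q"]) force+
          next
            case 4 then show ?thesis using m(2) c i12 by (intro bexI[of _ D]) force+
          qed
        qed
      qed
      have K: "{{}, P, B - P, B} \<in> subalgs B" unfolding subalgs_def using PB by blast
      define a where "a = point_half 2 (\<lambda>i. if i = 1 then p1 else p2) {{}, P, B - P, B}"
      define v where "v = point_half 2 (\<lambda>i. if i = 1 then z1 else z2) G"
      have a: "a \<in> halves 2 B" unfolding a_def by (rule half2[OF K _ p]) simp
      have v: "v \<in> halves 2 Y" unfolding v_def by (rule half2[OF less.prems Z(1) z])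
      have av: "a O v\<inverse> \<in> rank_set r B Y"
        by (rule rank_le_rank_set[OF rank_le_factor[OF halves_brels[OF a] brels_converse[OF halves_brels[OF v]]
              fin[OF ty(2)] fin[OF Y]] r'])
      \<comment> \<open>Left multiplication with this rectangle discards the old domain and installs
        \<open>H\<close>.\<close>
      have HA: "H \<times> Pow A \<in> rank_set r X A"
        by (rule rank_setI[OF Times_rank0[OF H subalgs_Pow] r0])
      have "(s O (a O v\<inverse>), t O (a O v\<inverse>)) \<in> E" by (rule E_right[OF st sb Y av])
      then have E: "((H \<times> Pow A) O (s O (a O v\<inverse>)), (H \<times> Pow A) O (t O (a O v\<inverse>))) \<in> E"
        by (rule E_left[OF _ brels_comp[OF sb rank_set_brels[OF av]] X HA])
      have HR: "(H \<times> Pow A) O w = H \<times> Range w" if "w \<in> brels A Y" for w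
        using brels_sub[OF that] by blast
      \<comment> \<open>The members of \<open>G\<close> that do not separate \<open>z1\<close> and
        \<open>z2\<close>; at least \<open>Z\<close> is lost, so the cardinality drops.\<close>
      define G' where "G' = {W \<in> G. z1 \<in> W \<longleftrightarrow> z2 \<in> W}"
      have a_iff: "(W, J) \<in> a \<longleftrightarrow> W \<in> {{}, P, B - P, B} \<and> J = {i \<in> {1..2}. (if i = 1 then p1 else p2) \<in> W}" for W J
        unfolding a_def by (rule point_half_iff)
      have v_iff: "(W, J) \<in> v \<longleftrightarrow> W \<in> G \<and> J = {i \<in> {1..2}. (if i = 1 then z1 else z2) \<in> W}" for W J
        unfolding v_def by (rule point_half_iff)
      have set1: "{i \<in> {1..2::nat}. (if i = 1 then c1 else c2) \<in> W} =
          (if c1 \<in> W then {1} else {}) \<union> (if c2 \<in> W then {2} else {})" for c1 c2 :: 'a and W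
        by auto
      \<comment> \<open>The range of \<open>s\<close> contains \<open>P\<close>, so through
        \<open>a\<close> it reaches all four subsets of \<open>{1..2}\<close>. The range of
        \<open>t\<close> contains neither \<open>P\<close> nor its complement and reaches only the
        two trivial subsets.\<close>
      have ra: "Range (s O a) = Pow {1..2}"
      proof
        show "Range (s O a) \<subseteq> Pow {1..2}" using brels_sub[OF halves_brels[OF a]] by blast
        have mem: "{} \<in> Range s" "P \<in> Range s" "B - P \<in> Range s" "B \<in> Range s"
          using P(1) subalgs_empty[OF subalgs_Range[OF sb]] subalgs_full[OF subalgs_Range[OF sb]]
            subalgs_compl[OF subalgs_Range[OF sb] P(1)] by auto
        have "({}, {}) \<in> a" "(P, {1}) \<in> a" "(B - P, {2}) \<in> a" "(B, {1} \<union> {2}) \<in> a"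
          unfolding a_iff set1 using p PB by auto
        then have "{} \<in> Range (s O a)" "{1} \<in> Range (s O a)" "{2} \<in> Range (s O a)" "{1} \<union> {2} \<in> Range (s O a)"
          using mem by blast+
        moreover have "{1..2::nat} = {1} \<union> {2}" by auto
        ultimately show "Pow {1..2} \<subseteq> Range (s O a)" using J2 by (metis PowD subsetI)
      qed
      have ta: "Range (t O a) = {{}, {1..2}}"
      proof
        show "Range (t O a) \<subseteq> {{}, {1..2}}"
        proof
          fix J assume "J \<in> Range (t O a)"
          then obtain W where W: "W \<in> Range t" "(W, J) \<in> a" by blast
          then have "W = {} \<or> W = B" using P(2) BP unfolding a_iff by blast
          then show "J \<in> {{}, {1..2}}" using halves_empty[OF a] halves_full[OF a] W(2) by blast
        qed
        have "({}, {}) \<in> t O a" "(A, {1..2}) \<in> t O a"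
          using brels_empty[OF brels_comp[OF tb halves_brels[OF a]]] brels_full[OF brels_comp[OF tb halves_brels[OF a]]] .
        then show "{{}, {1..2}} \<subseteq> Range (t O a)" by blast
      qed
      have "Range (s O (a O v\<inverse>)) = G"
      proof -
        have "Range (s O (a O v\<inverse>)) = {W. \<exists>J\<in>Range (s O a). (W, J) \<in> v}" by blast
        also have "\<dots> = Domain v" unfolding ra using brels_sub[OF halves_brels[OF v]] by blast
        also have "\<dots> = G" unfolding v_def by (rule Domain_point_half)
        finally show ?thesis .
      qed
      moreover have "Range (t O (a O v\<inverse>)) = G'"
      proof -
        have "Range (t O (a O v\<inverse>)) = {W. \<exists>J\<in>Range (t O a). (W, J) \<in> v}" by blast
        also have "\<dots> = {W \<in> G. {i \<in> {1..2::nat}. (if i = 1 then z1 else z2) \<in> W} \<in> {{}, {1..2}}}"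
          unfolding ta v_iff by auto
        also have "\<dots> = G'"
        proof -
          have "{1..2::nat} = {1, 2}" by auto
          then show ?thesis unfolding G'_def set1 by auto
        qed
        finally show ?thesis .
      qed
      ultimately have E': "(H \<times> G, H \<times> G') \<in> E"
        using E HR brels_comp[OF sb rank_set_brels[OF av]] brels_comp[OF tb rank_set_brels[OF av]] by simp
      have G': "G' \<in> subalgs Y"
        using less.prems z ZY unfolding subalgs_def G'_def by blast
      have "G' \<subset> G" using Z(1) z unfolding G'_def by blast
      then have "card G' < card G" using finG by (rule psubset_card_mono[rotated])
      then have "(H \<times> G', H \<times> {{}, Y}) \<in> E" using less.hyps G' by blast
      then show ?thesis by (rule E_trans[OF E'])
    qed
  qed
  have one: "(H \<times> G, H \<times> {{}, Y}) \<in> E" if G: "G \<in> subalgs Y" for G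
  proof (cases "Range s \<subseteq> Range t")
    case False
    then show ?thesis using wlog[OF st s t _ _ G] by blast
  next
    case True
    then obtain P where "P \<in> Range t" "P \<notin> Range s" using ne by blast
    then show ?thesis using wlog[OF E_sym[OF st] t s _ _ G] by blast
  qed
  show ?thesis using E_trans[OF one[OF G(1)] E_sym[OF one[OF G(2)]]] .
qed

end

text \<open>On rank 0 these are Green's H, L, R and the full relation: the range of a relation
  encodes the cokernel, its domain the kernel.\<close>

primrec base_rel :: "kind \<Rightarrow> ('a set \<times> 'b set) set \<Rightarrow> ('a set \<times> 'b set) set \<Rightarrow> bool" where
  "base_rel Mu s t \<longleftrightarrow> Domain s = Domain t \<and> Range s = Range t"
| "base_rel Lam s t \<longleftrightarrow> Range s = Range t"
| "base_rel Rho s t \<longleftrightarrow> Domain s = Domain t"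
| "base_rel Ree s t \<longleftrightarrow> True"

lemma base_rel_flat: "s \<in> brels A B \<Longrightarrow> t \<in> brels A B \<Longrightarrow> base_rel k (flat s) (flat t) \<longleftrightarrow> base_rel k s t"
  by (cases k) (simp_all add: Domain_flat Range_flat)

definition nu_brel :: "nat \<Rightarrow> (nat \<Rightarrow> nat) set \<Rightarrow> 'a set \<Rightarrow> 'b set \<Rightarrow> (('a set \<times> 'b set) set) rel" where
  "nu_brel q N A B = {(u O v\<inverse>, u O perm_rel q \<pi> O v\<inverse>) | u v \<pi>.
     u \<in> halves q A \<and> v \<in> halves q B \<and> \<pi> \<in> N}"

text \<open>The counterpart of \<open>kappa_cong\<close>. A retraction keeps domain and range, so
  these are compared directly in all ranks up to \<open>q\<close>.\<close>

definition kappa_brel :: "'a set set \<Rightarrow> enat \<Rightarrow> kind \<Rightarrow> nat \<Rightarrow> (nat \<Rightarrow> nat) set \<Rightarrow> (('a set \<times> 'a set) set) rel" where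
  "kappa_brel C r k q N = {(s, t). \<exists>A\<in>C. \<exists>B\<in>C. s \<in> rank_set r A B \<and> t \<in> rank_set r A B \<and>
     (s = t \<or> (s \<in> rank_le q A B \<and> t \<in> rank_le q A B \<and> base_rel k s t) \<or> (s, t) \<in> nu_brel (q + 1) N A B)}"

definition nabla_brel :: "'a set set \<Rightarrow> enat \<Rightarrow> (('a set \<times> 'a set) set) rel" where
  "nabla_brel C r = {(s, t). \<exists>A\<in>C. \<exists>B\<in>C. s \<in> rank_set r A B \<and> t \<in> rank_set r A B}"

lemma nu_brelI:
  "u \<in> halves q A \<Longrightarrow> v \<in> halves q B \<Longrightarrow> \<pi> \<in> N \<Longrightarrow> (u O v\<inverse>, u O perm_rel q \<pi> O v\<inverse>) \<in> nu_brel q N A B"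
  unfolding nu_brel_def by blast

lemma nu_brelE:
  assumes "(s, t) \<in> nu_brel q N A B"
  obtains u v \<pi> where "u \<in> halves q A" "v \<in> halves q B" "\<pi> \<in> N" "s = u O v\<inverse>" "t = u O perm_rel q \<pi> O v\<inverse>"
  using assms unfolding nu_brel_def by blast

lemma forget_empty_iff: "i \<in> {1..q} \<Longrightarrow> ({}, K) \<in> forget i q \<longleftrightarrow> K \<subseteq> {i}"
  unfolding forget_def by auto

text \<open>Through \<open>forget i q\<close> the empty set reaches exactly the subsets of
  \<open>{i}\<close>. If \<open>b\<close> changed this for no \<open>i\<close>, its images of the
  empty set would lie in two different singletons and its range would contain every singleton, so it
  would be a half. Two points exist as \<open>q \<ge> 2\<close>.\<close>

lemma forget_not_half:
  assumes b: "b \<in> brels {1..q} {1..q}" "b \<notin> halves q {1..q}" and q: "2 \<le> q"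
  shows "\<exists>i\<in>{1..q}. \<exists>K. ({}, K) \<in> forget i q \<longleftrightarrow> ({}, K) \<notin> forget i q O b"
proof (rule ccontr)
  assume "\<not> ?thesis"
  then have eq: "({}, K) \<in> forget i q \<longleftrightarrow> ({}, K) \<in> forget i q O b" if "i \<in> {1..q}" for i K
    using that by blast
  have "b \<in> halves q {1..q}"
  proof (rule halvesI[OF b(1)])
    fix K assume K: "({}, K) \<in> b"
    have "K \<subseteq> {i}" if i: "i \<in> {1..q}" for i
    proof -
      have "({}, K) \<in> forget i q O b" using K brels_empty[OF forget_brels[of i q]] by blast
      then show ?thesis using eq[OF i] forget_empty_iff[OF i] by blast
    qed
    from this[of 1] this[of 2] show "K = {}" using q by auto
  next
    show "Range b = Pow {1..q}"
    proof
      show "Range b \<subseteq> Pow {1..q}" using brels_sub[OF b(1)] by blast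
      have "{i} \<in> Range b" if i: "i \<in> {1..q}" for i
        using eq[OF i, of "{i}"] forget_empty_iff[OF i, of "{i}"] by blast
      then have "(\<Union>i\<in>J. {i}) \<in> Range b" if "J \<subseteq> {1..q}" for J
        using that finite_subset[OF that] by (intro subalgs_UN[OF subalgs_Range[OF b(1)]]) auto
      then show "Pow {1..q} \<subseteq> Range b" by auto
    qed
  qed
  then show False using b(2) by simp
qed

text \<open>Forgetting a moved point \<open>i\<close> lets the empty set reach \<open>{i}\<close>,
  and the permutation carries this on to a different singleton.\<close>

lemma forget_perm:
  assumes p: "\<pi> permutes {1..q}" "\<pi> \<noteq> id"
  shows "\<exists>i\<in>{1..q}. \<exists>K. ({}, K) \<in> forget i q \<longleftrightarrow> ({}, K) \<notin> forget i q O perm_rel q \<pi>"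
proof -
  obtain i where i: "\<pi> i \<noteq> i" using p(2) by (auto simp: fun_eq_iff)
  then have iq: "i \<in> {1..q}" using permutes_not_in[OF p(1)] by blast
  have "({}, {\<pi> i}) \<in> forget i q O perm_rel q \<pi>"
  proof
    show "({}, {i}) \<in> forget i q" using forget_empty_iff[OF iq] by blast
    show "({i}, {\<pi> i}) \<in> perm_rel q \<pi>" using iq by (simp add: perm_rel_iff)
  qed
  moreover have "({}, {\<pi> i}) \<notin> forget i q" using forget_empty_iff[OF iq] i by blast
  ultimately show ?thesis using iq by blast
qed

lemma half_sandwich_empty:
  assumes x: "x \<in> halves q A"
  shows "({}, P) \<in> x O c O x\<inverse> \<longleftrightarrow> (\<exists>K. ({}, K) \<in> c \<and> (P, K) \<in> x)"
  using halves_empty[OF x] brels_empty[OF halves_brels[OF x]] by blast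

context brel_cong begin

text \<open>The class of \<open>forget i q\<close> is not preserved by multiplication with \<open>b\<close>, which yields a
  non-trivial pair one rank lower.\<close>

lemma descend:
  assumes q: "2 \<le> q" "enat q \<le> r" and x: "x \<in> halves q A" and A: "A \<in> C"
    and b: "(idr q, b) \<in> ind q" and i: "i \<in> {1..q}"
    and ne: "({}, K) \<in> forget i q \<longleftrightarrow> ({}, K) \<notin> forget i q O b"
  shows "\<exists>b'. (idr (q - 1), b') \<in> ind (q - 1) \<and> b' \<notin> halves (q - 1) {1..q - 1}"
proof -
  note fb = forget_brels[of i q] and fr = forget_rank[OF i]
  have bb: "b \<in> brels {1..q} {1..q}" using ind_brels[OF b] by simp
  note xb = halves_brels[OF x]
  let ?s = "x O forget i q O x\<inverse>" and ?t = "x O (forget i q O b) O x\<inverse>"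
  have E: "(?s, ?t) \<in> E"
    using indD[OF ind_left[OF b fb] A A xb xb] unfolding brels_right_Id[OF fb] .
  have s: "?s \<in> rank_class (q - 1) A A" using halves_sandwich_rank_class[OF x x fr] .
  have "forget i q O b \<in> rank_le (q - 1) {1..q} {1..q}"
    by (rule rank_le_comp_right[OF rank_leI[OF fr order_refl] bb]) simp_all
  then obtain j where j: "j \<le> q - 1" "forget i q O b \<in> rank_class j {1..q} {1..q}" by (rule rank_leE)
  have t: "?t \<in> rank_class j A A" using halves_sandwich_rank_class[OF x x j(2)] .
  have "(?s, ?t) \<notin> h_rel (q - 1) A A"
  proof
    \<comment> \<open>For an H-related pair the empty set reaches the same sets on both sides. A
      preimage of \<open>K\<close> under the half \<open>x\<close> shows that here it does
      not.\<close>
    assume "(?s, ?t) \<in> h_rel (q - 1) A A"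
    then have eq: "(\<exists>K. ({}, K) \<in> forget i q \<and> (P, K) \<in> x) \<longleftrightarrow> (\<exists>K. ({}, K) \<in> forget i q O b \<and> (P, K) \<in> x)" for P
      using h_rel_empty_iff[of ?s ?t "q - 1" A A P] unfolding half_sandwich_empty[OF x] by blast
    have "K \<subseteq> {1..q}" using ne brels_sub[OF fb] brels_sub[OF brels_comp[OF fb bb]] by blast
    then obtain P where P: "(P, K) \<in> x" using halves_surj[OF x] by blast
    have "K' = K" if "(P, K') \<in> x" for K' using halves_unique[OF x that P] .
    then show False using eq[of P] ne P by metis
  qed
  moreover have "1 \<le> q - 1" "enat (q - 1) \<le> r" using q order_trans[of "enat (q - 1)" "enat q" r] by simp_all
  ultimately show ?thesis using separate_pair[OF E s t j(1)] by blast
qed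

text \<open>A rank-0 relation \<open>z\<close> is a rectangle, so \<open>z O c O z = z\<close>. Once
  the identity is related to \<open>z\<close>, each \<open>c\<close> on \<open>{1..q}\<close> is
  related to \<open>z O c O z\<close>, that is, to \<open>z\<close>. Hence rectangles with different
  ranges, or domains, are related; \<open>rank0_right\<close> and its mirror image spread this over
  all objects, and each relation of rank at most \<open>q\<close> is related to one of rank
  0.\<close>

lemma ind_collapse_rank0:
  assumes q: "2 \<le> q" "enat q \<le> r" and x: "x \<in> halves q A" and A: "A \<in> C"
    and b: "(idr q, b) \<in> ind q" and z0: "(b, z) \<in> ind q" and z: "z \<in> rank_class 0 {1..q} {1..q}"
    and s: "s \<in> rank_le q X Y" and t: "t \<in> rank_le q X Y" and X: "X \<in> C" and Y: "Y \<in> C"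
  shows "(s, t) \<in> E"
proof -
  interpret dual: brel_cong C r "(\<lambda>(s, t). (s\<inverse>, t\<inverse>)) ` E" by (rule converse_cong)
  have r2: "2 \<le> r" using order_trans[of 2 "enat q" r] q by (simp add: numeral_eq_enat)
  note xb = halves_brels[OF x]
  have zb: "z \<in> brels {1..q} {1..q}" using z by (rule rank_class_brels)
  have iz: "(idr q, z) \<in> ind q" using ind_trans[OF b z0] .
  have zcz: "z O c O z = z" if c: "c \<in> brels {1..q} {1..q}" for c
  proof -
    have "flat z = z" using z by (rule rank0_flat)
    then have "z = Domain z \<times> Range z" unfolding flat_def by simp
    moreover have "{} \<in> Range z" "{} \<in> Domain z" using brels_empty[OF zb] by blast+
    ultimately obtain G H where GH: "z = G \<times> H" "{} \<in> H" "{} \<in> G" by metis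
    show ?thesis unfolding GH(1) using GH(2,3) brels_empty[OF c] by blast
  qed
  have cz: "(c, z) \<in> ind q" if c: "c \<in> brels {1..q} {1..q}" for c
  proof -
    have "(c, z O c) \<in> ind q" using ind_right[OF iz c] unfolding brels_left_Id[OF c] .
    moreover have zc: "z O c \<in> brels {1..q} {1..q}" using zb c by (rule brels_comp)
    have "(z O c, (z O c) O z) \<in> ind q" using ind_left[OF iz zc] unfolding brels_right_Id[OF zc] .
    then have "(z O c, z) \<in> ind q" using zcz[OF c] by (simp only: O_assoc)
    ultimately show ?thesis by (rule ind_trans)
  qed
  have all: "(c, d) \<in> ind q" if "c \<in> brels {1..q} {1..q}" "d \<in> brels {1..q} {1..q}" for c d
    using ind_trans[OF cz[OF that(1)] ind_sym[OF cz[OF that(2)]]] .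
  \<comment> \<open>The trivial and the full algebra on \<open>{1..q}\<close>. They differ for
    \<open>q \<ge> 2\<close>, and a preimage \<open>R\<close> of \<open>{1}\<close> under
    \<open>x\<close> shows the difference on the object \<open>A\<close>.\<close>
  let ?T = "{{}, {1..q}}" and ?P = "Pow {1..q}"
  note T = subalgs_triv[of "{1..q}"] and P = subalgs_Pow[of "{1..q}"]
  obtain R where R: "(R, {1}) \<in> x" using halves_surj[OF x, of "{1}"] q by auto
  have x0: "({}, {}) \<in> x" using brels_empty[OF xb] .
  have "2 \<in> {1..q}" using q by simp
  then have "{1} \<noteq> {1..q}"
    by (metis one_neq_zero plus_1_eq_Suc add_cancel_right_right numeral_2_eq_2 One_nat_def singleton_iff)
  then have notT: "{1} \<notin> ?T" by blast
  have notR: "(R, J) \<in> x \<Longrightarrow> J \<notin> ?T" for J using halves_unique[OF x R] notT by blast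
  have Pm: "{1} \<in> ?P" "{} \<in> ?P" using q by auto
  have rk: "x O c O x\<inverse> \<in> rank_class 0 A A" if "c \<in> rank_class 0 {1..q} {1..q}" for c
    using halves_sandwich_rank_class[OF x x that] .
  have right: "(H \<times> G1, H \<times> G2) \<in> E" if "U \<in> C" "V \<in> C" "H \<in> subalgs U" "G1 \<in> subalgs V" "G2 \<in> subalgs V" for U V H G1 G2
  proof (rule rank0_right[OF _ _ _ _ r2 that])
    show "(x O (?T \<times> ?P) O x\<inverse>, x O (?T \<times> ?T) O x\<inverse>) \<in> E"
      by (rule indD[OF all[OF brels_Times[OF T P] brels_Times[OF T T]] A A xb xb])
    show "x O (?T \<times> ?P) O x\<inverse> \<in> rank_class 0 A A" "x O (?T \<times> ?T) O x\<inverse> \<in> rank_class 0 A A"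
      by (rule rk[OF Times_rank0[OF T P]], rule rk[OF Times_rank0[OF T T]])
    have "R \<in> Range (x O (?T \<times> ?P) O x\<inverse>)" using R x0 Pm by blast
    moreover have "R \<notin> Range (x O (?T \<times> ?T) O x\<inverse>)" using notR by blast
    ultimately show "Range (x O (?T \<times> ?P) O x\<inverse>) \<noteq> Range (x O (?T \<times> ?T) O x\<inverse>)" by blast
  qed
  have left: "(G1 \<times> H, G2 \<times> H) \<in> E" if "U \<in> C" "V \<in> C" "H \<in> subalgs V" "G1 \<in> subalgs U" "G2 \<in> subalgs U" for U V H G1 G2
  proof -
    have "(H \<times> G1, H \<times> G2) \<in> (\<lambda>(s, t). (s\<inverse>, t\<inverse>)) ` E"
    proof (rule dual.rank0_right[OF _ _ _ _ r2 that(2,1,3,4,5)])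
      have "(x O (?P \<times> ?T) O x\<inverse>, x O (?T \<times> ?T) O x\<inverse>) \<in> E"
        by (rule indD[OF all[OF brels_Times[OF P T] brels_Times[OF T T]] A A xb xb])
      moreover have "(x O (?T \<times> ?P) O x\<inverse>)\<inverse> = x O (?P \<times> ?T) O x\<inverse>" "(x O (?T \<times> ?T) O x\<inverse>)\<inverse> = x O (?T \<times> ?T) O x\<inverse>"
        by (simp_all only: converse_relcomp converse_Times converse_converse O_assoc)
      ultimately show "(x O (?T \<times> ?P) O x\<inverse>, x O (?T \<times> ?T) O x\<inverse>) \<in> (\<lambda>(s, t). (s\<inverse>, t\<inverse>)) ` E"
        unfolding dual_iff by simp
      show "x O (?T \<times> ?P) O x\<inverse> \<in> rank_class 0 A A" "x O (?T \<times> ?T) O x\<inverse> \<in> rank_class 0 A A"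
        by (rule rk[OF Times_rank0[OF T P]], rule rk[OF Times_rank0[OF T T]])
      have "R \<in> Range (x O (?T \<times> ?P) O x\<inverse>)" using R x0 Pm by blast
      moreover have "R \<notin> Range (x O (?T \<times> ?T) O x\<inverse>)" using notR by blast
      ultimately show "Range (x O (?T \<times> ?P) O x\<inverse>) \<noteq> Range (x O (?T \<times> ?T) O x\<inverse>)" by blast
    qed
    then show ?thesis unfolding dual_iff converse_Times .
  qed
  have rank0: "(s, t) \<in> E" if s: "s \<in> rank_class 0 X Y" and t: "t \<in> rank_class 0 X Y" for s t
  proof -
    have eqs: "s = Domain s \<times> Range s" "t = Domain t \<times> Range t"
      using rank0_flat[OF s] rank0_flat[OF t] unfolding flat_def by simp_all
    note D = subalgs_Domain[OF rank_class_brels[OF s]] subalgs_Domain[OF rank_class_brels[OF t]]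
      and R = subalgs_Range[OF rank_class_brels[OF s]] subalgs_Range[OF rank_class_brels[OF t]]
    have "(Domain s \<times> Range s, Domain t \<times> Range t) \<in> E"
      using E_trans[OF right[OF X Y D(1) R] left[OF X Y R(2) D]] .
    then show ?thesis using eqs by simp
  qed
  \<comment> \<open>A factorisation through \<open>{1..q}\<close> has the identity in the middle,
    which may be replaced by \<open>z\<close>.\<close>
  have low: "\<exists>s'\<in>rank_class 0 X Y. (s, s') \<in> E" if s: "s \<in> rank_le q X Y" for s
  proof -
    obtain a a' where a: "a \<in> brels X {1..q}" "a' \<in> brels Y {1..q}" "s = a O a'\<inverse>" using s by (rule rank_le_ex_factor)
    have "(a O idr q O a'\<inverse>, a O z O a'\<inverse>) \<in> E" by (rule indD[OF iz X Y a(1,2)])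
    moreover have "a O idr q O a'\<inverse> = s" unfolding a(3) brels_left_Id[OF brels_converse[OF a(2)]] ..
    moreover have "a O z O a'\<inverse> \<in> rank_class 0 X Y"
      using sandwich_rank[OF a(1,2) z fin[OF X] fin[OF Y]] unfolding rank_le_def by simp
    ultimately show ?thesis by auto
  qed
  obtain s' t' where "s' \<in> rank_class 0 X Y" "(s, s') \<in> E" "t' \<in> rank_class 0 X Y" "(t, t') \<in> E"
    using low[OF s] low[OF t] by blast
  then show ?thesis using rank0[of s' t'] E_trans E_sym by meson
qed

text \<open>By descent the hypothesis holds one rank lower, so on \<open>A\<close> all relations of
  rank below \<open>q\<close> are related to their cut versions. This applies to a copy of
  \<open>b\<close>; pulled back, \<open>b\<close> and hence the identity is related to a relation of
  rank 0, and \<open>ind_collapse_rank0\<close> finishes.\<close>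

lemma collapse:
  assumes "2 \<le> q" "enat q \<le> r" "x \<in> halves q A" "A \<in> C" "(idr q, b) \<in> ind q" "b \<notin> halves q {1..q}"
    "X \<in> C" "Y \<in> C" "s \<in> rank_le q X Y" "t \<in> rank_le q X Y"
  shows "(s, t) \<in> E"
  using assms
proof (induction q arbitrary: x b X Y s t rule: less_induct)
  case (less q)
  note q = less.prems(1,2) and x = less.prems(3) and A = less.prems(4) and b = less.prems(5,6)
  have r1: "1 \<le> r" using order_trans[of 1 "enat q" r] q by (simp add: one_enat_def)
  have r': "enat (q - 1) \<le> r" using order_trans[of "enat (q - 1)" "enat q" r] q by simp
  note xb = halves_brels[OF x]
  have bb: "b \<in> brels {1..q} {1..q}" using ind_brels[OF b(1)] by simp
  obtain i K where i: "i \<in> {1..q}" "({}, K) \<in> forget i q \<longleftrightarrow> ({}, K) \<notin> forget i q O b"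
    using forget_not_half[OF bb b(2) q(1)] by blast
  obtain b' where b': "(idr (q - 1), b') \<in> ind (q - 1)" "b' \<notin> halves (q - 1) {1..q - 1}"
    using descend[OF q x A b(1) i] by blast
  obtain y z where "y \<in> halves (q - 1) {1..q}" using forget_rank[OF i(1)] by (rule rank_classE)
  then have x': "x O y \<in> halves (q - 1) A" by (rule halves_comp[OF x])
  \<comment> \<open>For \<open>q = 2\<close> the rank below is 1, where \<open>collapse1\<close>
    offers only the cutting of transversals and not a full collapse. Cutting is all that the
    induction step uses.\<close>
  have flat: "(s, flat s) \<in> E" if s: "s \<in> rank_le (q - 1) A A" for s
  proof (cases "q = 2")
    case True
    then show ?thesis using collapse1[of b' A A s] b' r1 A s by simp
  next
    case False
    then have "2 \<le> q - 1" using q by simp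
    then show ?thesis
      using less.IH[of "q - 1" "x O y" b' A A s "flat s"] r' x' A b' s q
        rank_leI[OF flat_rank0[OF rank_le_brels[OF s]], of "q - 1"] by simp
  qed
  obtain k where k: "k < q" "b \<in> rank_class k {1..q} {1..q}" using half_or_lower[OF bb b(2)] by auto
  let ?s = "x O b O x\<inverse>"
  have "?s \<in> rank_class k A A" using halves_sandwich_rank_class[OF x x k(2)] .
  then have sl: "?s \<in> rank_le (q - 1) A A" using k(1) by (intro rank_leI) auto
  have "(x\<inverse> O ?s O x, x\<inverse> O flat ?s O x) \<in> ind q"
    by (rule ind_pull[OF flat[OF sl] rank_le_brels[OF sl] q(2) xb xb])
  then have "(b, x\<inverse> O flat ?s O x) \<in> ind q" unfolding half_sandwich[OF x x bb] .
  moreover have "x\<inverse> O flat ?s O x \<in> rank_le 0 {1..q} {1..q}"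
    by (rule rank_le_comp_left[OF brels_converse[OF xb] rank_le_comp_right[OF rank_leI[OF
          flat_rank0[OF rank_le_brels[OF sl]] order_refl] xb]]) (simp_all add: fin[OF A])
  then have "x\<inverse> O flat ?s O x \<in> rank_class 0 {1..q} {1..q}" unfolding rank_le_def by simp
  ultimately show ?case
    using ind_collapse_rank0[OF q x A b(1)] less.prems(7-10) by blast
qed

lemma pair_collapse:
  assumes st: "(s, t) \<in> E" and s: "s \<in> rank_class q A B" and t: "t \<in> rank_class k A B" and kq: "k \<le> q"
    and q: "2 \<le> q" and nh: "(s, t) \<notin> h_rel q A B"
    and X: "X \<in> C" "Y \<in> C" and s': "s' \<in> rank_le q X Y" "t' \<in> rank_le q X Y"
  shows "(s', t') \<in> E"
proof -
  note ty = E_typed[OF st rank_class_brels[OF s]]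
  obtain j where "enat j \<le> r" "s \<in> rank_class j A B" using ty(3) by (rule rank_setE)
  then have r: "enat q \<le> r" using rank_class_unique[OF s] by blast
  obtain b where b: "(idr q, b) \<in> ind q" "b \<notin> halves q {1..q}"
    using separate_pair[OF st s t kq _ r nh] q by auto
  obtain u v where u: "u \<in> halves q A" using s by (rule rank_classE)
  show ?thesis by (rule collapse[OF q r u ty(1) b X s'])
qed

lemma perm_descend:
  assumes q: "2 \<le> q" "enat q \<le> r" and x: "x \<in> halves q A" and A: "A \<in> C"
    and p: "\<pi> permutes {1..q}" "\<pi> \<noteq> id" and E: "(idr q, perm_rel q \<pi>) \<in> ind q"
  shows "\<exists>b'. (idr (q - 1), b') \<in> ind (q - 1) \<and> b' \<notin> halves (q - 1) {1..q - 1}"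
proof -
  obtain i K where "i \<in> {1..q}" "({}, K) \<in> forget i q \<longleftrightarrow> ({}, K) \<notin> forget i q O perm_rel q \<pi>"
    using forget_perm[OF p] by blast
  then show ?thesis by (rule descend[OF q x A E])
qed

text \<open>One descent lands at rank \<open>q - 1\<close>, and \<open>collapse\<close> works from
  rank 2 on; hence \<open>q \<ge> 3\<close>. For two points, \<open>flattens_perm\<close> is the
  substitute.\<close>

lemma perm_collapse:
  assumes q: "3 \<le> q" "enat q \<le> r" and x: "x \<in> halves q A" and A: "A \<in> C"
    and p: "\<pi> permutes {1..q}" "\<pi> \<noteq> id" and E: "(idr q, perm_rel q \<pi>) \<in> ind q"
    and X: "X \<in> C" "Y \<in> C" and s': "s' \<in> rank_le (q - 1) X Y" "t' \<in> rank_le (q - 1) X Y"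
  shows "(s', t') \<in> E"
proof -
  have q2: "2 \<le> q" using q by simp
  have r: "enat (q - 1) \<le> r" using order_trans[of "enat (q - 1)" "enat q" r] q by simp
  obtain b where b: "(idr (q - 1), b) \<in> ind (q - 1)" "b \<notin> halves (q - 1) {1..q - 1}"
    using perm_descend[OF q2 q(2) x A p E] by blast
  have "1 \<in> {1..q}" using q by simp
  then obtain y z where "y \<in> halves (q - 1) {1..q}" by (rule rank_classE[OF forget_rank])
  then have "x O y \<in> halves (q - 1) A" by (rule halves_comp[OF x])
  then show ?thesis using collapse[OF _ r _ A b X s'] q by simp
qed

text \<open>The switch between the families with \<open>q = 0\<close> and \<open>q = 1\<close>:
  whether the transversals of rank-1 elements may be cut.\<close>

definition flattens :: bool where
  "flattens \<longleftrightarrow> (\<forall>A\<in>C. \<forall>B\<in>C. \<forall>s\<in>rank_le 1 A B. (s, flat s) \<in> E)"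

text \<open>One point has only the trivial permutation, so H is equality in rank 1 and any
  non-trivial pair is separated.\<close>

lemma flattens_pair:
  assumes st: "(s, t) \<in> E" "s \<noteq> t" and s: "s \<in> rank_class 1 A B" and t: "t \<in> rank_le 1 A B"
  shows flattens
proof -
  note ty = E_typed[OF st(1) rank_class_brels[OF s]]
  obtain j where "enat j \<le> r" "s \<in> rank_class j A B" using ty(3) by (rule rank_setE)
  then have r: "enat 1 \<le> r" using rank_class_unique[OF s] by blast
  then have r1: "1 \<le> r" by (simp add: one_enat_def)
  obtain k where k: "k \<le> 1" "t \<in> rank_class k A B" using t by (rule rank_leE)
  have "(s, t) \<notin> h_rel 1 A B"
  proof
    assume "(s, t) \<in> h_rel 1 A B"
    then obtain u v \<pi> where h: "v \<in> halves 1 B" "\<pi> permutes {1..1}" "s = u O v\<inverse>" "t = u O perm_rel 1 \<pi> O v\<inverse>"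
      by (rule h_relE)
    have "\<pi> = id" using h(2) by (simp add: permutes_sing)
    then show False using st(2) h(3,4) half_middle_Id[OF h(1), of u] by (simp add: perm_rel_id)
  qed
  then obtain b where b: "(idr 1, b) \<in> ind 1" "b \<notin> halves 1 {1..1}"
    using separate_pair[OF st(1) s k(2,1) _ r] by auto
  then show ?thesis unfolding flattens_def using collapse1[OF b r1] by blast
qed

text \<open>The transposition of two points descends to rank 1. So a nontrivial subgroup in degree 2
  occurs only together with cutting in rank 1.\<close>

lemma flattens_perm:
  assumes E: "(idr 2, perm_rel 2 \<pi>) \<in> ind 2" and p: "\<pi> permutes {1..2}" "\<pi> \<noteq> id" and r: "2 \<le> r"
    and x: "x \<in> halves 2 A" and A: "A \<in> C"
  shows flattens
proof -
  have r2: "enat 2 \<le> r" and r1: "1 \<le> r" using r order_trans[of 1 2 r] by (simp_all add: numeral_eq_enat one_enat_def)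
  obtain b where b: "(idr 1, b) \<in> ind 1" "b \<notin> halves 1 {1..1}"
    using perm_descend[OF _ r2 x A p E] by auto
  then show ?thesis unfolding flattens_def using collapse1[OF b r1] by blast
qed

lemma flattens_iff:
  assumes flattens "A \<in> C" "B \<in> C" "s \<in> rank_le 1 A B" "t \<in> rank_le 1 A B"
  shows "(s, t) \<in> E \<longleftrightarrow> (flat s, flat t) \<in> E"
  using assms E_sym E_trans unfolding flattens_def by meson

end

section \<open>The normal subgroup attached to a congruence, and the classification\<close>

context brel_cong begin

definition perm_kernel :: "nat \<Rightarrow> (nat \<Rightarrow> nat) set" where
  "perm_kernel q = {\<pi>. \<pi> permutes {1..q} \<and> (idr q, perm_rel q \<pi>) \<in> ind q}"

text \<open>Products, inverses and conjugates come from multiplying pairs of \<open>ind q\<close> on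
  either side. Reflexivity at the identity is a hypothesis because \<open>ind q\<close> speaks of
  elements of the ideal; \<open>ind_refl\<close> supplies it when \<open>q \<le> r\<close> and some
  object has a half of rank \<open>q\<close>.\<close>

lemma perm_kernel_normal:
  assumes "(idr q, idr q) \<in> ind q"
  shows "perm_kernel q \<lhd> sym_group q"
proof -
  interpret G: group "sym_group q" by (rule sym_group_is_group)
  have br: "perm_rel q \<pi> \<in> brels {1..q} {1..q}" if "\<pi> permutes {1..q}" for \<pi>
    by (rule halves_brels[OF perm_rel_halves[OF that]])
  have mult: "\<rho> \<circ> \<pi> \<in> perm_kernel q" if p: "\<pi> \<in> perm_kernel q" "\<rho> \<in> perm_kernel q" for \<pi> \<rho>
  proof -
    have pp: "\<pi> permutes {1..q}" "\<rho> permutes {1..q}" using p unfolding perm_kernel_def by auto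
    have "(perm_rel q \<pi> O idr q, perm_rel q \<pi> O perm_rel q \<rho>) \<in> ind q"
      using p(2) unfolding perm_kernel_def by (intro ind_left br pp) simp
    then have "(perm_rel q \<pi>, perm_rel q (\<rho> \<circ> \<pi>)) \<in> ind q"
      unfolding brels_right_Id[OF br[OF pp(1)]] perm_rel_comp[OF pp(1)] .
    then have "(idr q, perm_rel q (\<rho> \<circ> \<pi>)) \<in> ind q"
      using p(1) ind_trans unfolding perm_kernel_def by blast
    then show ?thesis unfolding perm_kernel_def using permutes_compose[OF pp] by simp
  qed
  have inv: "Hilbert_Choice.inv \<pi> \<in> perm_kernel q" if p: "\<pi> \<in> perm_kernel q" for \<pi>
  proof -
    have pp: "\<pi> permutes {1..q}" and ip: "Hilbert_Choice.inv \<pi> permutes {1..q}"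
      using p permutes_inv unfolding perm_kernel_def by auto
    have "(idr q O perm_rel q (Hilbert_Choice.inv \<pi>), perm_rel q \<pi> O perm_rel q (Hilbert_Choice.inv \<pi>)) \<in> ind q"
      using p unfolding perm_kernel_def by (intro ind_right br ip) simp
    then have "(perm_rel q (Hilbert_Choice.inv \<pi>), idr q) \<in> ind q"
      unfolding brels_left_Id[OF br[OF ip]] perm_rel_comp[OF pp] permutes_inv_o(2)[OF pp] perm_rel_id .
    then show ?thesis unfolding perm_kernel_def using ip ind_sym by simp
  qed
  have "id \<in> perm_kernel q" unfolding perm_kernel_def using assms by (simp add: perm_rel_id permutes_id)
  then have id: "perm_kernel q \<noteq> {}" by blast
  have car: "perm_kernel q \<subseteq> carrier (sym_group q)" unfolding perm_kernel_def sym_group_def by auto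
  have sub: "subgroup (perm_kernel q) (sym_group q)"
  proof (rule G.subgroupI[OF car id])
    show "inv\<^bsub>sym_group q\<^esub> \<pi> \<in> perm_kernel q" if "\<pi> \<in> perm_kernel q" for \<pi>
      using inv[OF that] sym_group_inv_equality[of \<pi> q] car that by auto
    show "\<pi> \<otimes>\<^bsub>sym_group q\<^esub> \<rho> \<in> perm_kernel q" if "\<pi> \<in> perm_kernel q" "\<rho> \<in> perm_kernel q" for \<pi> \<rho>
      unfolding sym_group_mult using mult[OF that(2,1)] .
  qed
  show ?thesis
  proof (rule G.normal_invI[OF sub])
    fix \<sigma> \<pi> assume s: "\<sigma> \<in> carrier (sym_group q)" and p: "\<pi> \<in> perm_kernel q"
    have sp: "\<sigma> permutes {1..q}" and ip: "Hilbert_Choice.inv \<sigma> permutes {1..q}" and pp: "\<pi> permutes {1..q}"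
      using s p permutes_inv unfolding perm_kernel_def sym_group_carrier by auto
    have "(perm_rel q (Hilbert_Choice.inv \<sigma>) O idr q, perm_rel q (Hilbert_Choice.inv \<sigma>) O perm_rel q \<pi>) \<in> ind q"
      using p unfolding perm_kernel_def by (intro ind_left br ip) simp
    then have "(perm_rel q (Hilbert_Choice.inv \<sigma>) O perm_rel q \<sigma>, (perm_rel q (Hilbert_Choice.inv \<sigma>) O perm_rel q \<pi>) O perm_rel q \<sigma>) \<in> ind q"
      unfolding brels_right_Id[OF br[OF ip]] by (rule ind_right[OF _ br[OF sp]])
    moreover have "\<pi> \<circ> Hilbert_Choice.inv \<sigma> permutes {1..q}" using permutes_compose[OF ip pp] .
    ultimately have "(idr q, perm_rel q (\<sigma> \<circ> (\<pi> \<circ> Hilbert_Choice.inv \<sigma>))) \<in> ind q"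
      unfolding perm_rel_comp[OF ip] by (simp add: perm_rel_comp permutes_inv_o(1)[OF sp] perm_rel_id)
    then show "\<sigma> \<otimes>\<^bsub>sym_group q\<^esub> \<pi> \<otimes>\<^bsub>sym_group q\<^esub> inv\<^bsub>sym_group q\<^esub> \<sigma> \<in> perm_kernel q"
      using permutes_compose[OF permutes_compose[OF ip pp] sp]
      unfolding sym_group_inv_equality[OF s] sym_group_mult perm_kernel_def by (simp add: o_assoc)
  qed
qed

lemma ind_refl:
  assumes "x \<in> halves q A" "A \<in> C" "enat q \<le> r"
  shows "(idr q, idr q) \<in> ind q"
proof -
  have "x O x\<inverse> \<in> rank_set r A A" using rank_setI[OF rank_classI[OF assms(1,1)] assms(3)] .
  then have "(x O idr q O x\<inverse>, x O idr q O x\<inverse>) \<in> E"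
    unfolding half_middle_Id[OF assms(1)] by (rule E_refl[OF assms(2,2)])
  then show ?thesis by (rule ind_lift[OF _ assms(1,1,3) brels_Id brels_Id])
qed

lemma E_ranks:
  assumes "(s, t) \<in> E"
  obtains A B i j where "A \<in> C" "B \<in> C" "s \<in> rank_class i A B" "t \<in> rank_class j A B" "enat i \<le> r" "enat j \<le> r"
proof -
  obtain A B where "A \<in> C" "B \<in> C" "s \<in> rank_set r A B" "t \<in> rank_set r A B" using objects[OF assms] by blast
  then show ?thesis using that by (meson rank_setE)
qed

lemma kappa_sub:
  assumes q: "enat (q + 1) \<le> r"
    and low: "\<And>A B s t. A \<in> C \<Longrightarrow> B \<in> C \<Longrightarrow> s \<in> rank_le q A B \<Longrightarrow> t \<in> rank_le q A B \<Longrightarrow> base_rel k s t \<Longrightarrow> (s, t) \<in> E"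
  shows "kappa_brel C r k q (perm_kernel (q + 1)) \<subseteq> E"
proof (rule subrelI)
  fix s t assume "(s, t) \<in> kappa_brel C r k q (perm_kernel (q + 1))"
  then obtain A B where AB: "A \<in> C" "B \<in> C" "s \<in> rank_set r A B" "t \<in> rank_set r A B"
    and c: "s = t \<or> (s \<in> rank_le q A B \<and> t \<in> rank_le q A B \<and> base_rel k s t) \<or>
      (s, t) \<in> nu_brel (q + 1) (perm_kernel (q + 1)) A B"
    unfolding kappa_brel_def by blast
  from c show "(s, t) \<in> E"
  proof (elim disjE conjE)
    assume "s = t" then show ?thesis using E_refl[OF AB(1,2,3)] by simp
  next
    assume "s \<in> rank_le q A B" "t \<in> rank_le q A B" "base_rel k s t"
    then show ?thesis by (rule low[OF AB(1,2)])
  next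
    assume "(s, t) \<in> nu_brel (q + 1) (perm_kernel (q + 1)) A B"
    then obtain u v \<pi> where h: "u \<in> halves (q + 1) A" "v \<in> halves (q + 1) B" "\<pi> \<in> perm_kernel (q + 1)"
      "s = u O v\<inverse>" "t = u O perm_rel (q + 1) \<pi> O v\<inverse>" by (rule nu_brelE)
    then show ?thesis using ind_perm_iff[OF h(1,2) AB(1,2) q] unfolding perm_kernel_def by simp
  qed
qed

lemma base_rel_sym: "base_rel k s t \<Longrightarrow> base_rel k t s"
  by (cases k) simp_all

lemma sub_kappa:
  assumes low: "\<And>A B s t. A \<in> C \<Longrightarrow> B \<in> C \<Longrightarrow> s \<in> rank_le q A B \<Longrightarrow> t \<in> rank_le q A B \<Longrightarrow> (s, t) \<in> E \<Longrightarrow> s \<noteq> t \<Longrightarrow> base_rel k s t"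
    and high: "\<And>A B s t i j. A \<in> C \<Longrightarrow> B \<in> C \<Longrightarrow> s \<in> rank_class i A B \<Longrightarrow> t \<in> rank_class j A B \<Longrightarrow>
      (s, t) \<in> E \<Longrightarrow> s \<noteq> t \<Longrightarrow> j \<le> i \<Longrightarrow> q < i \<Longrightarrow> i = q + 1 \<and> (s, t) \<in> h_rel (q + 1) A B"
  shows "E \<subseteq> kappa_brel C r k q (perm_kernel (q + 1))"
proof (rule subrelI)
  fix s t assume st: "(s, t) \<in> E"
  obtain A B i j where ij: "A \<in> C" "B \<in> C" "s \<in> rank_class i A B" "t \<in> rank_class j A B" "enat i \<le> r" "enat j \<le> r"
    using st by (rule E_ranks)
  have "s = t \<or> (s \<in> rank_le q A B \<and> t \<in> rank_le q A B \<and> base_rel k s t) \<or>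
      (s, t) \<in> nu_brel (q + 1) (perm_kernel (q + 1)) A B"
  proof (cases "s = t \<or> (i \<le> q \<and> j \<le> q)")
    case True
    then show ?thesis using low[OF ij(1,2) rank_leI[OF ij(3)] rank_leI[OF ij(4)] st] rank_leI[OF ij(3)] rank_leI[OF ij(4)] by blast
  next
    case False
    show ?thesis
    proof (cases "j \<le> i")
      case True
      then have h: "i = q + 1" "(s, t) \<in> h_rel (q + 1) A B" using high[OF ij(1-4) st] False by auto
      obtain u v \<pi> where u: "u \<in> halves (q + 1) A" "v \<in> halves (q + 1) B" "\<pi> permutes {1..q + 1}"
        "s = u O v\<inverse>" "t = u O perm_rel (q + 1) \<pi> O v\<inverse>" using h(2) by (rule h_relE)
      have "(idr (q + 1), perm_rel (q + 1) \<pi>) \<in> ind (q + 1)"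
        using ind_perm_iff[OF u(1,2) ij(1,2) _ u(3)] st ij(5) unfolding u(4,5) h(1) by simp
      then have "\<pi> \<in> perm_kernel (q + 1)" using u(3) unfolding perm_kernel_def by simp
      then show ?thesis using nu_brelI[OF u(1,2)] unfolding u(4,5) by blast
    next
      \<comment> \<open>With the larger rank on the right, the swapped pair lies in
        \<open>h_rel\<close>, where both ranks are equal: a contradiction.\<close>
      case False': False
      then have ne: "t \<noteq> s" "i \<le> j" "q < j" using False by auto
      then have h: "(t, s) \<in> h_rel (q + 1) A B" "j = q + 1" using high[OF ij(1,2,4,3) E_sym[OF st] ne] by auto
      have "s \<in> rank_class (q + 1) A B" using h_rel_rank[OF h(1)] by simp
      then have "i = q + 1" by (rule rank_class_unique[OF ij(3)])
      then show ?thesis using h(2) False' by simp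
    qed
  qed
  then show "(s, t) \<in> kappa_brel C r k q (perm_kernel (q + 1))"
    using ij rank_setI[OF ij(3,5)] rank_setI[OF ij(4,6)] unfolding kappa_brel_def by blast
qed

text \<open>Whether ranges matter and whether domains matter are two separate questions, each with
  an all-or-nothing answer: by \<open>rank0_right\<close> and its mirror image, one related pair
  with different ranges, or domains, makes all of them interchangeable. The four combinations are
  the four kinds.\<close>

lemma rank0_kind:
  assumes r: "2 \<le> r"
  shows "\<exists>k. \<forall>A\<in>C. \<forall>B\<in>C. \<forall>s\<in>rank_class 0 A B. \<forall>t\<in>rank_class 0 A B. (s, t) \<in> E \<longleftrightarrow> base_rel k s t"
proof -
  interpret dual: brel_cong C r "(\<lambda>(s, t). (s\<inverse>, t\<inverse>)) ` E" by (rule converse_cong)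
  define P1 where "P1 \<longleftrightarrow> (\<exists>A\<in>C. \<exists>B\<in>C. \<exists>s\<in>rank_class 0 A B. \<exists>t\<in>rank_class 0 A B. (s, t) \<in> E \<and> Range s \<noteq> Range t)"
  define P2 where "P2 \<longleftrightarrow> (\<exists>A\<in>C. \<exists>B\<in>C. \<exists>s\<in>rank_class 0 A B. \<exists>t\<in>rank_class 0 A B. (s, t) \<in> E \<and> Domain s \<noteq> Domain t)"
  define k where "k = (if P1 then (if P2 then Ree else Rho) else (if P2 then Lam else Mu))"
  have right: "(H \<times> G1, H \<times> G2) \<in> E" if "P1" "U \<in> C" "V \<in> C" "H \<in> subalgs U" "G1 \<in> subalgs V" "G2 \<in> subalgs V" for U V H G1 G2
    using that(1) rank0_right[OF _ _ _ _ r that(2-6)] unfolding P1_def by blast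
  have left: "(G1 \<times> H, G2 \<times> H) \<in> E" if p: "P2" "U \<in> C" "V \<in> C" "H \<in> subalgs V" "G1 \<in> subalgs U" "G2 \<in> subalgs U" for U V H G1 G2
  proof -
    obtain A B s t where st: "s \<in> rank_class 0 A B" "t \<in> rank_class 0 A B" "(s, t) \<in> E" "Domain s \<noteq> Domain t"
      using p(1) unfolding P2_def by blast
    have "(s\<inverse>, t\<inverse>) \<in> (\<lambda>(s, t). (s\<inverse>, t\<inverse>)) ` E" unfolding dual_iff using st by simp
    moreover have "Range (s\<inverse>) \<noteq> Range (t\<inverse>)" using st(4) by simp
    ultimately have "(H \<times> G1, H \<times> G2) \<in> (\<lambda>(s, t). (s\<inverse>, t\<inverse>)) ` E"
      using dual.rank0_right[OF _ rank_class_converse[OF st(1)] rank_class_converse[OF st(2)] _ r p(3,2,4,5,6)] by blast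
    then show ?thesis unfolding dual_iff converse_Times .
  qed
  have "(s, t) \<in> E \<longleftrightarrow> base_rel k s t"
    if AB: "A \<in> C" "B \<in> C" and s: "s \<in> rank_class 0 A B" and t: "t \<in> rank_class 0 A B" for A B s t
  proof
    assume st: "(s, t) \<in> E"
    have "\<not> P1 \<Longrightarrow> Range s = Range t" unfolding P1_def using AB s t st by blast
    moreover have "\<not> P2 \<Longrightarrow> Domain s = Domain t" unfolding P2_def using AB s t st by blast
    ultimately show "base_rel k s t" unfolding k_def by simp
  next
    assume b: "base_rel k s t"
    have eqs: "s = Domain s \<times> Range s" "t = Domain t \<times> Range t"
      using rank0_flat[OF s] rank0_flat[OF t] unfolding flat_def by simp_all
    note D = subalgs_Domain[OF rank_class_brels[OF s]] subalgs_Domain[OF rank_class_brels[OF t]]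
      and R = subalgs_Range[OF rank_class_brels[OF s]] subalgs_Range[OF rank_class_brels[OF t]]
    have rf: "(s, s) \<in> E" using E_refl[OF AB rank_setI[OF s]] by (simp add: zero_enat_def[symmetric])
    have "Range s = Range t \<or> P1" "Domain s = Domain t \<or> P2" using b unfolding k_def by (auto split: if_splits)
    then have "(Domain s \<times> Range s, Domain s \<times> Range t) \<in> E" "(Domain s \<times> Range t, Domain t \<times> Range t) \<in> E"
      using right[OF _ AB D(1) R] left[OF _ AB R(2) D] rf eqs
        E_refl[OF AB rank_setI[OF Times_rank0[OF D(1) R(2)]]] by (auto simp: zero_enat_def[symmetric])
    then show "(s, t) \<in> E" using E_trans eqs by metis
  qed
  then show ?thesis by blast
qed

text \<open>The level \<open>q\<close> is the last rank at which \<open>T\<close> holds, if that is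
  at least 2; otherwise it is 0 or 1 according to \<open>flattens\<close>, and the kind is read off
  in rank 0. Above the level non-trivial pairs are H-related. Such a pair of rank
  \<open>i \<ge> 3\<close> collapses all ranks below \<open>i\<close>, so \<open>i\<close> can only
  be \<open>q + 1\<close>, and the permutations that occur form the subgroup.\<close>

theorem classification:
  assumes r: "2 \<le> r"
  shows "E = nabla_brel C r \<or>
    (\<exists>k q. q \<le> 1 \<and> E = kappa_brel C r k q (perm_kernel (q + 1))) \<or>
    (\<exists>q. 2 \<le> q \<and> enat (q + 1) \<le> r \<and> E = kappa_brel C r Ree q (perm_kernel (q + 1)))"
proof -
  define T where "T q \<longleftrightarrow> (\<forall>A\<in>C. \<forall>B\<in>C. \<forall>s\<in>rank_le q A B. \<forall>t\<in>rank_le q A B. (s, t) \<in> E)" for q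
  have T_mono: "T q" if "T p" "q \<le> p" for p q
    using that rank_le_mono unfolding T_def by blast
  have le_r: "enat i \<le> r" if "enat j \<le> r" "i \<le> j" for i j using that order_trans[of "enat i" "enat j" r] by simp
  have r2: "enat 2 \<le> r" and r1: "enat 1 \<le> r"
    using r le_r[of 2 1] by (simp_all add: numeral_eq_enat)
  have non_h: "T i" if "(s, t) \<in> E" "s \<in> rank_class i A B" "t \<in> rank_class j A B" "j \<le> i" "2 \<le> i"
    "(s, t) \<notin> h_rel i A B" for s t i j A B
    using pair_collapse[OF that] unfolding T_def by blast
  have h_perm: "\<exists>\<pi>. \<pi> permutes {1..i} \<and> \<pi> \<noteq> id \<and> (idr i, perm_rel i \<pi>) \<in> ind i"
    if st: "(s, t) \<in> E" "s \<noteq> t" and h: "(s, t) \<in> h_rel i A B" and i: "enat i \<le> r" and AB: "A \<in> C" "B \<in> C" for s t i A B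
  proof -
    obtain u v \<pi> where u: "u \<in> halves i A" "v \<in> halves i B" "\<pi> permutes {1..i}"
      "s = u O v\<inverse>" "t = u O perm_rel i \<pi> O v\<inverse>" using h by (rule h_relE)
    have "(idr i, perm_rel i \<pi>) \<in> ind i"
      using ind_perm_iff[OF u(1,2) AB i u(3)] st(1) unfolding u(4,5) by simp
    moreover have "\<pi> \<noteq> id" using st(2) half_middle_Id[OF u(2), of u] unfolding u(4,5) by (auto simp: perm_rel_id)
    ultimately show ?thesis using u(3) by blast
  qed
  have h_high: "T (i - 1)" if st: "(s, t) \<in> E" "s \<noteq> t" and h: "(s, t) \<in> h_rel i A B" and i: "enat i \<le> r" "3 \<le> i"
    and AB: "A \<in> C" "B \<in> C" for s t i A B
  proof -
    obtain \<pi> where p: "\<pi> permutes {1..i}" "\<pi> \<noteq> id" "(idr i, perm_rel i \<pi>) \<in> ind i"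
      using h_perm[OF st h i(1) AB] by blast
    obtain u v where "u \<in> halves i A" using h by (rule h_relE)
    then show ?thesis using perm_collapse[OF i(2,1) _ AB(1) p] unfolding T_def by blast
  qed
  \<comment> \<open>In the third case \<open>T\<close> may still hold at 0 or 1; this is covered
    there by the kind \<open>Ree\<close>.\<close>
  consider "\<forall>q. enat q \<le> r \<longrightarrow> T q" | p where "enat p \<le> r" "\<not> T p" "T 2" | "\<not> T 2" by blast
  then show ?thesis
  proof cases
    case 1
    have "E = nabla_brel C r"
    proof
      show "E \<subseteq> nabla_brel C r" using objects unfolding nabla_brel_def by blast
      show "nabla_brel C r \<subseteq> E"
      proof (rule subrelI)
        fix s t assume "(s, t) \<in> nabla_brel C r"
        then obtain A B where AB: "A \<in> C" "B \<in> C" "s \<in> rank_set r A B" "t \<in> rank_set r A B"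
          unfolding nabla_brel_def by blast
        obtain i where i: "enat i \<le> r" "s \<in> rank_class i A B" using AB(3) by (rule rank_setE)
        obtain j where j: "enat j \<le> r" "t \<in> rank_class j A B" using AB(4) by (rule rank_setE)
        have "T (max i j)" using 1 i(1) j(1) by (simp add: max_def)
        then show "(s, t) \<in> E"
          using AB(1,2) rank_leI[OF i(2), of "max i j"] rank_leI[OF j(2), of "max i j"] unfolding T_def by simp
      qed
    qed
    then show ?thesis by simp
  next
    case 2
    \<comment> \<open>The least rank at which \<open>T\<close> fails. It exceeds 2, since
      \<open>T\<close> holds at 2 and is inherited downwards, and the level is the rank just before
      it.\<close>
    define p0 where "p0 = (LEAST p. \<not> T p)"
    have p0: "\<not> T p0" "p0 \<le> p" unfolding p0_def using LeastI[of "\<lambda>p. \<not> T p" p] Least_le[of "\<lambda>p. \<not> T p" p] 2(2) by auto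
    have "2 < p0"
    proof (rule ccontr)
      assume "\<not> 2 < p0" then show False using T_mono[OF 2(3), of p0] p0(1) by simp
    qed
    define q where "q = p0 - 1"
    have q: "2 \<le> q" "q + 1 = p0" "enat (q + 1) \<le> r" using \<open>2 < p0\<close> p0(2) le_r[OF 2(1), of p0] unfolding q_def by auto
    have Tq: "T q" using not_less_Least[of q "\<lambda>p. \<not> T p"] q(2) unfolding p0_def by auto
    have nT: "\<not> T i" if "q + 1 \<le> i" for i using T_mono[of i p0] p0(1) q(2) that by auto
    have "E = kappa_brel C r Ree q (perm_kernel (q + 1))"
    proof
      show "kappa_brel C r Ree q (perm_kernel (q + 1)) \<subseteq> E"
        using Tq unfolding T_def by (intro kappa_sub[OF q(3)]) blast
      show "E \<subseteq> kappa_brel C r Ree q (perm_kernel (q + 1))"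
      proof (rule sub_kappa)
        fix A B s t i j assume a: "A \<in> C" "B \<in> C" "s \<in> rank_class i A B" "t \<in> rank_class j A B" "(s, t) \<in> E" "s \<noteq> t" "j \<le> i" "q < i"
        have h: "(s, t) \<in> h_rel i A B" using non_h[OF a(5,3,4,7)] nT[of i] a(8) q(1) by auto
        obtain i' where "enat i' \<le> r" "s \<in> rank_class i' A B"
          using E_typed(3)[OF a(5) rank_class_brels[OF a(3)]] by (rule rank_setE)
        then have ir: "enat i \<le> r" using rank_class_unique[OF a(3)] by blast
        have Ti: "T (i - 1)" using h_high[OF a(5,6) h ir _ a(1,2)] a(8) q(1) by simp
        have "i = q + 1"
        proof (rule ccontr)
          assume "i \<noteq> q + 1"
          then have "q + 1 \<le> i - 1" using a(8) by linarith
          then show False using nT Ti by blast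
        qed
        then show "i = q + 1 \<and> (s, t) \<in> h_rel (q + 1) A B" using h by simp
      qed simp
    qed
    then show ?thesis using q by blast
  next
    case 3
    have high: "i = 2 \<and> (s, t) \<in> h_rel 2 A B"
      if a: "A \<in> C" "B \<in> C" "s \<in> rank_class i A B" "t \<in> rank_class j A B" "(s, t) \<in> E" "s \<noteq> t" "j \<le> i" "1 < i" for A B s t i j
    proof -
      have h: "(s, t) \<in> h_rel i A B" using non_h[OF a(5,3,4,7)] 3 T_mono[of i 2] a(8) by auto
      obtain i' where "enat i' \<le> r" "s \<in> rank_class i' A B"
        using E_typed(3)[OF a(5) rank_class_brels[OF a(3)]] by (rule rank_setE)
      then have ir: "enat i \<le> r" using rank_class_unique[OF a(3)] by blast
      have "i = 2"
      proof (rule ccontr)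
        assume "i \<noteq> 2"
        then have "3 \<le> i" using a(8) by simp
        then have "T (i - 1)" by (rule h_high[OF a(5,6) h ir _ a(1,2)])
        then show False using 3 T_mono[of "i - 1" 2] \<open>3 \<le> i\<close> by simp
      qed
      then show ?thesis using h by simp
    qed
    obtain k where k: "\<And>A B s t. A \<in> C \<Longrightarrow> B \<in> C \<Longrightarrow> s \<in> rank_class 0 A B \<Longrightarrow> t \<in> rank_class 0 A B \<Longrightarrow>
        (s, t) \<in> E \<longleftrightarrow> base_rel k s t" using rank0_kind[OF r] by blast
    show ?thesis
    proof (cases flattens)
      case True
      have low: "(s, t) \<in> E \<longleftrightarrow> base_rel k s t"
        if "A \<in> C" "B \<in> C" "s \<in> rank_le 1 A B" "t \<in> rank_le 1 A B" for A B s t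
        using flattens_iff[OF True that] k[OF that(1,2) flat_rank0 flat_rank0]
          base_rel_flat[OF rank_le_brels[OF that(3)] rank_le_brels[OF that(4)]]
          rank_le_brels[OF that(3)] rank_le_brels[OF that(4)] by blast
      have "E = kappa_brel C r k 1 (perm_kernel (1 + 1))"
      proof
        show "kappa_brel C r k 1 (perm_kernel (1 + 1)) \<subseteq> E"
        proof (rule kappa_sub)
          show "enat (1 + 1) \<le> r" using r2 by (simp only: one_add_one)
        qed (use low in blast)
        show "E \<subseteq> kappa_brel C r k 1 (perm_kernel (1 + 1))"
        proof (rule sub_kappa)
          fix A B s t i j assume a: "A \<in> C" "B \<in> C" "s \<in> rank_class i A B" "t \<in> rank_class j A B" "(s, t) \<in> E" "s \<noteq> t" "j \<le> i" "1 < i"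
          show "i = 1 + 1 \<and> (s, t) \<in> h_rel (1 + 1) A B" using high[OF a] unfolding one_add_one .
        qed (use low in blast)
      qed
      then show ?thesis by blast
    next
      case False
      \<comment> \<open>If rank 1 cannot be cut, a non-trivial pair of rank 1 is excluded by
        \<open>flattens_pair\<close>, and one of rank 2 by the descent of its permutation.\<close>
      have only0: "i = 0"
        if a: "A \<in> C" "B \<in> C" "s \<in> rank_class i A B" "t \<in> rank_class j A B" "(s, t) \<in> E" "s \<noteq> t" "j \<le> i" for A B s t i j
      proof (rule ccontr)
        assume "i \<noteq> 0"
        then consider "i = 1" | "1 < i" by linarith
        then show False
        proof cases
          case 1
          then show ?thesis using flattens_pair[OF a(5,6) _ rank_leI[OF a(4)]] a(3,7) False by simp
        next
          case 2
          then have h: "(s, t) \<in> h_rel 2 A B" "i = 2" using high[OF a] by auto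
          obtain \<pi> where p: "\<pi> permutes {1..2}" "\<pi> \<noteq> id" "(idr 2, perm_rel 2 \<pi>) \<in> ind 2"
            using h_perm[OF a(5,6) h(1) r2 a(1,2)] by blast
          obtain u v where "u \<in> halves 2 A" using h(1) by (rule h_relE)
          then show ?thesis using flattens_perm[OF p(3,1,2) r _ a(1)] False by blast
        qed
      qed
      have r0: "rank_le 0 A B = rank_class 0 A B" for A B :: "'a set" unfolding rank_le_def by simp
      have "E = kappa_brel C r k 0 (perm_kernel (0 + 1))"
      proof
        show "kappa_brel C r k 0 (perm_kernel (0 + 1)) \<subseteq> E"
          using k r1 unfolding r0[symmetric] by (intro kappa_sub) auto
        show "E \<subseteq> kappa_brel C r k 0 (perm_kernel (0 + 1))"
        proof (rule sub_kappa)
          fix A B s t i j assume a: "A \<in> C" "B \<in> C" "s \<in> rank_class i A B" "t \<in> rank_class j A B" "(s, t) \<in> E" "s \<noteq> t" "j \<le> i" "0 < i"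
          then show "i = 0 + 1 \<and> (s, t) \<in> h_rel (0 + 1) A B" using only0[OF a(1-7)] by simp
        qed (use k in \<open>simp add: r0\<close>)
      qed
      then show ?thesis by blast
    qed
  qed
qed

end

section \<open>The converse direction: the models are congruences, with the stated
  inclusions\<close>

section \<open>The listed congruences\<close>

lemma kappa_brel_iff:
  assumes "A \<in> C" "B \<in> C" "s \<in> brels A B"
  shows "(s, t) \<in> kappa_brel C r k q N \<longleftrightarrow> s \<in> rank_set r A B \<and> t \<in> rank_set r A B \<and>
     (s = t \<or> (s \<in> rank_le q A B \<and> t \<in> rank_le q A B \<and> base_rel k s t) \<or> (s, t) \<in> nu_brel (q + 1) N A B)"
proof
  assume "(s, t) \<in> kappa_brel C r k q N"
  then obtain A' B' where AB: "s \<in> rank_set r A' B'" "t \<in> rank_set r A' B'"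
     "s = t \<or> (s \<in> rank_le q A' B' \<and> t \<in> rank_le q A' B' \<and> base_rel k s t) \<or> (s, t) \<in> nu_brel (q + 1) N A' B'"
    unfolding kappa_brel_def by blast
  moreover have "A' = A \<and> B' = B" using brels_eq_objects[OF rank_set_brels[OF AB(1)] assms(3)] .
  ultimately show "s \<in> rank_set r A B \<and> t \<in> rank_set r A B \<and>
     (s = t \<or> (s \<in> rank_le q A B \<and> t \<in> rank_le q A B \<and> base_rel k s t) \<or> (s, t) \<in> nu_brel (q + 1) N A B)" by simp
next
  assume "s \<in> rank_set r A B \<and> t \<in> rank_set r A B \<and>
     (s = t \<or> (s \<in> rank_le q A B \<and> t \<in> rank_le q A B \<and> base_rel k s t) \<or> (s, t) \<in> nu_brel (q + 1) N A B)"
  then show "(s, t) \<in> kappa_brel C r k q N" using assms(1,2) unfolding kappa_brel_def by blast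
qed

lemma nu_brel_rank:
  assumes "(s, t) \<in> nu_brel q N A B" "N \<subseteq> {\<pi>. \<pi> permutes {1..q}}"
  shows "s \<in> rank_class q A B \<and> t \<in> rank_class q A B"
proof -
  have "nu_brel q N A B \<subseteq> h_rel q A B" using assms(2) unfolding nu_brel_def h_rel_def by blast
  then show ?thesis using assms(1) h_rel_rank by blast
qed

lemma rank_le_not_class: "s \<in> rank_le q A B \<Longrightarrow> s \<in> rank_class p A B \<Longrightarrow> p \<le> q"
  using rank_leE rank_class_unique by metis

lemma halves_perm_comp: "u \<in> halves q A \<Longrightarrow> \<pi> permutes {1..q} \<Longrightarrow> u O perm_rel q \<pi> \<in> halves q A"
  using halves_comp perm_rel_halves by blast

lemma nu_brel_sym:
  assumes N: "N \<lhd> sym_group q" and st: "(s, t) \<in> nu_brel q N A B"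
  shows "(t, s) \<in> nu_brel q N A B"
proof -
  obtain u v \<pi> where u: "u \<in> halves q A" "v \<in> halves q B" "\<pi> \<in> N" "s = u O v\<inverse>" "t = u O perm_rel q \<pi> O v\<inverse>"
    using st by (rule nu_brelE)
  have p: "\<pi> permutes {1..q}" using sym_normal_subset[OF N] u(3) by blast
  have "(u O perm_rel q \<pi>) O perm_rel q (Hilbert_Choice.inv \<pi>) O v\<inverse> =
      u O (perm_rel q \<pi> O perm_rel q (Hilbert_Choice.inv \<pi>)) O v\<inverse>" by (simp only: O_assoc)
  also have "\<dots> = s" unfolding perm_rel_comp[OF p] permutes_inv_o(2)[OF p] perm_rel_id u(4)
    using brels_left_Id[OF brels_converse[OF halves_brels[OF u(2)]]] by simp
  finally have s: "s = (u O perm_rel q \<pi>) O perm_rel q (Hilbert_Choice.inv \<pi>) O v\<inverse>" by simp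
  have t: "t = (u O perm_rel q \<pi>) O v\<inverse>" unfolding u(5) by (simp only: O_assoc)
  show ?thesis unfolding s t by (rule nu_brelI[OF halves_perm_comp[OF u(1) p] u(2) sym_normal_inv[OF N u(3)]])
qed

text \<open>Two factorisations of the same relation differ by a permutation, which conjugates
  \<open>\<pi>\<close>; normality of \<open>N\<close> absorbs this.\<close>

lemma nu_brel_factor:
  assumes N: "N \<lhd> sym_group q" and u: "u \<in> halves q A" "v \<in> halves q B" and st: "(u O v\<inverse>, t) \<in> nu_brel q N A B"
  shows "\<exists>\<pi>\<in>N. t = u O perm_rel q \<pi> O v\<inverse>"
proof -
  obtain u' v' \<pi> where u': "u' \<in> halves q A" "v' \<in> halves q B" "\<pi> \<in> N" "u O v\<inverse> = u' O v'\<inverse>" "t = u' O perm_rel q \<pi> O v'\<inverse>"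
    using st by (rule nu_brelE)
  have p: "\<pi> permutes {1..q}" using sym_normal_subset[OF N] u'(3) by blast
  obtain \<rho> where r: "\<rho> permutes {1..q}" "u' = u O perm_rel q \<rho>" "v' = v O perm_rel q \<rho>"
    using halves_factor_unique[OF u'(1) u(1) u'(2) u(2) u'(4)[symmetric]] by blast
  have "t = u O (perm_rel q \<rho> O perm_rel q \<pi>) O perm_rel q (Hilbert_Choice.inv \<rho>) O v\<inverse>"
    unfolding u'(5) r(2,3) converse_relcomp perm_rel_converse[OF r(1)] by (simp only: O_assoc)
  also have "\<dots> = u O (perm_rel q (\<pi> \<circ> \<rho>) O perm_rel q (Hilbert_Choice.inv \<rho>)) O v\<inverse>"
    unfolding perm_rel_comp[OF r(1)] by (simp only: O_assoc)
  also have "\<dots> = u O perm_rel q (Hilbert_Choice.inv \<rho> \<circ> \<pi> \<circ> \<rho>) O v\<inverse>"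
    unfolding perm_rel_comp[OF permutes_compose[OF r(1) p]] by (simp only: o_assoc)
  finally show ?thesis using sym_normal_conj_inv[OF N u'(3) r(1)] by blast
qed

lemma nu_brel_trans:
  assumes N: "N \<lhd> sym_group q" and st: "(s, t) \<in> nu_brel q N A B" and tw: "(t, w) \<in> nu_brel q N A B"
  shows "(s, w) \<in> nu_brel q N A B"
proof -
  obtain u v \<pi> where u: "u \<in> halves q A" "v \<in> halves q B" "\<pi> \<in> N" "s = u O v\<inverse>" "t = u O perm_rel q \<pi> O v\<inverse>"
    using st by (rule nu_brelE)
  have p: "\<pi> permutes {1..q}" using sym_normal_subset[OF N] u(3) by blast
  have t: "t = (u O perm_rel q \<pi>) O v\<inverse>" unfolding u(5) by (simp only: O_assoc)
  obtain \<rho> where r: "\<rho> \<in> N" "w = (u O perm_rel q \<pi>) O perm_rel q \<rho> O v\<inverse>"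
    using nu_brel_factor[OF N halves_perm_comp[OF u(1) p] u(2) tw[unfolded t]] by blast
  have "w = u O (perm_rel q \<pi> O perm_rel q \<rho>) O v\<inverse>" unfolding r(2) by (simp only: O_assoc)
  then have "w = u O perm_rel q (\<rho> \<circ> \<pi>) O v\<inverse>" unfolding perm_rel_comp[OF p] .
  then show ?thesis unfolding u(4) using nu_brelI[OF u(1,2) sym_normal_comp[OF N r(1) u(3)]] by simp
qed

lemma base_rel_trans: "base_rel k s t \<Longrightarrow> base_rel k t w \<Longrightarrow> base_rel k s w"
  by (cases k) simp_all

lemma base_rel_sym: "base_rel k s t \<Longrightarrow> base_rel k t s"
  by (cases k) simp_all

text \<open>On at most two points a permutation sends a singleton to itself or to its complement.
  This is what lets congruences that respect kernels or cokernels identify permutations of degree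
  \<open>q + 1 = 2\<close>.\<close>

lemma subalgs2_perm:
  assumes G: "G \<in> subalgs {1..m}" and m: "m \<le> (2::nat)" and p: "\<pi> permutes {1..m}" and J: "J \<in> G"
  shows "\<pi> ` J \<in> G"
proof -
  have J': "J \<subseteq> {1..m}" using subalgs_sub[OF G J] .
  have im: "\<pi> ` {1..m} = {1..m}" using p by (rule permutes_image)
  consider "J = {}" | "J = {1..m}" | i where "J = {i}" "m = 2" "i \<in> {1..2}"
  proof -
    have "m = 0 \<or> m = 1 \<or> m = 2" using m by auto
    moreover have "{1..1::nat} = {1}" "{1..2::nat} = {1, 2}" by auto
    moreover have "J = {} \<or> J = {1} \<or> J = {2} \<or> J = {1, 2}" if "J \<subseteq> {1, 2}" using that by blast
    moreover have "J = {} \<or> J = {1}" if "J \<subseteq> {1}" using that by blast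
    moreover have "J = {}" if "m = 0" using that J' by simp
    ultimately show ?thesis using J' that by (metis insertCI)
  qed
  then show ?thesis
  proof cases
    case 1 then show ?thesis using subalgs_empty[OF G] by simp
  next
    case 2 then show ?thesis using im subalgs_full[OF G] by simp
  next
    case (3 i)
    have "\<pi> i \<in> {1..2}" using im 3(2,3) by blast
    then have "\<pi> i = i \<or> {\<pi> i} = {1..m} - {i}" using 3(2,3) by auto
    then have "{\<pi> i} = J \<or> {\<pi> i} = {1..m} - J" using 3(1) by auto
    moreover have "\<pi> ` J = {\<pi> i}" using 3(1) by simp
    ultimately show ?thesis using J subalgs_compl[OF G J] by metis
  qed
qed

lemma Range_perm_comp:
  assumes c: "c \<in> brels D {1..m}" and m: "m \<le> 2" and p: "\<pi> permutes {1..m}"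
  shows "Range (c O perm_rel m \<pi>) = Range c"
proof
  note G = subalgs_Range[OF c]
  have sub: "J \<subseteq> {1..m}" if "J \<in> Range c" for J using subalgs_sub[OF G that] .
  have pm: "(J, \<pi> ` J) \<in> perm_rel m \<pi>" if "J \<in> Range c" for J
    using sub[OF that] by (simp add: perm_rel_iff)
  show "Range (c O perm_rel m \<pi>) \<subseteq> Range c"
  proof
    fix K assume "K \<in> Range (c O perm_rel m \<pi>)"
    then obtain J where J: "J \<in> Range c" "(J, K) \<in> perm_rel m \<pi>" by blast
    then have "K = \<pi> ` J" by (simp add: perm_rel_iff)
    then show "K \<in> Range c" using subalgs2_perm[OF G m p J(1)] by simp
  qed
  show "Range c \<subseteq> Range (c O perm_rel m \<pi>)"
  proof
    fix K assume K: "K \<in> Range c"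
    have "Hilbert_Choice.inv \<pi> ` K \<in> Range c" using subalgs2_perm[OF G m permutes_inv[OF p] K] .
    moreover from pm[OF this] have "(Hilbert_Choice.inv \<pi> ` K, K) \<in> perm_rel m \<pi>"
      using permutes_surj[OF p] by (simp add: image_f_inv_f)
    ultimately show "K \<in> Range (c O perm_rel m \<pi>)" by blast
  qed
qed

text \<open>The delicate case is a pair that differs by a permutation and drops in rank, for a kind
  other than \<open>Ree\<close>. The domains agree, both being the domain of \<open>c\<close>, which
  has rank at most 1. The ranges agree because the range of \<open>c\<close> is a subalgebra on at
  most two points and so is invariant under the permutation.\<close>

lemma kappa_brel_left:
  assumes fin: "\<And>A. A \<in> C \<Longrightarrow> finite A" and N: "N \<lhd> sym_group (q + 1)"
    and kq: "k = Ree \<or> q \<le> 1" and st: "(s, t) \<in> kappa_brel C r k q N" and s: "s \<in> brels A B" and AB: "A \<in> C" "B \<in> C"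
    and D: "D \<in> C" and w: "w \<in> rank_set r D A"
  shows "(w O s, w O t) \<in> kappa_brel C r k q N"
proof -
  have ty: "s \<in> rank_set r A B" "t \<in> rank_set r A B"
    and c: "s = t \<or> (s \<in> rank_le q A B \<and> t \<in> rank_le q A B \<and> base_rel k s t) \<or> (s, t) \<in> nu_brel (q + 1) N A B"
    using st[unfolded kappa_brel_iff[OF AB s]] by auto
  have t: "t \<in> brels A B" using ty(2) by (rule rank_set_brels)
  have wb: "w \<in> brels D A" using w by (rule rank_set_brels)
  have rs: "w O s \<in> rank_set r D B" "w O t \<in> rank_set r D B"
    using rank_set_comp[OF w s fin[OF D] fin[OF AB(2)]] rank_set_comp[OF w t fin[OF D] fin[OF AB(2)]] .
  from c have "w O s = w O t \<or> (w O s \<in> rank_le q D B \<and> w O t \<in> rank_le q D B \<and> base_rel k (w O s) (w O t)) \<or>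
      (w O s, w O t) \<in> nu_brel (q + 1) N D B"
  proof (elim disjE conjE)
    assume "s = t" then show ?thesis by simp
  next
    assume l: "s \<in> rank_le q A B" "t \<in> rank_le q A B" and b: "base_rel k s t"
    have "base_rel k (w O s) (w O t)"
    proof (cases "k = Ree")
      case False
      then have "s \<in> rank_le 1 A B" "t \<in> rank_le 1 A B" using kq rank_le_mono l by blast+
      then have "Range (w O s) = Range s" "Range (w O t) = Range t"
        using rank_le1_Range[OF wb, of s B] rank_le1_Range[OF wb, of t B] by blast+
      moreover have "Domain s = Domain t \<Longrightarrow> Domain (w O s) = Domain (w O t)" by blast
      ultimately show ?thesis using b by (cases k) simp_all
    qed simp
    then show ?thesis
      using rank_le_comp_left[OF wb l(1) fin[OF D] fin[OF AB(2)]] rank_le_comp_left[OF wb l(2) fin[OF D] fin[OF AB(2)]] by blast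
  next
    assume "(s, t) \<in> nu_brel (q + 1) N A B"
    then obtain u v \<pi> where u: "u \<in> halves (q + 1) A" "v \<in> halves (q + 1) B" "\<pi> \<in> N" "s = u O v\<inverse>"
      "t = u O perm_rel (q + 1) \<pi> O v\<inverse>" by (rule nu_brelE)
    have p: "\<pi> permutes {1..q + 1}" using sym_normal_subset[OF N] u(3) by blast
    define c where "c = w O u"
    have cb: "c \<in> brels D {1..q + 1}" unfolding c_def by (rule brels_comp[OF wb halves_brels[OF u(1)]])
    have ws: "w O s = c O v\<inverse>" "w O t = c O perm_rel (q + 1) \<pi> O v\<inverse>"
      unfolding u(4,5) c_def by (simp_all only: O_assoc)
    show ?thesis
    proof (cases "c \<in> halves (q + 1) D")
      case True
      then show ?thesis using nu_brelI[OF True u(2,3)] unfolding ws by simp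
    next
      case False
      obtain j where "j < q + 1" "c \<in> rank_class j D {1..q + 1}" using half_or_lower[OF cb False fin[OF D]] by blast
      then have cl: "c \<in> rank_le q D {1..q + 1}" by (intro rank_leI) auto
      note vb = brels_converse[OF halves_brels[OF u(2)]] and pb = halves_brels[OF perm_rel_halves[OF p]]
      have l: "c O v\<inverse> \<in> rank_le q D B" "c O perm_rel (q + 1) \<pi> O v\<inverse> \<in> rank_le q D B"
        using rank_le_comp_right[OF cl vb fin[OF D] fin[OF AB(2)]]
          rank_le_comp_right[OF cl brels_comp[OF pb vb] fin[OF D] fin[OF AB(2)]] .
      have "base_rel k (c O v\<inverse>) (c O perm_rel (q + 1) \<pi> O v\<inverse>)"
      proof (cases "k = Ree")
        case False
        then have q: "q \<le> 1" using kq by simp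
        have c1: "c \<in> rank_le 1 D {1..q + 1}" using rank_le_mono[OF cl q] .
        have "Domain (c O v\<inverse>) = Domain c" "Domain (c O perm_rel (q + 1) \<pi> O v\<inverse>) = Domain c"
          using rank_le1_Domain[OF c1 vb] rank_le1_Domain[OF c1 brels_comp[OF pb vb]] .
        moreover have "Range (c O perm_rel (q + 1) \<pi> O v\<inverse>) = {Q. \<exists>J\<in>Range (c O perm_rel (q + 1) \<pi>). (Q, J) \<in> v}"
          "Range (c O v\<inverse>) = {Q. \<exists>J\<in>Range c. (Q, J) \<in> v}" by blast+
        ultimately show ?thesis using Range_perm_comp[OF cb _ p] q by (cases k) simp_all
      qed simp
      then show ?thesis using l unfolding ws by blast
    qed
  qed
  then show ?thesis unfolding kappa_brel_iff[OF D AB(2) brels_comp[OF wb s]] using rs by blast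
qed

primrec dual_kind :: "kind \<Rightarrow> kind" where
  "dual_kind Mu = Mu" | "dual_kind Lam = Rho" | "dual_kind Rho = Lam" | "dual_kind Ree = Ree"

lemma base_rel_dual: "base_rel (dual_kind k) (s\<inverse>) (t\<inverse>) \<longleftrightarrow> base_rel k s t"
  by (cases k) auto

lemma nu_brel_converse:
  assumes N: "N \<lhd> sym_group q" and st: "(s, t) \<in> nu_brel q N A B"
  shows "(s\<inverse>, t\<inverse>) \<in> nu_brel q N B A"
proof -
  obtain u v \<pi> where u: "u \<in> halves q A" "v \<in> halves q B" "\<pi> \<in> N" "s = u O v\<inverse>" "t = u O perm_rel q \<pi> O v\<inverse>"
    using st by (rule nu_brelE)
  have p: "\<pi> permutes {1..q}" using sym_normal_subset[OF N] u(3) by blast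
  have "s\<inverse> = v O u\<inverse>" unfolding u(4) by (simp add: converse_relcomp)
  moreover have "t\<inverse> = v O perm_rel q (Hilbert_Choice.inv \<pi>) O u\<inverse>"
    unfolding u(5) by (simp only: converse_relcomp perm_rel_converse[OF p] converse_converse O_assoc)
  ultimately show ?thesis using nu_brelI[OF u(2,1) sym_normal_inv[OF N u(3)]] by simp
qed

lemma kappa_brel_converse:
  assumes N: "N \<lhd> sym_group (q + 1)" and st: "(s, t) \<in> kappa_brel C r k q N"
  shows "(s\<inverse>, t\<inverse>) \<in> kappa_brel C r (dual_kind k) q N"
proof -
  obtain A B where AB: "A \<in> C" "B \<in> C" "s \<in> rank_set r A B" "t \<in> rank_set r A B"
     "s = t \<or> (s \<in> rank_le q A B \<and> t \<in> rank_le q A B \<and> base_rel k s t) \<or> (s, t) \<in> nu_brel (q + 1) N A B"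
    using st unfolding kappa_brel_def by blast
  have "s\<inverse> = t\<inverse> \<or> (s\<inverse> \<in> rank_le q B A \<and> t\<inverse> \<in> rank_le q B A \<and> base_rel (dual_kind k) (s\<inverse>) (t\<inverse>)) \<or> (s\<inverse>, t\<inverse>) \<in> nu_brel (q + 1) N B A"
    using AB(5) rank_le_converse nu_brel_converse[OF N] base_rel_dual by blast
  then show ?thesis
    unfolding kappa_brel_iff[OF AB(2,1) brels_converse[OF rank_set_brels[OF AB(3)]]]
    using rank_set_converse[OF AB(3)] rank_set_converse[OF AB(4)] by blast
qed

lemma dual_kind_dual: "dual_kind (dual_kind k) = k"
  by (cases k) simp_all

lemma kappa_brel_cong:
  assumes fin: "\<And>A. A \<in> C \<Longrightarrow> finite A" and N: "N \<lhd> sym_group (q + 1)" and kq: "k = Ree \<or> q \<le> 1"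
  shows "brel_cong C r (kappa_brel C r k q N)"
proof
  show "finite A" if "A \<in> C" for A using that by (rule fin)
  have obj: "\<exists>A\<in>C. \<exists>B\<in>C. s \<in> rank_set r A B \<and> t \<in> rank_set r A B" if "(s, t) \<in> kappa_brel C r k q N" for s t k
    using that unfolding kappa_brel_def by blast
  then show "\<exists>A\<in>C. \<exists>B\<in>C. s \<in> rank_set r A B \<and> t \<in> rank_set r A B" if "(s, t) \<in> kappa_brel C r k q N" for s t
    using that .
  show "(s, s) \<in> kappa_brel C r k q N" if "A \<in> C" "B \<in> C" "s \<in> rank_set r A B" for A B s
    using that unfolding kappa_brel_def by blast
  show "(t, s) \<in> kappa_brel C r k q N" if "(s, t) \<in> kappa_brel C r k q N" for s t
    using that nu_brel_sym[OF N] base_rel_sym unfolding kappa_brel_def by blast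
  show "(s, w) \<in> kappa_brel C r k q N" if st: "(s, t) \<in> kappa_brel C r k q N" and tw: "(t, w) \<in> kappa_brel C r k q N" for s t w
  proof -
    obtain A B where AB: "A \<in> C" "B \<in> C" "s \<in> rank_set r A B" "t \<in> rank_set r A B" using obj[OF st] by blast
    note s = kappa_brel_iff[OF AB(1,2) rank_set_brels[OF AB(3)]] and t = kappa_brel_iff[OF AB(1,2) rank_set_brels[OF AB(4)]]
    \<comment> \<open>A permutation pair has rank exactly \<open>q + 1\<close> on both sides, so it
      cannot be chained with a pair of rank at most \<open>q\<close>.\<close>
    have no: "False" if "s \<in> rank_le q A B" "(s, t) \<in> nu_brel (q + 1) N A B \<or> (t, s) \<in> nu_brel (q + 1) N A B" for s t
      using that nu_brel_rank[OF _ sym_normal_subset[OF N]] rank_le_not_class[of s q A B "q + 1"] by fastforce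
    show ?thesis
      using st[unfolded s] tw[unfolded t] no[of t s] no[of t w] base_rel_trans[of k s t w] nu_brel_trans[OF N, of s t A B w]
      unfolding s by blast
  qed
  show "(w O s, w O t) \<in> kappa_brel C r k q N"
    if st: "(s, t) \<in> kappa_brel C r k q N" "s \<in> brels A B" "D \<in> C" "w \<in> rank_set r D A" for s t w A B D
  proof -
    have "A \<in> C \<and> B \<in> C" using obj[OF st(1)] brels_eq_objects[OF rank_set_brels st(2)] by blast
    then show ?thesis using kappa_brel_left[OF fin N kq st(1,2) _ _ st(3,4)] by blast
  qed
  show "(s O w, t O w) \<in> kappa_brel C r k q N"
    if st: "(s, t) \<in> kappa_brel C r k q N" "s \<in> brels A B" "D \<in> C" "w \<in> rank_set r B D" for s t w A B D
  proof -
    have AB: "A \<in> C \<and> B \<in> C" using obj[OF st(1)] brels_eq_objects[OF rank_set_brels st(2)] by blast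
    have kq': "dual_kind k = Ree \<or> q \<le> 1" using kq by auto
    have "(w\<inverse> O s\<inverse>, w\<inverse> O t\<inverse>) \<in> kappa_brel C r (dual_kind k) q N"
      using kappa_brel_left[OF fin N kq' kappa_brel_converse[OF N st(1)] brels_converse[OF st(2)] _ _ st(3)
          rank_set_converse[OF st(4)]] AB by blast
    from kappa_brel_converse[OF N this] show ?thesis by (simp add: converse_relcomp dual_kind_dual)
  qed
qed

lemma nabla_brel_cong:
  assumes fin: "\<And>A. A \<in> C \<Longrightarrow> finite A"
  shows "brel_cong C r (nabla_brel C r)"
proof
  have obj: "A \<in> C \<and> B \<in> C \<and> s \<in> rank_set r A B \<and> t \<in> rank_set r A B" if "(s, t) \<in> nabla_brel C r" "s \<in> brels A B" for s t A B
    using that brels_eq_objects[OF rank_set_brels that(2)] unfolding nabla_brel_def by blast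
  show "finite A" if "A \<in> C" for A using that by (rule fin)
  show "\<exists>A\<in>C. \<exists>B\<in>C. s \<in> rank_set r A B \<and> t \<in> rank_set r A B" if "(s, t) \<in> nabla_brel C r" for s t
    using that unfolding nabla_brel_def by blast
  show "(s, s) \<in> nabla_brel C r" if "A \<in> C" "B \<in> C" "s \<in> rank_set r A B" for A B s
    using that unfolding nabla_brel_def by blast
  show "(t, s) \<in> nabla_brel C r" if "(s, t) \<in> nabla_brel C r" for s t
    using that unfolding nabla_brel_def by blast
  show "(s, w) \<in> nabla_brel C r" if st: "(s, t) \<in> nabla_brel C r" "(t, w) \<in> nabla_brel C r" for s t w
  proof -
    obtain A B where AB: "A \<in> C" "B \<in> C" "s \<in> rank_set r A B" "t \<in> rank_set r A B" using st unfolding nabla_brel_def by blast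
    then show ?thesis using obj[OF st(2) rank_set_brels[OF AB(4)]] unfolding nabla_brel_def by blast
  qed
  show "(w O s, w O t) \<in> nabla_brel C r"
    if st: "(s, t) \<in> nabla_brel C r" "s \<in> brels A B" "D \<in> C" "w \<in> rank_set r D A" for s t w A B D
  proof -
    note ty = obj[OF st(1,2)]
    have "w O s \<in> rank_set r D B" "w O t \<in> rank_set r D B"
      using rank_set_comp[OF st(4) _ fin[OF st(3)] fin, of s B] rank_set_comp[OF st(4) _ fin[OF st(3)] fin, of t B]
        ty rank_set_brels by blast+
    then show ?thesis using ty st(3) unfolding nabla_brel_def by blast
  qed
  show "(s O w, t O w) \<in> nabla_brel C r"
    if st: "(s, t) \<in> nabla_brel C r" "s \<in> brels A B" "D \<in> C" "w \<in> rank_set r B D" for s t w A B D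
  proof -
    note ty = obj[OF st(1,2)]
    have "s O w \<in> rank_set r A D" "t O w \<in> rank_set r A D"
      using rank_set_comp[OF _ rank_set_brels[OF st(4)] fin fin[OF st(3)], of s r A]
        rank_set_comp[OF _ rank_set_brels[OF st(4)] fin fin[OF st(3)], of t r A] ty by blast+
    then show ?thesis using ty st(3) unfolding nabla_brel_def by blast
  qed
qed

subsection \<open>Inclusions\<close>

lemma base_rel_mono: "base_rel k s t \<Longrightarrow> kind_le k k' \<Longrightarrow> base_rel k' s t"
  by (cases k; cases k') (simp_all add: kind_le_def)

text \<open>When the level rises, the permutation pairs of the smaller congruence have to be
  absorbed. For \<open>Ree\<close> they are within the new level; for the other kinds only the step
  from 0 to 1 can occur, and in degree 1 the pairs are trivial.\<close>

lemma kappa_brel_mono: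
  assumes N: "N \<lhd> sym_group (q + 1)" and le: "qN_le (q, N) (q', N')" "kind_le k k'" and kq: "k' = Ree \<or> q' \<le> 1"
  shows "kappa_brel C r k q N \<subseteq> kappa_brel C r k' q' N'"
proof (rule subrelI)
  fix s t assume "(s, t) \<in> kappa_brel C r k q N"
  then obtain A B where AB: "A \<in> C" "B \<in> C" "s \<in> rank_set r A B" "t \<in> rank_set r A B" and
     c: "s = t \<or> (s \<in> rank_le q A B \<and> t \<in> rank_le q A B \<and> base_rel k s t) \<or> (s, t) \<in> nu_brel (q + 1) N A B"
    unfolding kappa_brel_def by blast
  have qq: "q \<le> q'" using le(1) unfolding qN_le_def by auto
  have "s = t \<or> (s \<in> rank_le q' A B \<and> t \<in> rank_le q' A B \<and> base_rel k' s t) \<or> (s, t) \<in> nu_brel (q' + 1) N' A B"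
  proof (cases "(s, t) \<in> nu_brel (q + 1) N A B")
    case False
    then show ?thesis using c rank_le_mono[OF _ qq] base_rel_mono[OF _ le(2)] by blast
  next
    case True
    show ?thesis
    proof (cases "q = q'")
      case eq: True
      then have "N \<subseteq> N'" using le(1) unfolding qN_le_def by simp
      then show ?thesis using True eq unfolding nu_brel_def by blast
    next
      case False
      then have lt: "q + 1 \<le> q'" using qq by simp
      obtain u v \<pi> where u: "u \<in> halves (q + 1) A" "v \<in> halves (q + 1) B" "\<pi> \<in> N" "s = u O v\<inverse>"
        "t = u O perm_rel (q + 1) \<pi> O v\<inverse>" using True by (rule nu_brelE)
      have p: "\<pi> permutes {1..q + 1}" using sym_normal_subset[OF N] u(3) by blast
      show ?thesis
      proof (cases "k' = Ree")
        case True': True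
        have "s \<in> rank_class (q + 1) A B" "t \<in> rank_class (q + 1) A B"
          using nu_brel_rank[OF True sym_normal_subset[OF N]] by simp_all
        then show ?thesis using rank_leI[of s _ A B, OF _ lt] rank_leI[of t _ A B, OF _ lt] True' by simp
      next
        case False
        then have "q = 0" using kq lt by simp
        then have "\<pi> = id" using p by (simp add: permutes_sing)
        then have "t = u O idr (q + 1) O v\<inverse>" unfolding u(5) perm_rel_id[symmetric] by simp
        then have "s = t" unfolding u(4)
          using brels_left_Id[OF brels_converse[OF halves_brels[OF u(2)]]] by simp
        then show ?thesis by simp
      qed
    qed
  qed
  then show "(s, t) \<in> kappa_brel C r k' q' N'" using AB unfolding kappa_brel_def by blast
qed

text \<open>This pair detects the level. Its members have different ranks, so it can enter only
  through the part of rank at most \<open>q\<close>; by \<open>flat_pair_in\<close> it does so for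
  every kind, because cutting keeps kernel and cokernel.\<close>

lemma rank_flat_pair:
  assumes A: "A \<in> C" and u: "u \<in> halves p A" and p: "1 \<le> p" "q < p" and N: "N \<lhd> sym_group (q + 1)"
  shows "(u O u\<inverse>, flat (u O u\<inverse>)) \<notin> kappa_brel C r k q N"
proof
  let ?s = "u O u\<inverse>"
  assume st: "(?s, flat ?s) \<in> kappa_brel C r k q N"
  have s: "?s \<in> rank_class p A A" by (rule rank_classI[OF u u])
  have f: "flat ?s \<in> rank_class 0 A A" by (rule flat_rank0[OF rank_class_brels[OF s]])
  have "?s \<noteq> flat ?s" using rank_class_unique[OF s] f p(1) by fastforce
  moreover have "?s \<notin> rank_le q A A" using rank_le_not_class[OF _ s, of q] p(2) by auto
  moreover have "(?s, flat ?s) \<notin> nu_brel (q + 1) N A A"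
    using nu_brel_rank[OF _ sym_normal_subset[OF N]] rank_class_unique[OF f] by fastforce
  ultimately show False using st kappa_brel_iff[OF A A rank_class_brels[OF s]] by blast
qed

lemma flat_pair_in:
  assumes A: "A \<in> C" and u: "u \<in> halves p A" and p: "p \<le> q" "enat p \<le> r"
  shows "(u O u\<inverse>, flat (u O u\<inverse>)) \<in> kappa_brel C r k q N"
proof -
  let ?s = "u O u\<inverse>"
  have s: "?s \<in> rank_class p A A" by (rule rank_classI[OF u u])
  have f: "flat ?s \<in> rank_class 0 A A" by (rule flat_rank0[OF rank_class_brels[OF s]])
  have "base_rel k ?s (flat ?s)"
    using Domain_flat[OF rank_class_brels[OF s]] Range_flat[OF rank_class_brels[OF s]] by (cases k) simp_all
  moreover have "enat 0 \<le> r" by (simp add: zero_enat_def[symmetric])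
  ultimately show ?thesis
    unfolding kappa_brel_iff[OF A A rank_class_brels[OF s]]
    using rank_setI[OF s p(2)] rank_setI[OF f] rank_leI[OF s p(1)] rank_leI[OF f] by simp
qed

lemma kappa_brel_not_nabla:
  assumes A: "A \<in> C" and u: "u \<in> halves (q + 1) A" and r: "enat (q + 1) \<le> r" and N: "N \<lhd> sym_group (q + 1)"
  shows "kappa_brel C r k q N \<noteq> nabla_brel C r"
proof
  assume eq: "kappa_brel C r k q N = nabla_brel C r"
  let ?s = "u O u\<inverse>"
  have s: "?s \<in> rank_class (q + 1) A A" by (rule rank_classI[OF u u])
  have "(?s, flat ?s) \<in> nabla_brel C r"
    using A rank_setI[OF s r] rank_setI[OF flat_rank0[OF rank_class_brels[OF s]]]
    unfolding nabla_brel_def by (auto simp: zero_enat_def[symmetric])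
  then show False using rank_flat_pair[OF A u _ _ N, of r k] eq by simp
qed

text \<open>The level is detected by the cut pair of rank \<open>q\<close>, the subgroup by the
  pairs \<open>(v O v\<inverse>, v O perm_rel (q + 1) \<pi> O v\<inverse>)\<close>, from which
  \<open>half_sandwich\<close> recovers \<open>\<pi>\<close>.\<close>

lemma kappa_brel_subset_qN:
  assumes A: "A \<in> C" "u \<in> halves q A" and B: "B \<in> C" "v \<in> halves (q + 1) B"
    and r: "enat (q + 1) \<le> r" and N: "N \<lhd> sym_group (q + 1)" and N': "N' \<lhd> sym_group (q' + 1)"
    and sub: "kappa_brel C r k q N \<subseteq> kappa_brel C r k' q' N'"
  shows "qN_le (q, N) (q', N')"
proof -
  have r': "enat q \<le> r" using r order_trans[of "enat q" "enat (q + 1)" r] by simp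
  have "q \<le> q'"
  proof (rule ccontr)
    assume "\<not> q \<le> q'"
    then show False
      using rank_flat_pair[OF A _ _ N', of r k'] flat_pair_in[OF A order_refl r', of k N] sub by auto
  qed
  moreover have "N \<subseteq> N'" if q: "q = q'"
  proof
    fix \<pi> assume p: "\<pi> \<in> N"
    have pp: "\<pi> permutes {1..q + 1}" using sym_normal_subset[OF N] p by blast
    let ?s = "v O v\<inverse>" and ?t = "v O perm_rel (q + 1) \<pi> O v\<inverse>"
    have s: "?s \<in> rank_class (q + 1) B B" by (rule rank_classI[OF B(2,2)])
    have nu: "(?s, ?t) \<in> nu_brel (q + 1) N B B" by (rule nu_brelI[OF B(2,2) p])
    then have "?t \<in> rank_class (q + 1) B B" using nu_brel_rank[OF _ sym_normal_subset[OF N]] by blast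
    then have "(?s, ?t) \<in> kappa_brel C r k q N"
      unfolding kappa_brel_iff[OF B(1,1) rank_class_brels[OF s]] using nu rank_setI[OF s r] rank_setI[OF _ r] by blast
    then have "(?s, ?t) \<in> kappa_brel C r k' q' N'" using sub by blast
    moreover have "?s \<notin> rank_le q' B B" using rank_le_not_class[OF _ s, of q'] q by auto
    ultimately have "?s = ?t \<or> (?s, ?t) \<in> nu_brel (q' + 1) N' B B"
      unfolding kappa_brel_iff[OF B(1,1) rank_class_brels[OF s]] by blast
    then have nu': "?s = ?t \<or> (?s, ?t) \<in> nu_brel (q + 1) N' B B" unfolding q .
    have inj: "\<pi> = \<rho>" if "?t = v O perm_rel (q + 1) \<rho> O v\<inverse>" "\<rho> permutes {1..q + 1}" for \<rho>
      using half_sandwich[OF B(2,2) halves_brels[OF perm_rel_halves[OF pp]]]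
        half_sandwich[OF B(2,2) halves_brels[OF perm_rel_halves[OF that(2)]]] that perm_rel_inject[OF _ pp that(2)] by metis
    have sid: "?s = v O perm_rel (q + 1) id O v\<inverse>"
      unfolding perm_rel_id using brels_left_Id[OF brels_converse[OF halves_brels[OF B(2)]]] by simp
    from nu' show "\<pi> \<in> N'"
    proof
      assume "?s = ?t"
      then have "?t = v O perm_rel (q + 1) id O v\<inverse>" using sid by (rule trans[OF sym])
      then have "\<pi> = id" by (rule inj[OF _ permutes_id])
      then show ?thesis using sym_normal_id[OF N'] by blast
    next
      assume "(?s, ?t) \<in> nu_brel (q + 1) N' B B"
      then obtain \<rho> where "\<rho> \<in> N'" "?t = v O perm_rel (q + 1) \<rho> O v\<inverse>"
        using nu_brel_factor[OF _ B(2,2), of N' ?t] N' q by blast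
      then show ?thesis using inj[of \<rho>] sym_normal_subset[OF N'] q by blast
    qed
  qed
  ultimately show ?thesis unfolding qN_le_def by auto
qed

text \<open>A half of rank 2 provides a proper nonempty subset of \<open>A\<close>, so the trivial
  and the full algebra on \<open>A\<close> differ. Rectangles formed from them differ in the range
  only or in the domain only, which tells the kinds apart.\<close>

lemma kappa_brel_subset_kind:
  assumes A: "A \<in> C" "u \<in> halves 2 A" and N': "N' \<lhd> sym_group (q' + 1)"
    and sub: "kappa_brel C r k q N \<subseteq> kappa_brel C r k' q' N'"
  shows "kind_le k k'"
proof -
  obtain R where R: "(R, {1}) \<in> u" using halves_surj[OF A(2), of "{1}"] by auto
  have RA: "R \<subseteq> A" using brels_sub[OF halves_brels[OF A(2)] R] by simp
  have "R \<noteq> {}" using halves_empty[OF A(2), of "{1}"] R by auto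
  moreover have "R \<noteq> A"
  proof
    assume "R = A"
    then have "{1} = {1..2::nat}" using halves_full[OF A(2)] R by blast
    moreover have "2 \<in> {1..2::nat}" by simp
    ultimately show False by (metis numeral_eq_one_iff semiring_norm(85) singletonD)
  qed
  ultimately have "{{}, A} \<noteq> Pow A" using RA by blast
  then obtain T P where TP: "T \<noteq> P" and T: "T \<in> subalgs A" and P: "P \<in> subalgs A"
    using subalgs_triv[of A] subalgs_Pow[of A] that by metis
  have r0: "enat 0 \<le> r" by (simp add: zero_enat_def[symmetric])
  \<comment> \<open>Used for both congruences. For the left one no normality of \<open>N\<close> is
    assumed, but there the pair is known to satisfy \<open>base_rel\<close>.\<close>
  have iff: "(s, t) \<in> kappa_brel C r k q N \<longleftrightarrow> base_rel k s t"
    if s: "s \<in> rank_class 0 A A" and t: "t \<in> rank_class 0 A A" and st: "s \<noteq> t" and N: "N \<lhd> sym_group (q + 1) \<or> base_rel k s t" for s t k q N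
  proof -
    have "(s, t) \<in> nu_brel (q + 1) N A A \<Longrightarrow> base_rel k s t"
      using N nu_brel_rank[OF _ sym_normal_subset] rank_class_unique[OF s] by fastforce
    then show ?thesis
      unfolding kappa_brel_iff[OF A(1,1) rank_class_brels[OF s]]
      using st rank_setI[OF s r0] rank_setI[OF t r0] rank_leI[OF s, of q] rank_leI[OF t, of q] by auto
  qed
  have imp: "base_rel k' s t" if "s \<in> rank_class 0 A A" "t \<in> rank_class 0 A A" "s \<noteq> t" "base_rel k s t" for s t
    using iff[OF that(1-3), of N q k] iff[OF that(1-3), of N' q' k'] N' sub that(4) by blast
  have e: "{} \<in> T" "{} \<in> P" using subalgs_empty T P by auto
  have D: "Domain (T \<times> P) = T" "Domain (T \<times> T) = T" "Domain (P \<times> T) = P"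
    "Range (T \<times> P) = P" "Range (T \<times> T) = T" "Range (P \<times> T) = T" using e by auto
  have ne: "T \<times> P \<noteq> T \<times> T" "P \<times> T \<noteq> T \<times> T" using D TP by metis+
  have "base_rel k (T \<times> P) (T \<times> T) \<Longrightarrow> base_rel k' (T \<times> P) (T \<times> T)"
    by (rule imp[OF Times_rank0[OF T P] Times_rank0[OF T T] ne(1)])
  moreover have "base_rel k (P \<times> T) (T \<times> T) \<Longrightarrow> base_rel k' (P \<times> T) (T \<times> T)"
    by (rule imp[OF Times_rank0[OF P T] Times_rank0[OF T T] ne(2)])
  ultimately show ?thesis
    using TP not_sym[OF TP] unfolding kind_le_def by (cases k; cases k') (simp_all add: D)
qed

section \<open>Lattice-theoretic tools: transfer of joins and meets along the order\<close>

section \<open>Order isomorphisms of lattices\<close>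

lemma partial_order_eqI:
  assumes "eq L = (=)" "\<And>x. x \<in> carrier L \<Longrightarrow> le L x x"
    "\<And>x y. x \<in> carrier L \<Longrightarrow> y \<in> carrier L \<Longrightarrow> le L x y \<Longrightarrow> le L y x \<Longrightarrow> x = y"
    "\<And>x y z. x \<in> carrier L \<Longrightarrow> y \<in> carrier L \<Longrightarrow> z \<in> carrier L \<Longrightarrow> le L x y \<Longrightarrow> le L y z \<Longrightarrow> le L x z"
  shows "partial_order L"
  by unfold_locales (simp_all add: assms(1), use assms(2-4) in \<open>blast+\<close>)

lemma latticeI:
  assumes "partial_order L"
    "\<And>x y. x \<in> carrier L \<Longrightarrow> y \<in> carrier L \<Longrightarrow> \<exists>s. least L s (Upper L {x, y})"
    "\<And>x y. x \<in> carrier L \<Longrightarrow> y \<in> carrier L \<Longrightarrow> \<exists>s. greatest L s (Lower L {x, y})"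
  shows "lattice L"
proof -
  interpret partial_order L by (rule assms(1))
  show ?thesis by unfold_locales (use assms in auto)
qed

lemma least_pair_iff:
  "x \<in> carrier L \<Longrightarrow> y \<in> carrier L \<Longrightarrow> least L s (Upper L {x, y}) \<longleftrightarrow>
    s \<in> carrier L \<and> le L x s \<and> le L y s \<and> (\<forall>z\<in>carrier L. le L x z \<longrightarrow> le L y z \<longrightarrow> le L s z)"
  unfolding least_def Upper_def by auto

lemma greatest_pair_iff:
  "x \<in> carrier L \<Longrightarrow> y \<in> carrier L \<Longrightarrow> greatest L s (Lower L {x, y}) \<longleftrightarrow>
    s \<in> carrier L \<and> le L s x \<and> le L s y \<and> (\<forall>z\<in>carrier L. le L z x \<longrightarrow> le L z y \<longrightarrow> le L z s)"
  unfolding greatest_def Lower_def by auto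

lemma lattice_bounds:
  assumes "lattice L" "x \<in> carrier L" "y \<in> carrier L"
  shows "least L (join L x y) (Upper L {x, y})" "greatest L (meet L x y) (Lower L {x, y})"
proof -
  interpret lattice L by (rule assms(1))
  show "least L (join L x y) (Upper L {x, y})" unfolding join_def by (rule sup_of_two_least[OF assms(2,3)])
  show "greatest L (meet L x y) (Lower L {x, y})" unfolding meet_def by (rule inf_of_two_greatest[OF assms(2,3)])
qed

lemma lattice_least_unique:
  assumes "partial_order L" "x \<in> carrier L" "y \<in> carrier L" "least L s (Upper L {x, y})" "least L t (Upper L {x, y})"
  shows "s = t"
proof -
  interpret partial_order L by (rule assms(1))
  show ?thesis using assms(4,5) unfolding least_pair_iff[OF assms(2,3)] by (auto intro: le_antisym)
qed

lemma lattice_greatest_unique: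
  assumes "partial_order L" "x \<in> carrier L" "y \<in> carrier L" "greatest L s (Lower L {x, y})" "greatest L t (Lower L {x, y})"
  shows "s = t"
proof -
  interpret partial_order L by (rule assms(1))
  show ?thesis using assms(4,5) unfolding greatest_pair_iff[OF assms(2,3)] by (auto intro: le_antisym)
qed

lemma order_iso_least:
  assumes g: "bij_betw g (carrier L) (carrier M)"
    and le: "\<And>x y. x \<in> carrier L \<Longrightarrow> y \<in> carrier L \<Longrightarrow> le L x y \<longleftrightarrow> le M (g x) (g y)"
    and xy: "x \<in> carrier L" "y \<in> carrier L"
  shows "least L s (Upper L {x, y}) \<Longrightarrow> least M (g s) (Upper M {g x, g y})"
    "greatest L s (Lower L {x, y}) \<Longrightarrow> greatest M (g s) (Lower M {g x, g y})"
proof -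
  have im: "carrier M = g ` carrier L" using g unfolding bij_betw_def by simp
  have gxy: "g x \<in> carrier M" "g y \<in> carrier M" using xy unfolding im by auto
  show "least L s (Upper L {x, y}) \<Longrightarrow> least M (g s) (Upper M {g x, g y})"
    unfolding least_pair_iff[OF xy] least_pair_iff[OF gxy] unfolding im using le xy by auto
  show "greatest L s (Lower L {x, y}) \<Longrightarrow> greatest M (g s) (Lower M {g x, g y})"
    unfolding greatest_pair_iff[OF xy] greatest_pair_iff[OF gxy] unfolding im using le xy by auto
qed

text \<open>Least upper and greatest lower bounds are defined by the order alone, so they are
  carried over, and the lattice property of \<open>M\<close> is inherited from
  \<open>L\<close>.\<close>

lemma order_iso_lattice_iso:
  assumes L: "lattice L" and M: "eq M = (=)" and g: "bij_betw g (carrier L) (carrier M)"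
    and le: "\<And>x y. x \<in> carrier L \<Longrightarrow> y \<in> carrier L \<Longrightarrow> le L x y \<longleftrightarrow> le M (g x) (g y)"
  shows "lattice_iso L M g"
proof -
  interpret L: lattice L by (rule L)
  have im: "carrier M = g ` carrier L" using g unfolding bij_betw_def by simp
  have oi: "least L s (Upper L {a, b}) \<Longrightarrow> least M (g s) (Upper M {g a, g b})"
    "greatest L s (Lower L {a, b}) \<Longrightarrow> greatest M (g s) (Lower M {g a, g b})"
    if "a \<in> carrier L" "b \<in> carrier L" for a b s
    using order_iso_least[of g L M a b s, OF g _ that] le by blast+
  have pM: "partial_order M"
  proof (rule partial_order_eqI[OF M])
    show "le M x x" if "x \<in> carrier M" for x using that le L.le_refl unfolding im by blast
    show "x = y" if "x \<in> carrier M" "y \<in> carrier M" "le M x y" "le M y x" for x y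
    proof -
      obtain a b where ab: "x = g a" "y = g b" "a \<in> carrier L" "b \<in> carrier L" using \<open>x \<in> carrier M\<close> \<open>y \<in> carrier M\<close> unfolding im by blast
      then have "a = b" using \<open>le M x y\<close> \<open>le M y x\<close> le[of a b] le[of b a] by (intro L.le_antisym) auto
      then show ?thesis using ab by simp
    qed
    show "le M x z" if xyz: "x \<in> carrier M" "y \<in> carrier M" "z \<in> carrier M" "le M x y" "le M y z" for x y z
    proof -
      obtain a b c where ab: "x = g a" "y = g b" "z = g c" "a \<in> carrier L" "b \<in> carrier L" "c \<in> carrier L"
        using xyz(1-3) unfolding im by blast
      then have "le L a c" using xyz(4,5) le[of a b] le[of b c] L.le_trans[of a b c] by auto
      then show ?thesis using ab le by simp
    qed
  qed
  have "lattice M"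
  proof (rule latticeI[OF pM])
    fix x y assume "x \<in> carrier M" "y \<in> carrier M"
    then obtain a b where ab: "x = g a" "y = g b" "a \<in> carrier L" "b \<in> carrier L" unfolding im by blast
    show "\<exists>s. least M s (Upper M {x, y})" "\<exists>s. greatest M s (Lower M {x, y})"
      using oi(1)[OF ab(3,4) lattice_bounds(1)[OF L ab(3,4)]] oi(2)[OF ab(3,4) lattice_bounds(2)[OF L ab(3,4)]]
      unfolding ab(1,2) by blast+
  qed
  moreover have "g (join L a b) = join M (g a) (g b)" "g (meet L a b) = meet M (g a) (g b)"
    if ab: "a \<in> carrier L" "b \<in> carrier L" for a b
  proof -
    have gab: "g a \<in> carrier M" "g b \<in> carrier M" using ab unfolding im by auto
    show "g (join L a b) = join M (g a) (g b)"
      using lattice_least_unique[OF pM gab oi(1)[OF ab lattice_bounds(1)[OF L ab]] lattice_bounds(1)[OF \<open>lattice M\<close> gab]] .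
    show "g (meet L a b) = meet M (g a) (g b)"
      using lattice_greatest_unique[OF pM gab oi(2)[OF ab lattice_bounds(2)[OF L ab]] lattice_bounds(2)[OF \<open>lattice M\<close> gab]] .
  qed
  ultimately show ?thesis unfolding lattice_iso_def join_pres_def meet_pres_def using L g by blast
qed

text \<open>Preservation of joins makes the injective map reflect the order, since \<open>x\<close>
  is below \<open>y\<close> iff their join is \<open>y\<close>.\<close>

lemma lattice_iso_inverse:
  assumes f: "lattice_iso L M g" and L: "eq L = (=)"
  shows "lattice_isomorphic M L"
proof -
  have g: "bij_betw g (carrier L) (carrier M)" and LM: "lattice L" "lattice M"
    using f unfolding lattice_iso_def join_pres_def by auto
  have mono: "isotone L M g"
    using join_pres_isotone[OF bij_betw_imp_funcset[OF g]] f unfolding lattice_iso_def by blast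
  interpret L: lattice L by (rule LM(1))
  interpret M: lattice M by (rule LM(2))
  have le: "le L x y \<longleftrightarrow> le M (g x) (g y)" if xy: "x \<in> carrier L" "y \<in> carrier L" for x y
  proof
    show "le L x y \<Longrightarrow> le M (g x) (g y)" using mono xy unfolding isotone_def by blast
    assume l: "le M (g x) (g y)"
    have gxy: "g x \<in> carrier M" "g y \<in> carrier M" using xy g unfolding bij_betw_def by auto
    have "g (join L x y) = join M (g x) (g y)" using f xy unfolding lattice_iso_def join_pres_def by blast
    moreover have "least M (g y) (Upper M {g x, g y})"
      unfolding least_pair_iff[OF gxy] using gxy l M.le_refl by blast
    then have "join M (g x) (g y) = g y"
      using lattice_least_unique[OF M.partial_order_axioms gxy lattice_bounds(1)[OF LM(2) gxy]] by blast
    ultimately have "g (join L x y) = g y" by simp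
    then have "join L x y = y" using g xy L.join_closed[OF xy] unfolding bij_betw_def by (meson inj_onD)
    then show "le L x y" using L.join_left[OF xy] by simp
  qed
  have "lattice_iso M L (inv_into (carrier L) g)"
  proof (rule order_iso_lattice_iso[OF LM(2) L bij_betw_inv_into[OF g]])
    fix x y assume xy: "x \<in> carrier M" "y \<in> carrier M"
    then obtain a b where ab: "x = g a" "y = g b" "a \<in> carrier L" "b \<in> carrier L" using g unfolding bij_betw_def by blast
    then show "le M x y \<longleftrightarrow> le L (inv_into (carrier L) g x) (inv_into (carrier L) g y)"
      using le g unfolding bij_betw_def by simp
  qed
  then show ?thesis unfolding lattice_isomorphic_def by blast
qed

lemma lattice_Eq_lattice: "lattice (Eq_lattice Z)"
proof (rule latticeI)
  have simps: "carrier (Eq_lattice Z) = Eqs Z" "le (Eq_lattice Z) = (\<subseteq>)" "eq (Eq_lattice Z) = (=)"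
    unfolding Eq_lattice_def incl_order_def by simp_all
  show "partial_order (Eq_lattice Z)" by (rule partial_order_eqI) (auto simp: simps)
  fix e f assume c: "e \<in> carrier (Eq_lattice Z)" "f \<in> carrier (Eq_lattice Z)"
  then have ef: "equiv Z e" "equiv Z f" unfolding simps Eqs_def by auto
  have sub: "e \<subseteq> Z \<times> Z" "f \<subseteq> Z \<times> Z" using ef equiv_type by blast+
  have "equiv Z ((e \<union> f)\<^sup>+)"
  proof (rule equivI)
    show "(e \<union> f)\<^sup>+ \<subseteq> Z \<times> Z" using sub trancl_subset_Sigma[of "e \<union> f" Z] by blast
    show "refl_on Z ((e \<union> f)\<^sup>+)" using ef(1) unfolding equiv_def refl_on_def by blast
    show "sym ((e \<union> f)\<^sup>+)" using ef unfolding equiv_def by (intro sym_trancl sym_Un) auto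
    show "trans ((e \<union> f)\<^sup>+)" by (rule trans_trancl)
  qed
  moreover have "(e \<union> f)\<^sup>+ \<subseteq> g" if "equiv Z g" "e \<subseteq> g" "f \<subseteq> g" for g
    using trancl_mono_subset[of "e \<union> f" g] that trancl_id[of g] unfolding equiv_def by simp
  ultimately show "\<exists>s. least (Eq_lattice Z) s (Upper (Eq_lattice Z) {e, f})"
    unfolding least_pair_iff[OF c] unfolding simps Eqs_def by (intro exI[of _ "(e \<union> f)\<^sup>+"]) auto
  have "equiv Z (e \<inter> f)" using ef sub unfolding equiv_def refl_on_def sym_def trans_def by blast
  then show "\<exists>s. greatest (Eq_lattice Z) s (Lower (Eq_lattice Z) {e, f})"
    unfolding greatest_pair_iff[OF c] unfolding simps Eqs_def by (intro exI[of _ "e \<inter> f"]) auto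
qed

lemma eq_Eq_lattice: "eq (Eq_lattice Z) = (=)"
  unfolding Eq_lattice_def incl_order_def by simp

lemma lattice_prod_order:
  assumes L: "lattice L" "eq L = (=)" and M: "lattice M" "eq M = (=)"
  shows "lattice (prod_order L M)"
proof (rule latticeI)
  interpret L: lattice L by (rule L(1))
  interpret M: lattice M by (rule M(1))
  have simps: "carrier (prod_order L M) = carrier L \<times> carrier M" "eq (prod_order L M) = (=)"
    "le (prod_order L M) p p' \<longleftrightarrow> le L (fst p) (fst p') \<and> le M (snd p) (snd p')" for p p'
    unfolding prod_order_def by (auto split: prod.splits)
  show "partial_order (prod_order L M)"
    by (rule partial_order_eqI) (auto simp: simps intro: L.le_antisym M.le_antisym L.le_trans M.le_trans)
  fix p p' assume c: "p \<in> carrier (prod_order L M)" "p' \<in> carrier (prod_order L M)"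
  then have m: "fst p \<in> carrier L" "fst p' \<in> carrier L" "snd p \<in> carrier M" "snd p' \<in> carrier M" unfolding simps by auto
  show "\<exists>s. least (prod_order L M) s (Upper (prod_order L M) {p, p'})"
    unfolding least_pair_iff[OF c] unfolding simps
    using lattice_bounds(1)[OF L(1) m(1,2)] lattice_bounds(1)[OF M(1) m(3,4)]
    unfolding least_pair_iff[OF m(1,2)] least_pair_iff[OF m(3,4)]
    by (intro exI[of _ "(join L (fst p) (fst p'), join M (snd p) (snd p'))"]) auto
  show "\<exists>s. greatest (prod_order L M) s (Lower (prod_order L M) {p, p'})"
    unfolding greatest_pair_iff[OF c] unfolding simps
    using lattice_bounds(2)[OF L(1) m(1,2)] lattice_bounds(2)[OF M(1) m(3,4)]
    unfolding greatest_pair_iff[OF m(1,2)] greatest_pair_iff[OF m(3,4)]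
    by (intro exI[of _ "(meet L (fst p) (fst p'), meet M (snd p) (snd p'))"]) auto
qed

lemma lattice_Prod_order:
  assumes L: "\<And>i. i \<in> J \<Longrightarrow> lattice (L i)" "\<And>i. i \<in> J \<Longrightarrow> eq (L i) = (=)"
  shows "lattice (Prod_order J L)"
proof (rule latticeI)
  have simps: "carrier (Prod_order J L) = (\<Pi>\<^sub>E i\<in>J. carrier (L i))" "eq (Prod_order J L) = (=)"
    "le (Prod_order J L) f g \<longleftrightarrow> (\<forall>i\<in>J. le (L i) (f i) (g i))" for f g
    unfolding Prod_order_def by auto
  have po: "partial_order (L i)" if "i \<in> J" for i
    using L(1)[OF that] unfolding lattice_def upper_semilattice_def by blast
  show "partial_order (Prod_order J L)"
  proof (rule partial_order_eqI[OF simps(2)])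
    show "le (Prod_order J L) f f" if "f \<in> carrier (Prod_order J L)" for f
      unfolding simps
    proof
      fix i assume i: "i \<in> J"
      interpret partial_order "L i" by (rule po[OF i])
      show "le (L i) (f i) (f i)" using that i unfolding simps by auto
    qed
    show "f = g" if fg: "f \<in> carrier (Prod_order J L)" "g \<in> carrier (Prod_order J L)" "le (Prod_order J L) f g" "le (Prod_order J L) g f" for f g
    proof (rule PiE_ext[of f J "\<lambda>i. carrier (L i)" g])
      show "f \<in> (\<Pi>\<^sub>E i\<in>J. carrier (L i))" "g \<in> (\<Pi>\<^sub>E i\<in>J. carrier (L i))" using fg unfolding simps by auto
      fix i assume i: "i \<in> J"
      interpret partial_order "L i" by (rule po[OF i])
      show "f i = g i" using fg i unfolding simps by (intro le_antisym) auto
    qed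
    show "le (Prod_order J L) f h" if fg: "f \<in> carrier (Prod_order J L)" "g \<in> carrier (Prod_order J L)" "h \<in> carrier (Prod_order J L)"
      "le (Prod_order J L) f g" "le (Prod_order J L) g h" for f g h
      unfolding simps
    proof
      fix i assume i: "i \<in> J"
      interpret partial_order "L i" by (rule po[OF i])
      show "le (L i) (f i) (h i)" using fg i unfolding simps by (intro le_trans[of "f i" "g i" "h i"]) auto
    qed
  qed
  fix f g assume c: "f \<in> carrier (Prod_order J L)" "g \<in> carrier (Prod_order J L)"
  then have m: "f i \<in> carrier (L i)" "g i \<in> carrier (L i)" if "i \<in> J" for i using that unfolding simps by auto
  show "\<exists>s. least (Prod_order J L) s (Upper (Prod_order J L) {f, g})"
  proof
    have b: "join (L i) (f i) (g i) \<in> carrier (L i) \<and> le (L i) (f i) (join (L i) (f i) (g i)) \<and> le (L i) (g i) (join (L i) (f i) (g i)) \<and>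
      (\<forall>z\<in>carrier (L i). le (L i) (f i) z \<longrightarrow> le (L i) (g i) z \<longrightarrow> le (L i) (join (L i) (f i) (g i)) z)" if i: "i \<in> J" for i
      using lattice_bounds(1)[OF L(1)[OF i] m(1)[OF i] m(2)[OF i]] unfolding least_pair_iff[OF m(1)[OF i] m(2)[OF i]] .
    show "least (Prod_order J L) (\<lambda>i\<in>J. join (L i) (f i) (g i)) (Upper (Prod_order J L) {f, g})"
      unfolding least_pair_iff[OF c] unfolding simps using b by (auto simp: PiE_iff)
  qed
  show "\<exists>s. greatest (Prod_order J L) s (Lower (Prod_order J L) {f, g})"
  proof
    have b: "meet (L i) (f i) (g i) \<in> carrier (L i) \<and> le (L i) (meet (L i) (f i) (g i)) (f i) \<and> le (L i) (meet (L i) (f i) (g i)) (g i) \<and>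
      (\<forall>z\<in>carrier (L i). le (L i) z (f i) \<longrightarrow> le (L i) z (g i) \<longrightarrow> le (L i) z (meet (L i) (f i) (g i)))" if i: "i \<in> J" for i
      using lattice_bounds(2)[OF L(1)[OF i] m(1)[OF i] m(2)[OF i]] unfolding greatest_pair_iff[OF m(1)[OF i] m(2)[OF i]] .
    show "greatest (Prod_order J L) (\<lambda>i\<in>J. meet (L i) (f i) (g i)) (Lower (Prod_order J L) {f, g})"
      unfolding greatest_pair_iff[OF c] unfolding simps using b by (auto simp: PiE_iff)
  qed
qed

lemma lattice_two_chain: "lattice two_chain"
proof (rule latticeI)
  have simps: "carrier two_chain = UNIV" "le two_chain = (\<le>)" "eq two_chain = (=)" unfolding two_chain_def by simp_all
  show "partial_order two_chain" by (rule partial_order_eqI) (auto simp: simps)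
  fix x y assume c: "x \<in> carrier two_chain" "y \<in> carrier two_chain"
  show "\<exists>s. least two_chain s (Upper two_chain {x, y})"
    unfolding least_pair_iff[OF c] unfolding simps by (intro exI[of _ "x \<or> y"]) auto
  show "\<exists>s. greatest two_chain s (Lower two_chain {x, y})"
    unfolding greatest_pair_iff[OF c] unfolding simps by (intro exI[of _ "x \<and> y"]) auto
qed

section \<open>Congruences of a rectangular band split into equivalences of its two
  coordinates\<close>

section \<open>Congruences of partial rectangular bands\<close>

lemma the_object:
  assumes "disjoint_family_on X C" "A \<in> C" "x \<in> X A"
  shows "(THE A. A \<in> C \<and> x \<in> X A) = A"
  using assms unfolding disjoint_family_on_def by (intro the_equality) auto

lemma prb_simps:
  assumes "prb_data C X Y" "A \<in> C" "B \<in> C" "x \<in> X A" "y \<in> Y B"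
  shows "src (prb C X Y) (x, y) = A" "tgt (prb C X Y) (x, y) = B" "(x, y) \<in> carrier (prb C X Y)"
  using assms the_object[of X C A x] the_object[of Y C B y] unfolding prb_def prb_data_def by auto

lemma prb_carrierE:
  assumes "p \<in> carrier (prb C X Y)"
  obtains A B x y where "A \<in> C" "B \<in> C" "x \<in> X A" "y \<in> Y B" "p = (x, y)"
  using assms unfolding prb_def by auto

lemma prb_prd: "prd (prb C X Y) p q = (fst p, snd q)"
  unfolding prb_def by simp

lemma prb_sigma_iff:
  assumes d: "prb_data C X Y" and A: "A \<in> C" "B \<in> C" "x \<in> X A" "y \<in> Y B"
    and E: "\<forall>A\<in>C. E1 A \<in> Eqs (X A)" "\<forall>A\<in>C. E2 A \<in> Eqs (Y A)"
  shows "((x, y), (x', y')) \<in> prb_sigma C X Y E1 E2 \<longleftrightarrow> (x, x') \<in> E1 A \<and> (y, y') \<in> E2 B"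
proof -
  have sub: "E1 A \<subseteq> X A \<times> X A" "E2 B \<subseteq> Y B \<times> Y B" using E A equiv_type unfolding Eqs_def by blast+
  have uA: "A' = A" if "A' \<in> C" "x \<in> X A'" for A'
    using that A d unfolding prb_data_def disjoint_family_on_def by blast
  have uB: "B' = B" if "B' \<in> C" "y \<in> Y B'" for B'
    using that A d unfolding prb_data_def disjoint_family_on_def by blast
  have "((x, y), (x', y')) \<in> prb_sigma C X Y E1 E2 \<longleftrightarrow>
    (\<exists>A\<in>C. \<exists>B\<in>C. (x \<in> X A \<and> y \<in> Y B) \<and> (x' \<in> X A \<and> y' \<in> Y B) \<and> (x, x') \<in> E1 A \<and> (y, y') \<in> E2 B)"
    unfolding prb_sigma_def by simp
  then show ?thesis using uA uB A sub by blast
qed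

lemma prb_sigma_carrier: "(p, q) \<in> prb_sigma C X Y E1 E2 \<Longrightarrow> p \<in> carrier (prb C X Y) \<and> q \<in> carrier (prb C X Y)"
  unfolding prb_sigma_def prb_def by auto

lemma prb_sigma_cong:
  assumes d: "prb_data C X Y" and E: "\<forall>A\<in>C. E1 A \<in> Eqs (X A)" "\<forall>A\<in>C. E2 A \<in> Eqs (Y A)"
  shows "prb_sigma C X Y E1 E2 \<in> Cong (prb C X Y)"
proof -
  let ?s = "prb_sigma C X Y E1 E2"
  note iff = prb_sigma_iff[OF d _ _ _ _ E]
  have eq: "equiv (X A) (E1 A)" "equiv (Y A) (E2 A)" if "A \<in> C" for A using E that unfolding Eqs_def by auto
  have both: "\<exists>A B x y x' y'. A \<in> C \<and> B \<in> C \<and> x \<in> X A \<and> y \<in> Y B \<and> x' \<in> X A \<and> y' \<in> Y B \<and> p = (x, y) \<and> q = (x', y')"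
    if "(p, q) \<in> ?s" for p q
    using that unfolding prb_sigma_def by (cases p; cases q) (auto; blast)
  have "equiv (carrier (prb C X Y)) ?s"
  proof (rule equivI)
    show "?s \<subseteq> carrier (prb C X Y) \<times> carrier (prb C X Y)" by (auto dest: prb_sigma_carrier)
    show "refl_on (carrier (prb C X Y)) ?s"
    proof (rule refl_onI)
      fix p assume "p \<in> carrier (prb C X Y)"
      then obtain A B x y where p: "A \<in> C" "B \<in> C" "x \<in> X A" "y \<in> Y B" "p = (x, y)" by (rule prb_carrierE)
      then show "(p, p) \<in> ?s" using iff[OF p(1-4), of x y] eq unfolding equiv_def refl_on_def by blast
    qed
    show "sym ?s"
    proof (rule symI)
      fix p q assume pq: "(p, q) \<in> ?s"
      obtain A B x y x' y' where h: "A \<in> C" "B \<in> C" "x \<in> X A" "y \<in> Y B" "x' \<in> X A" "y' \<in> Y B" "p = (x, y)" "q = (x', y')"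
        using both[OF pq] by blast
      show "(q, p) \<in> ?s"
        using pq iff[OF h(1-4), of x' y'] iff[OF h(1,2,5,6), of x y] eq h unfolding equiv_def sym_def by blast
    qed
    show "trans ?s"
    proof (rule transI)
      fix p q r assume pq: "(p, q) \<in> ?s" and qr: "(q, r) \<in> ?s"
      obtain A B x y x' y' where h: "A \<in> C" "B \<in> C" "x \<in> X A" "y \<in> Y B" "x' \<in> X A" "y' \<in> Y B" "p = (x, y)" "q = (x', y')"
        using both[OF pq] by blast
      obtain x'' y'' where r: "r = (x'', y'')" by (cases r)
      show "(p, r) \<in> ?s"
        using pq qr iff[OF h(1-4), of x' y'] iff[OF h(1,2,5,6), of x'' y''] iff[OF h(1-4), of x'' y''] eq h r
        unfolding equiv_def trans_def by blast
    qed
  qed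
  moreover have "?s \<subseteq> psim (prb C X Y)"
  proof (rule subrelI)
    fix p q assume pq: "(p, q) \<in> ?s"
    obtain A B x y x' y' where h: "A \<in> C" "B \<in> C" "x \<in> X A" "y \<in> Y B" "x' \<in> X A" "y' \<in> Y B" "p = (x, y)" "q = (x', y')"
      using both[OF pq] by blast
    show "(p, q) \<in> psim (prb C X Y)"
      unfolding psim_def using prb_simps[OF d h(1-4)] prb_simps[OF d h(1,2,5,6)] h(7,8) by simp
  qed
  moreover have "(prd (prb C X Y) a p, prd (prb C X Y) a q) \<in> ?s \<and> (prd (prb C X Y) p a, prd (prb C X Y) q a) \<in> ?s"
    if pq: "(p, q) \<in> ?s" and a: "a \<in> carrier (prb C X Y)" for p q a
  proof -
    obtain A B x y x' y' where h: "A \<in> C" "B \<in> C" "x \<in> X A" "y \<in> Y B" "x' \<in> X A" "y' \<in> Y B" "p = (x, y)" "q = (x', y')"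
      using both[OF pq] by blast
    obtain A' B' z w where a': "A' \<in> C" "B' \<in> C" "z \<in> X A'" "w \<in> Y B'" "a = (z, w)" using a by (rule prb_carrierE)
    have e: "(x, x') \<in> E1 A" "(y, y') \<in> E2 B" using pq iff[OF h(1-4), of x' y'] h(7,8) by auto
    have "(z, z) \<in> E1 A'" "(w, w) \<in> E2 B'" using eq a' unfolding equiv_def refl_on_def by blast+
    then show ?thesis
      unfolding prb_prd h(7,8) a'(5) using iff[OF a'(1) h(2) a'(3) h(4), of z y'] iff[OF h(1) a'(2) h(3) a'(4), of x' w] e by simp
  qed
  ultimately show ?thesis unfolding Cong_def by blast
qed

text \<open>A product takes its first coordinate from the left and its second from the right factor.
  So multiplication on the right overwrites second coordinates: whether two first coordinates are
  identified does not depend on the second one, and a related pair may be changed one coordinate at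
  a time.\<close>

lemma Cong_prb:
  assumes d: "prb_data C X Y"
  shows "Cong (prb C X Y) = {prb_sigma C X Y E1 E2 | E1 E2. (\<forall>A\<in>C. E1 A \<in> Eqs (X A)) \<and> (\<forall>A\<in>C. E2 A \<in> Eqs (Y A))}"
proof
  show "{prb_sigma C X Y E1 E2 | E1 E2. (\<forall>A\<in>C. E1 A \<in> Eqs (X A)) \<and> (\<forall>A\<in>C. E2 A \<in> Eqs (Y A))} \<subseteq> Cong (prb C X Y)"
    using prb_sigma_cong[OF d] by blast
  show "Cong (prb C X Y) \<subseteq> {prb_sigma C X Y E1 E2 | E1 E2. (\<forall>A\<in>C. E1 A \<in> Eqs (X A)) \<and> (\<forall>A\<in>C. E2 A \<in> Eqs (Y A))}"
  proof
    fix \<tau> assume t: "\<tau> \<in> Cong (prb C X Y)"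
    let ?S = "prb C X Y"
    have eq: "equiv (carrier ?S) \<tau>" and ps: "\<tau> \<subseteq> psim ?S" using t unfolding Cong_def by auto
    have sym: "(q, p) \<in> \<tau>" if "(p, q) \<in> \<tau>" for p q using eq that unfolding equiv_def sym_def by blast
    have trans: "(p, r) \<in> \<tau>" if "(p, q) \<in> \<tau>" "(q, r) \<in> \<tau>" for p q r using eq that unfolding equiv_def trans_def by blast
    have refl: "(p, p) \<in> \<tau>" if "p \<in> carrier ?S" for p using eq that unfolding equiv_def refl_on_def by blast
    have mul: "(tgt ?S a = src ?S p \<longrightarrow> ((fst a, snd p), (fst a, snd q)) \<in> \<tau>) \<and> (tgt ?S p = src ?S a \<longrightarrow> ((fst p, snd a), (fst q, snd a)) \<in> \<tau>)"
      if "(p, q) \<in> \<tau>" "a \<in> carrier ?S" for p q a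
      using t that unfolding Cong_def prb_prd by blast
    have ne: "\<exists>x. x \<in> X A" "\<exists>y. y \<in> Y A" if "A \<in> C" for A using d that unfolding prb_data_def by blast+
    have objs: "\<exists>x' y'. q = (x', y') \<and> x' \<in> X A \<and> y' \<in> Y B" if h: "A \<in> C" "B \<in> C" "x \<in> X A" "y \<in> Y B" "((x, y), q) \<in> \<tau>" for A B x y q
    proof -
      have p: "((x, y), q) \<in> psim ?S" using ps h(5) by blast
      then have "q \<in> carrier ?S" "src ?S q = A" "tgt ?S q = B" using prb_simps[OF d h(1-4)] unfolding psim_def by auto
      moreover obtain A' B' x' y' where "A' \<in> C" "B' \<in> C" "x' \<in> X A'" "y' \<in> Y B'" "q = (x', y')"
        using \<open>q \<in> carrier ?S\<close> by (rule prb_carrierE)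
      ultimately show ?thesis using prb_simps[OF d, of A' B' x' y'] by auto
    qed
    \<comment> \<open>By \<open>all1\<close> below, one witness for the common second coordinate is
      as good as any other.\<close>
    define E1 where "E1 A = {(x, x'). x \<in> X A \<and> x' \<in> X A \<and> (\<exists>B\<in>C. \<exists>y\<in>Y B. ((x, y), (x', y)) \<in> \<tau>)}" for A
    define E2 where "E2 B = {(y, y'). y \<in> Y B \<and> y' \<in> Y B \<and> (\<exists>A\<in>C. \<exists>x\<in>X A. ((x, y), (x, y')) \<in> \<tau>)}" for B
    have all1: "((x, w), (x', w)) \<in> \<tau>" if A: "A \<in> C" "(x, x') \<in> E1 A" and w: "D \<in> C" "w \<in> Y D" for A x x' D w
    proof -
      obtain B y where y: "x \<in> X A" "x' \<in> X A" "B \<in> C" "y \<in> Y B" "((x, y), (x', y)) \<in> \<tau>" using A(2) unfolding E1_def by blast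
      obtain z where z: "z \<in> X B" using ne(1)[OF y(3)] by blast
      show ?thesis using mul[OF y(5) prb_simps(3)[OF d y(3) w(1) z w(2)]]
          prb_simps(2)[OF d A(1) y(3,1,4)] prb_simps(1)[OF d y(3) w(1) z w(2)] by simp
    qed
    have all2: "((z, y), (z, y')) \<in> \<tau>" if B: "B \<in> C" "(y, y') \<in> E2 B" and z: "D \<in> C" "z \<in> X D" for B y y' D z
    proof -
      obtain A x where x: "y \<in> Y B" "y' \<in> Y B" "A \<in> C" "x \<in> X A" "((x, y), (x, y')) \<in> \<tau>" using B(2) unfolding E2_def by blast
      obtain w where w: "w \<in> Y A" using ne(2)[OF x(3)] by blast
      show ?thesis using mul[OF x(5) prb_simps(3)[OF d z(1) x(3) z(2) w]]
          prb_simps(1)[OF d x(3) B(1) x(4,1)] prb_simps(2)[OF d z(1) x(3) z(2) w] by simp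
    qed
    have e1: "E1 A \<in> Eqs (X A)" if A: "A \<in> C" for A
      unfolding Eqs_def mem_Collect_eq
    proof (rule equivI)
      obtain w where w: "w \<in> Y A" using ne(2)[OF A] by blast
      have iff: "(x, x') \<in> E1 A \<longleftrightarrow> x \<in> X A \<and> x' \<in> X A \<and> ((x, w), (x', w)) \<in> \<tau>" for x x'
        using all1[OF A _ A w] A w unfolding E1_def by blast
      show "E1 A \<subseteq> X A \<times> X A" unfolding E1_def by blast
      show "refl_on (X A) (E1 A)" using iff refl prb_simps(3)[OF d A A _ w] by (intro refl_onI) simp
      show "sym (E1 A)" using iff sym by (intro symI) blast
      show "trans (E1 A)" using iff trans by (intro transI) blast
    qed
    have e2: "E2 B \<in> Eqs (Y B)" if B: "B \<in> C" for B
      unfolding Eqs_def mem_Collect_eq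
    proof (rule equivI)
      obtain w where w: "w \<in> X B" using ne(1)[OF B] by blast
      have iff: "(y, y') \<in> E2 B \<longleftrightarrow> y \<in> Y B \<and> y' \<in> Y B \<and> ((w, y), (w, y')) \<in> \<tau>" for y y'
        using all2[OF B _ B w] B w unfolding E2_def by blast
      show "E2 B \<subseteq> Y B \<times> Y B" unfolding E2_def by blast
      show "refl_on (Y B) (E2 B)" using iff refl prb_simps(3)[OF d B B w] by (intro refl_onI) simp
      show "sym (E2 B)" using iff sym by (intro symI) blast
      show "trans (E2 B)" using iff trans by (intro transI) blast
    qed
    have E: "\<forall>A\<in>C. E1 A \<in> Eqs (X A)" "\<forall>A\<in>C. E2 A \<in> Eqs (Y A)" using e1 e2 by auto
    have "(p, q) \<in> \<tau> \<longleftrightarrow> (p, q) \<in> prb_sigma C X Y E1 E2" for p q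
    proof
      assume pq: "(p, q) \<in> \<tau>"
      then have "p \<in> carrier ?S" using ps unfolding psim_def by auto
      then obtain A B x y where p: "A \<in> C" "B \<in> C" "x \<in> X A" "y \<in> Y B" "p = (x, y)" by (rule prb_carrierE)
      obtain x' y' where q: "q = (x', y')" "x' \<in> X A" "y' \<in> Y B" using objs[OF p(1-4)] pq p(5) by blast
      obtain z where z: "z \<in> X B" using ne(1)[OF p(2)] by blast
      obtain w where w: "w \<in> Y A" using ne(2)[OF p(1)] by blast
      \<comment> \<open>Multiplication with \<open>(z, y)\<close> on the right replaces both second
        coordinates by \<open>y\<close>; the next fact does the same with first coordinates on the
        left.\<close>
      have 1: "((x, y), (x', y)) \<in> \<tau>"
        using mul[OF pq prb_simps(3)[OF d p(2,2) z p(4)]] prb_simps(2)[OF d p(1-4)] prb_simps(1)[OF d p(2,2) z p(4)] p(5) q(1) by simp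
      have 2: "((x, y), (x, y')) \<in> \<tau>"
        using mul[OF pq prb_simps(3)[OF d p(1,1,3) w]] prb_simps(1)[OF d p(1-4)] prb_simps(2)[OF d p(1,1,3) w] p(5) q(1) by simp
      have "(x, x') \<in> E1 A" "(y, y') \<in> E2 B" unfolding E1_def E2_def using 1 2 p q by blast+
      then show "(p, q) \<in> prb_sigma C X Y E1 E2"
        unfolding p(5) q(1) using prb_sigma_iff[OF d p(1-4) E] by blast
    next
      assume pq: "(p, q) \<in> prb_sigma C X Y E1 E2"
      then have "p \<in> carrier ?S" using prb_sigma_carrier by blast
      then obtain A B x y where p: "A \<in> C" "B \<in> C" "x \<in> X A" "y \<in> Y B" "p = (x, y)" by (rule prb_carrierE)
      obtain x' y' where q: "q = (x', y')" by (cases q)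
      have e: "(x, x') \<in> E1 A" "(y, y') \<in> E2 B" using pq prb_sigma_iff[OF d p(1-4) E] unfolding p(5) q by auto
      then have x': "x' \<in> X A" unfolding E1_def by blast
      show "(p, q) \<in> \<tau>" unfolding p(5) q
        using trans[OF all1[OF p(1) e(1) p(2,4)] all2[OF p(2) e(2) p(1) x']] .
    qed
    then have "\<tau> = prb_sigma C X Y E1 E2" by auto
    then show "\<tau> \<in> {prb_sigma C X Y E1 E2 | E1 E2. (\<forall>A\<in>C. E1 A \<in> Eqs (X A)) \<and> (\<forall>A\<in>C. E2 A \<in> Eqs (Y A))}"
      using E by blast
  qed
qed

text \<open>Inclusion can be tested in one coordinate at a time: the other one is held fixed, by
  reflexivity, at some element of a nonempty component.\<close>

lemma prb_sigma_subset_iff: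
  assumes d: "prb_data C X Y" and C: "C \<noteq> {}"
    and E: "\<forall>A\<in>C. E1 A \<in> Eqs (X A)" "\<forall>A\<in>C. E2 A \<in> Eqs (Y A)"
    and F: "\<forall>A\<in>C. F1 A \<in> Eqs (X A)" "\<forall>A\<in>C. F2 A \<in> Eqs (Y A)"
  shows "prb_sigma C X Y E1 E2 \<subseteq> prb_sigma C X Y F1 F2 \<longleftrightarrow> (\<forall>A\<in>C. E1 A \<subseteq> F1 A) \<and> (\<forall>A\<in>C. E2 A \<subseteq> F2 A)"
proof
  assume "(\<forall>A\<in>C. E1 A \<subseteq> F1 A) \<and> (\<forall>A\<in>C. E2 A \<subseteq> F2 A)"
  then show "prb_sigma C X Y E1 E2 \<subseteq> prb_sigma C X Y F1 F2" unfolding prb_sigma_def by auto blast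
next
  assume sub: "prb_sigma C X Y E1 E2 \<subseteq> prb_sigma C X Y F1 F2"
  have eq: "equiv (X A) (E1 A)" "equiv (Y A) (E2 A)" if "A \<in> C" for A using E that unfolding Eqs_def by auto
  have ne: "\<exists>x. x \<in> X A" "\<exists>y. y \<in> Y A" if "A \<in> C" for A using d that unfolding prb_data_def by blast+
  have "E1 A \<subseteq> F1 A" if A: "A \<in> C" for A
  proof (rule subrelI)
    fix x x' assume xx: "(x, x') \<in> E1 A"
    then have x: "x \<in> X A" using equiv_type[OF eq(1)[OF A]] by blast
    obtain y where y: "y \<in> Y A" using ne(2)[OF A] by blast
    have "(y, y) \<in> E2 A" using eq(2)[OF A] y unfolding equiv_def refl_on_def by blast
    then have "((x, y), (x', y)) \<in> prb_sigma C X Y F1 F2" using sub prb_sigma_iff[OF d A A x y E] xx by blast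
    then show "(x, x') \<in> F1 A" using prb_sigma_iff[OF d A A x y F] by blast
  qed
  moreover have "E2 A \<subseteq> F2 A" if A: "A \<in> C" for A
  proof (rule subrelI)
    fix y y' assume yy: "(y, y') \<in> E2 A"
    then have y: "y \<in> Y A" using equiv_type[OF eq(2)[OF A]] by blast
    obtain x where x: "x \<in> X A" using ne(1)[OF A] by blast
    have "(x, x) \<in> E1 A" using eq(1)[OF A] x unfolding equiv_def refl_on_def by blast
    then have "((x, y), (x, y')) \<in> prb_sigma C X Y F1 F2" using sub prb_sigma_iff[OF d A A x y E] yy by blast
    then show "(y, y') \<in> F2 A" using prb_sigma_iff[OF d A A x y F] by blast
  qed
  ultimately show "(\<forall>A\<in>C. E1 A \<subseteq> F1 A) \<and> (\<forall>A\<in>C. E2 A \<subseteq> F2 A)" by blast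
qed

lemma prb_order_iso:
  fixes C :: "'o set" and X :: "'o \<Rightarrow> 'x set" and Y :: "'o \<Rightarrow> 'y set"
  defines "L \<equiv> prod_order (Prod_order C (\<lambda>A. Eq_lattice (X A))) (Prod_order C (\<lambda>A. Eq_lattice (Y A)))"
  assumes d: "prb_data C X Y" and C: "C \<noteq> {}"
  shows "bij_betw (\<lambda>(E1, E2). prb_sigma C X Y E1 E2) (carrier L) (Cong (prb C X Y))"
    and "p \<in> carrier L \<Longrightarrow> q \<in> carrier L \<Longrightarrow>
      le L p q \<longleftrightarrow> (case p of (E1, E2) \<Rightarrow> prb_sigma C X Y E1 E2) \<subseteq> (case q of (E1, E2) \<Rightarrow> prb_sigma C X Y E1 E2)"
proof -
  let ?L = "\<lambda>X. Prod_order C (\<lambda>A. Eq_lattice (X A))"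
  have carL: "carrier (Prod_order C (\<lambda>A. Eq_lattice (Z A))) = (\<Pi>\<^sub>E A\<in>C. Eqs (Z A))" for Z :: "_ \<Rightarrow> 'z set"
    unfolding Prod_order_def Eq_lattice_def incl_order_def by simp
  have car: "carrier (prod_order (?L X) (Prod_order C (\<lambda>A. Eq_lattice (Y A)))) = (\<Pi>\<^sub>E A\<in>C. Eqs (X A)) \<times> (\<Pi>\<^sub>E A\<in>C. Eqs (Y A))"
    unfolding carL[symmetric] prod_order_def by simp
  have leL: "le (Prod_order C (\<lambda>A. Eq_lattice (Z A))) f g \<longleftrightarrow> (\<forall>A\<in>C. f A \<subseteq> g A)" for Z :: "_ \<Rightarrow> 'z set" and f g
    unfolding Prod_order_def Eq_lattice_def incl_order_def by simp
  have sub: "prb_sigma C X Y (fst p) (snd p) \<subseteq> prb_sigma C X Y (fst q) (snd q) \<longleftrightarrow>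
      (\<forall>A\<in>C. fst p A \<subseteq> fst q A) \<and> (\<forall>A\<in>C. snd p A \<subseteq> snd q A)"
    if "p \<in> (\<Pi>\<^sub>E A\<in>C. Eqs (X A)) \<times> (\<Pi>\<^sub>E A\<in>C. Eqs (Y A))" "q \<in> (\<Pi>\<^sub>E A\<in>C. Eqs (X A)) \<times> (\<Pi>\<^sub>E A\<in>C. Eqs (Y A))" for p q
    using that by (intro prb_sigma_subset_iff[OF d C]) (auto simp: PiE_iff)
  show "le L p q \<longleftrightarrow> (case p of (E1, E2) \<Rightarrow> prb_sigma C X Y E1 E2) \<subseteq> (case q of (E1, E2) \<Rightarrow> prb_sigma C X Y E1 E2)"
    if "p \<in> carrier L" "q \<in> carrier L"
  proof -
    have "le (prod_order (?L X) (Prod_order C (\<lambda>A. Eq_lattice (Y A)))) p q \<longleftrightarrow>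
        (\<forall>A\<in>C. fst p A \<subseteq> fst q A) \<and> (\<forall>A\<in>C. snd p A \<subseteq> snd q A)"
      unfolding prod_order_def by (simp add: case_prod_beta leL)
    then show ?thesis using sub[OF that[unfolded L_def car]] unfolding L_def by (simp add: case_prod_beta)
  qed
  show "bij_betw (\<lambda>(E1, E2). prb_sigma C X Y E1 E2) (carrier L) (Cong (prb C X Y))"
    unfolding L_def car bij_betw_def
  proof
    show "inj_on (\<lambda>(E1, E2). prb_sigma C X Y E1 E2) ((\<Pi>\<^sub>E A\<in>C. Eqs (X A)) \<times> (\<Pi>\<^sub>E A\<in>C. Eqs (Y A)))"
    proof (rule inj_onI)
      fix p q assume pq: "p \<in> (\<Pi>\<^sub>E A\<in>C. Eqs (X A)) \<times> (\<Pi>\<^sub>E A\<in>C. Eqs (Y A))" "q \<in> (\<Pi>\<^sub>E A\<in>C. Eqs (X A)) \<times> (\<Pi>\<^sub>E A\<in>C. Eqs (Y A))"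
        and eq: "(case p of (E1, E2) \<Rightarrow> prb_sigma C X Y E1 E2) = (case q of (E1, E2) \<Rightarrow> prb_sigma C X Y E1 E2)"
      have "\<forall>A\<in>C. fst p A = fst q A" "\<forall>A\<in>C. snd p A = snd q A"
        using sub[OF pq] sub[OF pq(2,1)] eq by (auto simp: case_prod_beta)
      then have "fst p = fst q" "snd p = snd q"
        using pq PiE_ext[of "fst p" C "\<lambda>A. Eqs (X A)" "fst q"] PiE_ext[of "snd p" C "\<lambda>A. Eqs (Y A)" "snd q"] by auto
      then show "p = q" by (rule prod_eqI)
    qed
    show "(\<lambda>(E1, E2). prb_sigma C X Y E1 E2) ` ((\<Pi>\<^sub>E A\<in>C. Eqs (X A)) \<times> (\<Pi>\<^sub>E A\<in>C. Eqs (Y A))) = Cong (prb C X Y)"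
    proof -
      have "\<exists>E\<in>(\<Pi>\<^sub>E A\<in>C. Eqs (X A)) \<times> (\<Pi>\<^sub>E A\<in>C. Eqs (Y A)). prb_sigma C X Y E1 E2 = (case E of (E1, E2) \<Rightarrow> prb_sigma C X Y E1 E2)"
        if E: "\<forall>A\<in>C. E1 A \<in> Eqs (X A)" "\<forall>A\<in>C. E2 A \<in> Eqs (Y A)" for E1 E2
      proof
        show "(restrict E1 C, restrict E2 C) \<in> (\<Pi>\<^sub>E A\<in>C. Eqs (X A)) \<times> (\<Pi>\<^sub>E A\<in>C. Eqs (Y A))" using E by auto
        show "prb_sigma C X Y E1 E2 = (case (restrict E1 C, restrict E2 C) of (E1, E2) \<Rightarrow> prb_sigma C X Y E1 E2)"
          unfolding prb_sigma_def by auto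
      qed
      moreover have "(case E of (E1, E2) \<Rightarrow> prb_sigma C X Y E1 E2) \<in> Cong (prb C X Y)"
        if "E \<in> (\<Pi>\<^sub>E A\<in>C. Eqs (X A)) \<times> (\<Pi>\<^sub>E A\<in>C. Eqs (Y A))" for E
        using that prb_sigma_cong[OF d, of "fst E" "snd E"] by (auto simp: PiE_iff case_prod_beta)
      ultimately show ?thesis unfolding Cong_prb[OF d] by (auto simp: image_iff)
    qed
  qed
qed

section \<open>Transport along isomorphisms\<close>

lemma Cong_iso:
  assumes f: "psgp_iso S T f"
    and closed: "\<And>x y. x \<in> carrier S \<Longrightarrow> y \<in> carrier S \<Longrightarrow> tgt S x = src S y \<Longrightarrow> prd S x y \<in> carrier S"
    and \<tau>: "\<tau> \<in> Cong T"
  shows "{(x, y). x \<in> carrier S \<and> y \<in> carrier S \<and> (f x, f y) \<in> \<tau>} \<in> Cong S"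
proof -
  let ?s = "{(x, y). x \<in> carrier S \<and> y \<in> carrier S \<and> (f x, f y) \<in> \<tau>}"
  have b: "f x \<in> carrier T" "src T (f x) = src S x" "tgt T (f x) = tgt S x" if "x \<in> carrier S" for x
    using f that unfolding psgp_iso_def bij_betw_def by auto
  have m: "f (prd S x y) = prd T (f x) (f y)" if "x \<in> carrier S" "y \<in> carrier S" "tgt S x = src S y" for x y
    using f that unfolding psgp_iso_def by blast
  have eq: "equiv (carrier T) \<tau>" and ps: "\<tau> \<subseteq> psim T" using \<tau> unfolding Cong_def by auto
  have "equiv (carrier S) ?s"
  proof (rule equivI)
    show "refl_on (carrier S) ?s" using eq b unfolding equiv_def refl_on_def by auto
    show "sym ?s" using eq unfolding equiv_def sym_def by auto
    show "trans ?s" using eq unfolding equiv_def trans_def by blast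
  qed auto
  moreover have "?s \<subseteq> psim S" using ps b unfolding psim_def by auto
  moreover have "(tgt S a = src S x \<longrightarrow> (prd S a x, prd S a y) \<in> ?s) \<and> (tgt S x = src S a \<longrightarrow> (prd S x a, prd S y a) \<in> ?s)"
    if xy: "(x, y) \<in> ?s" and a: "a \<in> carrier S" for x y a
  proof -
    have x: "x \<in> carrier S" "y \<in> carrier S" "(f x, f y) \<in> \<tau>" using xy by auto
    have st: "src S x = src S y" "tgt S x = tgt S y" using ps x b[OF x(1)] b[OF x(2)] unfolding psim_def by auto
    have mul: "(tgt T (f a) = src T (f x) \<longrightarrow> (prd T (f a) (f x), prd T (f a) (f y)) \<in> \<tau>) \<and>
      (tgt T (f x) = src T (f a) \<longrightarrow> (prd T (f x) (f a), prd T (f y) (f a)) \<in> \<tau>)"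
      using \<tau> x(3) b(1)[OF a] unfolding Cong_def by blast
    then show ?thesis
      using m[OF a x(1)] m[OF a x(2)] m[OF x(1) a] m[OF x(2) a] closed[OF a x(1)] closed[OF a x(2)]
        closed[OF x(1) a] closed[OF x(2) a] b[OF a] b[OF x(1)] st by simp
  qed
  ultimately show ?thesis unfolding Cong_def by blast
qed

lemma psgp_iso_inv:
  assumes f: "psgp_iso S T f"
    and closed: "\<And>x y. x \<in> carrier S \<Longrightarrow> y \<in> carrier S \<Longrightarrow> tgt S x = src S y \<Longrightarrow> prd S x y \<in> carrier S"
  shows "psgp_iso T S (inv_into (carrier S) f)"
  unfolding psgp_iso_def
proof (intro conjI ballI impI)
  have bij: "bij_betw f (carrier S) (carrier T)" using f unfolding psgp_iso_def by blast
  let ?g = "inv_into (carrier S) f"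
  show bg: "bij_betw ?g (carrier T) (carrier S)" by (rule bij_betw_inv_into[OF bij])
  have g: "?g x \<in> carrier S" "f (?g x) = x" if "x \<in> carrier T" for x
    using that bij bg bij_betw_inv_into_right[OF bij] unfolding bij_betw_def by auto
  show st: "src S (?g x) = src T x" "tgt S (?g x) = tgt T x" if "x \<in> carrier T" for x
    using f g[OF that] unfolding psgp_iso_def by metis+
  show "?g (prd T x y) = prd S (?g x) (?g y)" if x: "x \<in> carrier T" "y \<in> carrier T" "tgt T x = src T y" for x y
  proof -
    have c: "tgt S (?g x) = src S (?g y)" using st x by simp
    have "f (prd S (?g x) (?g y)) = prd T x y" using f g[OF x(1)] g[OF x(2)] c unfolding psgp_iso_def by metis
    then show ?thesis using bij_betw_inv_into_left[OF bij closed[OF g(1)[OF x(1)] g(1)[OF x(2)] c]] by simp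
  qed
qed

lemma Cong_iso_eq:
  assumes f: "psgp_iso S T f"
    and closed: "\<And>x y. x \<in> carrier S \<Longrightarrow> y \<in> carrier S \<Longrightarrow> tgt S x = src S y \<Longrightarrow> prd S x y \<in> carrier S"
    and closedT: "\<And>x y. x \<in> carrier T \<Longrightarrow> y \<in> carrier T \<Longrightarrow> tgt T x = src T y \<Longrightarrow> prd T x y \<in> carrier T"
  shows "bij_betw (\<lambda>\<tau>. {(x, y). x \<in> carrier S \<and> y \<in> carrier S \<and> (f x, f y) \<in> \<tau>}) (Cong T) (Cong S)"
proof (rule bij_betwI')
  let ?F = "\<lambda>\<tau>. {(x, y). x \<in> carrier S \<and> y \<in> carrier S \<and> (f x, f y) \<in> \<tau>}"
  have bij: "bij_betw f (carrier S) (carrier T)" using f unfolding psgp_iso_def by blast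
  have im: "carrier T = f ` carrier S" using bij unfolding bij_betw_def by simp
  show "?F \<tau> \<in> Cong S" if "\<tau> \<in> Cong T" for \<tau> by (rule Cong_iso[OF f closed that])
  have sub: "\<tau> \<subseteq> carrier T \<times> carrier T" if "\<tau> \<in> Cong T" for \<tau> using that equiv_type unfolding Cong_def by blast
  show "?F \<tau> = ?F \<tau>' \<longleftrightarrow> \<tau> = \<tau>'" if t: "\<tau> \<in> Cong T" "\<tau>' \<in> Cong T" for \<tau> \<tau>'
  proof
    assume eq: "?F \<tau> = ?F \<tau>'"
    have "(f x, f y) \<in> \<tau> \<longleftrightarrow> (f x, f y) \<in> \<tau>'" if "x \<in> carrier S" "y \<in> carrier S" for x y using eq that by blast
    then show "\<tau> = \<tau>'" using sub[OF t(1)] sub[OF t(2)] unfolding im by (auto 0 4)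
  qed simp
  show "\<exists>\<tau>\<in>Cong T. \<sigma> = ?F \<tau>" if s: "\<sigma> \<in> Cong S" for \<sigma>
  proof
    let ?g = "inv_into (carrier S) f"
    show "{(x, y). x \<in> carrier T \<and> y \<in> carrier T \<and> (?g x, ?g y) \<in> \<sigma>} \<in> Cong T"
      by (rule Cong_iso[OF psgp_iso_inv[OF f closed] closedT s])
    have "\<sigma> \<subseteq> carrier S \<times> carrier S" using s equiv_type unfolding Cong_def by blast
    then show "\<sigma> = ?F {(x, y). x \<in> carrier T \<and> y \<in> carrier T \<and> (?g x, ?g y) \<in> \<sigma>}"
      unfolding im using bij_betw_inv_into_left[OF bij] by auto metis
  qed
qed

section \<open>Translation of the results on Boolean relations back to partitions\<close>

section \<open>The ideals of the partition category\<close>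

lemma rank_psgp_simps [simp]:
  "carrier (rank_psgp C r) = rank_ideal C r" "src (rank_psgp C r) = pdom"
  "tgt (rank_psgp C r) = pcod" "prd (rank_psgp C r) = pmult"
  unfolding rank_psgp_def sub_psgp_def part_cat_def by simp_all

lemma sub_rank_psgp: "sub_psgp (rank_psgp C r) (rank_ideal C q) = rank_psgp C q"
  unfolding rank_psgp_def sub_psgp_def by simp

lemma part_cat_eq: "part_cat C = rank_psgp C \<infinity>"
  unfolding rank_psgp_def sub_psgp_def rank_ideal_def part_cat_def by simp

definition pull :: "'a set set \<Rightarrow> enat \<Rightarrow> (('a set \<times> 'a set) set) rel \<Rightarrow> 'a part rel" where
  "pull C r E = {(\<alpha>, \<beta>). \<alpha> \<in> rank_ideal C r \<and> \<beta> \<in> rank_ideal C r \<and> (sat \<alpha>, sat \<beta>) \<in> E}"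

lemma partition_typed:
  assumes "partition_on (A <+> B) \<alpha>" "sat \<alpha> \<in> brels A' B'"
  shows "A = A' \<and> B = B'"
  using brels_eq_objects[OF sat_brels[OF assms(1)] assms(2)] .

locale finite_family =
  fixes C :: "'a set set"
  assumes fin: "\<And>A. A \<in> C \<Longrightarrow> finite A" and nonempty: "C \<noteq> {}"
begin

lemma rank_idealE:
  assumes "\<alpha> \<in> rank_ideal C r"
  obtains A B where "A \<in> C" "B \<in> C" "partition_on (A <+> B) \<alpha>" "sat \<alpha> \<in> rank_set r A B"
proof -
  obtain A B where AB: "A \<in> C" "B \<in> C" "partition_on (A <+> B) \<alpha>" and r: "enat (rank \<alpha>) \<le> r"
    using assms unfolding rank_ideal_def part_cat_def by auto
  have "sat \<alpha> \<in> rank_class (rank \<alpha>) A B" using rank_iff[OF AB(3) fin[OF AB(1)] fin[OF AB(2)]] by blast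
  then show ?thesis using that[OF AB] rank_setI r by blast
qed

lemma rank_idealI:
  assumes AB: "A \<in> C" "B \<in> C" "partition_on (A <+> B) \<alpha>" and s: "sat \<alpha> \<in> rank_set r A B"
  shows "\<alpha> \<in> rank_ideal C r"
proof -
  obtain q where q: "enat q \<le> r" "sat \<alpha> \<in> rank_class q A B" using s by (rule rank_setE)
  then have "rank \<alpha> = q" using rank_iff[OF AB(3) fin[OF AB(1)] fin[OF AB(2)]] by blast
  then show ?thesis using q AB unfolding rank_ideal_def part_cat_def by auto
qed

lemma rank_ideal_ex:
  assumes AB: "A \<in> C" "B \<in> C" and s: "s \<in> rank_set r A B"
  shows "\<exists>\<alpha>\<in>rank_ideal C r. partition_on (A <+> B) \<alpha> \<and> sat \<alpha> = s"
proof -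
  obtain \<alpha> where "partition_on (A <+> B) \<alpha>" "sat \<alpha> = s"
    using sat_surj[OF rank_set_brels[OF s] fin[OF AB(1)] fin[OF AB(2)]] by blast
  then show ?thesis using rank_idealI[OF AB, of \<alpha> r] s by blast
qed

lemma rank_ideal_typed:
  assumes "\<alpha> \<in> rank_ideal C r" "sat \<alpha> \<in> brels A B"
  shows "A \<in> C" "B \<in> C" "partition_on (A <+> B) \<alpha>" "sat \<alpha> \<in> rank_set r A B"
proof -
  obtain A' B' where AB: "A' \<in> C" "B' \<in> C" "partition_on (A' <+> B') \<alpha>" "sat \<alpha> \<in> rank_set r A' B'"
    using assms(1) by (rule rank_idealE)
  then show "A \<in> C" "B \<in> C" "partition_on (A <+> B) \<alpha>" "sat \<alpha> \<in> rank_set r A B"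
    using partition_typed[OF AB(3) assms(2)] by auto
qed

lemma rank_ideal_sat_inject:
  assumes "\<alpha> \<in> rank_ideal C r" "\<beta> \<in> rank_ideal C r'" "sat \<alpha> = sat \<beta>"
  shows "\<alpha> = \<beta>"
proof -
  obtain A B where AB: "A \<in> C" "B \<in> C" "partition_on (A <+> B) \<alpha>" "sat \<alpha> \<in> rank_set r A B"
    using assms(1) by (rule rank_idealE)
  have "partition_on (A <+> B) \<beta>"
    using rank_ideal_typed[OF assms(2)] sat_brels[OF AB(3)] assms(3) by metis
  then show ?thesis using sat_inject[OF AB(3)] assms(3) by blast
qed

lemma psimI:
  assumes "A \<in> C" "B \<in> C" "partition_on (A <+> B) \<alpha>" "partition_on (A <+> B) \<beta>"
    "sat \<alpha> \<in> rank_set r A B" "sat \<beta> \<in> rank_set r A B"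
  shows "(\<alpha>, \<beta>) \<in> psim (rank_psgp C r)"
  using rank_idealI[OF assms(1,2,3,5)] rank_idealI[OF assms(1,2,4,6)] pdom_partition[OF assms(3)] pdom_partition[OF assms(4)]
    pcod_partition[OF assms(3)] pcod_partition[OF assms(4)] unfolding psim_def by simp

lemma psimE:
  assumes "(\<alpha>, \<beta>) \<in> psim (rank_psgp C r)"
  obtains A B where "A \<in> C" "B \<in> C" "partition_on (A <+> B) \<alpha>" "partition_on (A <+> B) \<beta>"
    "sat \<alpha> \<in> rank_set r A B" "sat \<beta> \<in> rank_set r A B"
proof -
  have a: "\<alpha> \<in> rank_ideal C r" "\<beta> \<in> rank_ideal C r" "pdom \<alpha> = pdom \<beta>" "pcod \<alpha> = pcod \<beta>"
    using assms unfolding psim_def by auto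
  obtain A B where AB: "A \<in> C" "B \<in> C" "partition_on (A <+> B) \<alpha>" "sat \<alpha> \<in> rank_set r A B"
    using a(1) by (rule rank_idealE)
  obtain A' B' where AB': "A' \<in> C" "B' \<in> C" "partition_on (A' <+> B') \<beta>" "sat \<beta> \<in> rank_set r A' B'"
    using a(2) by (rule rank_idealE)
  have "A' = A" "B' = B"
    using a(3,4) pdom_partition[OF AB(3)] pdom_partition[OF AB'(3)] pcod_partition[OF AB(3)] pcod_partition[OF AB'(3)] by auto
  then show ?thesis using that[OF AB(1-3)] AB AB' by blast
qed

lemma rank_ideal_mult:
  assumes a: "A \<in> C" "B \<in> C" "D \<in> C" "partition_on (A <+> B) \<alpha>" "partition_on (B <+> D) \<beta>"
    and r: "sat \<alpha> \<in> rank_set r A B \<or> sat \<beta> \<in> rank_set r B D"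
  shows "pmult \<alpha> \<beta> \<in> rank_ideal C r"
proof (rule rank_idealI[OF a(1,3) pmult_partition[OF a(4,5)]])
  note sb = sat_brels[OF a(4)] sat_brels[OF a(5)]
  have "sat \<alpha> O sat \<beta> \<in> rank_set r A D"
    using r
  proof
    assume "sat \<alpha> \<in> rank_set r A B"
    then show ?thesis using rank_set_comp[OF _ sb(2) fin[OF a(1)] fin[OF a(3)]] by blast
  next
    assume "sat \<beta> \<in> rank_set r B D"
    then have "(sat \<beta>)\<inverse> O (sat \<alpha>)\<inverse> \<in> rank_set r D A"
      by (rule rank_set_comp[OF rank_set_converse brels_converse[OF sb(1)] fin[OF a(3)] fin[OF a(1)]])
    then show ?thesis using rank_set_converse converse_relcomp converse_converse by metis
  qed
  then show "sat (pmult \<alpha> \<beta>) \<in> rank_set r A D" unfolding sat_pmult[OF a(4,5)] .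
qed

lemma composable:
  assumes "\<alpha> \<in> rank_ideal C r" "\<beta> \<in> rank_ideal C r'" "pcod \<alpha> = pdom \<beta>"
  obtains A B D where "A \<in> C" "B \<in> C" "D \<in> C" "partition_on (A <+> B) \<alpha>" "partition_on (B <+> D) \<beta>"
    "sat \<alpha> \<in> rank_set r A B" "sat \<beta> \<in> rank_set r' B D"
proof -
  obtain A B where AB: "A \<in> C" "B \<in> C" "partition_on (A <+> B) \<alpha>" "sat \<alpha> \<in> rank_set r A B"
    using assms(1) by (rule rank_idealE)
  obtain B' D where BD: "B' \<in> C" "D \<in> C" "partition_on (B' <+> D) \<beta>" "sat \<beta> \<in> rank_set r' B' D"
    using assms(2) by (rule rank_idealE)
  have "B' = B" using assms(3) pcod_partition[OF AB(3)] pdom_partition[OF BD(3)] by simp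
  then show ?thesis using that AB BD by blast
qed

lemma rank_ideal_closed:
  "\<alpha> \<in> rank_ideal C r \<Longrightarrow> \<beta> \<in> rank_ideal C r' \<Longrightarrow> pcod \<alpha> = pdom \<beta> \<Longrightarrow> pmult \<alpha> \<beta> \<in> rank_ideal C r"
  "\<alpha> \<in> rank_ideal C r' \<Longrightarrow> \<beta> \<in> rank_ideal C r \<Longrightarrow> pcod \<alpha> = pdom \<beta> \<Longrightarrow> pmult \<alpha> \<beta> \<in> rank_ideal C r"
  by (erule (2) composable, blast intro: rank_ideal_mult)+

lemma pull_cong:
  assumes E: "brel_cong C r E"
  shows "pull C r E \<in> Cong (rank_psgp C r)"
proof -
  interpret brel_cong C r E by (rule E)
  have "equiv (rank_ideal C r) (pull C r E)"
  proof (rule equivI)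
    show "pull C r E \<subseteq> rank_ideal C r \<times> rank_ideal C r" unfolding pull_def by blast
    show "refl_on (rank_ideal C r) (pull C r E)"
    proof (rule refl_onI)
      fix \<alpha> assume a: "\<alpha> \<in> rank_ideal C r"
      then obtain A B where "A \<in> C" "B \<in> C" "partition_on (A <+> B) \<alpha>" "sat \<alpha> \<in> rank_set r A B" by (rule rank_idealE)
      then show "(\<alpha>, \<alpha>) \<in> pull C r E" unfolding pull_def using E_refl a by blast
    qed
    show "sym (pull C r E)" unfolding pull_def by (rule symI) (auto intro: E_sym)
    show "trans (pull C r E)" unfolding pull_def by (rule transI) (auto intro: E_trans)
  qed
  moreover have "pull C r E \<subseteq> psim (rank_psgp C r)"
  proof (rule subrelI)
    fix \<alpha> \<beta> assume "(\<alpha>, \<beta>) \<in> pull C r E"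
    then have ab: "\<alpha> \<in> rank_ideal C r" "\<beta> \<in> rank_ideal C r" "(sat \<alpha>, sat \<beta>) \<in> E" unfolding pull_def by auto
    obtain A B where AB: "A \<in> C" "B \<in> C" "partition_on (A <+> B) \<alpha>" "sat \<alpha> \<in> rank_set r A B"
      using ab(1) by (rule rank_idealE)
    have "sat \<beta> \<in> rank_set r A B" using E_typed[OF ab(3) sat_brels[OF AB(3)]] by blast
    then show "(\<alpha>, \<beta>) \<in> psim (rank_psgp C r)"
      using psimI[OF AB(1-3) _ AB(4)] rank_ideal_typed(3)[OF ab(2) rank_set_brels] by blast
  qed
  moreover have "(pcod \<gamma> = pdom \<alpha> \<longrightarrow> (pmult \<gamma> \<alpha>, pmult \<gamma> \<beta>) \<in> pull C r E) \<and> (pcod \<alpha> = pdom \<gamma> \<longrightarrow> (pmult \<alpha> \<gamma>, pmult \<beta> \<gamma>) \<in> pull C r E)"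
    if ab: "(\<alpha>, \<beta>) \<in> pull C r E" and g: "\<gamma> \<in> rank_ideal C r" for \<alpha> \<beta> \<gamma>
  proof -
    have ab': "\<alpha> \<in> rank_ideal C r" "\<beta> \<in> rank_ideal C r" "(sat \<alpha>, sat \<beta>) \<in> E" using ab unfolding pull_def by auto
    obtain A B where AB: "A \<in> C" "B \<in> C" "partition_on (A <+> B) \<alpha>" "partition_on (A <+> B) \<beta>"
      "sat \<alpha> \<in> rank_set r A B" "sat \<beta> \<in> rank_set r A B"
      using \<open>pull C r E \<subseteq> psim (rank_psgp C r)\<close> ab by (blast elim: psimE)
    obtain D F where DF: "D \<in> C" "F \<in> C" "partition_on (D <+> F) \<gamma>" "sat \<gamma> \<in> rank_set r D F"
      using g by (rule rank_idealE)
    note dc = pdom_partition[OF AB(3)] pcod_partition[OF AB(3)] pdom_partition[OF DF(3)] pcod_partition[OF DF(3)]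
      pdom_partition[OF AB(4)] pcod_partition[OF AB(4)]
    show ?thesis
    proof (intro conjI impI)
      assume "pcod \<gamma> = pdom \<alpha>"
      then have F: "F = A" using dc by simp
      show "(pmult \<gamma> \<alpha>, pmult \<gamma> \<beta>) \<in> pull C r E"
        using E_left[OF ab'(3) sat_brels[OF AB(3)] DF(1) DF(4)[unfolded F]]
          rank_ideal_closed(1)[OF g ab'(1)] rank_ideal_closed(1)[OF g ab'(2)] dc F
        unfolding pull_def sat_pmult[OF DF(3)[unfolded F] AB(3), symmetric] sat_pmult[OF DF(3)[unfolded F] AB(4), symmetric] by simp
    next
      assume "pcod \<alpha> = pdom \<gamma>"
      then have D: "D = B" using dc by simp
      show "(pmult \<alpha> \<gamma>, pmult \<beta> \<gamma>) \<in> pull C r E"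
        using E_right[OF ab'(3) sat_brels[OF AB(3)] DF(2) DF(4)[unfolded D]]
          rank_ideal_closed(1)[OF ab'(1) g] rank_ideal_closed(1)[OF ab'(2) g] dc D
        unfolding pull_def sat_pmult[OF AB(3) DF(3)[unfolded D], symmetric] sat_pmult[OF AB(4) DF(3)[unfolded D], symmetric] by simp
    qed
  qed
  ultimately show ?thesis unfolding Cong_def by auto
qed

text \<open>\<open>E\<close> is the image of the congruence under \<open>sat\<close>. Injectivity of
  \<open>sat\<close> on the ideal keeps transitivity intact, and surjectivity onto
  \<open>rank_set\<close> provides every multiplier.\<close>

lemma cong_pull:
  assumes s: "\<sigma> \<in> Cong (rank_psgp C r)"
  shows "\<exists>E. brel_cong C r E \<and> \<sigma> = pull C r E"
proof -
  have eq: "equiv (rank_ideal C r) \<sigma>" and ps: "\<sigma> \<subseteq> psim (rank_psgp C r)"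
    and mul: "\<And>\<alpha> \<beta> \<gamma>. (\<alpha>, \<beta>) \<in> \<sigma> \<Longrightarrow> \<gamma> \<in> rank_ideal C r \<Longrightarrow>
      (pcod \<gamma> = pdom \<alpha> \<longrightarrow> (pmult \<gamma> \<alpha>, pmult \<gamma> \<beta>) \<in> \<sigma>) \<and> (pcod \<alpha> = pdom \<gamma> \<longrightarrow> (pmult \<alpha> \<gamma>, pmult \<beta> \<gamma>) \<in> \<sigma>)"
    using s unfolding Cong_def by auto
  define E where "E = (\<lambda>(\<alpha>, \<beta>). (sat \<alpha>, sat \<beta>)) ` \<sigma>"
  have E_iff: "(s, t) \<in> E \<longleftrightarrow> (\<exists>\<alpha> \<beta>. (\<alpha>, \<beta>) \<in> \<sigma> \<and> s = sat \<alpha> \<and> t = sat \<beta>)" for s t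
    unfolding E_def by force
  have mem: "\<alpha> \<in> rank_ideal C r \<and> \<beta> \<in> rank_ideal C r" if "(\<alpha>, \<beta>) \<in> \<sigma>" for \<alpha> \<beta>
    using ps that unfolding psim_def by auto
  have pull: "\<sigma> = pull C r E"
  proof
    show "\<sigma> \<subseteq> pull C r E" unfolding pull_def using mem E_iff by blast
    show "pull C r E \<subseteq> \<sigma>"
    proof (rule subrelI)
      fix \<alpha> \<beta> assume "(\<alpha>, \<beta>) \<in> pull C r E"
      then obtain \<alpha>' \<beta>' where ab: "\<alpha> \<in> rank_ideal C r" "\<beta> \<in> rank_ideal C r" "(\<alpha>', \<beta>') \<in> \<sigma>" "sat \<alpha> = sat \<alpha>'" "sat \<beta> = sat \<beta>'"
        unfolding pull_def E_iff by blast
      have "\<alpha> = \<alpha>'" "\<beta> = \<beta>'"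
        using rank_ideal_sat_inject[OF ab(1) _ ab(4)] rank_ideal_sat_inject[OF ab(2) _ ab(5)] mem[OF ab(3)] by auto
      then show "(\<alpha>, \<beta>) \<in> \<sigma>" using ab(3) by simp
    qed
  qed
  have "brel_cong C r E"
  proof
    show "finite A" if "A \<in> C" for A using that by (rule fin)
    show "\<exists>A\<in>C. \<exists>B\<in>C. s \<in> rank_set r A B \<and> t \<in> rank_set r A B" if "(s, t) \<in> E" for s t
      using that ps unfolding E_iff by (blast elim: psimE)
    show "(s, s) \<in> E" if AB: "A \<in> C" "B \<in> C" "s \<in> rank_set r A B" for A B s
    proof -
      obtain \<alpha> where "\<alpha> \<in> rank_ideal C r" "sat \<alpha> = s" using rank_ideal_ex[OF AB] by blast
      then show ?thesis using eq unfolding E_iff equiv_def refl_on_def by blast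
    qed
    show "(t, s) \<in> E" if "(s, t) \<in> E" for s t using that eq unfolding E_iff equiv_def sym_def by blast
    show "(s, u) \<in> E" if st: "(s, t) \<in> E" "(t, u) \<in> E" for s t u
    proof -
      obtain \<alpha> \<beta> \<beta>' \<gamma> where h: "(\<alpha>, \<beta>) \<in> \<sigma>" "s = sat \<alpha>" "t = sat \<beta>" "(\<beta>', \<gamma>) \<in> \<sigma>" "t = sat \<beta>'" "u = sat \<gamma>"
        using st unfolding E_iff by blast
      have "\<beta> = \<beta>'" using rank_ideal_sat_inject[of \<beta> r \<beta>' r] mem[OF h(1)] mem[OF h(4)] h(3,5) by simp
      then have "(\<alpha>, \<gamma>) \<in> \<sigma>" using h(1,4) eq unfolding equiv_def trans_def by blast
      then show ?thesis using h(2,6) unfolding E_iff by blast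
    qed
    have typed: "A \<in> C \<and> B \<in> C \<and> partition_on (A <+> B) \<alpha> \<and> partition_on (A <+> B) \<beta>"
      if ab: "(\<alpha>, \<beta>) \<in> \<sigma>" and sb: "sat \<alpha> \<in> brels A B" for \<alpha> \<beta> A B
    proof -
      obtain A' B' where AB: "A' \<in> C" "B' \<in> C" "partition_on (A' <+> B') \<alpha>" "partition_on (A' <+> B') \<beta>"
        using ab ps by (blast elim: psimE)
      then show ?thesis using partition_typed[OF AB(3) sb] by simp
    qed
    show "(w O s, w O t) \<in> E" if st: "(s, t) \<in> E" "s \<in> brels A B" "D \<in> C" "w \<in> rank_set r D A" for s t w A B D
    proof -
      obtain \<alpha> \<beta> where h: "(\<alpha>, \<beta>) \<in> \<sigma>" "s = sat \<alpha>" "t = sat \<beta>" using st(1) unfolding E_iff by blast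
      have AB: "A \<in> C" "B \<in> C" "partition_on (A <+> B) \<alpha>" "partition_on (A <+> B) \<beta>" using typed[OF h(1)] st(2) h(2) by auto
      obtain \<gamma> where g: "\<gamma> \<in> rank_ideal C r" "partition_on (D <+> A) \<gamma>" "sat \<gamma> = w"
        using rank_ideal_ex[OF st(3) AB(1) st(4)] by blast
      have "(pmult \<gamma> \<alpha>, pmult \<gamma> \<beta>) \<in> \<sigma>"
        using mul[OF h(1) g(1)] pcod_partition[OF g(2)] pdom_partition[OF AB(3)] by simp
      then show ?thesis unfolding E_iff h(2,3) g(3)[symmetric]
        using sat_pmult[OF g(2) AB(3)] sat_pmult[OF g(2) AB(4)] by metis
    qed
    show "(s O w, t O w) \<in> E" if st: "(s, t) \<in> E" "s \<in> brels A B" "D \<in> C" "w \<in> rank_set r B D" for s t w A B D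
    proof -
      obtain \<alpha> \<beta> where h: "(\<alpha>, \<beta>) \<in> \<sigma>" "s = sat \<alpha>" "t = sat \<beta>" using st(1) unfolding E_iff by blast
      have AB: "A \<in> C" "B \<in> C" "partition_on (A <+> B) \<alpha>" "partition_on (A <+> B) \<beta>" using typed[OF h(1)] st(2) h(2) by auto
      obtain \<gamma> where g: "\<gamma> \<in> rank_ideal C r" "partition_on (B <+> D) \<gamma>" "sat \<gamma> = w"
        using rank_ideal_ex[OF AB(2) st(3) st(4)] by blast
      have "(pmult \<alpha> \<gamma>, pmult \<beta> \<gamma>) \<in> \<sigma>"
        using mul[OF h(1) g(1)] pdom_partition[OF g(2)] pcod_partition[OF AB(3)] by simp
      then show ?thesis unfolding E_iff h(2,3) g(3)[symmetric]
        using sat_pmult[OF AB(3) g(2)] sat_pmult[OF AB(4) g(2)] by metis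
    qed
  qed
  then show ?thesis using pull by blast
qed

theorem Cong_rank_psgp: "Cong (rank_psgp C r) = {pull C r E | E. brel_cong C r E}"
  using pull_cong cong_pull by blast

lemma brel_cong_nabla: "brel_cong C r E \<Longrightarrow> E \<subseteq> nabla_brel C r"
  using brel_cong.objects unfolding nabla_brel_def by blast

text \<open>Each pair of \<open>E\<close> comes from a pair of partitions, so nothing is lost under
  \<open>pull\<close> and the order of congruences can be studied on the models.\<close>

lemma pull_subset_iff:
  assumes E: "E \<subseteq> nabla_brel C r"
  shows "pull C r E \<subseteq> pull C r E' \<longleftrightarrow> E \<subseteq> E'"
proof
  assume sub: "pull C r E \<subseteq> pull C r E'"
  show "E \<subseteq> E'"
  proof (rule subrelI)
    fix s t assume st: "(s, t) \<in> E"
    then obtain A B where AB: "A \<in> C" "B \<in> C" "s \<in> rank_set r A B" "t \<in> rank_set r A B"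
      using E unfolding nabla_brel_def by blast
    obtain \<alpha> \<beta> where "\<alpha> \<in> rank_ideal C r" "sat \<alpha> = s" "\<beta> \<in> rank_ideal C r" "sat \<beta> = t"
      using rank_ideal_ex[OF AB(1,2,3)] rank_ideal_ex[OF AB(1,2,4)] by blast
    then show "(s, t) \<in> E'" using sub st unfolding pull_def by blast
  qed
qed (auto simp: pull_def)

lemma psim_pull: "psim (rank_psgp C r) = pull C r (nabla_brel C r)"
proof
  show "psim (rank_psgp C r) \<subseteq> pull C r (nabla_brel C r)"
  proof (rule subrelI)
    fix \<alpha> \<beta> assume ab: "(\<alpha>, \<beta>) \<in> psim (rank_psgp C r)"
    then have "\<alpha> \<in> rank_ideal C r" "\<beta> \<in> rank_ideal C r" unfolding psim_def by auto
    then show "(\<alpha>, \<beta>) \<in> pull C r (nabla_brel C r)"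
      using ab unfolding pull_def nabla_brel_def by (blast elim: psimE)
  qed
  have "brel_cong C r (nabla_brel C r)" using nabla_brel_cong fin by blast
  then have "pull C r (nabla_brel C r) \<in> Cong (rank_psgp C r)" by (rule pull_cong)
  then show "pull C r (nabla_brel C r) \<subseteq> psim (rank_psgp C r)" unfolding Cong_def by blast
qed

lemma rank_ideal_mono: "q \<le> r \<Longrightarrow> rank_ideal C q \<subseteq> rank_ideal C r"
  unfolding rank_ideal_def by (auto intro: order_trans)

lemma rank0_ex:
  assumes "A \<in> C" "B \<in> C" "G \<in> subalgs A" "H \<in> subalgs B"
  shows "\<exists>\<alpha>\<in>rank_ideal C 0. partition_on (A <+> B) \<alpha> \<and> sat \<alpha> = G \<times> H"
  by (rule rank_ideal_ex[OF assms(1,2) rank_setI[OF Times_rank0[OF assms(3,4)]]]) (simp add: zero_enat_def)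

lemma rank_set_0: "rank_set 0 A B = rank_class 0 A B"
proof -
  have "{q. enat q \<le> 0} = {0}" by (auto simp: zero_enat_def)
  then show ?thesis unfolding rank_set_def by simp
qed

lemma rank_ideal_is_ideal:
  assumes "q \<le> r"
  shows "is_ideal (rank_psgp C r) (rank_ideal C q)"
proof -
  obtain A where A: "A \<in> C" using nonempty by blast
  obtain \<alpha> where "\<alpha> \<in> rank_ideal C 0" using rank0_ex[OF A A subalgs_Pow subalgs_Pow] by blast
  then have "rank_ideal C q \<noteq> {}" using rank_ideal_mono[of 0 q] by auto
  then show ?thesis unfolding is_ideal_def using rank_ideal_mono[OF assms] rank_ideal_closed by auto
qed

text \<open>An element \<open>\<beta>\<close> of an ideal is enclosed between rectangles that carry
  the kernel and the cokernel of the given rank-0 element. Every Boolean relation relates the empty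
  sets, so the product is that element.\<close>

lemma min_ideal_rank_psgp: "is_min_ideal (rank_psgp C r) (rank_ideal C 0)"
  unfolding is_min_ideal_def
proof (intro conjI allI impI)
  show "is_ideal (rank_psgp C r) (rank_ideal C 0)" by (rule rank_ideal_is_ideal) simp
  fix I assume I: "is_ideal (rank_psgp C r) I"
  then obtain \<beta> where b: "\<beta> \<in> I" "\<beta> \<in> rank_ideal C r" unfolding is_ideal_def by auto
  obtain A' B' where AB': "A' \<in> C" "B' \<in> C" "partition_on (A' <+> B') \<beta>" "sat \<beta> \<in> rank_set r A' B'"
    using b(2) by (rule rank_idealE)
  show "rank_ideal C 0 \<subseteq> I"
  proof
    fix \<alpha> assume a: "\<alpha> \<in> rank_ideal C 0"
    then obtain A B where AB: "A \<in> C" "B \<in> C" "partition_on (A <+> B) \<alpha>" "sat \<alpha> \<in> rank_set 0 A B" by (rule rank_idealE)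
    note D = subalgs_Domain[OF sat_brels[OF AB(3)]] and R = subalgs_Range[OF sat_brels[OF AB(3)]]
    obtain \<gamma> where g: "\<gamma> \<in> rank_ideal C 0" "partition_on (A <+> A') \<gamma>" "sat \<gamma> = Domain (sat \<alpha>) \<times> Pow A'"
      using rank0_ex[OF AB(1) AB'(1) D subalgs_Pow] by blast
    obtain \<delta> where d: "\<delta> \<in> rank_ideal C 0" "partition_on (B' <+> B) \<delta>" "sat \<delta> = Pow B' \<times> Range (sat \<alpha>)"
      using rank0_ex[OF AB'(2) AB(2) subalgs_Pow R] by blast
    have gr: "\<gamma> \<in> rank_ideal C r" "\<delta> \<in> rank_ideal C r" using g(1) d(1) rank_ideal_mono[of 0 r] by auto
    have gI: "pmult \<gamma> \<beta> \<in> I"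
      using I b(1) gr(1) pcod_partition[OF g(2)] pdom_partition[OF AB'(3)] unfolding is_ideal_def by auto
    have gp: "partition_on (A <+> B') (pmult \<gamma> \<beta>)" using pmult_partition[OF g(2) AB'(3)] .
    have gI': "pmult (pmult \<gamma> \<beta>) \<delta> \<in> I"
      using I gI gr(2) pcod_partition[OF gp] pdom_partition[OF d(2)] unfolding is_ideal_def by auto
    have "sat (pmult (pmult \<gamma> \<beta>) \<delta>) = (Domain (sat \<alpha>) \<times> Pow A') O sat \<beta> O (Pow B' \<times> Range (sat \<alpha>))"
      unfolding sat_pmult[OF gp d(2)] sat_pmult[OF g(2) AB'(3)] g(3) d(3) by (simp only: O_assoc)
    also have "\<dots> = Domain (sat \<alpha>) \<times> Range (sat \<alpha>)"
      using brels_empty[OF sat_brels[OF AB'(3)]] by blast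
    also have "\<dots> = sat \<alpha>" using rank0_flat AB(4) unfolding rank_set_0 flat_def by blast
    finally have "pmult (pmult \<gamma> \<beta>) \<delta> = \<alpha>"
      using sat_inject[OF pmult_partition[OF gp d(2)] AB(3)] by blast
    then show "\<alpha> \<in> I" using gI' by simp
  qed
qed

lemma min_ideal_eq_rank0: "min_ideal (rank_psgp C r) = rank_ideal C 0"
  by (rule min_ideal_eq[OF min_ideal_rank_psgp])

end

lemma fiber_eq_iff:
  assumes "x \<in> I" "y \<in> I"
  shows "{z \<in> I. f z = f x} = {z \<in> I. f z = f y} \<longleftrightarrow> f x = f y"
proof
  assume "{z \<in> I. f z = f x} = {z \<in> I. f z = f y}"
  moreover have "x \<in> {z \<in> I. f z = f x}" using assms by simp
  ultimately have "x \<in> {z \<in> I. f z = f y}" by (rule subst)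
  then show "f x = f y" by simp
qed simp

context finite_family begin

subsection \<open>Green's relations\<close>

lemma left_ideal1_eq:
  "left_ideal1 (rank_psgp C r) \<alpha> = insert \<alpha> {pmult \<gamma> \<alpha> | \<gamma>. \<gamma> \<in> rank_ideal C r \<and> pcod \<gamma> = pdom \<alpha>}"
  unfolding left_ideal1_def adj1_def can_sandwich_def sandwich_def by (auto simp: Let_def split_option_ex)

lemma right_ideal1_eq:
  "right_ideal1 (rank_psgp C r) \<alpha> = insert \<alpha> {pmult \<alpha> \<gamma> | \<gamma>. \<gamma> \<in> rank_ideal C r \<and> pcod \<alpha> = pdom \<gamma>}"
  unfolding right_ideal1_def adj1_def can_sandwich_def sandwich_def by (auto simp: Let_def split_option_ex)

text \<open>Left multiplication keeps the range of a rank-0 element, and a rectangle can give it any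
  domain. So Green's L on rank 0 is equality of cokernels, and dually R is equality of
  kernels.\<close>

lemma left_ideal1_rank0:
  assumes a: "\<alpha> \<in> rank_ideal C 0"
  shows "left_ideal1 (rank_psgp C r) \<alpha> = {\<beta> \<in> rank_ideal C 0. Range (sat \<beta>) = Range (sat \<alpha>)}"
proof
  obtain A B where AB: "A \<in> C" "B \<in> C" "partition_on (A <+> B) \<alpha>" "sat \<alpha> \<in> rank_set 0 A B" using a by (rule rank_idealE)
  have s0: "sat \<alpha> \<in> rank_le 1 A B" using AB(4) unfolding rank_set_0 by (rule rank_leI) simp
  show "left_ideal1 (rank_psgp C r) \<alpha> \<subseteq> {\<beta> \<in> rank_ideal C 0. Range (sat \<beta>) = Range (sat \<alpha>)}"
  proof -
    have "pmult \<gamma> \<alpha> \<in> rank_ideal C 0 \<and> Range (sat (pmult \<gamma> \<alpha>)) = Range (sat \<alpha>)"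
      if g: "\<gamma> \<in> rank_ideal C r" "pcod \<gamma> = pdom \<alpha>" for \<gamma>
    proof
      show "pmult \<gamma> \<alpha> \<in> rank_ideal C 0" using rank_ideal_closed(2)[OF g(1) a g(2)] .
      obtain D F where DF: "D \<in> C" "F \<in> C" "partition_on (D <+> F) \<gamma>" using g(1) by (rule rank_idealE)
      have F: "F = A" using g(2) pcod_partition[OF DF(3)] pdom_partition[OF AB(3)] by simp
      show "Range (sat (pmult \<gamma> \<alpha>)) = Range (sat \<alpha>)"
        unfolding sat_pmult[OF DF(3)[unfolded F] AB(3)] by (rule rank_le1_Range[OF sat_brels[OF DF(3)[unfolded F]] s0])
    qed
    then show ?thesis unfolding left_ideal1_eq using a by auto
  qed
  show "{\<beta> \<in> rank_ideal C 0. Range (sat \<beta>) = Range (sat \<alpha>)} \<subseteq> left_ideal1 (rank_psgp C r) \<alpha>"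
  proof
    fix \<beta> assume "\<beta> \<in> {\<beta> \<in> rank_ideal C 0. Range (sat \<beta>) = Range (sat \<alpha>)}"
    then have b: "\<beta> \<in> rank_ideal C 0" "Range (sat \<beta>) = Range (sat \<alpha>)" by auto
    obtain D F where DF: "D \<in> C" "F \<in> C" "partition_on (D <+> F) \<beta>" "sat \<beta> \<in> rank_set 0 D F" using b(1) by (rule rank_idealE)
    have F: "F = B" using brels_objects[OF sat_brels[OF DF(3)]] brels_objects[OF sat_brels[OF AB(3)]] b(2) by simp
    obtain \<gamma> where g: "\<gamma> \<in> rank_ideal C 0" "partition_on (D <+> A) \<gamma>" "sat \<gamma> = Domain (sat \<beta>) \<times> Pow A"
      using rank0_ex[OF DF(1) AB(1) subalgs_Domain[OF sat_brels[OF DF(3)]] subalgs_Pow] by blast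
    have "sat (pmult \<gamma> \<alpha>) = Domain (sat \<beta>) \<times> Range (sat \<alpha>)"
      unfolding sat_pmult[OF g(2) AB(3)] g(3) using brels_sub[OF sat_brels[OF AB(3)]] by blast
    also have "\<dots> = sat \<beta>" unfolding b(2)[symmetric] using rank0_flat DF(4) unfolding rank_set_0 flat_def by blast
    finally have "pmult \<gamma> \<alpha> = \<beta>" using sat_inject[OF pmult_partition[OF g(2) AB(3)]] DF(3) F by blast
    moreover have "\<gamma> \<in> rank_ideal C r" using g(1) rank_ideal_mono[of 0 r] by auto
    moreover have "pcod \<gamma> = pdom \<alpha>" using pcod_partition[OF g(2)] pdom_partition[OF AB(3)] by simp
    ultimately show "\<beta> \<in> left_ideal1 (rank_psgp C r) \<alpha>" unfolding left_ideal1_eq by blast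
  qed
qed

lemma right_ideal1_rank0:
  assumes a: "\<alpha> \<in> rank_ideal C 0"
  shows "right_ideal1 (rank_psgp C r) \<alpha> = {\<beta> \<in> rank_ideal C 0. Domain (sat \<beta>) = Domain (sat \<alpha>)}"
proof
  obtain A B where AB: "A \<in> C" "B \<in> C" "partition_on (A <+> B) \<alpha>" "sat \<alpha> \<in> rank_set 0 A B" using a by (rule rank_idealE)
  have s0: "sat \<alpha> \<in> rank_le 1 A B" using AB(4) unfolding rank_set_0 by (rule rank_leI) simp
  show "right_ideal1 (rank_psgp C r) \<alpha> \<subseteq> {\<beta> \<in> rank_ideal C 0. Domain (sat \<beta>) = Domain (sat \<alpha>)}"
  proof -
    have "pmult \<alpha> \<gamma> \<in> rank_ideal C 0 \<and> Domain (sat (pmult \<alpha> \<gamma>)) = Domain (sat \<alpha>)"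
      if g: "\<gamma> \<in> rank_ideal C r" "pcod \<alpha> = pdom \<gamma>" for \<gamma>
    proof
      show "pmult \<alpha> \<gamma> \<in> rank_ideal C 0" using rank_ideal_closed(1)[OF a g(1,2)] .
      obtain D F where DF: "D \<in> C" "F \<in> C" "partition_on (D <+> F) \<gamma>" using g(1) by (rule rank_idealE)
      have D: "D = B" using g(2) pdom_partition[OF DF(3)] pcod_partition[OF AB(3)] by simp
      show "Domain (sat (pmult \<alpha> \<gamma>)) = Domain (sat \<alpha>)"
        unfolding sat_pmult[OF AB(3) DF(3)[unfolded D]] by (rule rank_le1_Domain[OF s0 sat_brels[OF DF(3)[unfolded D]]])
    qed
    then show ?thesis unfolding right_ideal1_eq using a by auto
  qed
  show "{\<beta> \<in> rank_ideal C 0. Domain (sat \<beta>) = Domain (sat \<alpha>)} \<subseteq> right_ideal1 (rank_psgp C r) \<alpha>"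
  proof
    fix \<beta> assume "\<beta> \<in> {\<beta> \<in> rank_ideal C 0. Domain (sat \<beta>) = Domain (sat \<alpha>)}"
    then have b: "\<beta> \<in> rank_ideal C 0" "Domain (sat \<beta>) = Domain (sat \<alpha>)" by auto
    obtain D F where DF: "D \<in> C" "F \<in> C" "partition_on (D <+> F) \<beta>" "sat \<beta> \<in> rank_set 0 D F" using b(1) by (rule rank_idealE)
    have D: "D = A" using brels_objects[OF sat_brels[OF DF(3)]] brels_objects[OF sat_brels[OF AB(3)]] b(2) by simp
    obtain \<gamma> where g: "\<gamma> \<in> rank_ideal C 0" "partition_on (B <+> F) \<gamma>" "sat \<gamma> = Pow B \<times> Range (sat \<beta>)"
      using rank0_ex[OF AB(2) DF(2) subalgs_Pow subalgs_Range[OF sat_brels[OF DF(3)]]] by blast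
    have "sat (pmult \<alpha> \<gamma>) = Domain (sat \<alpha>) \<times> Range (sat \<beta>)"
      unfolding sat_pmult[OF AB(3) g(2)] g(3) using brels_sub[OF sat_brels[OF AB(3)]] by blast
    also have "\<dots> = sat \<beta>" unfolding b(2)[symmetric] using rank0_flat DF(4) unfolding rank_set_0 flat_def by blast
    finally have "pmult \<alpha> \<gamma> = \<beta>" using sat_inject[OF pmult_partition[OF AB(3) g(2)]] DF(3) D by blast
    moreover have "\<gamma> \<in> rank_ideal C r" using g(1) rank_ideal_mono[of 0 r] by auto
    moreover have "pcod \<alpha> = pdom \<gamma>" using pdom_partition[OF g(2)] pcod_partition[OF AB(3)] by simp
    ultimately show "\<beta> \<in> right_ideal1 (rank_psgp C r) \<alpha>" unfolding right_ideal1_eq by blast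
  qed
qed

lemma green_rank0:
  assumes a: "\<alpha> \<in> rank_ideal C 0" "\<beta> \<in> rank_ideal C 0"
  shows "(\<alpha>, \<beta>) \<in> green_L (rank_psgp C r) \<longleftrightarrow> Range (sat \<alpha>) = Range (sat \<beta>)"
    "(\<alpha>, \<beta>) \<in> green_R (rank_psgp C r) \<longleftrightarrow> Domain (sat \<alpha>) = Domain (sat \<beta>)"
proof -
  have ar: "\<alpha> \<in> rank_ideal C r" "\<beta> \<in> rank_ideal C r" using a rank_ideal_mono[of 0 r] by auto
  show "(\<alpha>, \<beta>) \<in> green_L (rank_psgp C r) \<longleftrightarrow> Range (sat \<alpha>) = Range (sat \<beta>)"
    unfolding green_L_def using ar fiber_eq_iff[OF a, of "\<lambda>\<gamma>. Range (sat \<gamma>)"]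
    by (simp add: left_ideal1_rank0[OF a(1)] left_ideal1_rank0[OF a(2)])
  show "(\<alpha>, \<beta>) \<in> green_R (rank_psgp C r) \<longleftrightarrow> Domain (sat \<alpha>) = Domain (sat \<beta>)"
    unfolding green_R_def using ar fiber_eq_iff[OF a, of "\<lambda>\<gamma>. Domain (sat \<gamma>)"]
    by (simp add: right_ideal1_rank0[OF a(1)] right_ideal1_rank0[OF a(2)])
qed

text \<open>The outer relations \<open>w\<close> and \<open>z\<close> are the same for all middle
  factors of the given type, and an adjoined identity contributes \<open>Id_on\<close>. This reduces
  \<open>nu_rel\<close> and \<open>ideal1\<close> to Boolean relations.\<close>

lemma sat_sandwich:
  assumes a: "a \<in> adj1 (rank_psgp C r)" and b: "b \<in> adj1 (rank_psgp C r)"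
    and x: "X \<in> C" "Y \<in> C" "partition_on (X <+> Y) \<nu>" and c: "can_sandwich (rank_psgp C r) a \<nu> b"
  obtains A B w z where "A \<in> C" "B \<in> C" "w \<in> brels A X" "z \<in> brels Y B"
    "\<And>\<mu>. partition_on (X <+> Y) \<mu> \<Longrightarrow> partition_on (A <+> B) (sandwich (rank_psgp C r) a \<mu> b) \<and>
      sat (sandwich (rank_psgp C r) a \<mu> b) = w O sat \<mu> O z"
proof -
  have left: "\<exists>A\<in>C. \<exists>w\<in>brels A X. \<forall>\<mu>. partition_on (X <+> Y) \<mu> \<longrightarrow>
      partition_on (A <+> Y) (case a of None \<Rightarrow> \<mu> | Some s \<Rightarrow> pmult s \<mu>) \<and> sat (case a of None \<Rightarrow> \<mu> | Some s \<Rightarrow> pmult s \<mu>) = w O sat \<mu>"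
  proof (cases a)
    case None
    show ?thesis
    proof (intro bexI allI impI)
      show "X \<in> C" by (rule x(1))
      show "Id_on (Pow X) \<in> brels X X" by (rule brels_Id)
      fix \<mu> assume m: "partition_on (X <+> Y) \<mu>"
      then show "partition_on (X <+> Y) (case a of None \<Rightarrow> \<mu> | Some s \<Rightarrow> pmult s \<mu>) \<and>
        sat (case a of None \<Rightarrow> \<mu> | Some s \<Rightarrow> pmult s \<mu>) = Id_on (Pow X) O sat \<mu>"
        using None brels_left_Id[OF sat_brels[OF m]] by simp
    qed
  next
    case (Some s)
    then have s: "s \<in> rank_ideal C r" "pcod s = pdom \<nu>" using a c unfolding adj1_def can_sandwich_def by auto
    obtain A X' where AX: "A \<in> C" "X' \<in> C" "partition_on (A <+> X') s" using s(1) by (rule rank_idealE)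
    have "X' = X" using s(2) pcod_partition[OF AX(3)] pdom_partition[OF x(3)] by simp
    then have p: "partition_on (A <+> X) s" using AX(3) by simp
    show ?thesis
    proof (intro bexI allI impI)
      show "A \<in> C" by (rule AX(1))
      show "sat s \<in> brels A X" using p by (rule sat_brels)
      fix \<mu> assume m: "partition_on (X <+> Y) \<mu>"
      then show "partition_on (A <+> Y) (case a of None \<Rightarrow> \<mu> | Some s \<Rightarrow> pmult s \<mu>) \<and>
        sat (case a of None \<Rightarrow> \<mu> | Some s \<Rightarrow> pmult s \<mu>) = sat s O sat \<mu>"
        using Some pmult_partition[OF p m] sat_pmult[OF p m] by simp
    qed
  qed
  then obtain A w where Aw: "A \<in> C" "w \<in> brels A X" and l: "\<And>\<mu>. partition_on (X <+> Y) \<mu> \<Longrightarrow>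
      partition_on (A <+> Y) (case a of None \<Rightarrow> \<mu> | Some s \<Rightarrow> pmult s \<mu>) \<and> sat (case a of None \<Rightarrow> \<mu> | Some s \<Rightarrow> pmult s \<mu>) = w O sat \<mu>"
    by blast
  have right: "\<exists>B\<in>C. \<exists>z\<in>brels Y B. \<forall>\<mu>. partition_on (A <+> Y) \<mu> \<longrightarrow>
      partition_on (A <+> B) (case b of None \<Rightarrow> \<mu> | Some t \<Rightarrow> pmult \<mu> t) \<and> sat (case b of None \<Rightarrow> \<mu> | Some t \<Rightarrow> pmult \<mu> t) = sat \<mu> O z"
  proof (cases b)
    case None
    show ?thesis
    proof (intro bexI allI impI)
      show "Y \<in> C" by (rule x(2))
      show "Id_on (Pow Y) \<in> brels Y Y" by (rule brels_Id)
      fix \<mu> assume m: "partition_on (A <+> Y) \<mu>"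
      then show "partition_on (A <+> Y) (case b of None \<Rightarrow> \<mu> | Some t \<Rightarrow> pmult \<mu> t) \<and>
        sat (case b of None \<Rightarrow> \<mu> | Some t \<Rightarrow> pmult \<mu> t) = sat \<mu> O Id_on (Pow Y)"
        using None brels_right_Id[OF sat_brels[OF m]] by simp
    qed
  next
    case (Some t)
    then have t: "t \<in> rank_ideal C r" "pcod \<nu> = pdom t" using b c unfolding adj1_def can_sandwich_def by auto
    obtain Y' B where YB: "Y' \<in> C" "B \<in> C" "partition_on (Y' <+> B) t" using t(1) by (rule rank_idealE)
    have "Y' = Y" using t(2) pdom_partition[OF YB(3)] pcod_partition[OF x(3)] by simp
    then have p: "partition_on (Y <+> B) t" using YB(3) by simp
    show ?thesis
    proof (intro bexI allI impI)
      show "B \<in> C" by (rule YB(2))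
      show "sat t \<in> brels Y B" using p by (rule sat_brels)
      fix \<mu> assume m: "partition_on (A <+> Y) \<mu>"
      then show "partition_on (A <+> B) (case b of None \<Rightarrow> \<mu> | Some t \<Rightarrow> pmult \<mu> t) \<and>
        sat (case b of None \<Rightarrow> \<mu> | Some t \<Rightarrow> pmult \<mu> t) = sat \<mu> O sat t"
        using Some pmult_partition[OF m p] sat_pmult[OF m p] by simp
    qed
  qed
  then obtain B z where Bz: "B \<in> C" "z \<in> brels Y B" and r: "\<And>\<mu>. partition_on (A <+> Y) \<mu> \<Longrightarrow>
      partition_on (A <+> B) (case b of None \<Rightarrow> \<mu> | Some t \<Rightarrow> pmult \<mu> t) \<and> sat (case b of None \<Rightarrow> \<mu> | Some t \<Rightarrow> pmult \<mu> t) = sat \<mu> O z"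
    by blast
  have "partition_on (A <+> B) (sandwich (rank_psgp C r) a \<mu> b) \<and> sat (sandwich (rank_psgp C r) a \<mu> b) = w O sat \<mu> O z"
    if m: "partition_on (X <+> Y) \<mu>" for \<mu>
  proof -
    have "sandwich (rank_psgp C r) a \<mu> b = (case b of None \<Rightarrow> (case a of None \<Rightarrow> \<mu> | Some s \<Rightarrow> pmult s \<mu>)
        | Some t \<Rightarrow> pmult (case a of None \<Rightarrow> \<mu> | Some s \<Rightarrow> pmult s \<mu>) t)"
      unfolding sandwich_def by (simp add: Let_def split: option.split)
    then show ?thesis using r[OF conjunct1[OF l[OF m]]] l[OF m] by (simp only: O_assoc simp_thms)
  qed
  then show ?thesis using that[OF Aw(1) Bz(1) Aw(2) Bz(2)] by blast
qed

lemma rank_ideal_rank: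
  assumes "A \<in> C" "B \<in> C" "partition_on (A <+> B) \<alpha>"
  shows "\<alpha> \<in> rank_ideal C r \<longleftrightarrow> enat (rank \<alpha>) \<le> r"
  using assms unfolding rank_ideal_def part_cat_def by auto

lemma sandwich_ex:
  assumes p: "enat p \<le> r" and x: "X \<in> C" "Y \<in> C" "partition_on (X <+> Y) \<nu>" and AB: "A \<in> C" "B \<in> C"
    and w: "w \<in> rank_le p A X" and z: "z \<in> rank_le p Y B"
  obtains a b where "a \<in> adj1 (rank_psgp C r)" "b \<in> adj1 (rank_psgp C r)"
    "\<And>\<mu>. partition_on (X <+> Y) \<mu> \<Longrightarrow> can_sandwich (rank_psgp C r) a \<mu> b \<and>
      partition_on (A <+> B) (sandwich (rank_psgp C r) a \<mu> b) \<and> sat (sandwich (rank_psgp C r) a \<mu> b) = w O sat \<mu> O z"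
proof -
  obtain \<alpha> where a: "\<alpha> \<in> rank_ideal C r" "partition_on (A <+> X) \<alpha>" "sat \<alpha> = w"
    using rank_ideal_ex[OF AB(1) x(1) rank_le_rank_set[OF w p]] by blast
  obtain \<beta> where b: "\<beta> \<in> rank_ideal C r" "partition_on (Y <+> B) \<beta>" "sat \<beta> = z"
    using rank_ideal_ex[OF x(2) AB(2) rank_le_rank_set[OF z p]] by blast
  have "can_sandwich (rank_psgp C r) (Some \<alpha>) \<mu> (Some \<beta>) \<and>
      partition_on (A <+> B) (sandwich (rank_psgp C r) (Some \<alpha>) \<mu> (Some \<beta>)) \<and>
      sat (sandwich (rank_psgp C r) (Some \<alpha>) \<mu> (Some \<beta>)) = w O sat \<mu> O z"
    if m: "partition_on (X <+> Y) \<mu>" for \<mu>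
  proof -
    note p1 = pmult_partition[OF a(2) m]
    have "sat (pmult (pmult \<alpha> \<mu>) \<beta>) = w O sat \<mu> O z"
      unfolding sat_pmult[OF p1 b(2)] sat_pmult[OF a(2) m] a(3) b(3) by (simp only: O_assoc)
    moreover have "partition_on (A <+> B) (pmult (pmult \<alpha> \<mu>) \<beta>)" using pmult_partition[OF p1 b(2)] .
    ultimately show ?thesis
      unfolding can_sandwich_def sandwich_def
      using pcod_partition[OF a(2)] pdom_partition[OF m] pcod_partition[OF m] pdom_partition[OF b(2)] by simp
  qed
  then show ?thesis using that[of "Some \<alpha>" "Some \<beta>"] a(1) b(1) unfolding adj1_def by simp
qed

text \<open>A relation of rank at most that of \<open>\<alpha>\<close> factors through
  \<open>{1..rank \<alpha>}\<close>, and the halves of \<open>\<alpha>\<close> let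
  \<open>\<alpha>\<close> play the identity in the middle. The outer factors then have rank at most
  that of \<open>\<alpha>\<close>, so they belong to the ideal.\<close>

lemma ideal1_rank:
  assumes x: "X \<in> C" "Y \<in> C" "partition_on (X <+> Y) \<alpha>" and q: "enat (rank \<alpha>) \<le> r"
  shows "ideal1 (rank_psgp C r) \<alpha> = rank_ideal C (enat (rank \<alpha>))"
proof
  have s: "sat \<alpha> \<in> rank_class (rank \<alpha>) X Y" using rank_iff[OF x(3) fin[OF x(1)] fin[OF x(2)]] by blast
  show "ideal1 (rank_psgp C r) \<alpha> \<subseteq> rank_ideal C (enat (rank \<alpha>))"
  proof
    fix \<beta> assume "\<beta> \<in> ideal1 (rank_psgp C r) \<alpha>"
    then obtain a b where ab: "a \<in> adj1 (rank_psgp C r)" "b \<in> adj1 (rank_psgp C r)" "can_sandwich (rank_psgp C r) a \<alpha> b"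
      "\<beta> = sandwich (rank_psgp C r) a \<alpha> b" unfolding ideal1_def by blast
    obtain A B w z where h: "A \<in> C" "B \<in> C" "w \<in> brels A X" "z \<in> brels Y B" "partition_on (A <+> B) \<beta>" "sat \<beta> = w O sat \<alpha> O z"
      unfolding ab(4) by (rule sat_sandwich[OF ab(1,2) x ab(3)]) (use x(3) in blast)
    have "sat \<beta> \<in> rank_le (rank \<alpha>) A B" unfolding h(6)
      by (intro rank_le_comp_left[OF h(3)] rank_le_comp_right[OF rank_leI[OF s order_refl] h(4)] fin h x)
    then show "\<beta> \<in> rank_ideal C (enat (rank \<alpha>))" using rank_idealI[OF h(1,2,5) rank_le_rank_set] by blast
  qed
  show "rank_ideal C (enat (rank \<alpha>)) \<subseteq> ideal1 (rank_psgp C r) \<alpha>"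
  proof
    fix \<beta> assume "\<beta> \<in> rank_ideal C (enat (rank \<alpha>))"
    then obtain A B where AB: "A \<in> C" "B \<in> C" "partition_on (A <+> B) \<beta>" "sat \<beta> \<in> rank_set (enat (rank \<alpha>)) A B" by (rule rank_idealE)
    obtain k where "enat k \<le> enat (rank \<alpha>)" "sat \<beta> \<in> rank_class k A B" using AB(4) by (rule rank_setE)
    then have "sat \<beta> \<in> rank_le (rank \<alpha>) A B" by (intro rank_leI) auto
    then obtain c d where cd: "c \<in> brels A {1..rank \<alpha>}" "d \<in> brels B {1..rank \<alpha>}" "sat \<beta> = c O d\<inverse>" by (rule rank_le_ex_factor)
    obtain u v where uv: "u \<in> halves (rank \<alpha>) X" "v \<in> halves (rank \<alpha>) Y" "sat \<alpha> = u O v\<inverse>" using s by (rule rank_classE)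
    have w: "c O u\<inverse> \<in> rank_le (rank \<alpha>) A X"
      by (rule rank_le_factor[OF cd(1) brels_converse[OF halves_brels[OF uv(1)]] fin[OF AB(1)] fin[OF x(1)]])
    have z: "v O d\<inverse> \<in> rank_le (rank \<alpha>) Y B"
      by (rule rank_le_factor[OF halves_brels[OF uv(2)] brels_converse[OF cd(2)] fin[OF x(2)] fin[OF AB(2)]])
    obtain a b where ab: "a \<in> adj1 (rank_psgp C r)" "b \<in> adj1 (rank_psgp C r)" "can_sandwich (rank_psgp C r) a \<alpha> b"
      "partition_on (A <+> B) (sandwich (rank_psgp C r) a \<alpha> b)"
      "sat (sandwich (rank_psgp C r) a \<alpha> b) = (c O u\<inverse>) O sat \<alpha> O (v O d\<inverse>)"
      using sandwich_ex[OF q x AB(1,2) w z] x(3) by metis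
    have "(c O u\<inverse>) O sat \<alpha> O (v O d\<inverse>) = c O (u\<inverse> O (u O v\<inverse>) O v) O d\<inverse>" unfolding uv(3) by (simp only: O_assoc)
    also have "\<dots> = sat \<beta>" unfolding half_sandwich_Id[OF uv(1,2)] brels_left_Id[OF brels_converse[OF cd(2)]] cd(3) ..
    finally have "sandwich (rank_psgp C r) a \<alpha> b = \<beta>" using sat_inject[OF ab(4) AB(3)] ab(5) by simp
    then show "\<beta> \<in> ideal1 (rank_psgp C r) \<alpha>" unfolding ideal1_def using ab(1-3) by blast
  qed
qed

lemma green_J_rank:
  assumes a: "\<alpha> \<in> rank_ideal C r"
  shows "(\<alpha>, \<beta>) \<in> green_J (rank_psgp C r) \<longleftrightarrow> \<beta> \<in> rank_ideal C r \<and> rank \<beta> = rank \<alpha>"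
proof -
  have self: "\<gamma> \<in> rank_ideal C (enat (rank \<gamma>)) \<and> ideal1 (rank_psgp C r) \<gamma> = rank_ideal C (enat (rank \<gamma>))"
    if g: "\<gamma> \<in> rank_ideal C r" for \<gamma>
  proof -
    obtain A B where AB: "A \<in> C" "B \<in> C" "partition_on (A <+> B) \<gamma>" using g by (rule rank_idealE)
    then show ?thesis using rank_ideal_rank[OF AB] ideal1_rank[OF AB] g by simp
  qed
  have le: "rank \<gamma> \<le> q" if "\<gamma> \<in> rank_ideal C (enat q)" for \<gamma> q using that unfolding rank_ideal_def by simp
  show ?thesis
  proof
    assume "(\<alpha>, \<beta>) \<in> green_J (rank_psgp C r)"
    then have b: "\<beta> \<in> rank_ideal C r" "ideal1 (rank_psgp C r) \<alpha> = ideal1 (rank_psgp C r) \<beta>" unfolding green_J_def by auto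
    then show "\<beta> \<in> rank_ideal C r \<and> rank \<beta> = rank \<alpha>"
      using self[OF a] self[OF b(1)] le[of \<alpha> "rank \<beta>"] le[of \<beta> "rank \<alpha>"] by auto
  next
    assume "\<beta> \<in> rank_ideal C r \<and> rank \<beta> = rank \<alpha>"
    then show "(\<alpha>, \<beta>) \<in> green_J (rank_psgp C r)" unfolding green_J_def using a self[OF a] self[of \<beta>] by simp
  qed
qed

subsection \<open>Retractions\<close>

definition split_part :: "'a part \<Rightarrow> 'a part" where
  "split_part \<alpha> = (THE \<beta>. \<beta> \<in> rank_ideal C 0 \<and> sat \<beta> = flat (sat \<alpha>))"

lemma split_part:
  assumes "A \<in> C" "B \<in> C" "partition_on (A <+> B) \<alpha>"
  shows "split_part \<alpha> \<in> rank_ideal C 0 \<and> partition_on (A <+> B) (split_part \<alpha>) \<and> sat (split_part \<alpha>) = flat (sat \<alpha>)"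
proof -
  have f: "flat (sat \<alpha>) \<in> rank_set 0 A B" unfolding rank_set_0 by (rule flat_rank0[OF sat_brels[OF assms(3)]])
  obtain \<beta> where b: "\<beta> \<in> rank_ideal C 0" "partition_on (A <+> B) \<beta>" "sat \<beta> = flat (sat \<alpha>)"
    using rank_ideal_ex[OF assms(1,2) f] by blast
  have "split_part \<alpha> = \<beta>"
    unfolding split_part_def
  proof (rule the_equality)
    show "\<beta> \<in> rank_ideal C 0 \<and> sat \<beta> = flat (sat \<alpha>)" using b by simp
    show "\<gamma> = \<beta>" if "\<gamma> \<in> rank_ideal C 0 \<and> sat \<gamma> = flat (sat \<alpha>)" for \<gamma>
      using rank_ideal_sat_inject[of \<gamma> 0 \<beta> 0] that b by simp
  qed
  then show ?thesis using b by simp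
qed

lemma rank_le_1_ideal:
  assumes "\<alpha> \<in> rank_ideal C q" "q \<le> 1" "sat \<alpha> \<in> brels A B"
  shows "sat \<alpha> \<in> rank_le 1 A B"
proof -
  obtain k where k: "enat k \<le> q" "sat \<alpha> \<in> rank_class k A B"
    using rank_ideal_typed(4)[OF assms(1,3)] by (rule rank_setE)
  then have "enat k \<le> enat 1" using assms(2) order_trans by (metis one_enat_def)
  then show ?thesis using rank_leI[OF k(2)] by simp
qed

text \<open>Multiplicativity is \<open>flat_comp\<close>, which is where both factors must have rank
  at most 1.\<close>

lemma split_part_retraction:
  assumes q: "q \<le> 1" "q \<le> r"
  shows "is_retraction (rank_psgp C r) (rank_ideal C q) split_part"
  unfolding is_retraction_def min_ideal_eq_rank0
proof (intro conjI ballI impI)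
  fix \<alpha> assume a: "\<alpha> \<in> rank_ideal C q"
  obtain A B where AB: "A \<in> C" "B \<in> C" "partition_on (A <+> B) \<alpha>" "sat \<alpha> \<in> rank_set q A B" using a by (rule rank_idealE)
  note s = split_part[OF AB(1-3)]
  show "split_part \<alpha> \<in> rank_ideal C 0" using s by simp
  have "split_part \<alpha> \<in> rank_ideal C r" "\<alpha> \<in> rank_ideal C r" using s rank_ideal_mono[of 0 r] rank_ideal_mono[OF q(2)] a by auto
  then show "(\<alpha>, split_part \<alpha>) \<in> psim (rank_psgp C r)"
    unfolding psim_def using pdom_partition[OF AB(3)] pcod_partition[OF AB(3)]
      pdom_partition[of A B "split_part \<alpha>"] pcod_partition[of A B "split_part \<alpha>"] s by simp
  fix \<beta> assume b: "\<beta> \<in> rank_ideal C q" and c: "tgt (rank_psgp C r) \<alpha> = src (rank_psgp C r) \<beta>"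
  obtain A B D where ABD: "A \<in> C" "B \<in> C" "D \<in> C" "partition_on (A <+> B) \<alpha>" "partition_on (B <+> D) \<beta>"
    by (rule composable[OF a b]) (use c in simp_all)
  note sa = split_part[OF ABD(1,2,4)] and sb = split_part[OF ABD(2,3,5)] and sp = split_part[OF ABD(1,3) pmult_partition[OF ABD(4,5)]]
  have "flat (sat \<alpha> O sat \<beta>) = flat (sat \<alpha>) O flat (sat \<beta>)"
    using flat_comp[OF rank_le_1_ideal[OF a q(1) sat_brels[OF ABD(4)]] rank_le_1_ideal[OF b q(1) sat_brels[OF ABD(5)]]] .
  then have "sat (split_part (pmult \<alpha> \<beta>)) = sat (pmult (split_part \<alpha>) (split_part \<beta>))"
    using sa sb sp sat_pmult[OF ABD(4,5)] sat_pmult[of A B "split_part \<alpha>" D "split_part \<beta>"] by simp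
  then show "split_part (prd (rank_psgp C r) \<alpha> \<beta>) = prd (rank_psgp C r) (split_part \<alpha>) (split_part \<beta>)"
    using sat_inject[of A D "split_part (pmult \<alpha> \<beta>)" "pmult (split_part \<alpha>) (split_part \<beta>)"]
      pmult_partition[of A B "split_part \<alpha>" D "split_part \<beta>"] sa sb sp by simp
next
  fix \<alpha> assume a: "\<alpha> \<in> rank_ideal C 0"
  obtain A B where AB: "A \<in> C" "B \<in> C" "partition_on (A <+> B) \<alpha>" "sat \<alpha> \<in> rank_set 0 A B" using a by (rule rank_idealE)
  have "sat (split_part \<alpha>) = sat \<alpha>" using split_part[OF AB(1-3)] rank0_flat AB(4) unfolding rank_set_0 by auto
  then show "split_part \<alpha> = \<alpha>" using rank_ideal_sat_inject split_part[OF AB(1-3)] a by blast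
qed

lemma retractable_rank_ideal: "q \<le> 1 \<Longrightarrow> q \<le> r \<Longrightarrow> retractable (rank_psgp C r) (rank_ideal C q)"
  unfolding retractable_def using rank_ideal_is_ideal split_part_retraction by blast

text \<open>Multiplying by rank-0 elements determines the kernel and the cokernel of the image of a retraction.\<close>

lemma retr_sat:
  assumes q: "q \<le> 1" "q \<le> r" and a: "\<alpha> \<in> rank_ideal C q"
  shows "retr (rank_psgp C r) (rank_ideal C q) \<alpha> \<in> rank_ideal C 0"
    "sat (retr (rank_psgp C r) (rank_ideal C q) \<alpha>) = flat (sat \<alpha>)"
proof -
  let ?f = "retr (rank_psgp C r) (rank_ideal C q)"
  have f: "is_retraction (rank_psgp C r) (rank_ideal C q) ?f"
    using someI[of "is_retraction (rank_psgp C r) (rank_ideal C q)", OF split_part_retraction[OF q]]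
    unfolding retr_def .
  obtain A B where AB: "A \<in> C" "B \<in> C" "partition_on (A <+> B) \<alpha>" "sat \<alpha> \<in> rank_set q A B" using a by (rule rank_idealE)
  show f0: "?f \<alpha> \<in> rank_ideal C 0" using f a unfolding is_retraction_def min_ideal_eq_rank0 by blast
  have "(\<alpha>, ?f \<alpha>) \<in> psim (rank_psgp C r)" using f a unfolding is_retraction_def by blast
  then obtain A' B' where AB': "partition_on (A' <+> B') \<alpha>" "partition_on (A' <+> B') (?f \<alpha>)" by (rule psimE)
  have fp: "partition_on (A <+> B) (?f \<alpha>)" using AB' partition_typed[OF AB'(1) sat_brels[OF AB(3)]] by simp
  have fa: "sat (?f \<alpha>) \<in> rank_le 1 A B" by (rule rank_le_1_ideal[OF f0 _ sat_brels[OF fp]]) simp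
  have al: "sat \<alpha> \<in> rank_le 1 A B" by (rule rank_le_1_ideal[OF a q(1) sat_brels[OF AB(3)]])
  have q0: "rank_ideal C 0 \<subseteq> rank_ideal C q" by (rule rank_ideal_mono) simp
  have fix0: "?f \<beta> = \<beta>" if "\<beta> \<in> rank_ideal C 0" for \<beta> using f that unfolding is_retraction_def min_ideal_eq_rank0 by blast
  obtain \<beta> where b: "\<beta> \<in> rank_ideal C 0" "partition_on (B <+> A) \<beta>"
    using rank0_ex[OF AB(2,1) subalgs_Pow subalgs_Pow] by blast
  have mult: "\<And>\<alpha> \<beta>. \<alpha> \<in> rank_ideal C q \<Longrightarrow> \<beta> \<in> rank_ideal C q \<Longrightarrow> pcod \<alpha> = pdom \<beta> \<Longrightarrow> ?f (pmult \<alpha> \<beta>) = pmult (?f \<alpha>) (?f \<beta>)"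
    using f unfolding is_retraction_def by simp
  \<comment> \<open>The product has rank 0, so the retraction fixes both it and
    \<open>\<beta>\<close>. In rank at most 1 the domain of a product is that of its left factor,
    which gives the kernel.\<close>
  have "pmult \<alpha> \<beta> = pmult (?f \<alpha>) \<beta>"
    using mult[OF a, of \<beta>] b q0 fix0 rank_ideal_closed(2)[OF a b(1)] pcod_partition[OF AB(3)] pdom_partition[OF b(2)] by auto
  then have "sat \<alpha> O sat \<beta> = sat (?f \<alpha>) O sat \<beta>" using sat_pmult[OF AB(3) b(2)] sat_pmult[OF fp b(2)] by simp
  then have D: "Domain (sat \<alpha>) = Domain (sat (?f \<alpha>))"
    using rank_le1_Domain[OF al sat_brels[OF b(2)]] rank_le1_Domain[OF fa sat_brels[OF b(2)]] by simp
  have "pmult \<beta> \<alpha> = pmult \<beta> (?f \<alpha>)"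
    using mult[OF _ a, of \<beta>] b q0 fix0 rank_ideal_closed(1)[OF b(1) a] pdom_partition[OF AB(3)] pcod_partition[OF b(2)] by auto
  then have "sat \<beta> O sat \<alpha> = sat \<beta> O sat (?f \<alpha>)" using sat_pmult[OF b(2) AB(3)] sat_pmult[OF b(2) fp] by simp
  then have R: "Range (sat \<alpha>) = Range (sat (?f \<alpha>))"
    using rank_le1_Range[OF sat_brels[OF b(2)] al] rank_le1_Range[OF sat_brels[OF b(2)] fa] by simp
  have "flat (sat (?f \<alpha>)) = sat (?f \<alpha>)"
    using rank0_flat rank_ideal_typed(4)[OF f0 sat_brels[OF fp]] unfolding rank_set_0 by blast
  then show "sat (?f \<alpha>) = flat (sat \<alpha>)" unfolding flat_def D R by simp
qed

end

subsection \<open>The groups of natural partitions\<close>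

text \<open>The points \<open>x 1, ..., x q\<close> carry the transversals and all other points are
  singletons. Kernel and cokernel are thus trivial, which is why the half is built on all of
  \<open>Pow X\<close>.\<close>

lemma natural_partition:
  fixes x :: "nat \<Rightarrow> 'a"
  assumes x: "bij_betw x {1..n} X" and q: "q \<le> n" and p: "\<pi> permutes {1..q}"
  shows "partition_on (X <+> X) (natural x n q \<pi>)"
    "sat (natural x n q \<pi>) = point_half q x (Pow X) O perm_rel q \<pi> O (point_half q x (Pow X))\<inverse>"
proof -
  have inj: "i = j" if "x i = x j" "i \<in> {1..n}" "j \<in> {1..n}" for i j using x that unfolding bij_betw_def inj_on_def by blast
  have X: "X = x ` {1..n}" using x unfolding bij_betw_def by simp
  have im: "\<pi> ` {1..q} = {1..q}" using p by (rule permutes_image)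
  have pin: "\<pi> i \<in> {1..q}" if "i \<in> {1..q}" for i using im that by blast
  have n: "{1..n} = {1..q} \<union> {q+1..n}" using q by auto
  have sub: "{1..q} \<subseteq> {1..n}" "{q+1..n} \<subseteq> {1..n}" using n by auto
  show part: "partition_on (X <+> X) (natural x n q \<pi>)"
  proof (rule partition_onI)
    show "\<Union>(natural x n q \<pi>) = X <+> X"
    proof -
      have "\<Union>(natural x n q \<pi>) = Inl ` x ` {1..q} \<union> Inr ` x ` \<pi> ` {1..q} \<union> Inl ` x ` {q+1..n} \<union> Inr ` x ` {q+1..n}"
      proof -
        have "\<Union>((\<lambda>i. {Inl (x i), Inr (x (\<pi> i))}) ` {1..q}) = Inl ` x ` {1..q} \<union> Inr ` x ` \<pi> ` {1..q}"
          "\<Union>((\<lambda>i. {Inl (x i)}) ` {q+1..n}) = (Inl ` x ` {q+1..n} :: ('a + 'a) set)"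
          "\<Union>((\<lambda>i. {Inr (x i)}) ` {q+1..n}) = (Inr ` x ` {q+1..n} :: ('a + 'a) set)" by blast+
        then show ?thesis unfolding natural_def Union_Un_distrib by simp
      qed
      also have "\<dots> = X <+> X" unfolding im X n Plus_def by blast
      finally show ?thesis .
    qed
    show "{} \<notin> natural x n q \<pi>" unfolding natural_def by auto
    have pinj: "i = j" if "\<pi> i = \<pi> j" for i j using permutes_inj[OF p] that by (rule injD)
    have d: "{1..q} \<inter> {q+1..n} = {}" by auto
    fix b c assume b: "b \<in> natural x n q \<pi>" and c: "c \<in> natural x n q \<pi>" and ne: "b \<noteq> c"
    show "disjnt b c"
    proof (rule ccontr)
      assume "\<not> disjnt b c"
      then obtain z where z: "z \<in> b" "z \<in> c" unfolding disjnt_def by blast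
      \<comment> \<open>Expresses a block through any one of its points \<open>z\<close>, so that
        two blocks with a common point are equal.\<close>
      have uniq: "b = (if \<exists>i\<in>{1..q}. z = Inl (x i) \<or> z = Inr (x (\<pi> i)) then
          (let i = (THE i. i \<in> {1..q} \<and> (z = Inl (x i) \<or> z = Inr (x (\<pi> i)))) in {Inl (x i), Inr (x (\<pi> i))}) else {z})"
        if b: "b \<in> natural x n q \<pi>" and z: "z \<in> b" for b
      proof -
        have u: "i = j" if "i \<in> {1..q}" "j \<in> {1..q}" "z = Inl (x i) \<or> z = Inr (x (\<pi> i))" "z = Inl (x j) \<or> z = Inr (x (\<pi> j))" for i j
        proof -
          have "x i = x j \<or> x (\<pi> i) = x (\<pi> j)" using that(3,4) by auto
          moreover have "i \<in> {1..n}" "j \<in> {1..n}" "\<pi> i \<in> {1..n}" "\<pi> j \<in> {1..n}"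
            using that(1,2) pin sub(1) by blast+
          ultimately show ?thesis using inj[of i j] inj[of "\<pi> i" "\<pi> j"] pinj[of i j] by metis
        qed
        consider i where "i \<in> {1..q}" "b = {Inl (x i), Inr (x (\<pi> i))}" | i where "i \<in> {q+1..n}" "b = {Inl (x i)} \<or> b = {Inr (x i)}"
          using b unfolding natural_def by blast
        then show ?thesis
        proof cases
          case (1 i)
          then have zi: "z = Inl (x i) \<or> z = Inr (x (\<pi> i))" using z by blast
          have "(THE i. i \<in> {1..q} \<and> (z = Inl (x i) \<or> z = Inr (x (\<pi> i)))) = i"
            using 1(1) zi u by (intro the_equality) blast+
          then show ?thesis using 1 zi by auto
        next
          case (2 i)
          have "\<not> (\<exists>j\<in>{1..q}. z = Inl (x j) \<or> z = Inr (x (\<pi> j)))"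
          proof
            assume "\<exists>j\<in>{1..q}. z = Inl (x j) \<or> z = Inr (x (\<pi> j))"
            then obtain j where j: "j \<in> {1..q}" "z = Inl (x j) \<or> z = Inr (x (\<pi> j))" by blast
            then have "x i = x j \<or> x i = x (\<pi> j)" using 2(2) z by auto
            then have "i = j \<or> i = \<pi> j" using inj[of i j] inj[of i "\<pi> j"] sub 2(1) j(1) pin[OF j(1)] by blast
            then show False using d 2(1) j(1) pin[OF j(1)] by blast
          qed
          then show ?thesis using 2 z by auto
        qed
      qed
      show False using uniq[OF b z(1)] uniq[OF c z(2)] ne by simp
    qed
  qed
  have xX: "x i \<in> X" if "i \<in> {1..n}" for i using that X by blast
  have "(P, Q) \<in> sat (natural x n q \<pi>) \<longleftrightarrow> P \<subseteq> X \<and> Q \<subseteq> X \<and> (\<forall>i\<in>{1..q}. x i \<in> P \<longleftrightarrow> x (\<pi> i) \<in> Q)" for P Q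
  proof
    assume s: "(P, Q) \<in> sat (natural x n q \<pi>)"
    have "x i \<in> P \<longleftrightarrow> x (\<pi> i) \<in> Q" if i: "i \<in> {1..q}" for i
    proof -
      have b: "{Inl (x i), Inr (x (\<pi> i))} \<in> natural x n q \<pi>" unfolding natural_def using i by blast
      show ?thesis using sat_step[OF part s b, of "Inl (x i)" "Inr (x (\<pi> i))"] sat_step[OF part s b, of "Inr (x (\<pi> i))" "Inl (x i)"] by auto
    qed
    then show "P \<subseteq> X \<and> Q \<subseteq> X \<and> (\<forall>i\<in>{1..q}. x i \<in> P \<longleftrightarrow> x (\<pi> i) \<in> Q)" using brels_sub[OF sat_brels[OF part] s] by blast
  next
    assume a: "P \<subseteq> X \<and> Q \<subseteq> X \<and> (\<forall>i\<in>{1..q}. x i \<in> P \<longleftrightarrow> x (\<pi> i) \<in> Q)"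
    show "(P, Q) \<in> sat (natural x n q \<pi>)"
    proof (rule satI[OF part])
      show "P \<subseteq> X" "Q \<subseteq> X" using a by auto
      fix b y z assume b: "b \<in> natural x n q \<pi>" "y \<in> b" "z \<in> b" "y \<in> P <+> Q"
      then consider i where "i \<in> {1..q}" "b = {Inl (x i), Inr (x (\<pi> i))}" | i where "b = {Inl (x i)} \<or> b = {Inr (x i)}"
        unfolding natural_def by blast
      then show "z \<in> P <+> Q"
      proof cases
        case (1 i) then show ?thesis using a b(2-4) by auto
      next
        case (2 i) then show ?thesis using b(2-4) by auto
      qed
    qed
  qed
  moreover have "(P, Q) \<in> point_half q x (Pow X) O perm_rel q \<pi> O (point_half q x (Pow X))\<inverse> \<longleftrightarrow>
      P \<subseteq> X \<and> Q \<subseteq> X \<and> (\<forall>i\<in>{1..q}. x i \<in> P \<longleftrightarrow> x (\<pi> i) \<in> Q)" for P Q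
  proof -
    have "(P, Q) \<in> point_half q x (Pow X) O perm_rel q \<pi> O (point_half q x (Pow X))\<inverse> \<longleftrightarrow>
      P \<subseteq> X \<and> Q \<subseteq> X \<and> \<pi> ` {i \<in> {1..q}. x i \<in> P} = {i \<in> {1..q}. x i \<in> Q}"
      unfolding point_half_def perm_rel_def by (auto simp: relcomp_unfold)
    moreover have "\<pi> ` {i \<in> {1..q}. x i \<in> P} = {i \<in> {1..q}. x i \<in> Q} \<longleftrightarrow> (\<forall>i\<in>{1..q}. x i \<in> P \<longleftrightarrow> x (\<pi> i) \<in> Q)"
    proof
      assume e: "\<pi> ` {i \<in> {1..q}. x i \<in> P} = {i \<in> {1..q}. x i \<in> Q}"
      show "\<forall>i\<in>{1..q}. x i \<in> P \<longleftrightarrow> x (\<pi> i) \<in> Q"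
      proof
        fix i assume i: "i \<in> {1..q}"
        have "x (\<pi> i) \<in> Q \<longleftrightarrow> \<pi> i \<in> \<pi> ` {i \<in> {1..q}. x i \<in> P}" unfolding e using pin[OF i] by simp
        also have "\<dots> \<longleftrightarrow> x i \<in> P" using i by (simp add: inj_image_mem_iff[OF permutes_inj[OF p]])
        finally show "x i \<in> P \<longleftrightarrow> x (\<pi> i) \<in> Q" by simp
      qed
    next
      assume e: "\<forall>i\<in>{1..q}. x i \<in> P \<longleftrightarrow> x (\<pi> i) \<in> Q"
      show "\<pi> ` {i \<in> {1..q}. x i \<in> P} = {i \<in> {1..q}. x i \<in> Q}"
      proof
        show "\<pi> ` {i \<in> {1..q}. x i \<in> P} \<subseteq> {i \<in> {1..q}. x i \<in> Q}" using e pin by blast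
        show "{i \<in> {1..q}. x i \<in> Q} \<subseteq> \<pi> ` {i \<in> {1..q}. x i \<in> P}"
        proof
          fix j assume "j \<in> {i \<in> {1..q}. x i \<in> Q}"
          then have j: "j \<in> {1..q}" "x j \<in> Q" by auto
          then obtain i where "i \<in> {1..q}" "j = \<pi> i" using im by blast
          then show "j \<in> \<pi> ` {i \<in> {1..q}. x i \<in> P}" using e j by blast
        qed
      qed
    qed
    ultimately show ?thesis by simp
  qed
  ultimately show "sat (natural x n q \<pi>) = point_half q x (Pow X) O perm_rel q \<pi> O (point_half q x (Pow X))\<inverse>"
    by (intro subset_antisym subrelI) simp_all
qed

lemma natural_half:
  fixes x :: "nat \<Rightarrow> 'a"
  assumes x: "bij_betw x {1..n} X" and q: "q \<le> n"
  shows "point_half q x (Pow X) \<in> halves q X"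
proof (rule point_half_halves[OF subalgs_Pow])
  have "inj_on x {1..n}" using x unfolding bij_betw_def by simp
  then have inj: "inj_on x {1..q}" by (rule inj_on_subset) (use q in simp)
  have sub: "x ` {1..q} \<subseteq> X" using x q unfolding bij_betw_def by auto
  show "x i \<in> X" if "i \<in> {1..q}" for i using sub that by blast
  show "\<exists>P\<in>Pow X. \<forall>i\<in>{1..q}. (x i \<in> P) = (i \<in> J)" if J: "J \<subseteq> {1..q}" for J
    using sub J inj_on_image_mem_iff[OF inj _ J] by (intro bexI[of _ "x ` J"]) auto
qed

context finite_family begin

text \<open>A sandwich of a natural partition has the form
  \<open>c O perm_rel p \<pi> O d\<inverse>\<close>. It stays in rank \<open>p\<close> only if
  \<open>c\<close> and \<open>d\<close> are halves, and then exchanging \<open>\<pi>\<close> for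
  \<open>\<rho>\<close> amounts to an element of \<open>N\<close>. Conversely
  \<open>u O u0\<inverse>\<close> and \<open>u0 O v\<inverse>\<close> carry the standard half
  \<open>u0\<close> to arbitrary ones.\<close>

lemma nu_rel_eq:
  fixes x :: "nat \<Rightarrow> 'a"
  assumes X: "X \<in> C" "bij_betw x {1..n} X" and p: "p \<le> n" "enat p \<le> r" and N: "N \<lhd> sym_group p"
  shows "nu_rel (rank_psgp C r) (natural x n p ` N) =
    pull C r {(s, t). \<exists>A\<in>C. \<exists>B\<in>C. (s, t) \<in> nu_brel p N A B}"
proof -
  let ?S = "rank_psgp C r"
  define u0 where "u0 = point_half p x (Pow X)"
  have u0: "u0 \<in> halves p X" unfolding u0_def by (rule natural_half[OF X(2) p(1)])
  note u0b = halves_brels[OF u0]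
  have perm: "\<pi> permutes {1..p}" if "\<pi> \<in> N" for \<pi> using sym_normal_subset[OF N] that by blast
  have nat: "partition_on (X <+> X) (natural x n p \<pi>)" "sat (natural x n p \<pi>) = u0 O perm_rel p \<pi> O u0\<inverse>"
    if "\<pi> \<in> N" for \<pi>
    using natural_partition[OF X(2) p(1) perm[OF that]] unfolding u0_def by auto
  have natr: "natural x n p \<pi> \<in> rank_ideal C r \<and> rank (natural x n p \<pi>) = p" if pi: "\<pi> \<in> N" for \<pi>
  proof -
    have "sat (natural x n p \<pi>) = (u0 O perm_rel p \<pi>) O u0\<inverse>" unfolding nat(2)[OF pi] by (simp only: O_assoc)
    then have "sat (natural x n p \<pi>) \<in> rank_class p X X"
      using rank_classI[OF halves_perm_comp[OF u0 perm[OF pi]] u0] by simp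
    then have "rank (natural x n p \<pi>) = p" using rank_iff[OF nat(1)[OF pi] fin[OF X(1)] fin[OF X(1)]] by blast
    then show ?thesis using rank_ideal_rank[OF X(1,1) nat(1)[OF pi]] p(2) by simp
  qed
  have idN: "id \<in> N" by (rule sym_normal_id[OF N])
  \<comment> \<open>The J-class used in \<open>nu_rel\<close> is the set of all elements of rank
    \<open>p\<close>; \<open>N\<close> contains \<open>id\<close>, so the image is not
    empty.\<close>
  have D: "green_J ?S `` (natural x n p ` N) = {\<alpha> \<in> rank_ideal C r. rank \<alpha> = p}"
  proof -
    have "(natural x n p \<pi>, \<alpha>) \<in> green_J ?S \<longleftrightarrow> \<alpha> \<in> rank_ideal C r \<and> rank \<alpha> = p" if "\<pi> \<in> N" for \<pi> \<alpha>
      using green_J_rank[of "natural x n p \<pi>" r \<alpha>] natr[OF that] by simp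
    then show ?thesis using idN by blast
  qed
  have mem: "(\<alpha>, \<beta>) \<in> nu_rel ?S (natural x n p ` N) \<longleftrightarrow> (\<exists>a b \<pi> \<rho>. a \<in> adj1 ?S \<and> b \<in> adj1 ?S \<and> \<pi> \<in> N \<and> \<rho> \<in> N \<and>
      can_sandwich ?S a (natural x n p \<pi>) b \<and> can_sandwich ?S a (natural x n p \<rho>) b \<and>
      \<alpha> = sandwich ?S a (natural x n p \<pi>) b \<and> \<beta> = sandwich ?S a (natural x n p \<rho>) b \<and>
      \<alpha> \<in> rank_ideal C r \<and> rank \<alpha> = p \<and> \<beta> \<in> rank_ideal C r \<and> rank \<beta> = p)" for \<alpha> \<beta>
    unfolding nu_rel_def Let_def D by blast
  show ?thesis
  proof
    show "nu_rel ?S (natural x n p ` N) \<subseteq> pull C r {(s, t). \<exists>A\<in>C. \<exists>B\<in>C. (s, t) \<in> nu_brel p N A B}"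
    proof (rule subrelI)
      fix \<alpha> \<beta> assume "(\<alpha>, \<beta>) \<in> nu_rel ?S (natural x n p ` N)"
      then obtain a b \<pi> \<rho> where h: "a \<in> adj1 ?S" "b \<in> adj1 ?S" "\<pi> \<in> N" "\<rho> \<in> N" "can_sandwich ?S a (natural x n p \<pi>) b"
        "\<alpha> = sandwich ?S a (natural x n p \<pi>) b" "\<beta> = sandwich ?S a (natural x n p \<rho>) b"
        "\<alpha> \<in> rank_ideal C r" "rank \<alpha> = p" "\<beta> \<in> rank_ideal C r"
        unfolding mem by blast
      obtain A B w z where AB: "A \<in> C" "B \<in> C" "w \<in> brels A X" "z \<in> brels X B"
        and sw: "\<And>\<mu>. partition_on (X <+> X) \<mu> \<Longrightarrow> partition_on (A <+> B) (sandwich ?S a \<mu> b) \<and> sat (sandwich ?S a \<mu> b) = w O sat \<mu> O z"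
        using sat_sandwich[OF h(1,2) X(1,1) nat(1)[OF h(3)] h(5)] by metis
      define c where "c = w O u0"
      define d where "d = z\<inverse> O u0"
      have cb: "c \<in> brels A {1..p}" and db: "d \<in> brels B {1..p}"
        unfolding c_def d_def by (rule brels_comp[OF AB(3) u0b], rule brels_comp[OF brels_converse[OF AB(4)] u0b])
      have eq: "w O (u0 O perm_rel p \<sigma> O u0\<inverse>) O z = c O perm_rel p \<sigma> O d\<inverse>" for \<sigma>
        unfolding c_def d_def by (simp only: O_assoc converse_relcomp converse_converse)
      have sa: "partition_on (A <+> B) \<alpha>" "sat \<alpha> = c O perm_rel p \<pi> O d\<inverse>"
        and sb: "sat \<beta> = c O perm_rel p \<rho> O d\<inverse>"
        using sw[OF nat(1)[OF h(3)]] sw[OF nat(1)[OF h(4)]] unfolding h(6,7) nat(2)[OF h(3)] nat(2)[OF h(4)] eq by simp_all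
      have rk: "sat \<alpha> \<in> rank_class p A B" using rank_iff[OF sa(1) fin[OF AB(1)] fin[OF AB(2)]] h(9) by blast
      note pb = halves_brels[OF perm_rel_halves[OF perm[OF h(3)]]]
      have c: "c \<in> halves p A"
      proof (rule ccontr)
        assume "c \<notin> halves p A"
        then obtain k where k: "k < p" "c \<in> rank_class k A {1..p}" using half_or_lower[OF cb _ fin[OF AB(1)]] by blast
        have "p \<le> k" using rank_class_comp_right[OF k(2) brels_comp[OF pb brels_converse[OF db]]] rk unfolding sa(2) by blast
        then show False using k(1) by simp
      qed
      have d: "d \<in> halves p B"
      proof (rule ccontr)
        assume "d \<notin> halves p B"
        then obtain k where k: "k < p" "d \<in> rank_class k B {1..p}" using half_or_lower[OF db _ fin[OF AB(2)]] by blast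
        have "sat \<alpha> = (c O perm_rel p \<pi>) O d\<inverse>" unfolding sa(2) by (simp only: O_assoc)
        then have "p \<le> k" using rank_class_comp_left[OF brels_comp[OF cb pb] rank_class_converse[OF k(2)]] rk by simp
        then show False using k(1) by simp
      qed
      \<comment> \<open>With \<open>c O perm_rel p \<pi>\<close> as the new left half, this is the
        permutation that leads from the first member of the pair to the second.\<close>
      let ?\<sigma> = "\<rho> \<circ> Hilbert_Choice.inv \<pi>"
      have sN: "?\<sigma> \<in> N" by (rule sym_normal_comp[OF N h(4) sym_normal_inv[OF N h(3)]])
      have "?\<sigma> \<circ> \<pi> = \<rho>" using permutes_inv_o(2)[OF perm[OF h(3)]] by (simp add: o_assoc[symmetric])
      then have "(c O perm_rel p \<pi>) O perm_rel p ?\<sigma> O d\<inverse> = sat \<beta>"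
        unfolding sb using perm_rel_comp[OF perm[OF h(3)], of ?\<sigma>] by (metis O_assoc)
      moreover have "(c O perm_rel p \<pi>) O d\<inverse> = sat \<alpha>" unfolding sa(2) by (simp only: O_assoc)
      ultimately have "(sat \<alpha>, sat \<beta>) \<in> nu_brel p N A B"
        using nu_brelI[OF halves_perm_comp[OF c perm[OF h(3)]] d sN] by simp
      then show "(\<alpha>, \<beta>) \<in> pull C r {(s, t). \<exists>A\<in>C. \<exists>B\<in>C. (s, t) \<in> nu_brel p N A B}"
        unfolding pull_def using h(8,10) AB(1,2) by blast
    qed
    show "pull C r {(s, t). \<exists>A\<in>C. \<exists>B\<in>C. (s, t) \<in> nu_brel p N A B} \<subseteq> nu_rel ?S (natural x n p ` N)"
    proof (rule subrelI)
      fix \<alpha> \<beta> assume "(\<alpha>, \<beta>) \<in> pull C r {(s, t). \<exists>A\<in>C. \<exists>B\<in>C. (s, t) \<in> nu_brel p N A B}"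
      then obtain A B where ab: "\<alpha> \<in> rank_ideal C r" "\<beta> \<in> rank_ideal C r" "A \<in> C" "B \<in> C" "(sat \<alpha>, sat \<beta>) \<in> nu_brel p N A B"
        unfolding pull_def by blast
      obtain u v \<pi> where u: "u \<in> halves p A" "v \<in> halves p B" "\<pi> \<in> N" "sat \<alpha> = u O v\<inverse>" "sat \<beta> = u O perm_rel p \<pi> O v\<inverse>"
        using ab(5) by (rule nu_brelE)
      have rk: "sat \<alpha> \<in> rank_class p A B" "sat \<beta> \<in> rank_class p A B"
        using nu_brel_rank[OF ab(5) sym_normal_subset[OF N]] by auto
      have pa: "partition_on (A <+> B) \<alpha>" "partition_on (A <+> B) \<beta>"
        using rank_ideal_typed(3)[OF ab(1) rank_class_brels[OF rk(1)]] rank_ideal_typed(3)[OF ab(2) rank_class_brels[OF rk(2)]] .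
      have ra: "rank \<alpha> = p" "rank \<beta> = p" using rank_iff[OF pa(1)] rank_iff[OF pa(2)] rk fin ab(3,4) by blast+
      have w: "u O u0\<inverse> \<in> rank_le p A X"
        by (rule rank_le_factor[OF halves_brels[OF u(1)] brels_converse[OF u0b] fin[OF ab(3)] fin[OF X(1)]])
      have z: "u0 O v\<inverse> \<in> rank_le p X B"
        by (rule rank_le_factor[OF u0b brels_converse[OF halves_brels[OF u(2)]] fin[OF X(1)] fin[OF ab(4)]])
      obtain a b where s: "a \<in> adj1 ?S" "b \<in> adj1 ?S"
        and sw: "\<And>\<mu>. partition_on (X <+> X) \<mu> \<Longrightarrow> can_sandwich ?S a \<mu> b \<and> partition_on (A <+> B) (sandwich ?S a \<mu> b) \<and>
          sat (sandwich ?S a \<mu> b) = (u O u0\<inverse>) O sat \<mu> O (u0 O v\<inverse>)"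
        using sandwich_ex[OF p(2) X(1,1) nat(1)[OF idN] ab(3,4) w z] by metis
      have eq: "(u O u0\<inverse>) O (u0 O perm_rel p \<sigma> O u0\<inverse>) O (u0 O v\<inverse>) = u O perm_rel p \<sigma> O v\<inverse>" if "\<sigma> \<in> N" for \<sigma>
      proof -
        have "(u O u0\<inverse>) O (u0 O perm_rel p \<sigma> O u0\<inverse>) O (u0 O v\<inverse>) = u O (u0\<inverse> O (u0 O perm_rel p \<sigma> O u0\<inverse>) O u0) O v\<inverse>"
          by (simp only: O_assoc)
        then show ?thesis unfolding half_sandwich[OF u0 u0 halves_brels[OF perm_rel_halves[OF perm[OF that]]]] .
      qed
      have vid: "u O perm_rel p id O v\<inverse> = u O v\<inverse>"
        unfolding perm_rel_id brels_left_Id[OF brels_converse[OF halves_brels[OF u(2)]]] ..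
      have "sandwich ?S a (natural x n p id) b = \<alpha>"
        using sw[OF nat(1)[OF idN]] sat_inject[OF _ pa(1)] unfolding nat(2)[OF idN] eq[OF idN] vid u(4) by metis
      moreover have "sandwich ?S a (natural x n p \<pi>) b = \<beta>"
        using sw[OF nat(1)[OF u(3)]] sat_inject[OF _ pa(2)] unfolding nat(2)[OF u(3)] eq[OF u(3)] u(5) by metis
      ultimately show "(\<alpha>, \<beta>) \<in> nu_rel ?S (natural x n p ` N)"
        unfolding mem using s idN u(3) sw[OF nat(1)[OF idN]] sw[OF nat(1)[OF u(3)]] ab(1,2) ra by metis
    qed
  qed
qed

lemma rank_ideal_le_iff:
  assumes "\<alpha> \<in> rank_ideal C r" "sat \<alpha> \<in> brels A B"
  shows "\<alpha> \<in> rank_ideal C (enat q) \<longleftrightarrow> sat \<alpha> \<in> rank_le q A B"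
proof
  assume "\<alpha> \<in> rank_ideal C (enat q)"
  then obtain k where "enat k \<le> enat q" "sat \<alpha> \<in> rank_class k A B"
    using rank_ideal_typed(4)[OF _ assms(2)] rank_setE by metis
  then show "sat \<alpha> \<in> rank_le q A B" by (intro rank_leI) auto
next
  assume "sat \<alpha> \<in> rank_le q A B"
  then show "\<alpha> \<in> rank_ideal C (enat q)"
    using rank_idealI[OF rank_ideal_typed(1-3)[OF assms] rank_le_rank_set] by blast
qed

text \<open>The retraction replaces an element by the rank-0 element with the same kernel and
  cokernel, and there Green's relations are equality of these.\<close>

lemma kappa_cong_eq:
  assumes q: "k = Ree \<or> q \<le> 1" "enat q \<le> r"
  shows "kappa_cong k (rank_psgp C r) (rank_ideal C (enat q)) N =
    {(\<alpha>, \<beta>). \<alpha> \<in> rank_ideal C (enat q) \<and> \<beta> \<in> rank_ideal C (enat q) \<and> (\<alpha>, \<beta>) \<in> psim (rank_psgp C r) \<and> base_rel k (sat \<alpha>) (sat \<beta>)}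
      \<union> nu_rel (rank_psgp C r) N \<union> Id_on (rank_ideal C r)"
proof (cases "k = Ree")
  case True
  then show ?thesis by (auto simp: R_cong_def nabla_on_def)
next
  case False
  then have q1: "enat q \<le> 1" using q(1) by (simp add: one_enat_def)
  let ?f = "retr (rank_psgp C r) (rank_ideal C (enat q))"
  have DR: "Range (sat (?f \<alpha>)) = Range (sat \<alpha>)" "Domain (sat (?f \<alpha>)) = Domain (sat \<alpha>)" if a: "\<alpha> \<in> rank_ideal C (enat q)" for \<alpha>
  proof -
    obtain A B where "partition_on (A <+> B) \<alpha>" using a by (rule rank_idealE)
    then have "sat \<alpha> \<in> brels A B" by (rule sat_brels)
    then show "Range (sat (?f \<alpha>)) = Range (sat \<alpha>)" "Domain (sat (?f \<alpha>)) = Domain (sat \<alpha>)"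
      using retr_sat(2)[OF q1 q(2) a] Range_flat[of "sat \<alpha>" A B] Domain_flat[of "sat \<alpha>" A B] by simp_all
  qed
  have g: "(?f \<alpha>, ?f \<beta>) \<in> green_L (rank_psgp C r) \<longleftrightarrow> Range (sat \<alpha>) = Range (sat \<beta>)"
    "(?f \<alpha>, ?f \<beta>) \<in> green_R (rank_psgp C r) \<longleftrightarrow> Domain (sat \<alpha>) = Domain (sat \<beta>)"
    if "\<alpha> \<in> rank_ideal C (enat q)" "\<beta> \<in> rank_ideal C (enat q)" for \<alpha> \<beta>
    using green_rank0[OF retr_sat(1)[OF q1 q(2) that(1)] retr_sat(1)[OF q1 q(2) that(2)], of r] DR[OF that(1)] DR[OF that(2)] by simp_all
  have "kappa_cong k (rank_psgp C r) (rank_ideal C (enat q)) N = {(\<alpha>, \<beta>). \<alpha> \<in> rank_ideal C (enat q) \<and> \<beta> \<in> rank_ideal C (enat q) \<and>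
      (\<alpha>, \<beta>) \<in> psim (rank_psgp C r) \<and> (?f \<alpha>, ?f \<beta>) \<in> (case k of Lam \<Rightarrow> green_L (rank_psgp C r) | Rho \<Rightarrow> green_R (rank_psgp C r) | _ \<Rightarrow> green_H (rank_psgp C r))}
      \<union> nu_rel (rank_psgp C r) N \<union> Id_on (rank_ideal C r)"
    using False by (cases k) (simp_all add: lambda_cong_def rho_cong_def mu_cong_def retr_cong_def)
  moreover have "(?f \<alpha>, ?f \<beta>) \<in> (case k of Lam \<Rightarrow> green_L (rank_psgp C r) | Rho \<Rightarrow> green_R (rank_psgp C r) | _ \<Rightarrow> green_H (rank_psgp C r)) \<longleftrightarrow> base_rel k (sat \<alpha>) (sat \<beta>)"
    if "\<alpha> \<in> rank_ideal C (enat q)" "\<beta> \<in> rank_ideal C (enat q)" for \<alpha> \<beta>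
    using False g[OF that] by (cases k) (auto simp: green_H_def)
  ultimately show ?thesis by (auto simp del: kappa_cong.simps)
qed

lemma kappa_cong_pull:
  fixes x :: "nat \<Rightarrow> 'a"
  assumes X: "X \<in> C" "bij_betw x {1..n} X" and q: "q + 1 \<le> n" "enat (q + 1) \<le> r" "k = Ree \<or> q \<le> 1"
    and N: "N \<lhd> sym_group (q + 1)"
  shows "kappa_cong k (rank_psgp C r) (rank_ideal C (enat q)) (natural x n (q + 1) ` N) = pull C r (kappa_brel C r k q N)"
proof -
  have qr: "enat q \<le> r" using q(2) order_trans[of "enat q" "enat (q + 1)" r] by simp
  have mem: "(\<alpha>, \<beta>) \<in> kappa_cong k (rank_psgp C r) (rank_ideal C (enat q)) (natural x n (q + 1) ` N) \<longleftrightarrow>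
    (\<alpha> \<in> rank_ideal C (enat q) \<and> \<beta> \<in> rank_ideal C (enat q) \<and> (\<alpha>, \<beta>) \<in> psim (rank_psgp C r) \<and> base_rel k (sat \<alpha>) (sat \<beta>)) \<or>
    (\<alpha> \<in> rank_ideal C r \<and> \<beta> \<in> rank_ideal C r \<and> (\<exists>A\<in>C. \<exists>B\<in>C. (sat \<alpha>, sat \<beta>) \<in> nu_brel (q + 1) N A B)) \<or>
    (\<alpha> = \<beta> \<and> \<alpha> \<in> rank_ideal C r)" for \<alpha> \<beta>
    unfolding kappa_cong_eq[OF q(3) qr] nu_rel_eq[OF X q(1,2) N] pull_def by auto
  have sub: "rank_ideal C (enat q) \<subseteq> rank_ideal C r" by (rule rank_ideal_mono[OF qr])
  have "(\<alpha>, \<beta>) \<in> kappa_cong k (rank_psgp C r) (rank_ideal C (enat q)) (natural x n (q + 1) ` N) \<longleftrightarrow> (\<alpha>, \<beta>) \<in> pull C r (kappa_brel C r k q N)" for \<alpha> \<beta>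
  proof (cases "\<alpha> \<in> rank_ideal C r \<and> \<beta> \<in> rank_ideal C r")
    case False
    then show ?thesis unfolding mem using sub unfolding pull_def by blast
  next
    case True
    then obtain A B where AB: "A \<in> C" "B \<in> C" "partition_on (A <+> B) \<alpha>" "sat \<alpha> \<in> rank_set r A B" by (blast elim: rank_idealE)
    note sb = sat_brels[OF AB(3)]
    have ps: "(\<alpha>, \<beta>) \<in> psim (rank_psgp C r) \<longleftrightarrow> sat \<beta> \<in> rank_set r A B"
    proof
      assume "(\<alpha>, \<beta>) \<in> psim (rank_psgp C r)"
      then obtain A' B' where "partition_on (A' <+> B') \<alpha>" "sat \<beta> \<in> rank_set r A' B'" by (rule psimE)
      then show "sat \<beta> \<in> rank_set r A B" using partition_typed[OF _ sb] by blast
    next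
      assume s: "sat \<beta> \<in> rank_set r A B"
      then have "partition_on (A <+> B) \<beta>" using rank_ideal_typed(3) rank_set_brels True by blast
      then show "(\<alpha>, \<beta>) \<in> psim (rank_psgp C r)" using psimI[OF AB(1-3) _ AB(4) s] by blast
    qed
    have nu: "(\<exists>A\<in>C. \<exists>B\<in>C. (sat \<alpha>, sat \<beta>) \<in> nu_brel (q + 1) N A B) \<longleftrightarrow> (sat \<alpha>, sat \<beta>) \<in> nu_brel (q + 1) N A B \<and> sat \<beta> \<in> rank_set r A B"
    proof
      assume "\<exists>A\<in>C. \<exists>B\<in>C. (sat \<alpha>, sat \<beta>) \<in> nu_brel (q + 1) N A B"
      then obtain A' B' where h: "(sat \<alpha>, sat \<beta>) \<in> nu_brel (q + 1) N A' B'" by blast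
      have rk: "sat \<alpha> \<in> rank_class (q + 1) A' B'" "sat \<beta> \<in> rank_class (q + 1) A' B'"
        using nu_brel_rank[OF h sym_normal_subset[OF N]] by auto
      have "A' = A" "B' = B" using brels_eq_objects[OF rank_class_brels[OF rk(1)] sb] by auto
      then show "(sat \<alpha>, sat \<beta>) \<in> nu_brel (q + 1) N A B \<and> sat \<beta> \<in> rank_set r A B" using h rank_setI[OF rk(2) q(2)] by simp
    qed (use AB in blast)
    have low: "\<alpha> \<in> rank_ideal C (enat q) \<and> \<beta> \<in> rank_ideal C (enat q) \<longleftrightarrow> sat \<alpha> \<in> rank_le q A B \<and> sat \<beta> \<in> rank_le q A B"
      if "sat \<beta> \<in> rank_set r A B"
      using rank_ideal_le_iff[of \<alpha> r A B q] rank_ideal_le_iff[of \<beta> r A B q] True sb rank_set_brels[OF that] by simp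
    have inj: "\<alpha> = \<beta> \<longleftrightarrow> sat \<alpha> = sat \<beta>" using rank_ideal_sat_inject[of \<alpha> r \<beta> r] True by auto
    have eqr: "sat \<alpha> = sat \<beta> \<Longrightarrow> sat \<beta> \<in> rank_set r A B" using AB(4) by simp
    show ?thesis
      unfolding mem unfolding ps nu inj pull_def mem_Collect_eq prod.case kappa_brel_iff[OF AB(1,2) sb]
      using True AB(4) low eqr by blast
  qed
  then show ?thesis by (intro subset_antisym subrelI) simp_all
qed

end

lemma kind_le_antisym: "kind_le k k' \<Longrightarrow> kind_le k' k \<Longrightarrow> k = k'"
  unfolding kind_le_def by (cases k; cases k') auto

lemma qN_le_antisym: "qN_le p p' \<Longrightarrow> qN_le p' p \<Longrightarrow> p = p'"
  unfolding qN_le_def by (cases p; cases p') auto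

lemma qN_le_total:
  assumes "snd p \<lhd> sym_group (fst p + 1)" "snd p' \<lhd> sym_group (fst p' + 1)"
  shows "qN_le p p' \<or> qN_le p' p"
proof (cases "fst p = fst p'")
  case True
  then show ?thesis using normal_sym_chain[of "snd p" "fst p + 1" "snd p'"] assms unfolding qN_le_def by auto
qed (auto simp: qN_le_def)

context finite_family begin

text \<open>All order statements are decided on the models: \<open>pull_subset_iff\<close> reduces
  inclusion to \<open>kappa_brel\<close>, and distinctness follows from antisymmetry of the orders
  on pairs and kinds.\<close>

theorem Cong_higher:
  fixes X :: "nat \<Rightarrow> 'a set" and x :: "nat \<Rightarrow> nat \<Rightarrow> 'a"
  assumes X: "\<And>q. enat q < xi C \<Longrightarrow> X q \<in> C \<and> q \<le> card (X q) \<and> bij_betw (x q) {1..card (X q)} (X q)"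
    and r: "2 \<le> r" "r < xi C \<or> (r = \<infinity> \<and> xi C = \<infinity>)"
  shows "(let S = rank_psgp C r;
           K = (\<lambda>k (q, N). kappa_cong k S (rank_ideal C (enat q))
                  (natural (x (q + 1)) (card (X (q + 1))) (q + 1) ` N));
           low = qN_pairs {q. q \<le> 1};
           high = qN_pairs {q. 2 \<le> q \<and> enat q < r};
           nabla = psim S
       in (\<forall>q\<le>1. retractable S (rank_ideal C (enat q))) \<and>
          Cong S = {K k p | k p. p \<in> low} \<union> {K Ree p | p. p \<in> high} \<union> {nabla} \<and>
          inj_on (\<lambda>(k, p). K k p) (UNIV \<times> low) \<and>
          inj_on (K Ree) high \<and>
          {K k p | k p. p \<in> low} \<inter> {K Ree p | p. p \<in> high} = {} \<and>
          nabla \<notin> {K k p | k p. p \<in> low} \<union> {K Ree p | p. p \<in> high} \<and>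
          (\<forall>p\<in>low \<union> high. \<forall>p'\<in>low \<union> high. qN_le p p' \<or> qN_le p' p) \<and>
          (\<forall>k k'. \<forall>p\<in>low. \<forall>p'\<in>low. K k p \<subseteq> K k' p' \<longleftrightarrow> qN_le p p' \<and> kind_le k k') \<and>
          (\<forall>p\<in>high. \<forall>p'\<in>high. K Ree p \<subseteq> K Ree p' \<longleftrightarrow> qN_le p p') \<and>
          (\<forall>k. \<forall>p\<in>low. \<forall>p'\<in>high. K k p \<subset> K Ree p') \<and>
          (\<forall>\<sigma>\<in>Cong S. \<sigma> \<subseteq> nabla))"
proof -
  define S where "S = rank_psgp C r"
  define K where "K = (\<lambda>k (q, N). kappa_cong k S (rank_ideal C (enat q))
                  (natural (x (q + 1)) (card (X (q + 1))) (q + 1) ` N))"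
  define low where "low = qN_pairs {q. q \<le> 1}"
  define high where "high = qN_pairs {q. 2 \<le> q \<and> enat q < r}"
  \<comment> \<open>Every rank that occurs is below \<open>xi C\<close>, so the given family has an
    object with that many points, and thereby a half of that rank.\<close>
  have xi: "enat p < xi C" if p: "enat p \<le> r" for p
    using r(2)
  proof
    assume "r < xi C" then show ?thesis using p by (rule le_less_trans[rotated])
  qed simp
  have half: "\<exists>A\<in>C. \<exists>u. u \<in> halves p A" if "enat p \<le> r" for p
    using X[OF xi[OF that]] natural_half[of "x p" "card (X p)" "X p" p] by blast
  have r2: "enat 2 \<le> r" using r(1) by (simp add: numeral_eq_enat)
  have le_r: "enat i \<le> r" if "enat j \<le> r" "i \<le> j" for i j using that order_trans[of "enat i" "enat j" r] by simp
  have lowD: "q \<le> 1 \<and> N \<lhd> sym_group (q + 1) \<and> enat (q + 1) \<le> r" if "(q, N) \<in> low" for q N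
    using that le_r[OF r2, of "q + 1"] unfolding low_def qN_pairs_def by auto
  have highD: "2 \<le> q \<and> N \<lhd> sym_group (q + 1) \<and> enat (q + 1) \<le> r" if "(q, N) \<in> high" for q N
    using that unfolding high_def qN_pairs_def by (auto simp: Suc_ile_eq)
  have K: "K k (q, N) = pull C r (kappa_brel C r k q N)"
    if "N \<lhd> sym_group (q + 1)" "enat (q + 1) \<le> r" "k = Ree \<or> q \<le> 1" for k q N
    unfolding K_def S_def using kappa_cong_pull[of "X (q + 1)" "x (q + 1)" "card (X (q + 1))" q r k N] X[OF xi[OF that(2)]] that by simp
  have bc: "brel_cong C r (kappa_brel C r k q N)" if "N \<lhd> sym_group (q + 1)" "k = Ree \<or> q \<le> 1" for k q N
    by (rule kappa_brel_cong[OF fin that])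
  have sub: "K k (q, N) \<subseteq> K k' (q', N') \<longleftrightarrow> qN_le (q, N) (q', N') \<and> kind_le k k'"
    if a: "N \<lhd> sym_group (q + 1)" "enat (q + 1) \<le> r" "k = Ree \<or> q \<le> 1"
      "N' \<lhd> sym_group (q' + 1)" "enat (q' + 1) \<le> r" "k' = Ree \<or> q' \<le> 1" for k q N k' q' N'
  proof -
    have "K k (q, N) \<subseteq> K k' (q', N') \<longleftrightarrow> kappa_brel C r k q N \<subseteq> kappa_brel C r k' q' N'"
      unfolding K[OF a(1-3)] K[OF a(4-6)] by (rule pull_subset_iff[OF brel_cong_nabla[OF bc[OF a(1,3)]]])
    also have "\<dots> \<longleftrightarrow> qN_le (q, N) (q', N') \<and> kind_le k k'"
    proof
      assume s: "kappa_brel C r k q N \<subseteq> kappa_brel C r k' q' N'"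
      obtain A u where A: "A \<in> C" "u \<in> halves q A" using half[OF le_r[OF a(2), of q]] by auto
      obtain B v where B: "B \<in> C" "v \<in> halves (q + 1) B" using half[OF a(2)] by auto
      obtain D w where D: "D \<in> C" "w \<in> halves 2 D" using half[OF r2] by auto
      show "qN_le (q, N) (q', N') \<and> kind_le k k'"
        using kappa_brel_subset_qN[OF A B a(2,1,4) s] kappa_brel_subset_kind[OF D a(4) s] by blast
    next
      assume "qN_le (q, N) (q', N') \<and> kind_le k k'"
      then show "kappa_brel C r k q N \<subseteq> kappa_brel C r k' q' N'" using kappa_brel_mono[OF a(1) _ _ a(6)] by blast
    qed
    finally show ?thesis .
  qed
  have sub_low: "K k p \<subseteq> K k' p' \<longleftrightarrow> qN_le p p' \<and> kind_le k k'" if "p \<in> low" "p' \<in> low" for k p k' p'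
    using sub[of "snd p" "fst p" k "snd p'" "fst p'" k'] lowD[of "fst p" "snd p"] lowD[of "fst p'" "snd p'"] that by simp
  have sub_high: "K Ree p \<subseteq> K Ree p' \<longleftrightarrow> qN_le p p'" if "p \<in> high" "p' \<in> high" for p p'
    using sub[of "snd p" "fst p" Ree "snd p'" "fst p'" Ree] highD[of "fst p" "snd p"] highD[of "fst p'" "snd p'"] that
    by (simp add: kind_le_def)
  have low_high: "K k p \<subset> K Ree p'" if "p \<in> low" "p' \<in> high" for k p p'
  proof -
    have p: "fst p \<le> 1" "snd p \<lhd> sym_group (fst p + 1)" "enat (fst p + 1) \<le> r" using lowD[of "fst p" "snd p"] that by auto
    have p': "2 \<le> fst p'" "snd p' \<lhd> sym_group (fst p' + 1)" "enat (fst p' + 1) \<le> r" using highD[of "fst p'" "snd p'"] that by auto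
    have "K k p \<subseteq> K Ree p'" using sub[OF p(2,3) _ p'(2,3), of k Ree] p p' by (simp add: qN_le_def kind_le_def)
    moreover have "\<not> K Ree p' \<subseteq> K k p" using sub[OF p'(2,3) _ p(2,3), of Ree k] p p' by (simp add: qN_le_def)
    ultimately show ?thesis by blast
  qed
  have retr: "retractable S (rank_ideal C (enat q))" if "q \<le> 1" for q
    unfolding S_def using that le_r[OF r2, of q] by (intro retractable_rank_ideal) (auto simp: one_enat_def)
  have nabla: "psim S = pull C r (nabla_brel C r)" unfolding S_def by (rule psim_pull)
  have K_cong: "K k (q, N) \<in> Cong S" if "N \<lhd> sym_group (q + 1)" "enat (q + 1) \<le> r" "k = Ree \<or> q \<le> 1" for k q N
    unfolding K[OF that] S_def by (rule pull_cong[OF bc[OF that(1,3)]])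
  have Cong: "Cong S = {K k p | k p. p \<in> low} \<union> {K Ree p | p. p \<in> high} \<union> {psim S}"
  proof
    show "{K k p | k p. p \<in> low} \<union> {K Ree p | p. p \<in> high} \<union> {psim S} \<subseteq> Cong S"
    proof -
      have "K k p \<in> Cong S" if "p \<in> low" for k p using K_cong[of "snd p" "fst p" k] lowD[of "fst p" "snd p"] that by simp
      moreover have "K Ree p \<in> Cong S" if "p \<in> high" for p using K_cong[of "snd p" "fst p" Ree] highD[of "fst p" "snd p"] that by simp
      moreover have "psim S \<in> Cong S" unfolding nabla unfolding S_def by (rule pull_cong[OF nabla_brel_cong[OF fin]])
      ultimately show ?thesis by blast
    qed
    show "Cong S \<subseteq> {K k p | k p. p \<in> low} \<union> {K Ree p | p. p \<in> high} \<union> {psim S}"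
    proof
      fix \<sigma> assume "\<sigma> \<in> Cong S"
      then obtain E where E: "brel_cong C r E" "\<sigma> = pull C r E" unfolding S_def Cong_rank_psgp by blast
      interpret brel_cong C r E by (rule E(1))
      have norm: "perm_kernel (q + 1) \<lhd> sym_group (q + 1)" if q: "enat (q + 1) \<le> r" for q
        using half[OF q] perm_kernel_normal[OF ind_refl] q by blast
      consider "E = nabla_brel C r" | k q where "q \<le> 1" "E = kappa_brel C r k q (perm_kernel (q + 1))"
        | q where "2 \<le> q" "enat (q + 1) \<le> r" "E = kappa_brel C r Ree q (perm_kernel (q + 1))"
        using classification[OF r(1)] by blast
      then show "\<sigma> \<in> {K k p | k p. p \<in> low} \<union> {K Ree p | p. p \<in> high} \<union> {psim S}"
      proof cases
        case 1
        then show ?thesis using E(2) nabla by simp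
      next
        case (2 k q)
        have q: "enat (q + 1) \<le> r" using le_r[OF r2, of "q + 1"] 2(1) by simp
        have "\<sigma> = K k (q, perm_kernel (q + 1))" using E(2) 2 K[OF norm[OF q] q] by simp
        moreover have "(q, perm_kernel (q + 1)) \<in> low" unfolding low_def qN_pairs_def using 2(1) norm[OF q] by simp
        ultimately show ?thesis by blast
      next
        case (3 q)
        have "\<sigma> = K Ree (q, perm_kernel (q + 1))" using E(2) 3 K[OF norm[OF 3(2)] 3(2)] by simp
        moreover have "(q, perm_kernel (q + 1)) \<in> high"
          unfolding high_def qN_pairs_def using 3(1,2) norm[OF 3(2)] by (simp add: Suc_ile_eq)
        ultimately show ?thesis by blast
      qed
    qed
  qed
  have not_nabla: "psim S \<noteq> K k (q, N)" if a: "N \<lhd> sym_group (q + 1)" "enat (q + 1) \<le> r" "k = Ree \<or> q \<le> 1" for k q N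
  proof
    assume "psim S = K k (q, N)"
    then have "pull C r (nabla_brel C r) = pull C r (kappa_brel C r k q N)" unfolding nabla K[OF a] .
    then have "nabla_brel C r = kappa_brel C r k q N"
      using pull_subset_iff[of "nabla_brel C r" r "kappa_brel C r k q N"] pull_subset_iff[OF brel_cong_nabla[OF bc[OF a(1,3)]], of "nabla_brel C r"] by simp
    moreover obtain B v where "B \<in> C" "v \<in> halves (q + 1) B" using half[OF a(2)] by auto
    ultimately show False using kappa_brel_not_nabla[of B C v q r N k] a by simp
  qed
  have c1: "\<forall>q\<le>1. retractable S (rank_ideal C (enat q))" using retr by blast
  have c2: "inj_on (\<lambda>(k, p). K k p) (UNIV \<times> low)"
  proof (rule inj_onI)
    fix y z assume "y \<in> UNIV \<times> low" "z \<in> UNIV \<times> low" "(\<lambda>(k, p). K k p) y = (\<lambda>(k, p). K k p) z"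
    then have h: "snd y \<in> low" "snd z \<in> low" "K (fst y) (snd y) = K (fst z) (snd z)" by (auto simp: case_prod_beta)
    then have "fst y = fst z" "snd y = snd z"
      using sub_low[OF h(1,2), of "fst y" "fst z"] sub_low[OF h(2,1), of "fst z" "fst y"] kind_le_antisym qN_le_antisym by auto
    then show "y = z" by (rule prod_eqI)
  qed
  have c3: "inj_on (K Ree) high"
  proof (rule inj_onI)
    fix p p' assume h: "p \<in> high" "p' \<in> high" "K Ree p = K Ree p'"
    then show "p = p'" using sub_high[OF h(1,2)] sub_high[OF h(2,1)] qN_le_antisym by auto
  qed
  have c4: "{K k p | k p. p \<in> low} \<inter> {K Ree p | p. p \<in> high} = {}" using low_high by blast
  have c5: "psim S \<notin> {K k p | k p. p \<in> low} \<union> {K Ree p | p. p \<in> high}"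
  proof -
    have "psim S \<noteq> K k p" if "p \<in> low" for k p using not_nabla[of "snd p" "fst p" k] lowD[of "fst p" "snd p"] that by simp
    moreover have "psim S \<noteq> K Ree p" if "p \<in> high" for p using not_nabla[of "snd p" "fst p" Ree] highD[of "fst p" "snd p"] that by simp
    ultimately show ?thesis by blast
  qed
  have c6: "\<forall>p\<in>low \<union> high. \<forall>p'\<in>low \<union> high. qN_le p p' \<or> qN_le p' p"
  proof -
    have "snd p \<lhd> sym_group (fst p + 1)" if "p \<in> low \<union> high" for p
      using that lowD[of "fst p" "snd p"] highD[of "fst p" "snd p"] by auto
    then show ?thesis using qN_le_total by blast
  qed
  have c7: "\<forall>\<sigma>\<in>Cong S. \<sigma> \<subseteq> psim S" unfolding Cong_def by blast
  have c8: "\<forall>k k'. \<forall>p\<in>low. \<forall>p'\<in>low. K k p \<subseteq> K k' p' \<longleftrightarrow> qN_le p p' \<and> kind_le k k'"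
    "\<forall>p\<in>high. \<forall>p'\<in>high. K Ree p \<subseteq> K Ree p' \<longleftrightarrow> qN_le p p'"
    "\<forall>k. \<forall>p\<in>low. \<forall>p'\<in>high. K k p \<subset> K Ree p'"
    by (intro allI ballI sub_low, assumption+) (intro ballI sub_high, assumption+, intro allI ballI low_high, assumption+)
  show ?thesis
    using c1 Cong c2 c3 c4 c5 c6 c8 c7 unfolding Let_def K_def low_def high_def S_def
    by (intro conjI)
qed

end

section \<open>Rank 0 as a rectangular band of kernels and cokernels\<close>

section \<open>The minimal ideal\<close>

text \<open>Points that lie in the same members of \<open>G\<close>; for a subalgebra of a finite
  power set the classes are its atoms. This identifies subalgebras of \<open>Pow A\<close> with
  equivalences on \<open>A\<close>, which gives the band its components
  \<open>Eqs A\<close>.\<close>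

definition atom_equiv :: "'a set set \<Rightarrow> 'a rel" where
  "atom_equiv G = {(a, b). a \<in> \<Union>G \<and> b \<in> \<Union>G \<and> (\<forall>P\<in>G. a \<in> P \<longleftrightarrow> b \<in> P)}"

lemma Union_subalgs: "G \<in> subalgs A \<Longrightarrow> \<Union>G = A"
  using subalgs_full subalgs_sub by blast

lemma atom_equiv_Eqs:
  assumes "G \<in> subalgs A"
  shows "atom_equiv G \<in> Eqs A"
proof -
  have "equiv A (atom_equiv G)"
    unfolding atom_equiv_def Union_subalgs[OF assms] by (rule equivI) (auto simp: refl_on_def sym_def trans_def)
  then show ?thesis unfolding Eqs_def by simp
qed

text \<open>A member of \<open>G\<close> is a union of classes of the common equivalence, hence a
  member of \<open>H\<close> by \<open>subalgs_closed_mem\<close>.\<close>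

lemma atom_equiv_inject:
  assumes G: "G \<in> subalgs A" and H: "H \<in> subalgs A" and fin: "finite A" and eq: "atom_equiv G = atom_equiv H"
  shows "G = H"
proof -
  have sub: "G \<subseteq> H" if G: "G \<in> subalgs A" and H: "H \<in> subalgs A" and eq: "atom_equiv G = atom_equiv H" for G H
  proof
    fix P assume P: "P \<in> G"
    then have PA: "P \<subseteq> A" using subalgs_sub[OF G] by blast
    show "P \<in> H"
    proof (rule subalgs_closed_mem[OF H fin PA])
      fix x y assume x: "x \<in> P" and y: "y \<in> A" and xy: "\<forall>Q\<in>H. x \<in> Q \<longleftrightarrow> y \<in> Q"
      have "(x, y) \<in> atom_equiv H" using x y xy PA unfolding atom_equiv_def Union_subalgs[OF H] by blast
      then have "(x, y) \<in> atom_equiv G" using eq by simp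
      then show "y \<in> P" using P x unfolding atom_equiv_def by blast
    qed
  qed
  show ?thesis using sub[OF G H eq] sub[OF H G eq[symmetric]] by blast
qed

text \<open>The subalgebra consists of all unions of classes; the class of a point is a member that
  separates it from every point outside.\<close>

lemma atom_equiv_surj:
  assumes "\<epsilon> \<in> Eqs A"
  shows "\<exists>G\<in>subalgs A. atom_equiv G = \<epsilon>"
proof
  have e: "equiv A \<epsilon>" using assms unfolding Eqs_def by simp
  have sym: "(y, x) \<in> \<epsilon>" if "(x, y) \<in> \<epsilon>" for x y using e that unfolding equiv_def sym_def by blast
  have ty: "x \<in> A" "y \<in> A" if "(x, y) \<in> \<epsilon>" for x y using equiv_type[OF e] that by auto
  let ?G = "{P. P \<subseteq> A \<and> (\<forall>x y. (x, y) \<in> \<epsilon> \<longrightarrow> x \<in> P \<longrightarrow> y \<in> P)}"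
  show G: "?G \<in> subalgs A" unfolding subalgs_def using sym ty by blast
  show "atom_equiv ?G = \<epsilon>"
  proof (rule subset_antisym)
    show "atom_equiv ?G \<subseteq> \<epsilon>"
    proof (rule subrelI)
      fix x y assume xy: "(x, y) \<in> atom_equiv ?G"
      have x: "x \<in> A" using xy unfolding atom_equiv_def Union_subalgs[OF G] by blast
      have cl: "\<epsilon> `` {x} \<in> ?G" using ty e unfolding equiv_def trans_def by blast
      have "x \<in> \<epsilon> `` {x}" using e x unfolding equiv_def refl_on_def by blast
      moreover have sep: "\<forall>P\<in>?G. x \<in> P \<longleftrightarrow> y \<in> P" using xy unfolding atom_equiv_def by simp
      ultimately have "y \<in> \<epsilon> `` {x}" using bspec[OF sep cl] by blast
      then show "(x, y) \<in> \<epsilon>" by simp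
    qed
    show "\<epsilon> \<subseteq> atom_equiv ?G"
    proof (rule subrelI)
      fix x y assume xy: "(x, y) \<in> \<epsilon>"
      show "(x, y) \<in> atom_equiv ?G"
        using ty[OF xy] xy sym[OF xy] unfolding atom_equiv_def Union_subalgs[OF G] by blast
    qed
  qed
qed

lemma Eqs_nonempty: "Eqs A \<noteq> {}"
  using atom_equiv_Eqs[OF subalgs_Pow] by blast

lemma disjoint_Eqs: "disjoint_family_on Eqs C"
proof -
  have "A = B" if "\<epsilon> \<in> Eqs A" "\<epsilon> \<in> Eqs B" for A B :: "'a set" and \<epsilon>
  proof -
    have "equiv A \<epsilon>" "equiv B \<epsilon>" using that unfolding Eqs_def by auto
    then have "Domain \<epsilon> = A" "Domain \<epsilon> = B" unfolding equiv_def refl_on_def by blast+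
    then show ?thesis by simp
  qed
  then show ?thesis unfolding disjoint_family_on_def by blast
qed

lemma prb_data_Eqs: "prb_data C Eqs Eqs"
  unfolding prb_data_def using Eqs_nonempty disjoint_Eqs by blast

lemma prb_closed:
  assumes "x \<in> carrier (prb C X Y)" "y \<in> carrier (prb C X Y)"
  shows "prd (prb C X Y) x y \<in> carrier (prb C X Y)"
  using assms unfolding prb_def by auto

definition band_of :: "'a part \<Rightarrow> 'a rel \<times> 'a rel" where
  "band_of \<alpha> = (atom_equiv (Domain (sat \<alpha>)), atom_equiv (Range (sat \<alpha>)))"

context finite_family
begin

lemma band_of_typed:
  assumes "A \<in> C" "B \<in> C" "partition_on (A <+> B) \<alpha>"
  shows "band_of \<alpha> \<in> Eqs A \<times> Eqs B" "src (prb C Eqs Eqs) (band_of \<alpha>) = A"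
    "tgt (prb C Eqs Eqs) (band_of \<alpha>) = B" "band_of \<alpha> \<in> carrier (prb C Eqs Eqs)"
proof -
  have e: "atom_equiv (Domain (sat \<alpha>)) \<in> Eqs A" "atom_equiv (Range (sat \<alpha>)) \<in> Eqs B"
    using atom_equiv_Eqs subalgs_Domain[OF sat_brels[OF assms(3)]] subalgs_Range[OF sat_brels[OF assms(3)]] by auto
  then show "band_of \<alpha> \<in> Eqs A \<times> Eqs B" unfolding band_of_def by simp
  show "src (prb C Eqs Eqs) (band_of \<alpha>) = A" "tgt (prb C Eqs Eqs) (band_of \<alpha>) = B" "band_of \<alpha> \<in> carrier (prb C Eqs Eqs)"
    unfolding band_of_def by (rule prb_simps[OF prb_data_Eqs assms(1,2) e])+
qed

text \<open>\<open>band_of\<close> is the pair of kernel and cokernel. A rank-0 relation is the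
  rectangle on its domain and range, so this pair determines it, and a product keeps the outer
  two.\<close>

lemma band_of_iso: "psgp_iso (rank_psgp C 0) (prb C Eqs Eqs) band_of"
  unfolding psgp_iso_def rank_psgp_simps
proof (intro conjI ballI impI)
  show "bij_betw band_of (rank_ideal C 0) (carrier (prb C Eqs Eqs))"
  proof (rule bij_betw_imageI)
    show "inj_on band_of (rank_ideal C 0)"
    proof (rule inj_onI)
      fix \<alpha> \<beta> assume a: "\<alpha> \<in> rank_ideal C 0" and b: "\<beta> \<in> rank_ideal C 0" and eq: "band_of \<alpha> = band_of \<beta>"
      obtain A B where AB: "A \<in> C" "B \<in> C" "partition_on (A <+> B) \<alpha>" "sat \<alpha> \<in> rank_set 0 A B"
        using a by (rule rank_idealE)
      obtain A' B' where AB': "A' \<in> C" "B' \<in> C" "partition_on (A' <+> B') \<beta>" "sat \<beta> \<in> rank_set 0 A' B'"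
        using b by (rule rank_idealE)
      have "A' = A" "B' = B" using band_of_typed(2,3)[OF AB(1-3)] band_of_typed(2,3)[OF AB'(1-3)] eq by auto
      note AB' = AB'[unfolded this]
      have "Domain (sat \<alpha>) = Domain (sat \<beta>)"
        using eq atom_equiv_inject[OF subalgs_Domain[OF sat_brels[OF AB(3)]] subalgs_Domain[OF sat_brels[OF AB'(3)]] fin[OF AB(1)]]
        unfolding band_of_def by simp
      moreover have "Range (sat \<alpha>) = Range (sat \<beta>)"
        using eq atom_equiv_inject[OF subalgs_Range[OF sat_brels[OF AB(3)]] subalgs_Range[OF sat_brels[OF AB'(3)]] fin[OF AB(2)]]
        unfolding band_of_def by simp
      ultimately have "flat (sat \<alpha>) = flat (sat \<beta>)" unfolding flat_def by simp
      then have "sat \<alpha> = sat \<beta>" using rank0_flat AB(4) AB'(4) unfolding rank_set_0 by metis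
      then show "\<alpha> = \<beta>" by (rule rank_ideal_sat_inject[OF a b])
    qed
    show "band_of ` rank_ideal C 0 = carrier (prb C Eqs Eqs)"
    proof (rule subset_antisym)
      show "band_of ` rank_ideal C 0 \<subseteq> carrier (prb C Eqs Eqs)" using band_of_typed(4) by (blast elim: rank_idealE)
      show "carrier (prb C Eqs Eqs) \<subseteq> band_of ` rank_ideal C 0"
      proof
        fix p assume "p \<in> carrier (prb C Eqs Eqs)"
        then obtain A B \<epsilon> \<delta> where p: "A \<in> C" "B \<in> C" "\<epsilon> \<in> Eqs A" "\<delta> \<in> Eqs B" "p = (\<epsilon>, \<delta>)" by (rule prb_carrierE)
        obtain G H where G: "G \<in> subalgs A" "atom_equiv G = \<epsilon>" and H: "H \<in> subalgs B" "atom_equiv H = \<delta>"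
          using atom_equiv_surj[OF p(3)] atom_equiv_surj[OF p(4)] by blast
        obtain \<alpha> where a: "\<alpha> \<in> rank_ideal C 0" "sat \<alpha> = G \<times> H" using rank0_ex[OF p(1,2) G(1) H(1)] by blast
        have "band_of \<alpha> = p"
          unfolding band_of_def a(2) p(5) using G H subalgs_nonempty[OF G(1)] subalgs_nonempty[OF H(1)]
          by (simp add: Domain_fst Range_snd)
        then show "p \<in> band_of ` rank_ideal C 0" using a(1) by blast
      qed
    qed
  qed
  fix \<alpha> assume a: "\<alpha> \<in> rank_ideal C 0"
  obtain A B where AB: "A \<in> C" "B \<in> C" "partition_on (A <+> B) \<alpha>" "sat \<alpha> \<in> rank_set 0 A B"
    using a by (rule rank_idealE)
  show "src (prb C Eqs Eqs) (band_of \<alpha>) = pdom \<alpha>" "tgt (prb C Eqs Eqs) (band_of \<alpha>) = pcod \<alpha>"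
    using band_of_typed(2,3)[OF AB(1-3)] pdom_partition[OF AB(3)] pcod_partition[OF AB(3)] by auto
  fix \<beta> assume b: "\<beta> \<in> rank_ideal C 0" and ab: "pcod \<alpha> = pdom \<beta>"
  obtain A B D where t: "A \<in> C" "B \<in> C" "D \<in> C" "partition_on (A <+> B) \<alpha>" "partition_on (B <+> D) \<beta>"
    using a b ab by (rule composable)
  have r: "sat \<alpha> \<in> rank_le 1 A B" "sat \<beta> \<in> rank_le 1 B D"
    using rank_le_1_ideal[OF a _ sat_brels[OF t(4)]] rank_le_1_ideal[OF b _ sat_brels[OF t(5)]] by auto
  show "band_of (pmult \<alpha> \<beta>) = prd (prb C Eqs Eqs) (band_of \<alpha>) (band_of \<beta>)"
    unfolding prb_prd band_of_def sat_pmult[OF t(4,5)] rank_le1_Domain[OF r(1) rank_le_brels[OF r(2)]]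
      rank_le1_Range[OF rank_le_brels[OF r(1)] r(2)] by simp
qed

definition pull_sigma :: "('a rel \<times> 'a rel) rel \<Rightarrow> 'a part rel" where
  "pull_sigma \<tau> = {(\<alpha>, \<beta>). \<alpha> \<in> rank_ideal C 0 \<and> \<beta> \<in> rank_ideal C 0 \<and> (band_of \<alpha>, band_of \<beta>) \<in> \<tau>}"

lemma pull_sigma_bij: "bij_betw pull_sigma (Cong (prb C Eqs Eqs)) (Cong (rank_psgp C 0))"
proof -
  have "bij_betw (\<lambda>\<tau>. {(x, y). x \<in> carrier (rank_psgp C 0) \<and> y \<in> carrier (rank_psgp C 0) \<and> (band_of x, band_of y) \<in> \<tau>})
    (Cong (prb C Eqs Eqs)) (Cong (rank_psgp C 0))"
    by (rule Cong_iso_eq[OF band_of_iso]) (simp_all add: rank_ideal_closed prb_closed)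
  moreover have "(\<lambda>\<tau>. {(x, y). x \<in> carrier (rank_psgp C 0) \<and> y \<in> carrier (rank_psgp C 0) \<and> (band_of x, band_of y) \<in> \<tau>}) = pull_sigma"
    unfolding pull_sigma_def rank_psgp_simps by (rule refl)
  ultimately show ?thesis by simp
qed

lemma pull_sigma_mono:
  assumes "\<tau> \<in> Cong (prb C Eqs Eqs)"
  shows "pull_sigma \<tau> \<subseteq> pull_sigma \<tau>' \<longleftrightarrow> \<tau> \<subseteq> \<tau>'"
proof
  assume sub: "pull_sigma \<tau> \<subseteq> pull_sigma \<tau>'"
  show "\<tau> \<subseteq> \<tau>'"
  proof (rule subrelI)
    fix p p' assume pp: "(p, p') \<in> \<tau>"
    have "\<tau> \<subseteq> carrier (prb C Eqs Eqs) \<times> carrier (prb C Eqs Eqs)" using assms equiv_type unfolding Cong_def by blast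
    then have "p \<in> band_of ` rank_ideal C 0" "p' \<in> band_of ` rank_ideal C 0"
      using pp band_of_iso unfolding psgp_iso_def bij_betw_def rank_psgp_simps by auto
    then show "(p, p') \<in> \<tau>'" using sub pp unfolding pull_sigma_def by auto
  qed
qed (auto simp: pull_sigma_def)

lemma minimal_ideal_band:
  "\<exists>(U :: 'a set \<Rightarrow> 'a rel set) (V :: 'a set \<Rightarrow> 'a rel set) f.
     prb_data C U V \<and> psgp_iso (rank_psgp C 0) (prb C U V) f \<and>
     Cong (rank_psgp C 0) =
       {{(\<alpha>, \<beta>). \<alpha> \<in> rank_ideal C 0 \<and> \<beta> \<in> rank_ideal C 0 \<and> (f \<alpha>, f \<beta>) \<in> prb_sigma C U V E1 E2} | E1 E2.
         (\<forall>A\<in>C. E1 A \<in> Eqs (U A)) \<and> (\<forall>A\<in>C. E2 A \<in> Eqs (V A))}"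
proof (intro exI conjI)
  have "Cong (rank_psgp C 0) = pull_sigma ` Cong (prb C Eqs Eqs)" using pull_sigma_bij unfolding bij_betw_def by simp
  then show "Cong (rank_psgp C 0) =
       {{(\<alpha>, \<beta>). \<alpha> \<in> rank_ideal C 0 \<and> \<beta> \<in> rank_ideal C 0 \<and> (band_of \<alpha>, band_of \<beta>) \<in> prb_sigma C Eqs Eqs E1 E2} | E1 E2.
         (\<forall>A\<in>C. E1 A \<in> Eqs (Eqs A)) \<and> (\<forall>A\<in>C. E2 A \<in> Eqs (Eqs A))}"
    unfolding Cong_prb[OF prb_data_Eqs] pull_sigma_def by blast
qed (rule prb_data_Eqs band_of_iso)+

lemma minimal_ideal_lattice_iso:
  "lattice_iso (prod_order (Prod_order C (\<lambda>A. Eq_lattice (Eqs A))) (Prod_order C (\<lambda>A. Eq_lattice (Eqs A))))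
     (cong_lattice (rank_psgp C 0)) (pull_sigma \<circ> (\<lambda>(E1, E2). prb_sigma C Eqs Eqs E1 E2))"
  (is "lattice_iso ?L ?N (?p \<circ> ?g)")
proof (rule order_iso_lattice_iso)
  show "lattice ?L"
    by (intro lattice_prod_order lattice_Prod_order lattice_Eq_lattice eq_Eq_lattice) (simp_all add: Prod_order_def)
  show "eq ?N = (=)" unfolding cong_lattice_def incl_order_def by simp
  have g: "bij_betw ?g (carrier ?L) (Cong (prb C Eqs Eqs))" by (rule prb_order_iso(1)[OF prb_data_Eqs nonempty])
  show "bij_betw (?p \<circ> ?g) (carrier ?L) (carrier ?N)"
    using bij_betw_trans[OF g pull_sigma_bij] unfolding cong_lattice_def incl_order_def by simp
  fix x y assume xy: "x \<in> carrier ?L" "y \<in> carrier ?L"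
  have "le ?L x y \<longleftrightarrow> ?g x \<subseteq> ?g y" by (rule prb_order_iso(2)[OF prb_data_Eqs nonempty xy])
  also have "\<dots> \<longleftrightarrow> ?p (?g x) \<subseteq> ?p (?g y)"
    by (rule pull_sigma_mono[symmetric, OF bij_betwE[OF g, rule_format, OF xy(1)]])
  finally show "le ?L x y \<longleftrightarrow> le ?N ((?p \<circ> ?g) x) ((?p \<circ> ?g) y)"
    unfolding cong_lattice_def incl_order_def by simp
qed

end

section \<open>Rank 1: congruences lifted along the retraction, and the assembly of all
  parts\<close>

section \<open>Congruences induced by a retraction\<close>

lemma Cong_restrict:
  assumes \<sigma>: "\<sigma> \<in> Cong S" and I: "is_ideal S I"
  shows "\<sigma> \<inter> I \<times> I \<in> Cong (sub_psgp S I)"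
proof -
  have e: "equiv (carrier S) \<sigma>" and sub: "\<sigma> \<subseteq> psim S" and
    comp: "\<And>x y a. (x, y) \<in> \<sigma> \<Longrightarrow> a \<in> carrier S \<Longrightarrow> (tgt S a = src S x \<longrightarrow> (prd S a x, prd S a y) \<in> \<sigma>) \<and>
      (tgt S x = src S a \<longrightarrow> (prd S x a, prd S y a) \<in> \<sigma>)"
    using \<sigma> unfolding Cong_def by auto
  have IS: "I \<subseteq> carrier S" using I unfolding is_ideal_def by simp
  have Icl: "\<And>x a. x \<in> I \<Longrightarrow> a \<in> carrier S \<Longrightarrow> (tgt S a = src S x \<longrightarrow> prd S a x \<in> I) \<and> (tgt S x = src S a \<longrightarrow> prd S x a \<in> I)"
    using I unfolding is_ideal_def by blast
  have "equiv I (\<sigma> \<inter> I \<times> I)"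
  proof (rule equivI)
    show "refl_on I (\<sigma> \<inter> I \<times> I)" using e IS unfolding equiv_def refl_on_def by blast
    show "sym (\<sigma> \<inter> I \<times> I)" using e unfolding equiv_def sym_def by blast
    show "trans (\<sigma> \<inter> I \<times> I)" using e unfolding equiv_def trans_def by blast
  qed auto
  moreover have "\<sigma> \<inter> I \<times> I \<subseteq> psim (sub_psgp S I)" using sub unfolding psim_def sub_psgp_def by auto
  moreover have "(tgt S a = src S x \<longrightarrow> (prd S a x, prd S a y) \<in> \<sigma> \<inter> I \<times> I) \<and>
      (tgt S x = src S a \<longrightarrow> (prd S x a, prd S y a) \<in> \<sigma> \<inter> I \<times> I)" if xy: "(x, y) \<in> \<sigma> \<inter> I \<times> I" and a: "a \<in> I" for x y a
  proof -
    have "src S y = src S x" "tgt S y = tgt S x" using xy sub unfolding psim_def by auto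
    then show ?thesis using comp[of x y a] Icl[of x a] Icl[of y a] xy a IS by auto
  qed
  ultimately show ?thesis unfolding Cong_def sub_psgp_def by auto
qed

text \<open>For \<open>x\<close> in \<open>M\<close> the product of \<open>a\<close> and
  \<open>x\<close> is in \<open>M\<close> and hence fixed by \<open>f\<close>; as \<open>f\<close>
  is multiplicative, \<open>a\<close> acts on \<open>M\<close> exactly as \<open>f a\<close> does.
  So compatibility inside \<open>M\<close> is already compatibility with all of
  \<open>S\<close>.\<close>

lemma retraction_lift:
  assumes f: "is_retraction S (carrier S) f" and M: "is_min_ideal S M"
    and closed: "\<And>x y. x \<in> carrier S \<Longrightarrow> y \<in> carrier S \<Longrightarrow> tgt S x = src S y \<Longrightarrow> prd S x y \<in> carrier S"
    and \<tau>: "\<tau> \<in> Cong (sub_psgp S M)"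
  shows "\<tau> \<union> Id_on (carrier S) \<in> Cong S"
    and "{(x, y). x \<in> carrier S \<and> y \<in> carrier S \<and> (f x, f y) \<in> \<tau>} \<in> Cong S"
proof -
  have m: "min_ideal S = M" by (rule min_ideal_eq[OF M])
  have I: "is_ideal S M" using M unfolding is_min_ideal_def by blast
  have MS: "M \<subseteq> carrier S" using I unfolding is_ideal_def by simp
  have Icl: "\<And>x a. x \<in> M \<Longrightarrow> a \<in> carrier S \<Longrightarrow> (tgt S a = src S x \<longrightarrow> prd S a x \<in> M) \<and> (tgt S x = src S a \<longrightarrow> prd S x a \<in> M)"
    using I unfolding is_ideal_def by blast
  have "f x \<in> M \<and> (x, f x) \<in> psim S" if "x \<in> carrier S" for x
    using f that unfolding is_retraction_def m by blast
  then have fM: "f x \<in> M" "src S (f x) = src S x" "tgt S (f x) = tgt S x" if "x \<in> carrier S" for x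
    using that unfolding psim_def by auto
  have fx: "f x = x" if "x \<in> M" for x using f that unfolding is_retraction_def m by blast
  have fp: "f (prd S x y) = prd S (f x) (f y)" if "x \<in> carrier S" "y \<in> carrier S" "tgt S x = src S y" for x y
    using f that unfolding is_retraction_def by blast
  have e: "equiv M \<tau>" and sub: "\<tau> \<subseteq> psim (sub_psgp S M)" using \<tau> unfolding Cong_def sub_psgp_def by auto
  have comp: "\<And>x y a. (x, y) \<in> \<tau> \<Longrightarrow> a \<in> M \<Longrightarrow> (tgt S a = src S x \<longrightarrow> (prd S a x, prd S a y) \<in> \<tau>) \<and>
      (tgt S x = src S a \<longrightarrow> (prd S x a, prd S y a) \<in> \<tau>)"
    using \<tau> unfolding Cong_def sub_psgp_def by auto
  have st: "x \<in> M" "y \<in> M" "src S y = src S x" "tgt S y = tgt S x" if "(x, y) \<in> \<tau>" for x y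
    using sub that unfolding psim_def sub_psgp_def by auto
  let ?u = "\<tau> \<union> Id_on (carrier S)" and ?t = "{(x, y). x \<in> carrier S \<and> y \<in> carrier S \<and> (f x, f y) \<in> \<tau>}"
  have "equiv (carrier S) ?u"
  proof (rule equivI)
    show "sym ?u" using e unfolding equiv_def sym_def by blast
    show "trans ?u" using e unfolding equiv_def trans_def by blast
  qed (use st(1,2) MS in \<open>auto simp: refl_on_def\<close>)
  moreover have "?u \<subseteq> psim S" using st MS unfolding psim_def by auto
  moreover have "(tgt S a = src S x \<longrightarrow> (prd S a x, prd S a y) \<in> ?u) \<and> (tgt S x = src S a \<longrightarrow> (prd S x a, prd S y a) \<in> ?u)"
    if xy: "(x, y) \<in> ?u" and a: "a \<in> carrier S" for x y a
    using xy
  proof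
    assume t: "(x, y) \<in> \<tau>"
    note s = st[OF t]
    have "prd S a x = prd S (f a) x \<and> prd S a y = prd S (f a) y" if "tgt S a = src S x"
      using fp[of a x] fp[of a y] fx s Icl[of x a] Icl[of y a] that a MS by auto
    moreover have "prd S x a = prd S x (f a) \<and> prd S y a = prd S y (f a)" if "tgt S x = src S a"
      using fp[of x a] fp[of y a] fx s Icl[of x a] Icl[of y a] that a MS by auto
    ultimately show ?thesis using comp[OF t fM(1)[OF a]] fM[OF a] by auto
  qed (use a closed in auto)
  ultimately show "?u \<in> Cong S" unfolding Cong_def by blast
  have "equiv (carrier S) ?t"
  proof (rule equivI)
    show "refl_on (carrier S) ?t" using e fM(1) unfolding equiv_def refl_on_def by auto
    show "sym ?t" using e unfolding equiv_def sym_def by blast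
    show "trans ?t" using e unfolding equiv_def trans_def by blast
  qed auto
  moreover have ps: "?t \<subseteq> psim S" using st(3,4) fM(2,3) unfolding psim_def by force
  moreover have "(tgt S a = src S x \<longrightarrow> (prd S a x, prd S a y) \<in> ?t) \<and> (tgt S x = src S a \<longrightarrow> (prd S x a, prd S y a) \<in> ?t)"
    if xy: "(x, y) \<in> ?t" and a: "a \<in> carrier S" for x y a
  proof -
    have s: "x \<in> carrier S" "y \<in> carrier S" "(f x, f y) \<in> \<tau>" "src S y = src S x" "tgt S y = tgt S x"
      using xy ps unfolding psim_def by auto
    show ?thesis
      using comp[OF s(3) fM(1)[OF a]] fM(2,3)[OF a] fM(2,3)[OF s(1)] fp[OF a s(1)] fp[OF a s(2)] fp[OF s(1) a] fp[OF s(2) a]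
        closed[OF a s(1)] closed[OF a s(2)] closed[OF s(1) a] closed[OF s(2) a] s by auto
  qed
  ultimately show "?t \<in> Cong S" unfolding Cong_def by blast
qed

context finite_family
begin

lemma rank_set_1: "rank_set 1 A B = rank_le 1 A B"
proof -
  have "{q. enat q \<le> 1} = {..1}" by (auto simp: one_enat_def)
  then show ?thesis unfolding rank_set_def rank_le_def by simp
qed

abbreviation "rho \<equiv> retr (rank_psgp C 1) (rank_ideal C 1)"

lemma rho_retraction: "is_retraction (rank_psgp C 1) (carrier (rank_psgp C 1)) rho"
  using retractable_rank_ideal[of 1 1] someI_ex[of "is_retraction (rank_psgp C 1) (rank_ideal C 1)"]
  unfolding retractable_def retr_def by simp

lemma rho_rank0: "\<alpha> \<in> rank_ideal C 1 \<Longrightarrow> rho \<alpha> \<in> rank_ideal C 0"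
  and rho_fixed: "\<alpha> \<in> rank_ideal C 0 \<Longrightarrow> rho \<alpha> = \<alpha>"
  using rho_retraction unfolding is_retraction_def min_ideal_eq_rank0 by auto

lemma equiv_Cong: "\<tau> \<in> Cong (rank_psgp C r) \<Longrightarrow> equiv (rank_ideal C r) \<tau>"
  unfolding Cong_def by simp

lemma theta_cong_iff:
  assumes "\<tau> \<in> Cong (rank_psgp C 0)"
  shows "(\<alpha>, \<beta>) \<in> theta_cong (rank_psgp C 1) (rank_ideal C 1) \<tau> \<longleftrightarrow>
    \<alpha> \<in> rank_ideal C 1 \<and> \<beta> \<in> rank_ideal C 1 \<and> (rho \<alpha>, rho \<beta>) \<in> \<tau>"
  using equiv_Cong[OF assms] rho_rank0 unfolding theta_cong_def equiv_def refl_on_def by auto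

lemma lift_eq:
  assumes "\<tau> \<in> Cong (rank_psgp C 0)"
  shows "\<tau> \<union> Id_on (rank_ideal C 1 - rank_ideal C 0) = \<tau> \<union> Id_on (rank_ideal C 1)"
  using equiv_Cong[OF assms] rank_ideal_mono[of 0 1] unfolding equiv_def refl_on_def by auto

lemma rank1_lift:
  assumes "\<tau> \<in> Cong (rank_psgp C 0)"
  shows "\<tau> \<union> Id_on (rank_ideal C 1) \<in> Cong (rank_psgp C 1)"
    and "theta_cong (rank_psgp C 1) (rank_ideal C 1) \<tau> \<in> Cong (rank_psgp C 1)"
proof -
  have t: "\<tau> \<in> Cong (sub_psgp (rank_psgp C 1) (rank_ideal C 0))" using assms unfolding sub_rank_psgp .
  have cl: "\<And>x y. x \<in> carrier (rank_psgp C 1) \<Longrightarrow> y \<in> carrier (rank_psgp C 1) \<Longrightarrow>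
      tgt (rank_psgp C 1) x = src (rank_psgp C 1) y \<Longrightarrow> prd (rank_psgp C 1) x y \<in> carrier (rank_psgp C 1)"
    by (simp add: rank_ideal_closed)
  note lift = retraction_lift[OF rho_retraction min_ideal_rank_psgp cl t]
  show "\<tau> \<union> Id_on (rank_ideal C 1) \<in> Cong (rank_psgp C 1)" using lift(1) by simp
  have "theta_cong (rank_psgp C 1) (rank_ideal C 1) \<tau> =
      {(x, y). x \<in> carrier (rank_psgp C 1) \<and> y \<in> carrier (rank_psgp C 1) \<and> (rho x, rho y) \<in> \<tau>}"
    using theta_cong_iff[OF assms] by auto
  then show "theta_cong (rank_psgp C 1) (rank_ideal C 1) \<tau> \<in> Cong (rank_psgp C 1)" using lift(2) by simp
qed

lemma rank1_liftable: "\<tau> \<in> Cong (rank_psgp C 0) \<Longrightarrow> liftable (rank_psgp C 1) \<tau>"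
  unfolding liftable_def min_ideal_eq_rank0 sub_rank_psgp using rank1_lift(1) by simp

text \<open>If rank 1 may be cut, every element is related to its retract, and the congruence is
  pulled back from rank 0. If not, by \<open>flattens_pair\<close> an element of rank 1 is related
  only to itself.\<close>

theorem Cong_rank1:
  "Cong (rank_psgp C 1) =
    {\<tau> \<union> Id_on (rank_ideal C 1 - rank_ideal C 0) | \<tau>. \<tau> \<in> Cong (rank_psgp C 0)} \<union>
    {theta_cong (rank_psgp C 1) (rank_ideal C 1) \<tau> | \<tau>. \<tau> \<in> Cong (rank_psgp C 0)}" (is "_ = ?R")
proof (rule subset_antisym)
  show "?R \<subseteq> Cong (rank_psgp C 1)" using rank1_lift lift_eq by auto
  show "Cong (rank_psgp C 1) \<subseteq> ?R"
  proof
    fix \<sigma> assume s: "\<sigma> \<in> Cong (rank_psgp C 1)"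
    then obtain E where E: "brel_cong C 1 E" "\<sigma> = pull C 1 E" unfolding Cong_rank_psgp by blast
    interpret E: brel_cong C 1 E by (rule E(1))
    have I01: "rank_ideal C 0 \<subseteq> rank_ideal C 1" by (rule rank_ideal_mono) simp
    have eq: "equiv (rank_ideal C 1) \<sigma>" by (rule equiv_Cong[OF s])
    let ?\<tau> = "\<sigma> \<inter> rank_ideal C 0 \<times> rank_ideal C 0"
    have t: "?\<tau> \<in> Cong (rank_psgp C 0)"
      using Cong_restrict[OF s rank_ideal_is_ideal[of 0 1]] unfolding sub_rank_psgp by simp
    show "\<sigma> \<in> ?R"
    proof (cases "E.flattens")
      case True
      have r: "(\<alpha>, rho \<alpha>) \<in> \<sigma>" "(rho \<alpha>, \<alpha>) \<in> \<sigma>" if a: "\<alpha> \<in> rank_ideal C 1" for \<alpha>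
      proof -
        obtain A B where AB: "A \<in> C" "B \<in> C" "partition_on (A <+> B) \<alpha>" "sat \<alpha> \<in> rank_set 1 A B"
          using a by (rule rank_idealE)
        have "(sat \<alpha>, flat (sat \<alpha>)) \<in> E" using True AB unfolding E.flattens_def rank_set_1 by blast
        moreover have "sat (rho \<alpha>) = flat (sat \<alpha>)" by (rule retr_sat(2)[OF _ _ a]) simp_all
        moreover have "rho \<alpha> \<in> rank_ideal C 1" using rho_rank0[OF a] I01 by blast
        ultimately show "(\<alpha>, rho \<alpha>) \<in> \<sigma>" using a unfolding E(2) pull_def by simp
        then show "(rho \<alpha>, \<alpha>) \<in> \<sigma>" using eq unfolding equiv_def sym_def by blast
      qed
      have tr: "(x, z) \<in> \<sigma>" if "(x, y) \<in> \<sigma>" "(y, z) \<in> \<sigma>" for x y z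
        using eq that unfolding equiv_def trans_def by blast
      have ty: "x \<in> rank_ideal C 1 \<and> y \<in> rank_ideal C 1" if "(x, y) \<in> \<sigma>" for x y using equiv_type[OF eq] that by blast
      have "(\<alpha>, \<beta>) \<in> \<sigma> \<longleftrightarrow> (\<alpha>, \<beta>) \<in> theta_cong (rank_psgp C 1) (rank_ideal C 1) ?\<tau>" for \<alpha> \<beta>
        unfolding theta_cong_iff[OF t] using r[of \<alpha>] r[of \<beta>] tr ty[of \<alpha> \<beta>] rho_rank0[of \<alpha>] rho_rank0[of \<beta>] by blast
      then have "\<sigma> = theta_cong (rank_psgp C 1) (rank_ideal C 1) ?\<tau>" by auto
      then show ?thesis using t by blast
    next
      case False
      have low: "\<alpha> \<in> rank_ideal C 0" if ab: "(\<alpha>, \<beta>) \<in> \<sigma>" "\<alpha> \<noteq> \<beta>" for \<alpha> \<beta>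
      proof -
        have I: "\<alpha> \<in> rank_ideal C 1" "\<beta> \<in> rank_ideal C 1" "(sat \<alpha>, sat \<beta>) \<in> E" using ab unfolding E(2) pull_def by auto
        have ne: "sat \<alpha> \<noteq> sat \<beta>" using rank_ideal_sat_inject[OF I(1,2)] ab(2) by blast
        obtain A B where AB: "A \<in> C" "B \<in> C" "partition_on (A <+> B) \<alpha>" "sat \<alpha> \<in> rank_set 1 A B"
          using I(1) by (rule rank_idealE)
        have b: "sat \<beta> \<in> rank_le 1 A B"
          using E.E_typed[OF I(3) sat_brels[OF AB(3)]] unfolding rank_set_1 by blast
        have "sat \<alpha> \<notin> rank_class 1 A B" using E.flattens_pair[OF I(3) ne _ b] False by blast
        then have "sat \<alpha> \<in> rank_class 0 A B"
          using AB(4) unfolding rank_set_1 by (auto elim!: rank_leE simp: le_Suc_eq)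
        then show ?thesis using rank_idealI[OF AB(1-3)] unfolding rank_set_0[symmetric] by blast
      qed
      have "\<beta> \<in> rank_ideal C 0" if "(\<alpha>, \<beta>) \<in> \<sigma>" "\<alpha> \<noteq> \<beta>" for \<alpha> \<beta>
        using low[of \<beta> \<alpha>] that eq unfolding equiv_def sym_def by blast
      then have "\<sigma> \<subseteq> ?\<tau> \<union> Id_on (rank_ideal C 1)"
        by (intro subrelI) (use low equiv_type[OF eq] in blast)
      moreover have "Id_on (rank_ideal C 1) \<subseteq> \<sigma>" using eq unfolding equiv_def refl_on_def by auto
      ultimately have "\<sigma> = ?\<tau> \<union> Id_on (rank_ideal C 1)" by blast
      then show ?thesis unfolding lift_eq[OF t, symmetric] using t by blast
    qed
  qed
qed

lemma rank1_nonempty: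
  assumes "A \<in> C" "a \<in> A"
  shows "\<exists>\<alpha>. \<alpha> \<in> rank_ideal C 1 \<and> \<alpha> \<notin> rank_ideal C 0"
proof -
  let ?u = "point_half 1 (\<lambda>_. a) (Pow A)"
  have "?u \<in> halves 1 A"
  proof (rule point_half_halves[OF subalgs_Pow])
    show "\<exists>P\<in>Pow A. \<forall>i\<in>{1..1}. (a \<in> P) = (i \<in> J)" if "J \<subseteq> {1..1}" for J :: "nat set"
      by (rule bexI[of _ "if 1 \<in> J then A else {}"]) (use assms in auto)
  qed (rule assms(2))
  then have u: "?u O ?u\<inverse> \<in> rank_class 1 A A" by (rule rank_classI) (rule \<open>?u \<in> halves 1 A\<close>)
  then have "?u O ?u\<inverse> \<in> rank_set 1 A A" by (rule rank_setI) (simp add: one_enat_def)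
  then obtain \<alpha> where a: "\<alpha> \<in> rank_ideal C 1" "sat \<alpha> = ?u O ?u\<inverse>" using rank_ideal_ex[OF assms(1,1)] by blast
  have "\<alpha> \<notin> rank_ideal C 0"
  proof
    assume "\<alpha> \<in> rank_ideal C 0"
    then have "sat \<alpha> \<in> rank_class 0 A A"
      using rank_ideal_typed(4)[of \<alpha> 0 A A] rank_class_brels[OF u] unfolding a(2) rank_set_0 by blast
    then show False using rank_class_unique[OF _ u] unfolding a(2) by fastforce
  qed
  then show ?thesis using a(1) by blast
qed

lemma rank1_lattice:
  assumes "A \<in> C" "a \<in> A"
  shows "lattice_isomorphic (cong_lattice (rank_psgp C 1)) (prod_order (cong_lattice (rank_psgp C 0)) two_chain)"
proof -
  let ?S0 = "rank_psgp C 0" and ?S1 = "rank_psgp C 1"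
  let ?\<theta> = "theta_cong ?S1 (rank_ideal C 1)" and ?\<epsilon> = "\<lambda>\<tau>. \<tau> \<union> Id_on (rank_ideal C 1 - rank_ideal C 0)"
  let ?g = "\<lambda>(\<tau>, b). if b then ?\<theta> \<tau> else ?\<epsilon> \<tau>"
  let ?L = "prod_order (cong_lattice ?S0) two_chain"
  obtain \<alpha> where a: "\<alpha> \<in> rank_ideal C 1" "\<alpha> \<notin> rank_ideal C 0" using rank1_nonempty[OF assms] by blast
  have ty: "\<tau> \<subseteq> rank_ideal C 0 \<times> rank_ideal C 0" if "\<tau> \<in> Cong ?S0" for \<tau> using equiv_type[OF equiv_Cong[OF that]] .
  have I01: "rank_ideal C 0 \<subseteq> rank_ideal C 1" by (rule rank_ideal_mono) simp
  have th0: "(x, y) \<in> ?\<theta> \<tau> \<longleftrightarrow> (x, y) \<in> \<tau>" if "\<tau> \<in> Cong ?S0" "x \<in> rank_ideal C 0" "y \<in> rank_ideal C 0" for x y \<tau>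
    unfolding theta_cong_iff[OF that(1)] using that(2,3) I01 rho_fixed by auto
  have tt: "?\<theta> \<tau> \<subseteq> ?\<theta> \<tau>' \<longleftrightarrow> \<tau> \<subseteq> \<tau>'" if t: "\<tau> \<in> Cong ?S0" "\<tau>' \<in> Cong ?S0" for \<tau> \<tau>'
  proof
    show "?\<theta> \<tau> \<subseteq> ?\<theta> \<tau>' \<Longrightarrow> \<tau> \<subseteq> \<tau>'" using th0[OF t(1)] th0[OF t(2)] ty[OF t(1)] by blast
    show "\<tau> \<subseteq> \<tau>' \<Longrightarrow> ?\<theta> \<tau> \<subseteq> ?\<theta> \<tau>'" by (rule subrelI) (use theta_cong_iff[OF t(1)] theta_cong_iff[OF t(2)] in blast)
  qed
  have et: "?\<epsilon> \<tau> \<subseteq> ?\<theta> \<tau>' \<longleftrightarrow> \<tau> \<subseteq> \<tau>'" if t: "\<tau> \<in> Cong ?S0" "\<tau>' \<in> Cong ?S0" for \<tau> \<tau>'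
  proof -
    have "Id_on (rank_ideal C 1 - rank_ideal C 0) \<subseteq> ?\<theta> \<tau>'" unfolding theta_cong_def by auto
    then show ?thesis using th0[OF t(2)] ty[OF t(1)] by blast
  qed
  have ee: "?\<epsilon> \<tau> \<subseteq> ?\<epsilon> \<tau>' \<longleftrightarrow> \<tau> \<subseteq> \<tau>'" if t: "\<tau> \<in> Cong ?S0" for \<tau> \<tau>'
    using ty[OF t] by blast
  \<comment> \<open>The element \<open>\<alpha>\<close> of rank 1 is related to its retract under
    \<open>?\<theta> \<tau>\<close> but only to itself under \<open>?\<epsilon> \<tau>'\<close>;
    this keeps the two copies of the lattice apart.\<close>
  have te: "\<not> ?\<theta> \<tau> \<subseteq> ?\<epsilon> \<tau>'" if t: "\<tau> \<in> Cong ?S0" "\<tau>' \<in> Cong ?S0" for \<tau> \<tau>'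
  proof
    assume sub: "?\<theta> \<tau> \<subseteq> ?\<epsilon> \<tau>'"
    have r: "rho \<alpha> \<in> rank_ideal C 0" by (rule rho_rank0[OF a(1)])
    then have "(rho \<alpha>, rho \<alpha>) \<in> \<tau>" using equiv_Cong[OF t(1)] unfolding equiv_def refl_on_def by blast
    then have "(\<alpha>, rho \<alpha>) \<in> ?\<theta> \<tau>" unfolding theta_cong_iff[OF t(1)] rho_fixed[OF r] using a(1) r I01 by auto
    then have "(\<alpha>, rho \<alpha>) \<in> ?\<epsilon> \<tau>'" using sub by blast
    then show False using ty[OF t(2)] a(2) r by auto
  qed
  have car: "carrier ?L = Cong ?S0 \<times> UNIV"
    unfolding prod_order_def cong_lattice_def incl_order_def two_chain_def by simp
  have le: "le ?L p p' \<longleftrightarrow> ?g p \<subseteq> ?g p'" if "p \<in> carrier ?L" "p' \<in> carrier ?L" for p p'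
  proof -
    obtain \<tau> b \<tau>' b' where p: "p = (\<tau>, b)" "p' = (\<tau>', b')" by (cases p, cases p')
    have t: "\<tau> \<in> Cong ?S0" "\<tau>' \<in> Cong ?S0" using that unfolding car p by auto
    have "le ?L p p' \<longleftrightarrow> \<tau> \<subseteq> \<tau>' \<and> (b \<longrightarrow> b')"
      unfolding p prod_order_def cong_lattice_def incl_order_def two_chain_def by simp
    then show ?thesis unfolding p using tt[OF t] et[OF t] ee[OF t(1)] te[OF t] by (cases b; cases b') simp_all
  qed
  have "lattice_iso ?L (cong_lattice ?S1) ?g"
  proof (rule order_iso_lattice_iso)
    have "lattice (cong_lattice ?S0)"
      using minimal_ideal_lattice_iso unfolding lattice_iso_def join_pres_def by blast
    then show "lattice ?L"
      by (rule lattice_prod_order) (rule lattice_two_chain | simp add: cong_lattice_def incl_order_def two_chain_def)+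
    show "eq (cong_lattice ?S1) = (=)" unfolding cong_lattice_def incl_order_def by simp
    show "bij_betw ?g (carrier ?L) (carrier (cong_lattice ?S1))"
    proof (rule bij_betw_imageI)
      show "inj_on ?g (carrier ?L)"
      proof (rule inj_onI)
        fix p p' assume pp: "p \<in> carrier ?L" "p' \<in> carrier ?L" "?g p = ?g p'"
        then have "le ?L p p'" "le ?L p' p" using le by auto
        then show "p = p'"
          unfolding prod_order_def cong_lattice_def incl_order_def two_chain_def by (auto split: prod.splits)
      qed
      have "?g ` carrier ?L = Cong ?S1"
      proof (rule subset_antisym)
        show "?g ` carrier ?L \<subseteq> Cong ?S1" unfolding car Cong_rank1 by auto
        show "Cong ?S1 \<subseteq> ?g ` carrier ?L"
        proof
          fix \<sigma> assume "\<sigma> \<in> Cong ?S1"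
          then consider \<tau> where "\<tau> \<in> Cong ?S0" "\<sigma> = ?\<epsilon> \<tau>" | \<tau> where "\<tau> \<in> Cong ?S0" "\<sigma> = ?\<theta> \<tau>"
            unfolding Cong_rank1 by blast
          then show "\<sigma> \<in> ?g ` carrier ?L"
          proof cases
            case 1
            then show ?thesis unfolding car by (intro image_eqI[of _ _ "(_, False)"]) auto
          next
            case 2
            then show ?thesis unfolding car by (intro image_eqI[of _ _ "(_, True)"]) auto
          qed
        qed
      qed
      then show "?g ` carrier ?L = carrier (cong_lattice ?S1)" unfolding cong_lattice_def incl_order_def by simp
    qed
    show "le ?L p p' \<longleftrightarrow> le (cong_lattice ?S1) (?g p) (?g p')" if "p \<in> carrier ?L" "p' \<in> carrier ?L" for p p'
      using le[OF that] unfolding cong_lattice_def incl_order_def by simp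
  qed
  then show ?thesis by (rule lattice_iso_inverse) (simp add: prod_order_def)
qed

end

theorem theorem6p6:
  fixes C :: "'a set set" and X :: "nat \<Rightarrow> 'a set" and x :: "nat \<Rightarrow> nat \<Rightarrow> 'a"
  assumes "C \<noteq> {}" and "\<And>A. A \<in> C \<Longrightarrow> finite A"
    and "\<And>q. enat q < xi C \<Longrightarrow>
           X q \<in> C \<and> q \<le> card (X q) \<and> bij_betw (x q) {1..card (X q)} (X q)"
  shows
    "(is_min_ideal (part_cat C) (rank_ideal C 0) \<and>
      (\<exists>(U :: 'a set \<Rightarrow> 'a rel set) (V :: 'a set \<Rightarrow> 'a rel set) f.
         prb_data C U V \<and> psgp_iso (rank_psgp C 0) (prb C U V) f \<and>
         Cong (rank_psgp C 0) =
           {{(\<alpha>, \<beta>). \<alpha> \<in> rank_ideal C 0 \<and> \<beta> \<in> rank_ideal C 0 \<and> (f \<alpha>, f \<beta>) \<in> prb_sigma C U V E1 E2} | E1 E2.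
             (\<forall>A\<in>C. E1 A \<in> Eqs (U A)) \<and> (\<forall>A\<in>C. E2 A \<in> Eqs (V A))}) \<and>
      lattice_isomorphic (cong_lattice (rank_psgp C 0))
        (prod_order (Prod_order C (\<lambda>A. Eq_lattice (Eqs A))) (Prod_order C (\<lambda>A. Eq_lattice (Eqs A)))))
     \<and>
     (1 < xi C \<longrightarrow>
      retractable (rank_psgp C 1) (rank_ideal C 1) \<and>
      (\<forall>\<tau>\<in>Cong (rank_psgp C 0). liftable (rank_psgp C 1) \<tau>) \<and>
      Cong (rank_psgp C 1) =
        {\<tau> \<union> Id_on (rank_ideal C 1 - rank_ideal C 0) | \<tau>. \<tau> \<in> Cong (rank_psgp C 0)} \<union>
        {theta_cong (rank_psgp C 1) (rank_ideal C 1) \<tau> | \<tau>. \<tau> \<in> Cong (rank_psgp C 0)} \<and>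
      lattice_isomorphic (cong_lattice (rank_psgp C 1))
        (prod_order (cong_lattice (rank_psgp C 0)) two_chain))
     \<and>
     (\<forall>r. 2 \<le> r \<and> (r < xi C \<or> (r = \<infinity> \<and> xi C = \<infinity>)) \<longrightarrow>
      (let S = rank_psgp C r;
           K = (\<lambda>k (q, N). kappa_cong k S (rank_ideal C (enat q))
                  (natural (x (q + 1)) (card (X (q + 1))) (q + 1) ` N));
           low = qN_pairs {q. q \<le> 1};
           high = qN_pairs {q. 2 \<le> q \<and> enat q < r};
           nabla = psim S
       in (\<forall>q\<le>1. retractable S (rank_ideal C (enat q))) \<and>
          Cong S = {K k p | k p. p \<in> low} \<union> {K Ree p | p. p \<in> high} \<union> {nabla} \<and>
          \<comment> \<open>distinctness\<close>
          inj_on (\<lambda>(k, p). K k p) (UNIV \<times> low) \<and>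
          inj_on (K Ree) high \<and>
          {K k p | k p. p \<in> low} \<inter> {K Ree p | p. p \<in> high} = {} \<and>
          nabla \<notin> {K k p | k p. p \<in> low} \<union> {K Ree p | p. p \<in> high} \<and>
          \<comment> \<open>inclusion order\<close>
          (\<forall>p\<in>low \<union> high. \<forall>p'\<in>low \<union> high. qN_le p p' \<or> qN_le p' p) \<and>
          (\<forall>k k'. \<forall>p\<in>low. \<forall>p'\<in>low. K k p \<subseteq> K k' p' \<longleftrightarrow> qN_le p p' \<and> kind_le k k') \<and>
          (\<forall>p\<in>high. \<forall>p'\<in>high. K Ree p \<subseteq> K Ree p' \<longleftrightarrow> qN_le p p') \<and>
          (\<forall>k. \<forall>p\<in>low. \<forall>p'\<in>high. K k p \<subset> K Ree p') \<and>
          (\<forall>\<sigma>\<in>Cong S. \<sigma> \<subseteq> nabla)))"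
proof -
  interpret finite_family C using assms(1,2) by unfold_locales
  have part1: "is_min_ideal (part_cat C) (rank_ideal C 0)" unfolding part_cat_eq by (rule min_ideal_rank_psgp)
  have lat0: "lattice_isomorphic (cong_lattice (rank_psgp C 0))
      (prod_order (Prod_order C (\<lambda>A. Eq_lattice (Eqs A))) (Prod_order C (\<lambda>A. Eq_lattice (Eqs A))))"
    by (rule lattice_iso_inverse[OF minimal_ideal_lattice_iso]) (simp add: prod_order_def)
  have part2: "lattice_isomorphic (cong_lattice (rank_psgp C 1)) (prod_order (cong_lattice (rank_psgp C 0)) two_chain)"
    if "1 < xi C"
  proof -
    \<comment> \<open>The hypothesis yields an object with a point, and with it an element of rank
      1, which \<open>rank1_lattice\<close> uses to distinguish the two levels of the chain.\<close>
    have X1: "X 1 \<in> C" "1 \<le> card (X 1)" using assms(3)[of 1] that by (auto simp: one_enat_def)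
    then obtain a where "a \<in> X 1" by (cases "X 1 = {}") auto
    then show ?thesis by (rule rank1_lattice[OF X1(1)])
  qed
  show ?thesis
  proof (intro conjI impI allI)
    show "retractable (rank_psgp C 1) (rank_ideal C 1)" by (rule retractable_rank_ideal) simp_all
    show "\<forall>\<tau>\<in>Cong (rank_psgp C 0). liftable (rank_psgp C 1) \<tau>" using rank1_liftable by blast
  qed (rule part1 minimal_ideal_band lat0 Cong_rank1 part2 | assumption | elim conjE, rule Cong_higher[OF assms(3)], assumption+)+
qed

end
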